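(* Let $\Omega\subset\mathbb{R}^d$, $d\ge2$, be a bounded domain with $\partial\Omega\in C^\infty$, and let $K$ be the Krein Laplacian in $L^2(\Omega)$. Let $V\in C(\overline\Omega;\mathbb{R})$. Then $$\sigma_{\rm ess}(K+V)=V(\partial\Omega).$$ In particular, $\sigma_{\rm ess}(K+V)=\{0\}$ if and only if $V_{|\partial\Omega}=0$.
   Context: A domain is an open, connected, non-empty set. $\mathcal{H}(\Omega)=\{u\in L^2(\Omega):\Delta u=0\text{ in }\Omega\}$, and $H^2_0(\Omega)$ is the closure of $C_0^\infty(\Omega)$ in the Sobolev space $H^2(\Omega)$. The Krein Laplacian is $K=-\Delta$ with domain ${\rm Dom}\,K=\mathcal{H}(\Omega)\dotplus H^2_0(\Omega)$ (direct sum); it is self-adjoint and non-negative in $L^2(\Omega)$. $K+V$, with $V$ acting as multiplication, is self-adjoint on ${\rm Dom}\,K$. $V(\partial\Omega)$ denotes the image of $\partial\Omega$ under $V$. *)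

theory Defs
  imports "HOL-Analysis.Analysis"
begin

section \<open>Smooth functions and smooth boundaries\<close>

primrec pderivs :: "'a::euclidean_space list \<Rightarrow> ('a \<Rightarrow> 'b::real_normed_vector) \<Rightarrow> 'a \<Rightarrow> 'b" where
  "pderivs [] f = f"
| "pderivs (v # vs) f = (\<lambda>x. frechet_derivative (pderivs vs f) (at x) v)"

text \<open>Total differentiability of all iterated partial derivatives is equivalent to
  membership in the class \<open>C\<^sup>\<infinity>\<close>, since it makes all of them continuous.\<close>

definition smooth :: "('a::euclidean_space \<Rightarrow> 'b::real_normed_vector) \<Rightarrow> bool" where
  "smooth f \<longleftrightarrow> (\<forall>vs. set vs \<subseteq> Basis \<longrightarrow> (\<forall>x. pderivs vs f differentiable (at x)))"

definition laplacian :: "('a::euclidean_space \<Rightarrow> 'b::real_normed_vector) \<Rightarrow> 'a \<Rightarrow> 'b" where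
  "laplacian f x = (\<Sum>i\<in>Basis. pderivs [i, i] f x)"

text \<open>Near each boundary point, \<open>\<Omega>\<close> is, in rotated coordinates with last axis \<open>e\<close>, the open
  set above the graph of a smooth function of the remaining \<open>d - 1\<close> coordinates.  Such a function
  is encoded as a smooth function on the whole space that is constant in direction \<open>e\<close>.\<close>

definition smooth_boundary :: "'a::euclidean_space set \<Rightarrow> bool" where
  "smooth_boundary \<Omega> \<longleftrightarrow>
     (\<forall>p \<in> frontier \<Omega>. \<exists>r > 0. \<exists>e. \<exists>\<gamma> :: 'a \<Rightarrow> real.
        norm e = 1 \<and> smooth \<gamma> \<and> (\<forall>x t. \<gamma> (x + t *\<^sub>R e) = \<gamma> x) \<and>
        \<Omega> \<inter> ball p r = {x \<in> ball p r. x \<bullet> e > \<gamma> x})"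

section \<open>Square-integrable functions\<close>

text \<open>Elements of \<open>L\<^sup>2\<close> are handled through representatives; identities between them are
  understood almost everywhere.  Complex scalars are used, as needed for spectral theory.\<close>

definition L2 :: "'a measure \<Rightarrow> ('a \<Rightarrow> complex) set" where
  "L2 M = {u \<in> borel_measurable M. integrable M (\<lambda>x. (cmod (u x))\<^sup>2)}"

definition L2_norm :: "'a measure \<Rightarrow> ('a \<Rightarrow> complex) \<Rightarrow> real" where
  "L2_norm M u = sqrt (LINT x|M. (cmod (u x))\<^sup>2)"

section \<open>Spectra of operators in \<open>L\<^sup>2\<close>\<close>

text \<open>An unbounded linear operator in \<open>L\<^sup>2\<close> is given by its graph: the set of all pairs \<open>(u, f)\<close>
  where \<open>u\<close> represents an element of the domain and \<open>f\<close> represents its image.\<close>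

type_synonym 'a L2_operator = "(('a \<Rightarrow> complex) \<times> ('a \<Rightarrow> complex)) set"

text \<open>\<open>z\<close> is in the resolvent set iff \<open>T - z\<close> is a bijection from its domain onto \<open>L\<^sup>2\<close> with
  bounded inverse.  The estimate expresses both injectivity and boundedness of the inverse.\<close>

definition resolvent_set :: "'a measure \<Rightarrow> 'a L2_operator \<Rightarrow> complex set" where
  "resolvent_set M T = {z.
     (\<forall>g \<in> L2 M. \<exists>(u, f) \<in> T. AE x in M. f x - z * u x = g x) \<and>
     (\<exists>C. \<forall>(u, f) \<in> T. L2_norm M u \<le> C * L2_norm M (\<lambda>x. f x - z * u x))}"

definition spectrum :: "'a measure \<Rightarrow> 'a L2_operator \<Rightarrow> complex set" where
  "spectrum M T = - resolvent_set M T"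

definition eigenspace :: "'a measure \<Rightarrow> 'a L2_operator \<Rightarrow> complex \<Rightarrow> ('a \<Rightarrow> complex) set" where
  "eigenspace M T z = {u. \<exists>f. (u, f) \<in> T \<and> (AE x in M. f x = z * u x)}"

definition eigenvalue :: "'a measure \<Rightarrow> 'a L2_operator \<Rightarrow> complex \<Rightarrow> bool" where
  "eigenvalue M T z \<longleftrightarrow> (\<exists>u \<in> eigenspace M T z. \<not> (AE x in M. u x = 0))"

definition finite_multiplicity :: "'a measure \<Rightarrow> 'a L2_operator \<Rightarrow> complex \<Rightarrow> bool" where
  "finite_multiplicity M T z \<longleftrightarrow>
     (\<exists>B. finite B \<and> B \<subseteq> L2 M \<and>
        (\<forall>u \<in> eigenspace M T z. \<exists>c. AE x in M. u x = (\<Sum>b\<in>B. c b * b x)))"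

text \<open>The usual definitions for self-adjoint operators, for which geometric and algebraic
  multiplicities coincide.\<close>

definition discrete_spectrum :: "'a measure \<Rightarrow> 'a L2_operator \<Rightarrow> complex set" where
  "discrete_spectrum M T =
     {z. z isolated_in spectrum M T \<and> eigenvalue M T z \<and> finite_multiplicity M T z}"

definition essential_spectrum :: "'a measure \<Rightarrow> 'a L2_operator \<Rightarrow> complex set" where
  "essential_spectrum M T = spectrum M T - discrete_spectrum M T"

definition add_potential :: "'a L2_operator \<Rightarrow> ('a \<Rightarrow> real) \<Rightarrow> 'a L2_operator" where
  "add_potential T V = {(u, \<lambda>x. f x + complex_of_real (V x) * u x) | u f. (u, f) \<in> T}"

section \<open>Weak derivatives and Sobolev spaces\<close>

definition test_functions :: "'a::euclidean_space set \<Rightarrow> ('a \<Rightarrow> complex) set" where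
  "test_functions \<Omega> =
     {\<phi>. smooth \<phi> \<and> compact (closure {x. \<phi> x \<noteq> 0}) \<and> closure {x. \<phi> x \<noteq> 0} \<subseteq> \<Omega>}"

definition has_weak_pderivs ::
  "'a::euclidean_space set \<Rightarrow> 'a list \<Rightarrow> ('a \<Rightarrow> complex) \<Rightarrow> ('a \<Rightarrow> complex) \<Rightarrow> bool" where
  "has_weak_pderivs \<Omega> vs u g \<longleftrightarrow>
     (\<forall>\<phi> \<in> test_functions \<Omega>.
        (LINT x|lebesgue_on \<Omega>. u x * pderivs vs \<phi> x) =
        (- 1) ^ length vs * (LINT x|lebesgue_on \<Omega>. g x * \<phi> x))"

text \<open>\<open>L\<^sup>2\<close> weak derivatives are unique almost everywhere, so the following choice is immaterial.\<close>

definition weak_pderivs ::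
  "'a::euclidean_space set \<Rightarrow> 'a list \<Rightarrow> ('a \<Rightarrow> complex) \<Rightarrow> 'a \<Rightarrow> complex" where
  "weak_pderivs \<Omega> vs u = (SOME g. g \<in> L2 (lebesgue_on \<Omega>) \<and> has_weak_pderivs \<Omega> vs u g)"

definition sobolev :: "nat \<Rightarrow> 'a::euclidean_space set \<Rightarrow> ('a \<Rightarrow> complex) set" where
  "sobolev m \<Omega> = {u \<in> L2 (lebesgue_on \<Omega>).
     \<forall>vs. set vs \<subseteq> Basis \<and> length vs \<le> m \<longrightarrow>
       (\<exists>g \<in> L2 (lebesgue_on \<Omega>). has_weak_pderivs \<Omega> vs u g)}"

text \<open>Mixed derivatives are counted once for every ordering, which gives an equivalent norm.\<close>

definition sobolev_norm :: "nat \<Rightarrow> 'a::euclidean_space set \<Rightarrow> ('a \<Rightarrow> complex) \<Rightarrow> real" where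
  "sobolev_norm m \<Omega> u =
     sqrt (\<Sum>vs | set vs \<subseteq> Basis \<and> length vs \<le> m. (L2_norm (lebesgue_on \<Omega>) (weak_pderivs \<Omega> vs u))\<^sup>2)"

definition sobolev_0 :: "nat \<Rightarrow> 'a::euclidean_space set \<Rightarrow> ('a \<Rightarrow> complex) set" where
  "sobolev_0 m \<Omega> = {u \<in> sobolev m \<Omega>. \<exists>\<phi> :: nat \<Rightarrow> 'a \<Rightarrow> complex.
     (\<forall>n. \<phi> n \<in> test_functions \<Omega>) \<and> (\<lambda>n. sobolev_norm m \<Omega> (\<lambda>x. u x - \<phi> n x)) \<longlonglongrightarrow> 0}"

section \<open>The Krein Laplacian\<close>

definition has_weak_laplacian ::
  "'a::euclidean_space set \<Rightarrow> ('a \<Rightarrow> complex) \<Rightarrow> ('a \<Rightarrow> complex) \<Rightarrow> bool" where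
  "has_weak_laplacian \<Omega> u g \<longleftrightarrow>
     (\<forall>\<phi> \<in> test_functions \<Omega>.
        (LINT x|lebesgue_on \<Omega>. u x * laplacian \<phi> x) = (LINT x|lebesgue_on \<Omega>. g x * \<phi> x))"

text \<open>For \<open>u \<in> L\<^sup>2(\<Omega>)\<close> the equation \<open>\<Delta>u = 0\<close> is understood in the sense of distributions.\<close>

definition harmonic_L2 :: "'a::euclidean_space set \<Rightarrow> ('a \<Rightarrow> complex) set" where
  "harmonic_L2 \<Omega> = {u \<in> L2 (lebesgue_on \<Omega>). has_weak_laplacian \<Omega> u (\<lambda>_. 0)}"

definition krein_domain :: "'a::euclidean_space set \<Rightarrow> ('a \<Rightarrow> complex) set" where
  "krein_domain \<Omega> = {\<lambda>x. h x + w x | h w. h \<in> harmonic_L2 \<Omega> \<and> w \<in> sobolev_0 2 \<Omega>}"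

definition krein_laplacian :: "'a::euclidean_space set \<Rightarrow> 'a L2_operator" where
  "krein_laplacian \<Omega> = {(u, f). u \<in> krein_domain \<Omega> \<and> f \<in> L2 (lebesgue_on \<Omega>) \<and>
     has_weak_laplacian \<Omega> u (\<lambda>x. - f x)}"

end

theory Submission
 imports Defs
begin

text \<open>For a closed operator \<open>T\<close> with \<open>T = T\<^sup>*\<close>, an estimate
 \<open>\<parallel>u\<parallel> \<le> C (\<parallel>(T - z) u\<parallel> + \<Sum>\<^sub>i \<bar>\<langle>u, b\<^sub>i\<rangle>\<bar>)\<close> with finitely many \<open>b\<^sub>i\<close> keeps \<open>z\<close> out of the essential spectrum,
 and a weakly null singular sequence at \<open>z\<close> puts it there.

 For \<open>z \<notin> V(\<partial>\<Omega>)\<close> put \<open>W = V - z\<close> and write \<open>u = h + w\<close> with \<open>h\<close> harmonic and \<open>w \<in> H\<^sup>2\<^sub>0\<close>, so that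
 \<open>(K + V - z) u = - \<Delta>w + W h + W w\<close>.  The Hankel operator \<open>h \<mapsto> P (W h)\<close>, where \<open>P\<close> projects onto the range of \<open>\<Delta>\<close>
 on \<open>H\<^sup>2\<^sub>0\<close>, is compact: for a polynomial \<open>W\<close> integration by parts moves a derivative from \<open>\<Delta>w\<close> to \<open>W\<close>, and
 the general case follows by approximation.  Hence \<open>\<Delta>w\<close> and \<open>W h\<close> are controlled separately up to compact terms.  As \<open>W\<close> is bounded away
 from \<open>0\<close> outside a compact subset of \<open>\<Omega>\<close>, on which harmonic functions are compact, the estimate follows.

 For \<open>x\<^sub>0 \<in> \<partial>\<Omega>\<close>, normalised harmonic functions with a pole approaching \<open>x\<^sub>0\<close> from outside concentrate at \<open>x\<^sub>0\<close>
 and form a singular sequence at \<open>V(x\<^sub>0)\<close>.\<close>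

section \<open>The Hilbert space of square-integrable functions\<close>

text \<open>The two estimates for \<open>krein_a_priori\<close> are circular: the norm of h is
  bounded by A times that of \<Delta>w, and \<Delta>w is bounded through h again. The Hankel term
  can be given any small weight, here 1/(4A), and this breaks the circle. Compactness is carried by
  inequalities with finitely many functionals instead of subsequences; in the end they must all be
  functionals of u, which is possible because functionals of w are functionals of \<Delta>w
  (\<open>lap0_functional\<close>) and \<Delta>w is (V - z) u minus the residual. Conversely K
  annihilates harmonic functions, so K + V multiplies them by V, and a harmonic sequence
  concentrating at a boundary point suffices. Its kernel has size |x - y|^(-d), hence L2 mass of
  order t^(-d) on a ball of radius t at distance of order t from the pole. This is why the harmonic
  polynomial has degree two: degree one would give t^(2-d), which stays bounded when d = 2. That
  such a sequence excludes discrete spectrum rests on a spectral gap, derived from resolvents and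
  quadratic forms rather than from a functional calculus.\<close>

notation test_functions ("\<D>")
abbreviation (input) cor :: "real => complex" where "cor \<equiv> of_real"
abbreviation lnorm :: "('a::euclidean_space => complex) => real" where "lnorm \<equiv> L2_norm lborel"

definition ip :: "'a measure => ('a => complex) => ('a => complex) => complex" where
 "ip M u v = (LINT x|M. u x * cnj (v x))"

lemma L2_measurable [measurable_dest]: "u \<in> L2 M ==> u \<in> borel_measurable M"
 and L2_integrable_square: "u \<in> L2 M ==> integrable M (\<lambda>x. (cmod (u x))\<^sup>2)" by (auto simp: L2_def)

lemma borel_measurable_cnj [measurable (raw)]:
 "f \<in> borel_measurable M ==> (\<lambda>x. cnj (f x)) \<in> borel_measurable M"
 by (rule measurable_compose[OF _ borel_measurable_continuous_onI]) (auto intro: continuous_intros)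

lemma L2_dominated:
 assumes "u \<in> borel_measurable M" "integrable M g" "AE x in M. (cmod (u x))\<^sup>2 \<le> g x"
 shows "u \<in> L2 M" unfolding L2_def mem_Collect_eq
proof
 show "integrable M (\<lambda>x. (cmod (u x))\<^sup>2)" by (rule Bochner_Integration.integrable_bound[OF assms(2)]) (use assms in auto)
qed (fact assms(1))

lemma L2_zero [simp]: "(\<lambda>x. 0) \<in> L2 M" by (simp add: L2_def)

lemma L2_scale [intro]: "u \<in> L2 M ==> (\<lambda>x. c * u x) \<in> L2 M" by (auto simp: L2_def norm_mult power_mult_distrib)

lemma cmod_add_square_le: "(cmod (a + b))\<^sup>2 \<le> 2 * (cmod a)\<^sup>2 + 2 * (cmod b)\<^sup>2"
proof -
 have "(cmod (a + b))\<^sup>2 \<le> (cmod a + cmod b)\<^sup>2" by (rule power_mono[OF norm_triangle_ineq]) simp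
 also have "\<dots> \<le> 2 * (cmod a)\<^sup>2 + 2 * (cmod b)\<^sup>2" using sum_squares_bound[of "cmod a" "cmod b"] by (simp add: power2_sum)
 finally show ?thesis .
qed

lemma L2_add [intro]:
 assumes "u \<in> L2 M" "v \<in> L2 M"
 shows "(\<lambda>x. u x + v x) \<in> L2 M"
proof (rule L2_dominated)
 show "integrable M (\<lambda>x. 2 * (cmod (u x))\<^sup>2 + 2 * (cmod (v x))\<^sup>2)" using assms[THEN L2_integrable_square] by simp
qed (use assms[THEN L2_measurable] cmod_add_square_le in auto)

lemma L2_uminus [intro]: "u \<in> L2 M ==> (\<lambda>x. - u x) \<in> L2 M" by (auto simp: L2_def)

lemma L2_diff [intro]: "u \<in> L2 M ==> v \<in> L2 M ==> (\<lambda>x. u x - v x) \<in> L2 M" using L2_add[OF _ L2_uminus, of u M v] by simp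

lemma L2_sum [intro]: "(\<And>i. i \<in> I ==> u i \<in> L2 M) ==> (\<lambda>x. \<Sum>i\<in>I. u i x) \<in> L2 M"
 by (induction I rule: infinite_finite_induct) auto

lemma L2_cnj [intro]: "u \<in> L2 M ==> (\<lambda>x. cnj (u x)) \<in> L2 M" by (auto simp: L2_def)

lemma L2_AE_cong:
 assumes "u \<in> L2 M" "v \<in> borel_measurable M" "AE x in M. u x = v x"
 shows "v \<in> L2 M" by (rule L2_dominated[OF assms(2) L2_integrable_square[OF assms(1)]]) (use assms(3) in auto)

lemma L2_mult_bounded:
 assumes "u \<in> L2 M" "f \<in> borel_measurable M" "\<And>x. x \<in> space M ==> cmod (f x) \<le> C"
 shows "(\<lambda>x. f x * u x) \<in> L2 M"
proof (rule L2_dominated)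
 show "(\<lambda>x. f x * u x) \<in> borel_measurable M" using assms(1,2) L2_measurable by auto
 show "integrable M (\<lambda>x. C\<^sup>2 * (cmod (u x))\<^sup>2)" using L2_integrable_square[OF assms(1)] by simp
 show "AE x in M. (cmod (f x * u x))\<^sup>2 \<le> C\<^sup>2 * (cmod (u x))\<^sup>2"
  using assms(3) by (auto simp: norm_mult power_mult_distrib intro!: mult_right_mono power_mono)
qed

lemma L2_mult_integrable:
 assumes "u \<in> L2 M" "v \<in> L2 M"
 shows "integrable M (\<lambda>x. u x * v x)"
proof (rule Bochner_Integration.integrable_bound)
 show "integrable M (\<lambda>x. (cmod (u x))\<^sup>2 + (cmod (v x))\<^sup>2)" using assms[THEN L2_integrable_square] by simp
 have "cmod a * cmod b \<le> (cmod a)\<^sup>2 + (cmod b)\<^sup>2" for a b :: complex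
 proof -
  have "2 * (cmod a * cmod b) \<le> (cmod a)\<^sup>2 + (cmod b)\<^sup>2" using sum_squares_bound[of "cmod a" "cmod b"] by simp
  moreover have "0 \<le> cmod a * cmod b" by simp
  ultimately show ?thesis by linarith
 qed
 then show "AE x in M. norm (u x * v x) \<le> norm ((cmod (u x))\<^sup>2 + (cmod (v x))\<^sup>2)" by (auto simp: norm_mult)
qed (use assms[THEN L2_measurable] in auto)

lemma ip_integrable: "u \<in> L2 M ==> v \<in> L2 M ==> integrable M (\<lambda>x. u x * cnj (v x))" by (intro L2_mult_integrable L2_cnj)

lemma ip_add_left: "u \<in> L2 M ==> v \<in> L2 M ==> w \<in> L2 M ==> ip M (\<lambda>x. u x + v x) w = ip M u w + ip M v w"
 unfolding ip_def by (simp add: distrib_right ip_integrable)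

lemma ip_diff_left: "u \<in> L2 M ==> v \<in> L2 M ==> w \<in> L2 M ==> ip M (\<lambda>x. u x - v x) w = ip M u w - ip M v w"
 unfolding ip_def by (simp add: left_diff_distrib ip_integrable)

lemma ip_scale_left: "ip M (\<lambda>x. c * u x) w = c * ip M u w" unfolding ip_def by (simp add: mult.assoc)

lemma ip_uminus_left: "ip M (\<lambda>x. - u x) w = - ip M u w" unfolding ip_def by simp

lemma ip_cnj: "cnj (ip M u v) = ip M v u" unfolding ip_def by (simp add: mult.commute flip: Bochner_Integration.integral_cnj)

lemma ip_add_right: "u \<in> L2 M ==> v \<in> L2 M ==> w \<in> L2 M ==> ip M w (\<lambda>x. u x + v x) = ip M w u + ip M w v"
 using ip_add_left[of u M v w] by (metis ip_cnj complex_cnj_add)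

lemma ip_diff_right: "u \<in> L2 M ==> v \<in> L2 M ==> w \<in> L2 M ==> ip M w (\<lambda>x. u x - v x) = ip M w u - ip M w v"
 using ip_diff_left[of u M v w] by (metis ip_cnj complex_cnj_diff)

lemma ip_scale_right: "ip M w (\<lambda>x. c * u x) = cnj c * ip M w u" using ip_scale_left[of M c u w] by (metis ip_cnj complex_cnj_mult)

lemma ip_uminus_right: "ip M w (\<lambda>x. - u x) = - ip M w u" unfolding ip_def by simp

lemma ip_sum_left:
 assumes "\<And>i. i \<in> I ==> u i \<in> L2 M" "w \<in> L2 M"
 shows "ip M (\<lambda>x. \<Sum>i\<in>I. u i x) w = (\<Sum>i\<in>I. ip M (u i) w)" using assms by (simp add: ip_def sum_distrib_right ip_integrable)

lemma ip_zero_left [simp]: "ip M (\<lambda>x. 0) w = 0"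
 and ip_zero_right [simp]: "ip M w (\<lambda>x. 0) = 0" by (simp_all add: ip_def)

lemma ip_AE_cong:
 assumes "AE x in M. u x = u' x" "AE x in M. v x = v' x"
  "u \<in> borel_measurable M" "u' \<in> borel_measurable M" "v \<in> borel_measurable M" "v' \<in> borel_measurable M"
 shows "ip M u v = ip M u' v'" unfolding ip_def by (rule integral_cong_AE) (use assms in auto)

lemma L2_norm_AE_cong:
 assumes "AE x in M. u x = u' x" "u \<in> borel_measurable M" "u' \<in> borel_measurable M"
 shows "L2_norm M u = L2_norm M u'" unfolding L2_norm_def by (rule arg_cong[where f = sqrt], rule integral_cong_AE) (use assms in auto)

lemma L2_norm_nonneg [simp]: "0 \<le> L2_norm M u" by (simp add: L2_norm_def)

lemma L2_norm_zero [simp]: "L2_norm M (\<lambda>x. 0) = 0" by (simp add: L2_norm_def)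

lemma L2_norm_square: "(L2_norm M u)\<^sup>2 = (LINT x|M. (cmod (u x))\<^sup>2)" by (simp add: L2_norm_def)

lemma ip_self: "ip M u u = cor ((L2_norm M u)\<^sup>2)"
 unfolding ip_def L2_norm_square complex_norm_square[symmetric] by (rule integral_complex_of_real)

lemma L2_norm_eq_0_iff:
 assumes "u \<in> L2 M"
 shows "L2_norm M u = 0 \<longleftrightarrow> (AE x in M. u x = 0)"
 unfolding L2_norm_def using integral_nonneg_eq_0_iff_AE[OF L2_integrable_square[OF assms]] by simp

lemma L2_norm_scale: "L2_norm M (\<lambda>x. c * u x) = cmod c * L2_norm M u" by (simp add: L2_norm_def norm_mult power_mult_distrib real_sqrt_mult)

lemma L2_norm_uminus [simp]: "L2_norm M (\<lambda>x. - u x) = L2_norm M u" by (simp add: L2_norm_def)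

lemma L2_norm_minus_commute: "L2_norm M (\<lambda>x. u x - v x) = L2_norm M (\<lambda>x. v x - u x)" by (simp add: L2_norm_def norm_minus_commute)

lemma L2_norm_cnj [simp]: "L2_norm M (\<lambda>x. cnj (u x)) = L2_norm M u" by (simp add: L2_norm_def)

lemma L2_norm_add_square:
 assumes "u \<in> L2 M" "v \<in> L2 M"
 shows "(L2_norm M (\<lambda>x. u x + v x))\<^sup>2 = (L2_norm M u)\<^sup>2 + 2 * Re (ip M u v) + (L2_norm M v)\<^sup>2"
proof -
 have "cor ((L2_norm M (\<lambda>x. u x + v x))\<^sup>2) = ip M u u + (ip M u v + ip M v u) + ip M v v"
  unfolding ip_self[symmetric] using assms by (simp add: ip_add_left ip_add_right L2_add)
 also have "ip M u v + ip M v u = cor (2 * Re (ip M u v))" using complex_add_cnj[of "ip M u v"] by (simp add: ip_cnj)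
 finally have "cor ((L2_norm M (\<lambda>x. u x + v x))\<^sup>2) =
   cor ((L2_norm M u)\<^sup>2 + 2 * Re (ip M u v) + (L2_norm M v)\<^sup>2)" by (simp add: ip_self)
 then show ?thesis by (simp only: of_real_eq_iff)
qed

lemma L2_norm_diff_square:
 assumes "u \<in> L2 M" "v \<in> L2 M"
 shows "(L2_norm M (\<lambda>x. u x - v x))\<^sup>2 = (L2_norm M u)\<^sup>2 - 2 * Re (ip M u v) + (L2_norm M v)\<^sup>2"
 using L2_norm_add_square[OF assms(1) L2_uminus[OF assms(2)]] by (simp add: ip_uminus_right)

lemma L2_Cauchy_Schwarz:
 assumes u: "u \<in> L2 M" and v: "v \<in> L2 M"
 shows "cmod (ip M u v) \<le> L2_norm M u * L2_norm M v"
proof (cases "L2_norm M v = 0")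
 case True
 then have "AE x in M. v x = 0" using v by (simp add: L2_norm_eq_0_iff)
 then have "ip M u v = ip M u (\<lambda>x. 0)" by (intro ip_AE_cong) (use u v L2_measurable in auto)
 then show ?thesis using True by simp
next
 case False
 define b c where "b = L2_norm M v" and "c = ip M u v / cor (b\<^sup>2)"
 have b: "b > 0" using False L2_norm_nonneg[of M v] unfolding b_def by linarith
 have "0 \<le> (L2_norm M (\<lambda>x. u x - c * v x))\<^sup>2" by simp
 also have "\<dots> = (L2_norm M u)\<^sup>2 - 2 * Re (cnj c * ip M u v) + (cmod c)\<^sup>2 * b\<^sup>2"
  using L2_norm_diff_square[OF u L2_scale[OF v, of c]] by (simp add: ip_scale_right L2_norm_scale power_mult_distrib b_def)
 also have "cnj c * ip M u v = cor ((cmod (ip M u v))\<^sup>2 / b\<^sup>2)" using complex_norm_square[of "ip M u v"] by (simp add: c_def mult.commute)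
 also have "(cmod c)\<^sup>2 * b\<^sup>2 = (cmod (ip M u v))\<^sup>2 / b\<^sup>2"
  using b by (simp add: c_def norm_divide norm_power power_divide) (simp add: field_simps eval_nat_numeral)
 finally have "(cmod (ip M u v))\<^sup>2 / b\<^sup>2 \<le> (L2_norm M u)\<^sup>2" by simp
 then have "(cmod (ip M u v))\<^sup>2 \<le> (L2_norm M u * b)\<^sup>2" using b by (simp add: divide_simps power_mult_distrib)
 then show ?thesis using b by (metis b_def power2_le_imp_le mult_nonneg_nonneg L2_norm_nonneg)
qed

lemma L2_norm_triangle:
 assumes "u \<in> L2 M" "v \<in> L2 M"
 shows "L2_norm M (\<lambda>x. u x + v x) \<le> L2_norm M u + L2_norm M v"
proof (rule power2_le_imp_le)
 have "Re (ip M u v) \<le> L2_norm M u * L2_norm M v" using L2_Cauchy_Schwarz[OF assms] complex_Re_le_cmod order_trans by blast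
 then show "(L2_norm M (\<lambda>x. u x + v x))\<^sup>2 \<le> (L2_norm M u + L2_norm M v)\<^sup>2"
  unfolding L2_norm_add_square[OF assms] by (simp add: power2_sum)
qed simp

lemma L2_norm_diff_triangle:
 assumes "u \<in> L2 M" "v \<in> L2 M"
 shows "L2_norm M (\<lambda>x. u x - v x) \<le> L2_norm M u + L2_norm M v" using L2_norm_triangle[OF assms(1) L2_uminus[OF assms(2)]] by simp

lemma L2_norm_dist_triangle:
 assumes "u \<in> L2 M" "v \<in> L2 M" "w \<in> L2 M"
 shows "L2_norm M (\<lambda>x. u x - w x) \<le> L2_norm M (\<lambda>x. u x - v x) + L2_norm M (\<lambda>x. v x - w x)"
 using L2_norm_triangle[of "\<lambda>x. u x - v x" M "\<lambda>x. v x - w x"] assms by (simp add: L2_diff)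

lemma L2_norm_diff_abs:
 assumes "u \<in> L2 M" "v \<in> L2 M"
 shows "\<bar>L2_norm M u - L2_norm M v\<bar> \<le> L2_norm M (\<lambda>x. u x - v x)"
 using L2_norm_triangle[of "\<lambda>x. u x - v x" M v] L2_norm_triangle[of "\<lambda>x. v x - u x" M u] assms
  L2_norm_minus_commute[of M u v] by (simp add: L2_diff abs_le_iff)

lemma L2_norm_mono:
 assumes "v \<in> L2 M" "u \<in> borel_measurable M" "AE x in M. cmod (u x) \<le> C * cmod (v x)" "0 \<le> C"
 shows "L2_norm M u \<le> C * L2_norm M v"
proof -
 have AE: "AE x in M. (cmod (u x))\<^sup>2 \<le> C\<^sup>2 * (cmod (v x))\<^sup>2"
  using assms(3) by eventually_elim (simp add: power_mono flip: power_mult_distrib)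
 have g: "integrable M (\<lambda>x. C\<^sup>2 * (cmod (v x))\<^sup>2)" using L2_integrable_square[OF assms(1)] by simp
 have "u \<in> L2 M" by (rule L2_dominated[OF assms(2) g AE])
 then have "(LINT x|M. (cmod (u x))\<^sup>2) \<le> (LINT x|M. C\<^sup>2 * (cmod (v x))\<^sup>2)"
  by (intro integral_mono_AE[OF _ g AE] L2_integrable_square)
 also have "\<dots> = C\<^sup>2 * (LINT x|M. (cmod (v x))\<^sup>2)" by simp
 finally have "sqrt (LINT x|M. (cmod (u x))\<^sup>2) \<le> sqrt (C\<^sup>2 * (LINT x|M. (cmod (v x))\<^sup>2))" by simp
 then show ?thesis using assms(4) unfolding L2_norm_def by (simp add: real_sqrt_mult)
qed

lemma L2_norm_mult_bounded:
 assumes "u \<in> L2 M" "f \<in> borel_measurable M" "\<And>x. x \<in> space M ==> cmod (f x) \<le> C" "0 \<le> C"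
 shows "L2_norm M (\<lambda>x. f x * u x) \<le> C * L2_norm M u"
proof (rule L2_norm_mono[OF assms(1)])
 show "(\<lambda>x. f x * u x) \<in> borel_measurable M" using assms(1,2) L2_measurable by auto
qed (use assms in \<open>auto simp: norm_mult intro!: mult_right_mono\<close>)

lemma L2_norm_sum:
 assumes "\<And>i. i \<in> I ==> u i \<in> L2 M"
 shows "L2_norm M (\<lambda>x. \<Sum>i\<in>I. u i x) \<le> (\<Sum>i\<in>I. L2_norm M (u i))" using assms
proof (induction I rule: infinite_finite_induct)
 case (insert i I)
 have "L2_norm M (\<lambda>x. \<Sum>j\<in>insert i I. u j x) \<le> L2_norm M (u i) + L2_norm M (\<lambda>x. \<Sum>j\<in>I. u j x)"
  using insert by (simp add: L2_norm_triangle L2_sum)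
 then show ?case using insert by (simp add: order_trans)
qed auto

subsection \<open>Convergence and completeness\<close>

definition L2_tendsto :: "'a measure => (nat => 'a => complex) => ('a => complex) => bool" where
 "L2_tendsto M s u \<longleftrightarrow> (\<lambda>n. L2_norm M (\<lambda>x. s n x - u x)) \<longlonglongrightarrow> 0"

lemma L2_tendstoI:
 assumes "\<And>n. L2_norm M (\<lambda>x. s n x - u x) \<le> b n" "b \<longlonglongrightarrow> 0"
 shows "L2_tendsto M s u" unfolding L2_tendsto_def by (rule tendsto_sandwich[OF _ _ tendsto_const assms(2)]) (auto simp: assms(1))

lemma L2_tendsto_const [simp]: "L2_tendsto M (\<lambda>n. u) u" by (simp add: L2_tendsto_def)

lemma L2_tendsto_norm:
 assumes "\<And>n. s n \<in> L2 M" "u \<in> L2 M" "L2_tendsto M s u"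
 shows "(\<lambda>n. L2_norm M (s n)) \<longlonglongrightarrow> L2_norm M u"
proof -
 have "(\<lambda>n. L2_norm M (s n) - L2_norm M u) \<longlonglongrightarrow> 0" using assms(3)[unfolded L2_tendsto_def]
  by (rule tendsto_0_le[where K = 1]) (auto intro!: always_eventually simp: L2_norm_diff_abs assms)
 then show ?thesis by (simp add: LIM_zero_iff)
qed

lemma L2_tendsto_add:
 assumes "\<And>n. s n \<in> L2 M" "\<And>n. t n \<in> L2 M" "u \<in> L2 M" "v \<in> L2 M" "L2_tendsto M s u" "L2_tendsto M t v"
 shows "L2_tendsto M (\<lambda>n x. s n x + t n x) (\<lambda>x. u x + v x)"
proof (rule L2_tendstoI)
 show "L2_norm M (\<lambda>x. s n x + t n x - (u x + v x)) \<le>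
   L2_norm M (\<lambda>x. s n x - u x) + L2_norm M (\<lambda>x. t n x - v x)" for n
  using L2_norm_triangle[of "\<lambda>x. s n x - u x" M "\<lambda>x. t n x - v x"] assms(1-4) by (simp add: L2_diff add_diff_add)
 show "(\<lambda>n. L2_norm M (\<lambda>x. s n x - u x) + L2_norm M (\<lambda>x. t n x - v x)) \<longlonglongrightarrow> 0"
  using tendsto_add[OF assms(5,6)[unfolded L2_tendsto_def]] by simp
qed

lemma L2_tendsto_scale: "L2_tendsto M s u ==> L2_tendsto M (\<lambda>n x. c * s n x) (\<lambda>x. c * u x)"
 unfolding L2_tendsto_def right_diff_distrib[symmetric] L2_norm_scale by (rule tendsto_mult_right_zero)

lemma L2_tendsto_mult_bounded:
 assumes "\<And>n. s n \<in> L2 M" "u \<in> L2 M" "L2_tendsto M s u"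
  "f \<in> borel_measurable M" "\<And>x. x \<in> space M ==> cmod (f x) \<le> C"
 shows "L2_tendsto M (\<lambda>n x. f x * s n x) (\<lambda>x. f x * u x)"
proof (rule L2_tendstoI)
 have "L2_norm M (\<lambda>x. f x * (s n x - u x)) \<le> \<bar>C\<bar> * L2_norm M (\<lambda>x. s n x - u x)" for n
 proof (rule L2_norm_mult_bounded)
  show "cmod (f x) \<le> \<bar>C\<bar>" if "x \<in> space M" for x using assms(5)[OF that] by linarith
 qed (use assms in auto)
 then show "L2_norm M (\<lambda>x. f x * s n x - f x * u x) \<le> \<bar>C\<bar> * L2_norm M (\<lambda>x. s n x - u x)" for n
  by (simp add: right_diff_distrib)
 show "(\<lambda>n. \<bar>C\<bar> * L2_norm M (\<lambda>x. s n x - u x)) \<longlonglongrightarrow> 0"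
  using assms(3) unfolding L2_tendsto_def by (rule tendsto_mult_right_zero)
qed

lemma L2_tendsto_diff:
 assumes "\<And>n. s n \<in> L2 M" "\<And>n. t n \<in> L2 M" "u \<in> L2 M" "v \<in> L2 M" "L2_tendsto M s u" "L2_tendsto M t v"
 shows "L2_tendsto M (\<lambda>n x. s n x - t n x) (\<lambda>x. u x - v x)"
 using L2_tendsto_add[OF assms(1) L2_uminus[OF assms(2)] assms(3) L2_uminus[OF assms(4)] assms(5)]
  L2_tendsto_scale[OF assms(6), of "-1"] by simp

lemma L2_tendsto_ip:
 assumes "\<And>n. s n \<in> L2 M" "\<And>n. t n \<in> L2 M" "u \<in> L2 M" "v \<in> L2 M" "L2_tendsto M s u" "L2_tendsto M t v"
 shows "(\<lambda>n. ip M (s n) (t n)) \<longlonglongrightarrow> ip M u v"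
proof -
 have "(\<lambda>n. ip M (s n) (t n) - ip M u v) \<longlonglongrightarrow> 0"
 proof (rule Lim_null_comparison)
  show "(\<lambda>n. L2_norm M (\<lambda>x. s n x - u x) * L2_norm M (t n) + L2_norm M u * L2_norm M (\<lambda>x. t n x - v x)) \<longlonglongrightarrow> 0"
   using tendsto_add[OF tendsto_mult[OF assms(5)[unfolded L2_tendsto_def] L2_tendsto_norm[OF assms(2,4,6)]]
     tendsto_mult[OF tendsto_const[of "L2_norm M u"] assms(6)[unfolded L2_tendsto_def]]] by simp
  show "\<forall>\<^sub>F n in sequentially. cmod (ip M (s n) (t n) - ip M u v) \<le>
    L2_norm M (\<lambda>x. s n x - u x) * L2_norm M (t n) + L2_norm M u * L2_norm M (\<lambda>x. t n x - v x)"
  proof (rule always_eventually, rule allI)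
   fix n
   have "ip M (s n) (t n) - ip M u v = ip M (\<lambda>x. s n x - u x) (t n) + ip M u (\<lambda>x. t n x - v x)"
    using assms(1-4) by (simp add: ip_diff_left ip_diff_right)
   also have "cmod \<dots> \<le> cmod (ip M (\<lambda>x. s n x - u x) (t n)) + cmod (ip M u (\<lambda>x. t n x - v x))" by (rule norm_triangle_ineq)
   also have "\<dots> \<le> L2_norm M (\<lambda>x. s n x - u x) * L2_norm M (t n) + L2_norm M u * L2_norm M (\<lambda>x. t n x - v x)"
    by (intro add_mono L2_Cauchy_Schwarz L2_diff assms)
   finally show "cmod (ip M (s n) (t n) - ip M u v) \<le>
     L2_norm M (\<lambda>x. s n x - u x) * L2_norm M (t n) + L2_norm M u * L2_norm M (\<lambda>x. t n x - v x)" .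
  qed
 qed
 then show ?thesis by (simp add: LIM_zero_iff)
qed

lemma L2_nn_integral: "u \<in> L2 M ==> (\<integral>\<^sup>+x. ennreal ((cmod (u x))\<^sup>2) \<partial>M) = ennreal ((L2_norm M u)\<^sup>2)"
 by (simp add: L2_norm_square nn_integral_eq_integral L2_integrable_square)

text \<open>One bound in \<open>ennreal\<close> yields both membership and the norm estimate, so
  Tonelli and Fatou arguments need no prior integrability.\<close>

lemma L2I_nn_integral:
 assumes "u \<in> borel_measurable M" "(\<integral>\<^sup>+x. ennreal ((cmod (u x))\<^sup>2) \<partial>M) \<le> ennreal (a\<^sup>2)"
 shows "u \<in> L2 M" "0 \<le> a ==> L2_norm M u \<le> a"
proof -
 have "(\<integral>\<^sup>+x. ennreal (norm ((cmod (u x))\<^sup>2)) \<partial>M) < \<infinity>" using assms(2) by (simp add: le_less_trans)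
 then show u: "u \<in> L2 M" unfolding L2_def mem_Collect_eq by (intro conjI assms(1) integrableI_bounded) (use assms(1) in auto)
 show "L2_norm M u \<le> a" if "0 \<le> a"
 proof (rule power2_le_imp_le[OF _ that])
  show "(L2_norm M u)\<^sup>2 \<le> a\<^sup>2" using assms(2) unfolding L2_nn_integral[OF u] by (simp add: ennreal_le_iff)
 qed
qed

text \<open>AM-GM with weight 2^k bounds each term by 2^(-k) plus 2^k times its square, and both
  series converge.\<close>

lemma summable_weighted_squares:
 fixes a :: "nat => real"
 assumes "summable (\<lambda>k. 2 ^ k * (a k)\<^sup>2)"
 shows "summable (\<lambda>k. \<bar>a k\<bar>)"
proof (rule summable_comparison_test_ev)
 have "\<bar>a k\<bar> \<le> (1/2) ^ k + 2 ^ k * (a k)\<^sup>2" for k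
 proof -
  have e: "(1/2 :: real) ^ k = inverse (2 ^ k)" by (simp add: power_one_over inverse_eq_divide)
  define b :: real where "b = 2 ^ k"
  have b: "b > 0" by (simp add: b_def)
  have "0 \<le> (b * \<bar>a k\<bar> - 1)\<^sup>2" by simp
  then have "2 * (b * \<bar>a k\<bar>) \<le> b\<^sup>2 * (a k)\<^sup>2 + 1" by (simp add: power2_diff power_mult_distrib)
  then have "b * \<bar>a k\<bar> \<le> b\<^sup>2 * (a k)\<^sup>2 + 1" using b by (smt (verit) mult_nonneg_nonneg abs_ge_zero)
  then have "\<bar>a k\<bar> \<le> inverse b + b * (a k)\<^sup>2" using b by (simp add: field_simps power2_eq_square)
  then show ?thesis unfolding e b_def .
 qed
 then show "\<forall>\<^sub>F k in sequentially. norm \<bar>a k\<bar> \<le> (1/2) ^ k + 2 ^ k * (a k)\<^sup>2" by simp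
 show "summable (\<lambda>k. (1/2 :: real) ^ k + 2 ^ k * (a k)\<^sup>2)" by (intro summable_add assms summable_geometric) simp
qed

text \<open>Increments of a fast subsequence have norm at most 2^(-k). Their squares remain
  integrable after weighting by 2^k, which gives absolute convergence almost everywhere by
  \<open>summable_weighted_squares\<close>. Fatou's lemma then turns the pointwise limit into a norm
  limit of the whole sequence.\<close>

theorem Riesz_Fischer:
 assumes s: "\<And>n. s n \<in> L2 M"
  and cauchy: "\<And>e. e > 0 ==> \<exists>N. \<forall>m\<ge>N. \<forall>n\<ge>N. L2_norm M (\<lambda>x. s m x - s n x) < e"
 shows "\<exists>u\<in>L2 M. L2_tendsto M s u"
proof -
 obtain N where N: "\<And>k m n. m \<ge> N k ==> n \<ge> N k ==> L2_norm M (\<lambda>x. s m x - s n x) < (1/2) ^ k"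
  using cauchy[of "(1/2) ^ k" for k] by (metis zero_less_power zero_less_divide_1_iff zero_less_numeral)
 \<comment> \<open>Maximum and successor make the indices strictly increasing while each stays
   beyond its threshold \<open>N k\<close>.\<close>
 define r where "r = rec_nat (N 0) (\<lambda>k j. Suc (max j (N (Suc k))))"
 have r_ge: "r k \<ge> N k" for k by (cases k) (auto simp: r_def)
 have "strict_mono r" by (rule strict_monoI_Suc) (auto simp: r_def less_Suc_eq_le)
 then have r_ge2: "r k \<ge> k" for k by (simp add: strict_mono_imp_increasing)
 define d where "d k x = s (r (Suc k)) x - s (r k) x" for k x
 have d: "d k \<in> L2 M" for k unfolding d_def by (intro L2_diff s)
 have r_step: "r (Suc k) \<ge> N k" for k using r_ge[of k] strict_mono_less[OF \<open>strict_mono r\<close>, of k "Suc k"] by simp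
 have d_le: "L2_norm M (d k) \<le> (1/2) ^ k" for k unfolding d_def using N[OF r_step r_ge, of k] by simp
 have [measurable]: "d k \<in> borel_measurable M" "s k \<in> borel_measurable M" for k using d s L2_measurable by auto
 have "(\<integral>\<^sup>+x. (\<Sum>k. ennreal (2 ^ k * (cmod (d k x))\<^sup>2)) \<partial>M) = (\<Sum>k. \<integral>\<^sup>+x. ennreal (2 ^ k * (cmod (d k x))\<^sup>2) \<partial>M)"
  by (rule nn_integral_suminf) simp
 also have "\<dots> = (\<Sum>k. ennreal (2 ^ k * (L2_norm M (d k))\<^sup>2))" by (simp add: ennreal_mult nn_integral_cmult L2_nn_integral d)
 also have "\<dots> \<le> (\<Sum>k. ennreal ((1/2) ^ k))"
 proof (intro suminf_le ennreal_leI summableI)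
  fix k
  have "(L2_norm M (d k))\<^sup>2 \<le> ((1/2) ^ k)\<^sup>2" by (rule power_mono[OF d_le L2_norm_nonneg])
  then have "2 ^ k * (L2_norm M (d k))\<^sup>2 \<le> 2 ^ k * ((1/2) ^ k)\<^sup>2" by simp
  also have "\<dots> = (1/2) ^ k" by (simp add: power2_eq_square power_one_over)
  finally show "2 ^ k * (L2_norm M (d k))\<^sup>2 \<le> (1/2) ^ k" .
 qed
 also have "\<dots> = ennreal (\<Sum>k. (1/2) ^ k)" by (intro suminf_ennreal2 summable_geometric) auto
 also have "\<dots> < \<infinity>" by simp
 finally have "(\<integral>\<^sup>+x. (\<Sum>k. ennreal (2 ^ k * (cmod (d k x))\<^sup>2)) \<partial>M) \<noteq> \<infinity>" by simp
 then have "AE x in M. (\<Sum>k. ennreal (2 ^ k * (cmod (d k x))\<^sup>2)) \<noteq> \<infinity>" by (intro nn_integral_noteq_infinite) auto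
 then have conv: "AE x in M. convergent (\<lambda>k. s (r k) x)"
 proof eventually_elim
  case (elim x)
  then have "summable (\<lambda>k. 2 ^ k * (cmod (d k x))\<^sup>2)" by (intro summable_suminf_not_top) auto
  then have "summable (\<lambda>k. cmod (d k x))" using summable_weighted_squares[of "\<lambda>k. cmod (d k x)"] by simp
  then have "summable (\<lambda>k. d k x)" by (rule summable_norm_cancel)
  then have "convergent (\<lambda>n. \<Sum>k<n. d k x)" by (simp add: summable_iff_convergent)
  moreover have "(\<Sum>k<n. d k x) = s (r n) x - s (r 0) x" for n unfolding d_def by (rule sum_lessThan_telescope)
  ultimately have "convergent (\<lambda>n. s (r n) x - s (r 0) x)" by simp
  then have "convergent (\<lambda>n. (s (r n) x - s (r 0) x) + s (r 0) x)" by (intro convergent_add convergent_const)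
  then show ?case by simp
 qed
 define u where "u x = lim (\<lambda>k. s (r k) x)" for x
 have u[measurable]: "u \<in> borel_measurable M" unfolding u_def by measurable
 have lim: "AE x in M. (\<lambda>k. s (r k) x) \<longlonglongrightarrow> u x" using conv unfolding u_def by (auto simp: convergent_LIMSEQ_iff)
 have key: "(\<integral>\<^sup>+x. ennreal ((cmod (s n x - u x))\<^sup>2) \<partial>M) \<le> ennreal (((1/2) ^ k)\<^sup>2)" if n: "n \<ge> N k" for n k
 proof -
  have "(\<integral>\<^sup>+x. ennreal ((cmod (s n x - u x))\<^sup>2) \<partial>M)
    = (\<integral>\<^sup>+x. liminf (\<lambda>j. ennreal ((cmod (s n x - s (r j) x))\<^sup>2)) \<partial>M)"
  proof (rule nn_integral_cong_AE, use lim in eventually_elim)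
   case (elim x)
   then have "(\<lambda>j. ennreal ((cmod (s n x - s (r j) x))\<^sup>2)) \<longlonglongrightarrow> ennreal ((cmod (s n x - u x))\<^sup>2)"
    by (intro tendsto_intros)
   then show ?case by (rule lim_imp_Liminf[OF sequentially_bot, symmetric])
  qed
  also have "\<dots> \<le> liminf (\<lambda>j. \<integral>\<^sup>+x. ennreal ((cmod (s n x - s (r j) x))\<^sup>2) \<partial>M)"
   by (rule nn_integral_liminf) simp
  also have "\<dots> = liminf (\<lambda>j. ennreal ((L2_norm M (\<lambda>x. s n x - s (r j) x))\<^sup>2))"
   by (intro arg_cong[where f = liminf] ext L2_nn_integral L2_diff s)
  also have "\<dots> \<le> ennreal (((1/2) ^ k)\<^sup>2)"
  proof (rule Liminf_le)
   show "\<forall>\<^sub>F j in sequentially. ennreal ((L2_norm M (\<lambda>x. s n x - s (r j) x))\<^sup>2) \<le> ennreal (((1/2) ^ k)\<^sup>2)"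
    using eventually_ge_at_top[of "N k"]
   proof eventually_elim
    case (elim j)
    then have "r j \<ge> N k" using r_ge2[of j] by simp
    then have "L2_norm M (\<lambda>x. s n x - s (r j) x) \<le> (1/2) ^ k" using N[OF n] by force
    then show ?case by (intro ennreal_leI power_mono) auto
   qed
  qed simp
  finally show ?thesis .
 qed
 have u_L2: "u \<in> L2 M"
 proof -
  have "(\<lambda>x. s (N 0) x - u x) \<in> L2 M" by (rule L2I_nn_integral(1)[OF _ key[of 0 "N 0"]]) auto
  from L2_diff[OF s[of "N 0"] this] show ?thesis by simp
 qed
 have "(\<lambda>n. L2_norm M (\<lambda>x. s n x - u x)) \<longlonglongrightarrow> 0"
 proof (rule LIMSEQ_I)
  fix e :: real assume "e > 0"
  then obtain k where k: "(1/2) ^ k < e" using real_arch_pow_inv[of e "1/2"] by auto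
  have "L2_norm M (\<lambda>x. s n x - u x) \<le> (1/2) ^ k" if "n \<ge> N k" for n by (rule L2I_nn_integral(2)[OF _ key[OF that]]) auto
  then show "\<exists>n0. \<forall>n\<ge>n0. norm (L2_norm M (\<lambda>x. s n x - u x) - 0) < e" using k by (intro exI[of _ "N k"]) force
 qed
 with u_L2 show ?thesis unfolding L2_tendsto_def by blast
qed

lemma L2_tendsto_Cauchy:
 assumes "\<And>n. s n \<in> L2 M" "u \<in> L2 M" "L2_tendsto M s u" "e > 0"
 shows "\<exists>N. \<forall>m\<ge>N. \<forall>n\<ge>N. L2_norm M (\<lambda>x. s m x - s n x) < e"
proof -
 obtain N where N: "\<And>n. n \<ge> N ==> L2_norm M (\<lambda>x. s n x - u x) < e/2"
  using LIMSEQ_D[OF assms(3)[unfolded L2_tendsto_def], of "e/2"] assms(4) by auto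
 have "L2_norm M (\<lambda>x. s m x - s n x) < e" if "m \<ge> N" "n \<ge> N" for m n
  using L2_norm_dist_triangle[OF assms(1,2,1), of m n] N[OF that(1)] N[OF that(2)]
   L2_norm_minus_commute[of M u "s n"] by simp
 then show ?thesis by blast
qed

subsection \<open>Orthogonal projections\<close>

definition closed_subspace :: "'a measure => ('a => complex) set => bool" where
 "closed_subspace M S \<longleftrightarrow> S \<subseteq> L2 M \<and> (\<lambda>x. 0) \<in> S \<and>
   (\<forall>u\<in>S. \<forall>v\<in>S. (\<lambda>x. u x + v x) \<in> S) \<and> (\<forall>c. \<forall>u\<in>S. (\<lambda>x. c * u x) \<in> S) \<and>
   (\<forall>s. \<forall>u\<in>L2 M. (\<forall>n. s n \<in> S) \<longrightarrow> L2_tendsto M s u \<longrightarrow> u \<in> S)"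

text \<open>Midpoints remain in \<open>S\<close>, so the parallelogram identity makes a minimising
  sequence Cauchy. A variation of the minimiser along \<open>t\<close> shows that the error is
  orthogonal to \<open>t\<close>.\<close>

theorem L2_projection:
 assumes S: "closed_subspace M S" and g: "g \<in> L2 M"
 shows "\<exists>p\<in>S. \<forall>t\<in>S. ip M (\<lambda>x. g x - p x) t = 0"
proof -
 have sub: "u \<in> L2 M" if "u \<in> S" for u using S that by (auto simp: closed_subspace_def)
 have add: "(\<lambda>x. u x + v x) \<in> S" if "u \<in> S" "v \<in> S" for u v using S that by (auto simp: closed_subspace_def)
 have scale: "(\<lambda>x. c * u x) \<in> S" if "u \<in> S" for c u using S that by (auto simp: closed_subspace_def)
 define D where "D = (\<lambda>u. L2_norm M (\<lambda>x. g x - u x)) ` S"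
 define d where "d = Inf D"
 have D_ne: "D \<noteq> {}" using S by (auto simp: D_def closed_subspace_def)
 have D_bdd: "bdd_below D" by (auto simp: D_def intro!: bdd_belowI[of _ 0])
 have d_le: "d \<le> L2_norm M (\<lambda>x. g x - u x)" if "u \<in> S" for u unfolding d_def using that D_bdd by (auto simp: D_def intro!: cInf_lower)
 have d0: "0 \<le> d" unfolding d_def by (rule cInf_greatest[OF D_ne]) (auto simp: D_def)
 have "\<exists>u\<in>S. L2_norm M (\<lambda>x. g x - u x) < d + inverse (real (Suc n))" for n
 proof -
  have "Inf D < d + inverse (real (Suc n))" by (simp add: d_def)
  then show ?thesis using cInf_less_iff[OF D_ne D_bdd] by (auto simp: D_def)
 qed
 then obtain s where s: "\<And>n. s n \<in> S" and s_le: "\<And>n. L2_norm M (\<lambda>x. g x - s n x) < d + inverse (real (Suc n))" by metis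
 have s_lim: "(\<lambda>n. L2_norm M (\<lambda>x. g x - s n x)) \<longlonglongrightarrow> d"
 proof (rule tendsto_sandwich[of "\<lambda>_. d"])
  show "(\<lambda>n. d + inverse (real (Suc n))) \<longlonglongrightarrow> d"
   using tendsto_add[OF tendsto_const LIMSEQ_inverse_real_of_nat, of d] by simp
 qed (auto simp: d_le s less_imp_le[OF s_le] simp del: of_nat_Suc intro!: always_eventually)
 have par: "(L2_norm M (\<lambda>x. s m x - s n x))\<^sup>2 \<le>
   2 * (L2_norm M (\<lambda>x. g x - s m x))\<^sup>2 + 2 * (L2_norm M (\<lambda>x. g x - s n x))\<^sup>2 - 4 * d\<^sup>2" for m n
 proof -
  let ?a = "\<lambda>x. g x - s m x" and ?b = "\<lambda>x. g x - s n x"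
  have ab: "?a \<in> L2 M" "?b \<in> L2 M" using g s sub by auto
  have "(\<lambda>x. (1/2) * (s m x + s n x)) \<in> S" by (intro scale add s)
  then have "d \<le> L2_norm M (\<lambda>x. g x - (1/2) * (s m x + s n x))" by (rule d_le)
  also have "(\<lambda>x. g x - (1/2) * (s m x + s n x)) = (\<lambda>x. (1/2) * (?a x + ?b x))" by (auto simp: field_simps)
  also have "L2_norm M \<dots> = L2_norm M (\<lambda>x. ?a x + ?b x) / 2" unfolding L2_norm_scale by simp
  finally have "2 * d \<le> L2_norm M (\<lambda>x. ?a x + ?b x)" by simp
  then have "4 * d\<^sup>2 \<le> (L2_norm M (\<lambda>x. ?a x + ?b x))\<^sup>2" using power_mono[of "2 * d" _ 2] d0 by (simp add: power_mult_distrib)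
  moreover have "(L2_norm M (\<lambda>x. s m x - s n x))\<^sup>2 = (L2_norm M (\<lambda>x. ?b x - ?a x))\<^sup>2" by simp
  moreover note L2_norm_add_square[OF ab] L2_norm_diff_square[OF ab(2,1)]
  moreover have "Re (ip M ?b ?a) = Re (ip M ?a ?b)" by (metis ip_cnj complex_cnj(1) cnj.simps(1))
  ultimately show ?thesis by argo
 qed
 have "\<exists>p\<in>L2 M. L2_tendsto M s p"
 proof (rule Riesz_Fischer)
  fix e :: real assume e: "e > 0"
  have "(\<lambda>n. (L2_norm M (\<lambda>x. g x - s n x))\<^sup>2) \<longlonglongrightarrow> d\<^sup>2" by (intro tendsto_intros s_lim)
  then obtain N where N: "\<And>n. n \<ge> N ==> \<bar>(L2_norm M (\<lambda>x. g x - s n x))\<^sup>2 - d\<^sup>2\<bar> < e\<^sup>2 / 4"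
   using LIMSEQ_D[of _ "d\<^sup>2" "e\<^sup>2 / 4"] e by (auto simp: real_norm_def)
  have "L2_norm M (\<lambda>x. s m x - s n x) < e" if "m \<ge> N" "n \<ge> N" for m n
  proof (rule power2_less_imp_less)
   show "(L2_norm M (\<lambda>x. s m x - s n x))\<^sup>2 < e\<^sup>2" using par[of m n] N[OF that(1)] N[OF that(2)] by argo
  qed (use e in simp)
  then show "\<exists>N. \<forall>m\<ge>N. \<forall>n\<ge>N. L2_norm M (\<lambda>x. s m x - s n x) < e" by blast
 qed (use s sub in auto)
 then obtain p where p: "p \<in> L2 M" and sp: "L2_tendsto M s p" by blast
 have pS: "p \<in> S" using S s sp p unfolding closed_subspace_def by blast
 have "(\<lambda>n. L2_norm M (\<lambda>x. g x - s n x)) \<longlonglongrightarrow> L2_norm M (\<lambda>x. g x - p x)"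
  by (intro L2_tendsto_norm L2_tendsto_diff sp) (use g p s sub in auto)
 then have dp: "L2_norm M (\<lambda>x. g x - p x) = d" using s_lim LIMSEQ_unique by blast
 let ?q = "\<lambda>x. g x - p x"
 have q: "?q \<in> L2 M" using g p by auto
 have "ip M ?q t = 0" if t: "t \<in> S" for t
 proof (rule ccontr)
  assume nz: "ip M ?q t \<noteq> 0"
  define a where "a = (cmod (ip M ?q t))\<^sup>2"
  define b where "b = (L2_norm M t)\<^sup>2"
  \<comment> \<open>A step with r b < 1 strictly lowers the distance unless the inner product
    vanishes; adding 1 keeps the inverse meaningful for a null \<open>t\<close>.\<close>
  define r where "r = inverse (b + 1)"
  define c where "c = cor r * ip M ?q t"
  have a: "a > 0" using nz by (simp add: a_def)
  have b: "b \<ge> 0" by (simp add: b_def)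
  have r: "r > 0" "r * b < 1" using b by (auto simp: r_def field_simps)
  have "(\<lambda>x. p x + c * t x) \<in> S" by (intro add scale pS t)
  then have "d \<le> L2_norm M (\<lambda>x. ?q x - c * t x)" using d_le by (simp add: diff_diff_eq)
  then have "d\<^sup>2 \<le> (L2_norm M (\<lambda>x. ?q x - c * t x))\<^sup>2" using d0 by (rule power_mono)
  also have "\<dots> = d\<^sup>2 - 2 * Re (cnj c * ip M ?q t) + (cmod c)\<^sup>2 * b" using L2_norm_diff_square[OF q L2_scale[OF sub[OF t], of c]] dp
   by (simp add: ip_scale_right L2_norm_scale power_mult_distrib b_def)
  also have "cnj c * ip M ?q t = cor (r * a)" using complex_norm_square[of "ip M ?q t"] by (simp add: c_def a_def mult.commute)
  also have "(cmod c)\<^sup>2 = r\<^sup>2 * a" by (simp add: c_def a_def norm_mult power_mult_distrib)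
  finally have "2 * (r * a) \<le> r\<^sup>2 * a * b" by simp
  also have "\<dots> = (r * b) * (r * a)" by (simp add: power2_eq_square)
  also have "\<dots> \<le> 1 * (r * a)" by (rule mult_right_mono) (use r a in auto)
  finally have "r * a \<le> 0" by linarith
  moreover have "r * a > 0" using r a by simp
  ultimately show False by simp
 qed
 with pS show ?thesis by blast
qed

definition L2_closure :: "'a measure => ('a => complex) set => ('a => complex) set" where
 "L2_closure M S = {u \<in> L2 M. \<exists>s. (\<forall>n. s n \<in> S) \<and> L2_tendsto M s u}"

lemma L2_closure_iff:
 assumes "S \<subseteq> L2 M" "u \<in> L2 M"
 shows "u \<in> L2_closure M S \<longleftrightarrow> (\<forall>e>0. \<exists>v\<in>S. L2_norm M (\<lambda>x. v x - u x) < e)"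
proof
 assume "u \<in> L2_closure M S"
 then obtain s where s: "\<And>n. s n \<in> S" "L2_tendsto M s u" by (auto simp: L2_closure_def)
 show "\<forall>e>0. \<exists>v\<in>S. L2_norm M (\<lambda>x. v x - u x) < e"
 proof (intro allI impI)
  fix e :: real assume "e > 0"
  then obtain n where "L2_norm M (\<lambda>x. s n x - u x) < e" using LIMSEQ_D[OF s(2)[unfolded L2_tendsto_def], of e] by auto
  then show "\<exists>v\<in>S. L2_norm M (\<lambda>x. v x - u x) < e" using s(1) by blast
 qed
next
 assume "\<forall>e>0. \<exists>v\<in>S. L2_norm M (\<lambda>x. v x - u x) < e"
 then have "\<forall>n. \<exists>v\<in>S. L2_norm M (\<lambda>x. v x - u x) < inverse (real (Suc n))" by simp
 then obtain s where s: "\<And>n. s n \<in> S" "\<And>n. L2_norm M (\<lambda>x. s n x - u x) < inverse (real (Suc n))" by metis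
 have "L2_tendsto M s u" by (rule L2_tendstoI[OF less_imp_le[OF s(2)] LIMSEQ_inverse_real_of_nat])
 then show "u \<in> L2_closure M S" using s assms by (auto simp: L2_closure_def)
qed

lemma closed_subspace_closure:
 assumes "S \<subseteq> L2 M" "(\<lambda>x. 0) \<in> S" "\<And>u v. u \<in> S ==> v \<in> S ==> (\<lambda>x. u x + v x) \<in> S"
  "\<And>c u. u \<in> S ==> (\<lambda>x. c * u x) \<in> S"
 shows "closed_subspace M (L2_closure M S)" unfolding closed_subspace_def
proof (intro conjI ballI allI impI)
 show "L2_closure M S \<subseteq> L2 M" by (auto simp: L2_closure_def)
 show "(\<lambda>x. 0) \<in> L2_closure M S" unfolding L2_closure_def using assms(2) by (auto intro!: exI[of _ "\<lambda>_ _. 0"])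
next
 fix u v assume "u \<in> L2_closure M S" "v \<in> L2_closure M S"
 then obtain s t where st: "u \<in> L2 M" "\<And>n. s n \<in> S" "L2_tendsto M s u" "v \<in> L2 M" "\<And>n. t n \<in> S" "L2_tendsto M t v"
  by (auto simp: L2_closure_def)
 have "L2_tendsto M (\<lambda>n x. s n x + t n x) (\<lambda>x. u x + v x)" by (rule L2_tendsto_add) (use st assms(1) in auto)
 then show "(\<lambda>x. u x + v x) \<in> L2_closure M S"
  unfolding L2_closure_def using st assms(3) by (auto intro!: exI[of _ "\<lambda>n x. s n x + t n x"])
next
 fix c u assume "u \<in> L2_closure M S"
 then obtain s where s: "u \<in> L2 M" "\<And>n. s n \<in> S" "L2_tendsto M s u" by (auto simp: L2_closure_def)
 then show "(\<lambda>x. c * u x) \<in> L2_closure M S" unfolding L2_closure_def using assms(4) L2_tendsto_scale[OF s(3), of c]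
  by (auto intro!: exI[of _ "\<lambda>n x. c * s n x"])
next
 fix s u assume u: "u \<in> L2 M" and s: "\<forall>n. s n \<in> L2_closure M S" and lim: "L2_tendsto M s u"
 show "u \<in> L2_closure M S" unfolding L2_closure_iff[OF assms(1) u]
 proof (intro allI impI)
  fix e :: real assume e: "e > 0"
  then obtain n where n: "L2_norm M (\<lambda>x. s n x - u x) < e/2" using LIMSEQ_D[OF lim[unfolded L2_tendsto_def], of "e/2"] by auto
  have sn: "s n \<in> L2 M" using s by (auto simp: L2_closure_def)
  have "\<exists>v\<in>S. L2_norm M (\<lambda>x. v x - s n x) < e/2" using s e L2_closure_iff[OF assms(1) sn] by (meson half_gt_zero)
  then obtain v where v: "v \<in> S" "L2_norm M (\<lambda>x. v x - s n x) < e/2" by blast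
  have "L2_norm M (\<lambda>x. v x - u x) < e" using L2_norm_dist_triangle[of v M "s n" u] v n sn u assms(1) by fastforce
  with v show "\<exists>v\<in>S. L2_norm M (\<lambda>x. v x - u x) < e" by blast
 qed
qed

section \<open>Finite-dimensional spaces of square-integrable functions\<close>

text \<open>Each functional either vanishes on \<open>N\<close> or has a kernel in \<open>N\<close>
  complemented by one vector, so induction over the functionals exhausts \<open>N\<close>. This is
  how an a priori estimate yields finite multiplicity.\<close>

lemma L2_finite_dim_of_functionals:
 assumes "finite B" "B \<subseteq> L2 M" "N \<subseteq> L2 M"
  and "\<And>u v. u \<in> N ==> v \<in> N ==> (\<lambda>x. u x + v x) \<in> N" "\<And>c u. u \<in> N ==> (\<lambda>x. c * u x) \<in> N"
  and "\<And>u. u \<in> N ==> (\<forall>b\<in>B. ip M u b = 0) ==> AE x in M. u x = 0"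
 shows "\<exists>F. finite F \<and> F \<subseteq> L2 M \<and> (\<forall>u\<in>N. \<exists>c. AE x in M. u x = (\<Sum>b\<in>F. c b * b x))" using assms
proof (induction B arbitrary: N rule: finite_induct)
 case empty
 then show ?case by (intro exI[of _ "{}"]) auto
next
 case (insert b B)
 show ?case
 proof (cases "\<forall>u\<in>N. ip M u b = 0")
  case True
  show ?thesis by (rule insert.IH) (use insert.prems True in auto)
 next
  case False
  then obtain e where e: "e \<in> N" "ip M e b \<noteq> 0" by blast
  have b: "b \<in> L2 M" using insert.prems by auto
  define N' where "N' = {u \<in> N. ip M u b = 0}"
  have "\<exists>F. finite F \<and> F \<subseteq> L2 M \<and> (\<forall>u\<in>N'. \<exists>c. AE x in M. u x = (\<Sum>b\<in>F. c b * b x))"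
  proof (rule insert.IH)
   show "(\<lambda>x. u x + v x) \<in> N'" if "u \<in> N'" "v \<in> N'" for u v
   proof -
    have "u \<in> L2 M" "v \<in> L2 M" using that insert.prems(2) by (auto simp: N'_def)
    then show ?thesis using that insert.prems(3) b by (auto simp: N'_def ip_add_left)
   qed
   show "(\<lambda>x. c * u x) \<in> N'" if "u \<in> N'" for c u using that insert.prems(4) by (auto simp: N'_def ip_scale_left)
  qed (use insert.prems in \<open>auto simp: N'_def\<close>)
  then obtain F where F: "finite F" "F \<subseteq> L2 M" "\<And>u. u \<in> N' ==> \<exists>c. AE x in M. u x = (\<Sum>b\<in>F. c b * b x)" by blast
  have eL: "e \<in> L2 M" using e insert.prems(2) by auto
  have "\<exists>c. AE x in M. u x = (\<Sum>b\<in>insert e F. c b * b x)" if u: "u \<in> N" for u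
  proof -
   define a where "a = ip M u b / ip M e b"
   have uL: "u \<in> L2 M" using u insert.prems(2) by auto
   have "(\<lambda>x. u x + (- a) * e x) \<in> N" using u e insert.prems(3,4) by blast
   moreover have "ip M (\<lambda>x. u x + (- a) * e x) b = 0"
    using e(2) by (simp only: ip_add_left[OF uL L2_scale[OF eL] b] ip_scale_left) (simp add: a_def)
   ultimately have "(\<lambda>x. u x + (- a) * e x) \<in> N'" by (simp add: N'_def)
   from F(3)[OF this] obtain c where c: "AE x in M. u x + (- a) * e x = (\<Sum>b\<in>F. c b * b x)" by blast
   \<comment> \<open>\<open>e\<close> may already occur in \<open>F\<close>, hence its two
     coefficients are added.\<close>
   define c' where "c' y = (if y \<in> F then c y else 0) + (if y = e then a else 0)" for y
   have c': "(\<Sum>y\<in>insert e F. c' y * y x) = (\<Sum>y\<in>F. c y * y x) + a * e x" for x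
   proof -
    have "(\<Sum>y\<in>insert e F. c' y * y x) =
      (\<Sum>y\<in>insert e F. (if y \<in> F then c y * y x else 0)) + (\<Sum>y\<in>insert e F. if y = e then a * y x else 0)"
     unfolding sum.distrib[symmetric] c'_def by (intro sum.cong refl) (auto simp: distrib_right)
    also have "(\<Sum>y\<in>insert e F. (if y \<in> F then c y * y x else 0)) = (\<Sum>y\<in>F. c y * y x)"
     by (rule sum.mono_neutral_cong_right) (use F in auto)
    also have "(\<Sum>y\<in>insert e F. if y = e then a * y x else 0) = a * e x" using F(1) by (subst sum.delta) auto
    finally show ?thesis .
   qed
   have "AE x in M. u x = (\<Sum>y\<in>insert e F. c' y * y x)" using c
   proof eventually_elim
    case (elim x)
    then show ?case unfolding c' by (simp add: algebra_simps)
   qed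
   then show ?thesis by blast
  qed
  then show ?thesis using F eL by (intro exI[of _ "insert e F"]) auto
 qed
qed

text \<open>In finite dimension weak convergence to zero is norm convergence; this is that fact with
  a constant independent of the coefficients. The induction splits off the component of the new
  vector orthogonal to the closure of the earlier span, so that the new coefficient is read off by
  one inner product.\<close>

lemma L2_finite_dim_norm_le:
 assumes "finite B" "B \<subseteq> L2 M"
 shows "\<exists>E C. finite E \<and> E \<subseteq> L2 M \<and> 0 \<le> C \<and>
  (\<forall>c. L2_norm M (\<lambda>x. \<Sum>b\<in>B. c b * b x) \<le> C * (\<Sum>a\<in>E. cmod (ip M (\<lambda>x. \<Sum>b\<in>B. c b * b x) a)))"
 using assms
proof (induction B rule: finite_induct)
 case empty
 show ?case by (intro exI[of _ "{}"] exI[of _ 0]) simp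
next
 case (insert b B)
 let ?s = "\<lambda>c x. \<Sum>y\<in>B. c y * y x"
 have bL: "b \<in> L2 M" and BL: "B \<subseteq> L2 M" using insert.prems by auto
 then obtain E C where E: "finite E" "E \<subseteq> L2 M" "0 \<le> C"
  and EC: "\<And>c. L2_norm M (?s c) \<le> C * (\<Sum>a\<in>E. cmod (ip M (?s c) a))" using insert.IH by blast
 define S where "S = range ?s"
 have sL: "?s c \<in> L2 M" for c using BL by (intro L2_sum L2_scale) auto
 have SL: "S \<subseteq> L2 M" using sL by (auto simp: S_def)
 have cl: "closed_subspace M (L2_closure M S)"
 proof (rule closed_subspace_closure[OF SL])
  show "(\<lambda>x. 0) \<in> S" unfolding S_def by (rule range_eqI[of _ _ "\<lambda>y. 0"]) simp
  show "(\<lambda>x. u x + v x) \<in> S" if uv: "u \<in> S" "v \<in> S" for u v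
  proof -
   obtain c d where "u = ?s c" "v = ?s d" using uv by (auto simp: S_def)
   then show ?thesis unfolding S_def by (intro range_eqI[of _ _ "\<lambda>y. c y + d y"]) (simp add: distrib_right sum.distrib)
  qed
  show "(\<lambda>x. d * u x) \<in> S" if uS: "u \<in> S" for d u
  proof -
   obtain c where "u = ?s c" using uS by (auto simp: S_def)
   then show ?thesis unfolding S_def by (intro range_eqI[of _ _ "\<lambda>y. d * c y"]) (simp add: sum_distrib_left mult.assoc)
  qed
 qed
 \<comment> \<open>Both sides are continuous in L2, so the bound passes from the span to its
   closure, where the projection \<open>p\<close> of \<open>b\<close> lies.\<close>
 have bound: "L2_norm M v \<le> C * (\<Sum>a\<in>E. cmod (ip M v a))" if v: "v \<in> L2_closure M S" for v
 proof -
  obtain t where t: "\<And>n. t n \<in> S" "L2_tendsto M t v" and vL: "v \<in> L2 M" using v by (auto simp: L2_closure_def)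
  have tL: "t n \<in> L2 M" for n using t(1) SL by auto
  have lim: "(\<lambda>n. C * (\<Sum>a\<in>E. cmod (ip M (t n) a))) \<longlonglongrightarrow> C * (\<Sum>a\<in>E. cmod (ip M v a))"
   by (intro tendsto_intros L2_tendsto_ip tL vL t(2) L2_tendsto_const) (use E in auto)
  have "L2_norm M (t n) \<le> C * (\<Sum>a\<in>E. cmod (ip M (t n) a))" for n using t(1)[of n] EC by (auto simp: S_def)
  then show ?thesis by (intro LIMSEQ_le[OF L2_tendsto_norm[OF tL vL t(2)] lim]) auto
 qed
 obtain p where p: "p \<in> L2_closure M S" "\<And>t. t \<in> L2_closure M S ==> ip M (\<lambda>x. b x - p x) t = 0"
  using L2_projection[OF cl bL] by blast
 have pL: "p \<in> L2 M" using p(1) by (simp add: L2_closure_def)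
 define w where "w x = b x - p x" for x
 have wL: "w \<in> L2 M" unfolding w_def by (rule L2_diff[OF bL pL])
 define K where "K = C * (\<Sum>a\<in>E. cmod (ip M w a)) + L2_norm M w"
 have K0: "K = 0" if w0: "L2_norm M w = 0"
 proof -
  have "ip M w a = 0" if "a \<in> E" for a using L2_Cauchy_Schwarz[OF wL, of a] E(2) that w0 by auto
  then show ?thesis using w0 by (simp add: K_def)
 qed
 \<comment> \<open>If \<open>w\<close> is null, then \<open>K\<close> is zero too, and the quotient
   by zero is a harmless 0: a dependent vector adds nothing.\<close>
 define D where "D = C + K / (L2_norm M w)\<^sup>2"
 have K: "0 \<le> K" unfolding K_def by (intro add_nonneg_nonneg mult_nonneg_nonneg E(3) sum_nonneg) auto
 have "L2_norm M (\<lambda>x. \<Sum>y\<in>insert b B. c y * y x) \<le>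
   D * (\<Sum>a\<in>insert w E. cmod (ip M (\<lambda>x. \<Sum>y\<in>insert b B. c y * y x) a))" for c
 proof -
  define v where "v x = (\<Sum>y\<in>insert b B. c y * y x)" for x
  define q where "q x = ?s c x + c b * p x" for x
  have "?s c \<in> L2_closure M S" using sL by (auto simp: L2_closure_def S_def intro!: exI[of _ "\<lambda>_. ?s c"])
  then have q: "q \<in> L2_closure M S" unfolding q_def using cl p(1) by (simp add: closed_subspace_def)
  have qL: "q \<in> L2 M" using q by (simp add: L2_closure_def)
  have v: "v = (\<lambda>x. q x + c b * w x)" using insert.hyps by (auto simp: v_def q_def w_def algebra_simps)
  have ipv: "ip M v a = ip M q a + c b * ip M w a" if "a \<in> L2 M" for a
   unfolding v by (simp only: ip_add_left[OF qL L2_scale[OF wL] that] ip_scale_left)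
  have "ip M w q = 0" using p(2)[OF q] by (simp add: w_def[abs_def])
  then have "ip M q w = 0" using ip_cnj[of M w q] by simp
  then have "cmod (ip M v w) = cmod (c b) * (L2_norm M w)\<^sup>2" by (simp add: ipv[OF wL] ip_self norm_mult norm_power)
  then have cw: "cmod (c b) * K = K / (L2_norm M w)\<^sup>2 * cmod (ip M v w)" using K0 by (cases "L2_norm M w = 0") auto
  let ?N = "\<Sum>a\<in>insert w E. cmod (ip M v a)"
  have "(\<Sum>a\<in>E. cmod (ip M q a)) \<le> (\<Sum>a\<in>E. cmod (ip M v a) + cmod (c b) * cmod (ip M w a))"
  proof (rule sum_mono)
   fix a assume "a \<in> E"
   then have "ip M q a = ip M v a - c b * ip M w a" using ipv E(2) by auto
   then show "cmod (ip M q a) \<le> cmod (ip M v a) + cmod (c b) * cmod (ip M w a)" unfolding norm_mult[symmetric] by (simp only: norm_triangle_ineq4)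
  qed
  then have "C * (\<Sum>a\<in>E. cmod (ip M q a)) \<le> C * (\<Sum>a\<in>E. cmod (ip M v a) + cmod (c b) * cmod (ip M w a))"
   by (rule mult_left_mono[OF _ E(3)])
  then have "L2_norm M q \<le> C * (\<Sum>a\<in>E. cmod (ip M v a)) + cmod (c b) * (C * (\<Sum>a\<in>E. cmod (ip M w a)))"
   using bound[OF q] by (simp add: sum.distrib sum_distrib_left[symmetric] algebra_simps)
  then have "L2_norm M v \<le> C * (\<Sum>a\<in>E. cmod (ip M v a)) + cmod (c b) * K"
   using L2_norm_triangle[OF qL L2_scale[OF wL, of "c b"]] by (simp add: v L2_norm_scale K_def distrib_left)
  also have "\<dots> \<le> C * ?N + K / (L2_norm M w)\<^sup>2 * ?N"
   unfolding cw using E(1) K by (intro add_mono mult_left_mono sum_mono2 member_le_sum E(3)) auto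
  finally show ?thesis by (simp add: v_def[abs_def] D_def distrib_right)
 qed
 moreover have "0 \<le> D" using E(3) K by (simp add: D_def)
 ultimately show ?case using E(1,2) wL by (intro exI[of _ "insert w E"] exI[of _ D]) simp
qed

lemma finite_family_convergent_subseq:
 fixes a :: "nat => 'b => complex"
 assumes "finite B" "\<And>n b. b \<in> B ==> cmod (a n b) \<le> K b"
 shows "\<exists>r. strict_mono (r :: nat => nat) \<and> (\<forall>b\<in>B. convergent (\<lambda>n. a (r n) b))" using assms
proof (induction B rule: finite_induct)
 case empty
 show ?case by (intro exI[of _ id]) (simp add: strict_mono_def)
next
 case (insert b B)
 then obtain r where r: "strict_mono (r :: nat => nat)" "\<forall>b\<in>B. convergent (\<lambda>n. a (r n) b)" by auto
 have "bounded (range (\<lambda>n. a (r n) b))" using insert.prems by (auto simp: bounded_iff)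
 then obtain l q where q: "strict_mono (q :: nat => nat)" "((\<lambda>n. a (r n) b) \<circ> q) \<longlonglongrightarrow> l"
  using bounded_imp_convergent_subsequence by blast
 have "convergent (\<lambda>n. a (r (q n)) b')" if "b' \<in> B" for b'
  using convergent_subseq_convergent[OF _ q(1), of "\<lambda>n. a (r n) b'"] r(2) that by (simp add: o_def)
 moreover have "convergent (\<lambda>n. a (r (q n)) b)" using q(2) by (auto simp: o_def convergent_def)
 ultimately show ?case using strict_mono_o[OF r(1) q(1)] by (intro exI[of _ "r \<circ> q"] conjI ballI) (auto simp: o_def)
qed

section \<open>Essential spectra of self-adjoint operators\<close>

text \<open>\<open>symmetric\<close> and \<open>maximal\<close> together say that the graph equals
  its adjoint graph. Operators consist of representatives here; linearity, closedness and stability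
  under changes on null sets are all drawn from \<open>maximal\<close>.\<close>

locale self_adjoint =
 fixes M :: "'a measure" and T :: "'a L2_operator"
 assumes dom: "T \<subseteq> L2 M \<times> L2 M"
  and symmetric: "\<And>u f v k. (u, f) \<in> T ==> (v, k) \<in> T ==> ip M f v = ip M u k"
  and maximal: "\<And>g k. g \<in> L2 M ==> k \<in> L2 M ==> (\<And>u f. (u, f) \<in> T ==> ip M f g = ip M u k) ==> (g, k) \<in> T"
begin

abbreviation nrm :: "('a => complex) => real" where "nrm \<equiv> L2_norm M"

lemma L2D: "(u, f) \<in> T ==> u \<in> L2 M" "(u, f) \<in> T ==> f \<in> L2 M" using dom by auto

lemma zero_mem: "((\<lambda>x. 0), (\<lambda>x. 0)) \<in> T" by (rule maximal) auto

lemma add_mem: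
 assumes "(u, f) \<in> T" "(v, k) \<in> T"
 shows "((\<lambda>x. u x + v x), (\<lambda>x. f x + k x)) \<in> T"
proof (rule maximal)
 fix a b assume *: "(a, b) \<in> T"
 show "ip M b (\<lambda>x. u x + v x) = ip M a (\<lambda>x. f x + k x)" by (simp only: ip_add_right L2D[OF *] L2D[OF assms(1)] L2D[OF assms(2)]
    symmetric[OF * assms(1)] symmetric[OF * assms(2)])
qed (intro L2_add L2D[OF assms(1)] L2D[OF assms(2)])+

lemma scale_mem:
 assumes "(u, f) \<in> T"
 shows "((\<lambda>x. c * u x), (\<lambda>x. c * f x)) \<in> T"
proof (rule maximal)
 fix a b assume *: "(a, b) \<in> T"
 show "ip M b (\<lambda>x. c * u x) = ip M a (\<lambda>x. c * f x)" by (simp only: ip_scale_right symmetric[OF * assms])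
qed (intro L2_scale L2D[OF assms])+

lemma diff_mem:
 assumes "(u, f) \<in> T" "(v, k) \<in> T"
 shows "((\<lambda>x. u x - v x), (\<lambda>x. f x - k x)) \<in> T"
proof -
 have "(\<lambda>x. u x + (- 1) * v x) = (\<lambda>x. u x - v x)" "(\<lambda>x. f x + (- 1) * k x) = (\<lambda>x. f x - k x)" by auto
 then show ?thesis using add_mem[OF assms(1) scale_mem[OF assms(2), of "-1"]] by (simp only:)
qed

lemma AE_cong_mem:
 assumes "(u, f) \<in> T" "v \<in> L2 M" "k \<in> L2 M" "AE x in M. v x = u x" "AE x in M. k x = f x"
 shows "(v, k) \<in> T"
proof (rule maximal[OF assms(2,3)])
 fix u' f' assume *: "(u', f') \<in> T"
 have "ip M f' v = ip M f' u" "ip M u' k = ip M u' f"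
  by (rule ip_AE_cong; use assms L2D[OF *] L2D[OF assms(1)] in \<open>auto intro: L2_measurable\<close>)+
 then show "ip M f' v = ip M u' k" using symmetric[OF * assms(1)] by simp
qed

lemma closed_mem:
 assumes "\<And>n. (s n, t n) \<in> T" "u \<in> L2 M" "f \<in> L2 M" "L2_tendsto M s u" "L2_tendsto M t f"
 shows "(u, f) \<in> T"
proof (rule maximal[OF assms(2,3)])
 fix u' f' assume *: "(u', f') \<in> T"
 have "(\<lambda>n. ip M f' (s n)) \<longlonglongrightarrow> ip M f' u" by (rule L2_tendsto_ip) (use assms L2D(2)[OF *] L2D(1)[OF assms(1)] in auto)
 moreover have "(\<lambda>n. ip M f' (s n)) = (\<lambda>n. ip M u' (t n))" using symmetric[OF * assms(1)] by auto
 moreover have "(\<lambda>n. ip M u' (t n)) \<longlonglongrightarrow> ip M u' f"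
  by (rule L2_tendsto_ip) (use assms L2D(1)[OF *] L2D(2)[OF assms(1)] in auto)
 ultimately show "ip M f' u = ip M u' f" using LIMSEQ_unique by metis
qed

lemma res_L2: "(u, f) \<in> T ==> (\<lambda>x. f x - z * u x) \<in> L2 M" by (rule L2_diff[OF L2D(2) L2_scale[OF L2D(1)]])

lemma eigenspace_iff: "u \<in> eigenspace M T z \<longleftrightarrow> u \<in> L2 M \<and> (u, \<lambda>x. z * u x) \<in> T"
proof
 assume "u \<in> eigenspace M T z"
 then obtain f where f: "(u, f) \<in> T" "AE x in M. f x = z * u x" by (auto simp: eigenspace_def)
 then show "u \<in> L2 M \<and> (u, \<lambda>x. z * u x) \<in> T"
  using AE_cong_mem[OF f(1), of u "\<lambda>x. z * u x"] L2D[OF f(1)] by (auto simp: eq_commute)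
next
 assume "u \<in> L2 M \<and> (u, \<lambda>x. z * u x) \<in> T"
 then show "u \<in> eigenspace M T z" unfolding eigenspace_def by blast
qed

section \<open>Eigenvectors, range and resolvent bounds\<close>

lemma eigenvectors_orthogonal:
 assumes "u \<in> eigenspace M T z" "v \<in> eigenspace M T w" "z \<noteq> cnj w"
 shows "ip M u v = 0"
proof -
 have "z * ip M u v = cnj w * ip M u v" using symmetric[of u "\<lambda>x. z * u x" v "\<lambda>x. w * v x"] assms(1,2)
  by (simp add: eigenspace_iff ip_scale_left ip_scale_right)
 then show ?thesis using assms(3) by simp
qed

lemma eigenvalue_real:
 assumes "eigenvalue M T z"
 shows "cnj z = z"
proof (rule ccontr)
 assume *: "cnj z \<noteq> z"
 obtain u where u: "u \<in> eigenspace M T z" "\<not> (AE x in M. u x = 0)" using assms by (auto simp: eigenvalue_def)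
 have "ip M u u = 0" using eigenvectors_orthogonal[OF u(1) u(1)] * by auto
 then have "nrm u = 0" by (simp add: ip_self)
 then show False using u by (simp add: L2_norm_eq_0_iff eigenspace_iff)
qed

text \<open>Orthogonality to the range of T - z is the adjoint form of the eigenvalue equation for
  \<open>cnj z\<close>. Since eigenvalues are real, T - z therefore has dense range whenever z is
  not an eigenvalue.\<close>

lemma range_orthogonal:
 assumes "g \<in> L2 M" "\<And>u f. (u, f) \<in> T ==> ip M (\<lambda>x. f x - z * u x) g = 0"
 shows "(g, \<lambda>x. cnj z * g x) \<in> T"
proof (rule maximal)
 fix u f assume *: "(u, f) \<in> T"
 have "ip M f g - z * ip M u g = 0" using assms(2)[OF *] assms(1) L2D[OF *] by (simp add: ip_diff_left ip_scale_left L2_scale)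
 then show "ip M f g = ip M u (\<lambda>x. cnj z * g x)" by (simp add: ip_scale_right)
qed (use assms in auto)

lemma resolvent_bound:
 assumes "z \<in> resolvent_set M T"
 obtains C where "C > 0" "\<And>u f. (u, f) \<in> T ==> nrm u \<le> C * nrm (\<lambda>x. f x - z * u x)"
proof -
 obtain C where C: "\<forall>(u, f)\<in>T. nrm u \<le> C * nrm (\<lambda>x. f x - z * u x)" using assms unfolding resolvent_set_def by blast
 have "nrm u \<le> (\<bar>C\<bar> + 1) * nrm (\<lambda>x. f x - z * u x)" if "(u, f) \<in> T" for u f
 proof -
  have "C * nrm (\<lambda>x. f x - z * u x) \<le> (\<bar>C\<bar> + 1) * nrm (\<lambda>x. f x - z * u x)" by (intro mult_right_mono) auto
  then show ?thesis using C that by fastforce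
 qed
 then show ?thesis using that[of "\<bar>C\<bar> + 1"] by fastforce
qed

lemma resolvent_surj:
 assumes z: "z \<in> resolvent_set M T" and g: "g \<in> L2 M"
 obtains u where "(u, \<lambda>x. g x + z * u x) \<in> T"
proof -
 obtain w where w: "w \<in> T" "case w of (u, f) => AE x in M. f x - z * u x = g x" using assms unfolding resolvent_set_def by blast
 obtain u f where uf: "w = (u, f)" by (cases w)
 have T: "(u, f) \<in> T" and ae: "AE x in M. f x - z * u x = g x" using w uf by auto
 show ?thesis
 proof (rule that[OF AE_cong_mem[OF T L2D(1)[OF T] L2_add[OF g L2_scale[OF L2D(1)[OF T]]]]])
  show "AE x in M. g x + z * u x = f x" using ae by eventually_elim (simp add: algebra_simps)
 qed simp
qed

text \<open>The estimate expresses that T - z has finite-dimensional kernel and closed range: the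
  functionals absorb the kernel, and off it T - z is bounded below.\<close>

definition a_priori :: "complex => bool" where
 "a_priori z \<longleftrightarrow> (\<exists>B C. finite B \<and> B \<subseteq> L2 M \<and> (\<forall>u f. (u, f) \<in> T \<longrightarrow>
   nrm u \<le> C * (nrm (\<lambda>x. f x - z * u x) + (\<Sum>b\<in>B. cmod (ip M u b)))))"

lemma a_prioriE:
 assumes "a_priori z"
 obtains B C where "finite B" "B \<subseteq> L2 M" "C > 0" "\<And>u f. (u, f) \<in> T ==>
   nrm u \<le> C * (nrm (\<lambda>x. f x - z * u x) + (\<Sum>b\<in>B. cmod (ip M u b)))"
proof -
 obtain B C where BC: "finite B" "B \<subseteq> L2 M" "\<And>u f. (u, f) \<in> T ==>
   nrm u \<le> C * (nrm (\<lambda>x. f x - z * u x) + (\<Sum>b\<in>B. cmod (ip M u b)))" using assms unfolding a_priori_def by auto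
 have "nrm u \<le> (\<bar>C\<bar> + 1) * (nrm (\<lambda>x. f x - z * u x) + (\<Sum>b\<in>B. cmod (ip M u b)))"
  if "(u, f) \<in> T" for u f
 proof -
  have "C * (nrm (\<lambda>x. f x - z * u x) + (\<Sum>b\<in>B. cmod (ip M u b))) \<le>
    (\<bar>C\<bar> + 1) * (nrm (\<lambda>x. f x - z * u x) + (\<Sum>b\<in>B. cmod (ip M u b)))"
   by (intro mult_right_mono) (auto intro!: add_nonneg_nonneg sum_nonneg)
  then show ?thesis using BC(3)[OF that] by linarith
 qed
 moreover have "\<bar>C\<bar> + 1 > 0" by linarith
 ultimately show ?thesis using that BC(1,2) by blast
qed

text \<open>The finitely many inner products of a bounded sequence converge along one common
  subsequence. The estimate applied to differences makes that subsequence Cauchy, and closedness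
  puts its limit into the eigenspace.\<close>

lemma a_priori_compact:
 assumes "a_priori z" and T: "\<And>n. (u n, f n) \<in> T" and bd: "\<And>n. nrm (u n) \<le> 1"
  and lim: "(\<lambda>n. nrm (\<lambda>x. f n x - z * u n x)) \<longlonglongrightarrow> 0"
 obtains r v where "strict_mono (r :: nat => nat)" "v \<in> eigenspace M T z" "L2_tendsto M (\<lambda>n. u (r n)) v"
proof -
 obtain B C where B: "finite B" "B \<subseteq> L2 M" and C: "C > 0" and BC: "\<And>u f. (u, f) \<in> T ==>
   nrm u \<le> C * (nrm (\<lambda>x. f x - z * u x) + (\<Sum>b\<in>B. cmod (ip M u b)))" using a_prioriE[OF assms(1)] by metis
 have uL: "u n \<in> L2 M" and fL: "f n \<in> L2 M" for n using L2D[OF T] by auto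
 have "cmod (ip M (u n) b) \<le> nrm b" if "b \<in> B" for n b
 proof -
  have "cmod (ip M (u n) b) \<le> nrm (u n) * nrm b" using uL B that by (intro L2_Cauchy_Schwarz) auto
  also have "\<dots> \<le> 1 * nrm b" by (intro mult_right_mono bd) simp
  finally show ?thesis by simp
 qed
 from finite_family_convergent_subseq[OF B(1), of "\<lambda>n b. ip M (u n) b" "nrm", OF this]
 obtain r where r: "strict_mono (r :: nat => nat)" "\<And>b. b \<in> B ==> convergent (\<lambda>n. ip M (u (r n)) b)" by auto
 let ?p = "\<lambda>n x. f n x - z * u n x"
 have pL: "?p n \<in> L2 M" for n by (intro L2_diff L2_scale uL fL)
 have plim: "(\<lambda>n. nrm (?p (r n))) \<longlonglongrightarrow> 0" using LIMSEQ_subseq_LIMSEQ[OF lim r(1)] by (simp add: o_def)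
 have "\<exists>v\<in>L2 M. L2_tendsto M (\<lambda>n. u (r n)) v"
 proof (rule Riesz_Fischer)
  fix e :: real assume e: "e > 0"
  \<comment> \<open>The two residuals cost d/2 each and every functional costs d; the summand 2
    instead of 1 makes the final inequality strict.\<close>
  define d where "d = e / (C * (real (card B) + 2))"
  have d: "d > 0" using e C by (simp add: d_def)
  obtain N0 where N0: "\<And>n. n \<ge> N0 ==> nrm (?p (r n)) < d/2" using LIMSEQ_D[OF plim, of "d/2"] d by auto
  have "\<exists>N. \<forall>m\<ge>N. \<forall>n\<ge>N. cmod (ip M (u (r m)) b - ip M (u (r n)) b) < d" if "b \<in> B" for b
   using convergent_Cauchy[OF r(2)[OF that]] d unfolding Cauchy_def dist_norm by blast
  then obtain N where N: "\<And>b m n. b \<in> B ==> m \<ge> N b ==> n \<ge> N b ==>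
    cmod (ip M (u (r m)) b - ip M (u (r n)) b) < d" by metis
  define K where "K = Max (insert N0 (N ` B))"
  have K: "N0 \<le> K" "\<And>b. b \<in> B ==> N b \<le> K" using B(1) by (auto simp: K_def)
  have "nrm (\<lambda>x. u (r m) x - u (r n) x) < e" if mn: "m \<ge> K" "n \<ge> K" for m n
  proof -
   have "nrm (\<lambda>x. u (r m) x - u (r n) x) \<le>
    C * (nrm (\<lambda>x. (f (r m) x - f (r n) x) - z * (u (r m) x - u (r n) x)) +
     (\<Sum>b\<in>B. cmod (ip M (\<lambda>x. u (r m) x - u (r n) x) b)))" by (rule BC[OF diff_mem[OF T T]])
   also have "\<dots> \<le> C * (d + real (card B) * d)"
   proof (intro mult_left_mono add_mono)
    have "nrm (\<lambda>x. (f (r m) x - f (r n) x) - z * (u (r m) x - u (r n) x))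
      = nrm (\<lambda>x. ?p (r m) x - ?p (r n) x)" by (simp add: algebra_simps)
    also have "\<dots> \<le> nrm (?p (r m)) + nrm (?p (r n))" by (rule L2_norm_diff_triangle[OF pL pL])
    also have "\<dots> \<le> d" using N0[of m] N0[of n] K(1) mn by force
    finally show "nrm (\<lambda>x. (f (r m) x - f (r n) x) - z * (u (r m) x - u (r n) x)) \<le> d" .
    show "(\<Sum>b\<in>B. cmod (ip M (\<lambda>x. u (r m) x - u (r n) x) b)) \<le> real (card B) * d"
    proof (rule sum_bounded_above)
     fix b assume b: "b \<in> B"
     then have "ip M (\<lambda>x. u (r m) x - u (r n) x) b = ip M (u (r m)) b - ip M (u (r n)) b" using B(2) uL by (intro ip_diff_left) auto
     then show "cmod (ip M (\<lambda>x. u (r m) x - u (r n) x) b) \<le> d" using N[OF b, of m n] K(2)[OF b] mn by simp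
    qed
   qed (use C in simp)
   also have "\<dots> = (C * (real (card B) + 1)) * d" by (simp add: algebra_simps)
   also have "\<dots> < (C * (real (card B) + 2)) * d" using C d by (intro mult_strict_right_mono mult_strict_left_mono) auto
   also have "\<dots> = e" using C by (simp add: d_def)
   finally show ?thesis .
  qed
  then show "\<exists>N. \<forall>m\<ge>N. \<forall>n\<ge>N. nrm (\<lambda>x. u (r m) x - u (r n) x) < e" by blast
 qed (rule uL)
 then obtain v where v: "v \<in> L2 M" "L2_tendsto M (\<lambda>n. u (r n)) v" by blast
 have "L2_tendsto M (\<lambda>n. ?p (r n)) (\<lambda>x. 0)" using plim by (simp add: L2_tendsto_def)
 from L2_tendsto_add[OF pL L2_scale[OF uL] L2_zero L2_scale[OF v(1)] this L2_tendsto_scale[OF v(2), of z]]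
 have "L2_tendsto M (\<lambda>n. f (r n)) (\<lambda>x. z * v x)" by simp
 then have "(v, \<lambda>x. z * v x) \<in> T" using v by (intro closed_mem[OF T[of "r n" for n]]) auto
 with v r that show ?thesis by (auto simp: eigenspace_iff)
qed

lemma not_AE_zero_normalize:
 assumes "u \<in> eigenspace M T z" "\<not> (AE x in M. u x = 0)"
 obtains v where "v \<in> eigenspace M T z" "nrm v = 1"
proof
 have u: "u \<in> L2 M" "(u, \<lambda>x. z * u x) \<in> T" using assms by (auto simp: eigenspace_iff)
 then have n: "nrm u \<noteq> 0" using assms(2) by (simp add: L2_norm_eq_0_iff)
 let ?c = "cor (inverse (nrm u))"
 show "nrm (\<lambda>x. ?c * u x) = 1" using n by (subst L2_norm_scale) (simp add: norm_inverse)
 show "(\<lambda>x. ?c * u x) \<in> eigenspace M T z" using scale_mem[OF u(2), of ?c] u by (auto simp: eigenspace_iff mult.left_commute)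
qed

text \<open>Unit eigenvectors for eigenvalues tending to \<open>z\<close> have vanishing residuals
  at \<open>z\<close>, so a subsequence would converge to a unit eigenvector for \<open>z\<close>.
  But eigenvectors for different eigenvalues are orthogonal.\<close>

lemma a_priori_isolated:
 assumes "a_priori z"
 obtains d where "d > 0" "\<And>w. w \<noteq> z ==> dist w z < d ==> \<not> eigenvalue M T w"
proof (rule ccontr)
 assume no: "\<not> thesis"
 note goal = that
 have *: "\<exists>w. w \<noteq> z \<and> dist w z < d \<and> eigenvalue M T w" if "d > 0" for d using no goal that by blast
 have "\<forall>n. \<exists>w. w \<noteq> z \<and> dist w z < inverse (real (Suc n)) \<and> eigenvalue M T w" by (intro allI *) simp
 then obtain w where w: "\<And>n. w n \<noteq> z" "\<And>n. dist (w n) z < inverse (real (Suc n))" "\<And>n. eigenvalue M T (w n)" by metis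
 have "\<exists>v. v \<in> eigenspace M T (w n) \<and> nrm v = 1" for n using w(3)[of n] not_AE_zero_normalize unfolding eigenvalue_def by metis
 then obtain u where u: "\<And>n. u n \<in> eigenspace M T (w n)" "\<And>n. nrm (u n) = 1" by metis
 have uT: "(u n, \<lambda>x. w n * u n x) \<in> T" for n using u(1) by (auto simp: eigenspace_iff)
 have "(\<lambda>n. nrm (\<lambda>x. w n * u n x - z * u n x)) \<longlonglongrightarrow> 0"
 proof (rule tendsto_sandwich[OF _ _ tendsto_const LIMSEQ_inverse_real_of_nat])
  show "\<forall>\<^sub>F n in sequentially. nrm (\<lambda>x. w n * u n x - z * u n x) \<le> inverse (real (Suc n))"
   using w(2) by (auto simp: L2_norm_scale u left_diff_distrib[symmetric] dist_norm less_imp_le simp del: of_nat_Suc)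
 qed simp
 from a_priori_compact[OF assms uT _ this] u(2)
 obtain r v where v: "strict_mono (r :: nat => nat)" "v \<in> eigenspace M T z" "L2_tendsto M (\<lambda>n. u (r n)) v" by (metis order_refl)
 have vL: "v \<in> L2 M" using v by (simp add: eigenspace_iff)
 have uL: "u n \<in> L2 M" for n using u by (simp add: eigenspace_iff)
 have norm: "(\<lambda>n. nrm (u (r n))) \<longlonglongrightarrow> nrm v" by (rule L2_tendsto_norm) (use uL vL v in auto)
 then have v1: "nrm v = 1" by (simp add: u(2) LIMSEQ_const_iff)
 then have "eigenvalue M T z" using v(2) vL L2_norm_eq_0_iff[OF vL] by (auto simp: eigenvalue_def)
 then have zr: "cnj z = z" by (rule eigenvalue_real)
 have "ip M (u n) v = 0" for n using eigenvectors_orthogonal[OF u(1) v(2)] zr w(1) by simp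
 moreover have "(\<lambda>n. ip M (u (r n)) v) \<longlonglongrightarrow> ip M v v" by (rule L2_tendsto_ip) (use uL vL v in auto)
 ultimately have "ip M v v = 0" by (simp add: LIMSEQ_const_iff)
 then show False using v1 by (simp add: ip_self)
qed

text \<open>A shift of z by less than 1/(2C) changes the residual by so little that the change is
  absorbed into half of the norm of u.\<close>

lemma a_priori_open:
 assumes "a_priori z"
 obtains d where "d > 0" "\<And>w. dist w z < d ==> a_priori w"
proof -
 obtain B C where B: "finite B" "B \<subseteq> L2 M" and C: "C > 0" and BC: "\<And>u f. (u, f) \<in> T ==>
   nrm u \<le> C * (nrm (\<lambda>x. f x - z * u x) + (\<Sum>b\<in>B. cmod (ip M u b)))" using a_prioriE[OF assms(1)] by metis
 show ?thesis
 proof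
  show "inverse (2 * C) > 0" using C by simp
  fix w assume w: "dist w z < inverse (2 * C)"
  have "nrm u \<le> 2 * C * (nrm (\<lambda>x. f x - w * u x) + (\<Sum>b\<in>B. cmod (ip M u b)))"
   if uf: "(u, f) \<in> T" for u f
  proof -
   let ?S = "\<Sum>b\<in>B. cmod (ip M u b)"
   have "(\<lambda>x. f x - z * u x) = (\<lambda>x. (f x - w * u x) + (w - z) * u x)" by (auto simp: algebra_simps)
   then have "nrm (\<lambda>x. f x - z * u x) \<le> nrm (\<lambda>x. f x - w * u x) + dist w z * nrm u"
    using L2_norm_triangle[of "\<lambda>x. f x - w * u x" M "\<lambda>x. (w - z) * u x"] L2D[OF uf]
    by (simp add: L2_norm_scale dist_norm L2_diff L2_scale)
   also have "dist w z * nrm u \<le> inverse (2 * C) * nrm u" using w by (intro mult_right_mono) auto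
   finally have "C * (nrm (\<lambda>x. f x - z * u x) + ?S) \<le>
     C * (nrm (\<lambda>x. f x - w * u x) + inverse (2 * C) * nrm u + ?S)" using C by simp
   also have "\<dots> = C * (nrm (\<lambda>x. f x - w * u x) + ?S) + nrm u / 2" using C by (simp add: field_simps)
   finally show ?thesis using BC[OF uf] by simp
  qed
  then show "a_priori w" unfolding a_priori_def using B by blast
 qed
qed

text \<open>Without a kernel, compactness removes the functionals and leaves a lower bound, so the
  range is closed. Its orthogonal complement is the eigenspace for \<open>cnj z\<close>, which is
  trivial because eigenvalues are real.\<close>

lemma a_priori_resolvent:
 assumes ap: "a_priori z" and ne: "\<not> eigenvalue M T z"
 shows "z \<in> resolvent_set M T"
proof -
 have "\<exists>C. \<forall>(u, f)\<in>T. nrm u \<le> C * nrm (\<lambda>x. f x - z * u x)"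
 proof (rule ccontr)
  assume "\<not> ?thesis"
  then have "\<forall>n. \<exists>u f. (u, f) \<in> T \<and> nrm u > real (Suc n) * nrm (\<lambda>x. f x - z * u x)" by (force simp: not_le)
  then obtain u f where uf: "\<And>n. (u n, f n) \<in> T"
   "\<And>n. nrm (u n) > real (Suc n) * nrm (\<lambda>x. f n x - z * u n x)" by metis
  have pos: "nrm (u n) > 0" for n using uf(2)[of n] by (rule le_less_trans[rotated]) simp
  define c where "c n = cor (inverse (nrm (u n)))" for n
  have T: "((\<lambda>x. c n * u n x), (\<lambda>x. c n * f n x)) \<in> T" for n by (rule scale_mem[OF uf(1)])
  have one: "nrm (\<lambda>x. c n * u n x) = 1" for n using pos[of n] by (simp add: L2_norm_scale c_def norm_inverse)
  have le: "nrm (\<lambda>x. c n * f n x - z * (c n * u n x)) \<le> inverse (real (Suc n))" for n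
  proof -
   have "nrm (\<lambda>x. c n * f n x - z * (c n * u n x)) = nrm (\<lambda>x. c n * (f n x - z * u n x))" by (simp add: algebra_simps)
   also have "\<dots> = inverse (nrm (u n)) * nrm (\<lambda>x. f n x - z * u n x)"
    using pos[of n] unfolding L2_norm_scale c_def by (simp add: norm_inverse)
   also have "\<dots> \<le> inverse (real (Suc n))" using uf(2)[of n] pos[of n] by (simp add: field_simps del: of_nat_Suc)
   finally show ?thesis .
  qed
  have "(\<lambda>n. nrm (\<lambda>x. c n * f n x - z * (c n * u n x))) \<longlonglongrightarrow> 0"
   by (rule tendsto_sandwich[OF _ _ tendsto_const LIMSEQ_inverse_real_of_nat]) (use le in auto)
  from a_priori_compact[OF ap T _ this] one
  obtain r v where v: "strict_mono (r :: nat => nat)" "v \<in> eigenspace M T z"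
   "L2_tendsto M (\<lambda>n x. c (r n) * u (r n) x) v" by (metis order_refl)
  have vL: "v \<in> L2 M" using v by (simp add: eigenspace_iff)
  have "(\<lambda>n. nrm (\<lambda>x. c (r n) * u (r n) x)) \<longlonglongrightarrow> nrm v" by (rule L2_tendsto_norm) (use L2D[OF T] vL v in auto)
  then have "nrm v = 1" by (simp add: one LIMSEQ_const_iff)
  then show False using ne v(2) vL by (auto simp: eigenvalue_def L2_norm_eq_0_iff[OF vL, symmetric])
 qed
 then obtain C0 where C0: "\<And>u f. (u, f) \<in> T ==> nrm u \<le> C0 * nrm (\<lambda>x. f x - z * u x)" by blast
 define C where "C = \<bar>C0\<bar> + 1"
 have Cpos: "C > 0" by (simp add: C_def)
 have C: "nrm u \<le> C * nrm (\<lambda>x. f x - z * u x)" if "(u, f) \<in> T" for u f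
 proof -
  have "C0 * nrm (\<lambda>x. f x - z * u x) \<le> C * nrm (\<lambda>x. f x - z * u x)" by (intro mult_right_mono) (auto simp: C_def)
  then show ?thesis using C0[OF that] by linarith
 qed
 define S where "S = {g \<in> L2 M. \<exists>(u, f)\<in>T. AE x in M. f x - z * u x = g x}"
 have SI: "g \<in> S" if "g \<in> L2 M" "(u, f) \<in> T" "AE x in M. f x - z * u x = g x" for g u f using that by (auto simp: S_def)
 have "closed_subspace M S" unfolding closed_subspace_def
 proof (intro conjI ballI allI impI)
  show "S \<subseteq> L2 M" by (auto simp: S_def)
  show "(\<lambda>x. 0) \<in> S" by (rule SI[OF _ zero_mem]) auto
 next
  fix g h assume "g \<in> S" "h \<in> S"
  then obtain u f v k where *: "(u, f) \<in> T" "AE x in M. f x - z * u x = g x" "g \<in> L2 M"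
   "(v, k) \<in> T" "AE x in M. k x - z * v x = h x" "h \<in> L2 M" by (auto simp: S_def)
  show "(\<lambda>x. g x + h x) \<in> S"
  proof (rule SI[OF _ add_mem[OF *(1,4)]])
   show "AE x in M. f x + k x - z * (u x + v x) = g x + h x" using *(2,5)
   proof eventually_elim
    case (elim x)
    have "f x + k x - z * (u x + v x) = (f x - z * u x) + (k x - z * v x)" by (simp add: algebra_simps)
    then show ?case using elim by simp
   qed
  qed (use * in auto)
 next
  fix c g assume "g \<in> S"
  then obtain u f where *: "(u, f) \<in> T" "AE x in M. f x - z * u x = g x" "g \<in> L2 M" by (auto simp: S_def)
  show "(\<lambda>x. c * g x) \<in> S"
  proof (rule SI[OF _ scale_mem[OF *(1)]])
   show "AE x in M. c * f x - z * (c * u x) = c * g x" using *(2)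
   proof eventually_elim
    case (elim x)
    have "c * f x - z * (c * u x) = c * (f x - z * u x)" by (simp add: algebra_simps)
    then show ?case using elim by simp
   qed
  qed (use * in auto)
 next
  fix s g assume g: "g \<in> L2 M" and s: "\<forall>n. s n \<in> S" and lim: "L2_tendsto M s g"
  have "\<forall>n. \<exists>u f. (u, f) \<in> T \<and> (AE x in M. f x - z * u x = s n x)" using s unfolding S_def by blast
  then obtain u f where uf: "\<And>n. (u n, f n) \<in> T" "\<And>n. AE x in M. f n x - z * u n x = s n x" by metis
  have sL: "s n \<in> L2 M" for n using s by (auto simp: S_def)
  have le: "nrm (\<lambda>x. u m x - u n x) \<le> C * nrm (\<lambda>x. s m x - s n x)" for m n
  proof -
   have "nrm (\<lambda>x. u m x - u n x) \<le> C * nrm (\<lambda>x. (f m x - f n x) - z * (u m x - u n x))" by (rule C[OF diff_mem[OF uf(1) uf(1)]])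
   also have "nrm (\<lambda>x. (f m x - f n x) - z * (u m x - u n x)) = nrm (\<lambda>x. s m x - s n x)"
   proof (rule L2_norm_AE_cong)
    show "AE x in M. (f m x - f n x) - z * (u m x - u n x) = s m x - s n x" using uf(2)[of m] uf(2)[of n]
    proof eventually_elim
     case (elim x)
     show ?case unfolding elim[symmetric] by (simp add: algebra_simps)
    qed
    show "(\<lambda>x. (f m x - f n x) - z * (u m x - u n x)) \<in> borel_measurable M"
     by (rule L2_measurable[OF res_L2[OF diff_mem[OF uf(1) uf(1)]]])
   qed (use sL L2_measurable in auto)
   finally show ?thesis .
  qed
  have "\<exists>v\<in>L2 M. L2_tendsto M u v"
  proof (rule Riesz_Fischer)
   fix e :: real assume "e > 0"
   then obtain N where N: "\<forall>m\<ge>N. \<forall>n\<ge>N. nrm (\<lambda>x. s m x - s n x) < e / C"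
    using L2_tendsto_Cauchy[OF sL g lim, of "e / C"] Cpos by auto
   have "nrm (\<lambda>x. u m x - u n x) < e" if "m \<ge> N" "n \<ge> N" for m n
   proof -
    have "C * nrm (\<lambda>x. s m x - s n x) < e" using N that Cpos by (simp add: field_simps)
    then show ?thesis using le[of m n] by linarith
   qed
   then show "\<exists>N. \<forall>m\<ge>N. \<forall>n\<ge>N. nrm (\<lambda>x. u m x - u n x) < e" by blast
  qed (use L2D[OF uf(1)] in auto)
  then obtain v where v: "v \<in> L2 M" "L2_tendsto M u v" by blast
  have plim: "L2_tendsto M (\<lambda>n x. s n x + z * u n x) (\<lambda>x. g x + z * v x)"
   by (intro L2_tendsto_add L2_tendsto_scale lim v sL L2_scale g L2D(1)[OF uf(1)])
  have "(u n, \<lambda>x. s n x + z * u n x) \<in> T" for n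
  proof (rule AE_cong_mem[OF uf(1)[of n]])
   show "AE x in M. s n x + z * u n x = f n x" using uf(2)[of n] by eventually_elim (auto simp: algebra_simps)
  qed (simp_all add: L2_add L2_scale sL L2D[OF uf(1)])
  then have "(v, \<lambda>x. g x + z * v x) \<in> T"
   by (rule closed_mem[where s = u and t = "\<lambda>n x. s n x + z * u n x"]) (use v g plim in auto)
  then show "g \<in> S" by (rule SI[OF g]) auto
 qed
 have surj: "\<exists>(u, f)\<in>T. AE x in M. f x - z * u x = g x" if g: "g \<in> L2 M" for g
 proof -
  obtain p where p: "p \<in> S" "\<And>t. t \<in> S ==> ip M (\<lambda>x. g x - p x) t = 0"
   using L2_projection[OF \<open>closed_subspace M S\<close> g] by blast
  have pL: "p \<in> L2 M" using p by (simp add: S_def)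
  let ?q = "\<lambda>x. g x - p x"
  have qL: "?q \<in> L2 M" using g pL by auto
  have "(?q, \<lambda>x. cnj z * ?q x) \<in> T"
  proof (rule range_orthogonal[OF qL])
   fix u f assume uf: "(u, f) \<in> T"
   have "(\<lambda>x. f x - z * u x) \<in> S" by (rule SI[OF res_L2[OF uf] uf]) simp
   from p(2)[OF this] show "ip M (\<lambda>x. f x - z * u x) ?q = 0" using ip_cnj[of M ?q "\<lambda>x. f x - z * u x"] by simp
  qed
  then have eig: "?q \<in> eigenspace M T (cnj z)" using qL by (simp add: eigenspace_iff)
  have "AE x in M. ?q x = 0"
  proof (rule ccontr)
   assume nz: "\<not> (AE x in M. ?q x = 0)"
   have "eigenvalue M T (cnj z)" unfolding eigenvalue_def by (rule bexI[OF _ eig]) (rule nz)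
   then show False using eigenvalue_real[of "cnj z"] ne by simp
  qed
  moreover obtain u f where uf: "(u, f) \<in> T" "AE x in M. f x - z * u x = p x" using p by (auto simp: S_def)
  ultimately have "AE x in M. f x - z * u x = g x" by auto
  with uf show ?thesis by blast
 qed
 then show ?thesis unfolding resolvent_set_def using C by blast
qed

text \<open>Nearby points satisfy the estimate as well and are not eigenvalues, hence lie in the
  resolvent set. So an eigenvalue satisfying the estimate is isolated, and its multiplicity is
  finite because the functionals separate its eigenspace.\<close>

theorem a_priori_not_essential:
 assumes ap: "a_priori z"
 shows "z \<notin> essential_spectrum M T"
proof (cases "eigenvalue M T z")
 case False
 then show ?thesis using a_priori_resolvent[OF ap] by (simp add: essential_spectrum_def spectrum_def)
next
 case True
 then obtain u where u: "u \<in> eigenspace M T z" "nrm u = 1" using not_AE_zero_normalize unfolding eigenvalue_def by metis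
 have z: "z \<in> spectrum M T"
 proof (rule ccontr)
  assume "z \<notin> spectrum M T"
  then have "z \<in> resolvent_set M T" by (simp add: spectrum_def)
  then obtain C where C: "\<And>u f. (u, f) \<in> T ==> nrm u \<le> C * nrm (\<lambda>x. f x - z * u x)" using resolvent_bound by metis
  from C[of u "\<lambda>x. z * u x"] u show False by (simp add: eigenspace_iff)
 qed
 obtain d1 where d1: "d1 > 0" "\<And>w. w \<noteq> z ==> dist w z < d1 ==> \<not> eigenvalue M T w" using a_priori_isolated[OF ap] by metis
 obtain d2 where d2: "d2 > 0" "\<And>w. dist w z < d2 ==> a_priori w" using a_priori_open[OF ap] by metis
 have "w \<notin> spectrum M T" if "w \<noteq> z" "dist w z < min d1 d2" for w
  using a_priori_resolvent[OF d2(2) d1(2)] that by (simp add: spectrum_def)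
 then have "z isolated_in spectrum M T" unfolding isolated_in_dist_Ex_iff using z d1(1) d2(1)
  by (intro conjI exI[of _ "min d1 d2"]) (auto simp: dist_commute)
 moreover have "finite_multiplicity M T z"
 proof -
  obtain B C where B: "finite B" "B \<subseteq> L2 M" and BC: "\<And>u f. (u, f) \<in> T ==>
    nrm u \<le> C * (nrm (\<lambda>x. f x - z * u x) + (\<Sum>b\<in>B. cmod (ip M u b)))" using a_prioriE[OF ap] by metis
  show ?thesis unfolding finite_multiplicity_def
  proof (rule L2_finite_dim_of_functionals[OF B])
   show "(\<lambda>x. u x + v x) \<in> eigenspace M T z" if "u \<in> eigenspace M T z" "v \<in> eigenspace M T z" for u v
    using that add_mem[of u "\<lambda>x. z * u x" v "\<lambda>x. z * v x"] by (auto simp: eigenspace_iff distrib_left)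
   show "(\<lambda>x. c * u x) \<in> eigenspace M T z" if "u \<in> eigenspace M T z" for c u
    using that scale_mem[of u "\<lambda>x. z * u x" c] by (auto simp: eigenspace_iff mult.left_commute)
   show "AE x in M. u x = 0" if u: "u \<in> eigenspace M T z" and 0: "\<forall>b\<in>B. ip M u b = 0" for u
   proof -
    have "nrm u \<le> 0" using BC[of u "\<lambda>x. z * u x"] u 0 by (simp add: eigenspace_iff)
    then have "nrm u = 0" using L2_norm_nonneg[of M u] by linarith
    then show ?thesis using u by (simp add: eigenspace_iff L2_norm_eq_0_iff)
   qed
  qed (auto simp: eigenspace_iff)
 qed
 ultimately have "z \<in> discrete_spectrum M T" using True by (simp add: discrete_spectrum_def)
 then show ?thesis by (simp add: essential_spectrum_def)
qed

text \<open>If \<open>\<mu> \<plusminus> m\<close> are in the resolvent set, then \<open>(T - \<mu>)\<^sup>2 - m\<^sup>2\<close> is surjective.  If it is also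
 non-negative, the Cauchy-Schwarz inequality for its quadratic form makes it strictly positive, so
 that the lower bound \<open>m\<close> of \<open>T - \<mu>\<close> is not optimal.\<close>

lemma resolvent_norm:
 fixes \<mu> r :: real
 assumes res: "\<And>s. \<bar>s - \<mu>\<bar> < r ==> cor s \<in> resolvent_set M T" and uf: "(u, f) \<in> T"
 shows "r * nrm u \<le> nrm (\<lambda>x. f x - cor \<mu> * u x)"
proof (rule ccontr)
 let ?R = "\<lambda>u f x. f x - cor \<mu> * u x"
 assume "\<not> ?thesis"
 then have lt: "nrm (?R u f) < r * nrm u" by simp
 \<comment> \<open>The optimal lower bound of T - \<mu>. Were it below r, both \<mu> + m and \<mu> -
   m would lie in the resolvent set.\<close>
 define m where "m = Inf {nrm (?R u f) / nrm u |u f. (u, f) \<in> T \<and> 0 < nrm u}" (is "_ = Inf ?D")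
 have upos: "0 < nrm u" using lt L2_norm_nonneg[of M u] L2_norm_nonneg[of M "?R u f"] by (cases "nrm u = 0") (auto simp: less_le)
 have bdd: "bdd_below ?D" by (rule bdd_belowI[of _ 0]) auto
 have ne: "?D \<noteq> {}" using uf upos by blast
 have lower: "m * nrm u \<le> nrm (?R u f)" if T: "(u, f) \<in> T" for u f
 proof (cases "0 < nrm u")
  case True
  have "m \<le> nrm (?R u f) / nrm u" unfolding m_def by (rule cInf_lower[OF _ bdd]) (use T True in blast)
  then show ?thesis using True by (simp add: field_simps)
 next
  case False
  then have "nrm u = 0" using L2_norm_nonneg[of M u] by linarith
  then show ?thesis by simp
 qed
 have mr: "m < r" using lower[OF uf] lt upos by (metis le_less_trans mult_less_cancel_right_pos)
 have m0: "0 \<le> m" unfolding m_def by (rule cInf_greatest[OF ne]) auto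
 have r1: "cor (\<mu> + m) \<in> resolvent_set M T" and r2: "cor (\<mu> - m) \<in> resolvent_set M T" by (intro res; use mr m0 in simp)+
 obtain C1 where C1: "C1 > 0" "\<And>u f. (u, f) \<in> T ==> nrm u \<le> C1 * nrm (\<lambda>x. f x - cor (\<mu> + m) * u x)"
  using resolvent_bound[OF r1] by metis
 obtain C2 where C2: "C2 > 0" "\<And>u f. (u, f) \<in> T ==> nrm u \<le> C2 * nrm (\<lambda>x. f x - cor (\<mu> - m) * u x)"
  using resolvent_bound[OF r2] by metis
 define C where "C = C1 * C2"
 have C: "0 < C" using C1(1) C2(1) by (simp add: C_def)
 have strict: "(m\<^sup>2 + 1 / C) * (nrm v)\<^sup>2 \<le> (nrm (?R v k))\<^sup>2" if vk: "(v, k) \<in> T" for v k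
 proof -
  have vL: "v \<in> L2 M" using L2D[OF vk] by simp
  obtain y where yT: "(y, \<lambda>x. v x + cor (\<mu> + m) * y x) \<in> T" by (rule resolvent_surj[OF r1 vL])
  note yL = L2D(1)[OF yT]
  \<comment> \<open>Thus \<open>w\<close> solves ((T - \<mu>)^2 - m^2) w = v, and \<open>p\<close>
    below is (T - \<mu>) w.\<close>
  obtain w where wT: "(w, \<lambda>x. y x + cor (\<mu> - m) * w x) \<in> T" by (rule resolvent_surj[OF r2 yL])
  note wL = L2D(1)[OF wT]
  define p where "p x = y x - cor m * w x" for x
  have pL: "p \<in> L2 M" unfolding p_def by (intro L2_diff L2_scale yL wL)
  have key: "ip M (?R a b) p = cor (m\<^sup>2) * ip M a w + ip M a v" if ab: "(a, b) \<in> T" for a b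
  proof -
   note aL = L2D(1)[OF ab] and bL = L2D(2)[OF ab]
   have s: "ip M b y = ip M a v + cor (\<mu> + m) * ip M a y" "ip M b w = ip M a y + cor (\<mu> - m) * ip M a w"
    using symmetric[OF ab yT] symmetric[OF ab wT] aL vL yL wL by (simp_all add: ip_add_right ip_scale_right L2_scale)
   have "ip M (?R a b) p = (ip M b y - cor \<mu> * ip M a y) - cor m * (ip M b w - cor \<mu> * ip M a w)" unfolding p_def using aL bL yL wL
    by (simp add: ip_diff_left ip_diff_right ip_scale_left ip_scale_right L2_scale L2_diff algebra_simps)
   then show ?thesis unfolding s by (simp add: algebra_simps power2_eq_square)
  qed
  have Rw: "?R w (\<lambda>x. y x + cor (\<mu> - m) * w x) = p" by (auto simp: p_def algebra_simps)
  \<comment> \<open>Testing the lower bound \<open>m\<close> on v - t w gains (2 t - C t^2) times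
    the squared norm of v; t = 1/C maximises this gain.\<close>
  define t where "t = 1 / C"
  have t: "0 < t" "t * C = 1" using C by (auto simp: t_def)
  let ?t = "cor t"
  have Re_wv: "Re (ip M w v) \<le> C * (nrm v)\<^sup>2"
  proof -
   have "nrm w \<le> C2 * nrm y" using C2(2)[OF wT] by simp
   also have "\<dots> \<le> C2 * (C1 * nrm v)" using C1(2)[OF yT] C2(1) by (intro mult_left_mono) auto
   finally have "nrm w * nrm v \<le> (C2 * (C1 * nrm v)) * nrm v" by (rule mult_right_mono) simp
   then show ?thesis using L2_Cauchy_Schwarz[OF wL vL] complex_Re_le_cmod[of "ip M w v"] by (simp add: C_def power2_eq_square mult_ac)
  qed
  have p2: "(nrm p)\<^sup>2 = m\<^sup>2 * (nrm w)\<^sup>2 + Re (ip M w v)"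
   using arg_cong[OF key[OF wT], of Re] unfolding Rw by (simp add: ip_self flip: of_real_power of_real_mult)
  have Rvp: "Re (ip M (?R v k) p) = m\<^sup>2 * Re (ip M v w) + (nrm v)\<^sup>2"
   using arg_cong[OF key[OF vk], of Re] by (simp add: ip_self flip: of_real_power)
  have "m * nrm (\<lambda>x. v x - ?t * w x) \<le> nrm (\<lambda>x. ?R v k x - ?t * p x)"
  proof -
   have eq: "?R (\<lambda>x. v x - ?t * w x) (\<lambda>x. k x - ?t * (y x + cor (\<mu> - m) * w x)) = (\<lambda>x. ?R v k x - ?t * p x)"
    by (auto simp: p_def algebra_simps)
   show ?thesis using lower[OF diff_mem[OF vk scale_mem[OF wT, of ?t]]] unfolding eq .
  qed
  then have "(m * nrm (\<lambda>x. v x - ?t * w x))\<^sup>2 \<le> (nrm (\<lambda>x. ?R v k x - ?t * p x))\<^sup>2"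
   by (rule power_mono) (use m0 in simp)
  then have "m\<^sup>2 * ((nrm v)\<^sup>2 - 2 * t * Re (ip M v w) + t\<^sup>2 * (nrm w)\<^sup>2) \<le>
    (nrm (?R v k))\<^sup>2 - 2 * t * Re (ip M (?R v k) p) + t\<^sup>2 * (nrm p)\<^sup>2"
   unfolding power_mult_distrib L2_norm_diff_square[OF vL L2_scale[OF wL]] L2_norm_diff_square[OF res_L2[OF vk] L2_scale[OF pL]]
    L2_norm_scale ip_scale_right using t by (simp add: mult.assoc)
  then have "m\<^sup>2 * (nrm v)\<^sup>2 + 2 * (t * (nrm v)\<^sup>2) \<le> (nrm (?R v k))\<^sup>2 + t\<^sup>2 * Re (ip M w v)"
   unfolding p2 Rvp by (simp add: algebra_simps)
  moreover have "t\<^sup>2 * Re (ip M w v) \<le> t\<^sup>2 * (C * (nrm v)\<^sup>2)" by (intro mult_left_mono Re_wv) simp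
  moreover have "t\<^sup>2 * (C * (nrm v)\<^sup>2) = t * (nrm v)\<^sup>2" using t(2) by (simp add: power2_eq_square mult_ac)
  ultimately show ?thesis unfolding t_def[symmetric] distrib_right by linarith
 qed
 have "sqrt (m\<^sup>2 + 1 / C) \<le> m" unfolding m_def
 proof (rule cInf_greatest[OF ne], unfold m_def[symmetric])
  fix d assume "d \<in> ?D"
  then obtain v k where v: "(v, k) \<in> T" "0 < nrm v" "d = nrm (?R v k) / nrm v" by blast
  have "sqrt ((m\<^sup>2 + 1 / C) * (nrm v)\<^sup>2) \<le> nrm (?R v k)" by (rule real_le_lsqrt) (use strict[OF v(1)] in auto)
  then have "sqrt (m\<^sup>2 + 1 / C) * nrm v \<le> nrm (?R v k)" unfolding real_sqrt_mult by simp
  then show "sqrt (m\<^sup>2 + 1 / C) \<le> d" unfolding v(3) pos_le_divide_eq[OF v(2)] .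
 qed
 then have "m\<^sup>2 + 1 / C \<le> m\<^sup>2" by (rule sqrt_le_D)
 then show False using C by simp
qed

text \<open>Write R = T - l. The bound \<open>resolvent_norm\<close> at the centres l + d/2 and l -
  d/2 says that R^2 dominates both d R and - d R as quadratic forms. Polarising against
  \<open>v\<close> and approximating \<open>v\<close> by the range of R gives the gap; the
  approximation exists because \<open>v\<close> is orthogonal to the kernel.\<close>

lemma isolated_gap:
 fixes l d :: real
 assumes d: "d > 0" and res: "\<And>s. s \<noteq> l ==> \<bar>s - l\<bar> < d ==> cor s \<in> resolvent_set M T"
  and vk: "(v, k) \<in> T" and orth: "\<And>e. e \<in> eigenspace M T (cor l) ==> ip M v e = 0"
 shows "d * nrm v \<le> nrm (\<lambda>x. k x - cor l * v x)"
proof -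
 let ?l = "cor l"
 let ?R = "\<lambda>u f x. f x - ?l * u x"
 have form: "d * \<bar>Re (ip M (?R u f) u)\<bar> \<le> (nrm (?R u f))\<^sup>2" if T: "(u, f) \<in> T" for u f
 proof -
  have L: "u \<in> L2 M" "?R u f \<in> L2 M" using L2D[OF T] res_L2[OF T] by auto
  have expand: "(nrm (\<lambda>x. ?R u f x - c * u x))\<^sup>2 =
    (nrm (?R u f))\<^sup>2 - 2 * Re (cnj c * ip M (?R u f) u) + (cmod c * nrm u)\<^sup>2" for c
   using L2_norm_diff_square[OF L(2) L2_scale[OF L(1)], of c] by (simp add: ip_scale_right L2_norm_scale)
  \<comment> \<open>The sign \<open>s\<close> selects the centre l + s d/2 of a gap interval of
    radius d/2; after expansion the terms with the squared norm of u cancel.\<close>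
  have *: "- s * d * Re (ip M (?R u f) u) \<le> (nrm (?R u f))\<^sup>2 - 2 * s * d * Re (ip M (?R u f) u)"
   if s: "\<bar>s\<bar> = 1" for s :: real
  proof -
   have "d / 2 * nrm u \<le> nrm (\<lambda>x. f x - cor (l + s * d / 2) * u x)"
   proof (rule resolvent_norm[OF _ T])
    fix t assume t: "\<bar>t - (l + s * d / 2)\<bar> < d / 2"
    have "\<bar>s * d / 2\<bar> = d / 2" using s d by (simp add: abs_mult)
    then show "cor t \<in> resolvent_set M T" using t d by (intro res) linarith+
   qed
   then have "(d / 2 * nrm u)\<^sup>2 \<le> (nrm (\<lambda>x. f x - cor (l + s * d / 2) * u x))\<^sup>2" using d by (intro power_mono) auto
   also have "(\<lambda>x. f x - cor (l + s * d / 2) * u x) = (\<lambda>x. ?R u f x - cor (s * d / 2) * u x)" by (auto simp: algebra_simps)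
   also have "(nrm \<dots>)\<^sup>2 = (nrm (?R u f))\<^sup>2 - s * d * Re (ip M (?R u f) u) + (s * d / 2 * nrm u)\<^sup>2"
    unfolding expand by (simp add: power_mult_distrib norm_mult power_divide)
   also have "(s * d / 2 * nrm u)\<^sup>2 = (d / 2 * nrm u)\<^sup>2" using s by (simp add: power_mult_distrib power_divide abs_square_eq_1)
   finally show ?thesis by (simp add: algebra_simps)
  qed
  show ?thesis using *[of 1] *[of "-1"] d by (auto simp: abs_if)
 qed
 have polar: "2 * d * Re (ip M (?R u f) v) \<le> (nrm (?R u f))\<^sup>2 + (nrm (?R v k))\<^sup>2" if T: "(u, f) \<in> T" for u f
 proof -
  let ?p = "?R u f" and ?q = "?R v k"
  have L: "u \<in> L2 M" "?p \<in> L2 M" "v \<in> L2 M" "?q \<in> L2 M" "f \<in> L2 M" "k \<in> L2 M"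
   using L2D[OF T] res_L2[OF T] L2D[OF vk] res_L2[OF vk] by auto
  have "ip M ?p v = ip M u ?q" using L symmetric[OF T vk] by (simp add: ip_diff_left ip_diff_right ip_scale_left ip_scale_right L2_scale)
  then have qu: "Re (ip M ?q u) = Re (ip M ?p v)" by (metis ip_cnj cnj.simps(1))
  have plus: "d * Re (ip M (\<lambda>x. ?p x + ?q x) (\<lambda>x. u x + v x)) \<le> (nrm (\<lambda>x. ?p x + ?q x))\<^sup>2"
  proof -
   have "(\<lambda>x. ?p x + ?q x) = ?R (\<lambda>x. u x + v x) (\<lambda>x. f x + k x)" by (auto simp: algebra_simps)
   then have "d * \<bar>Re (ip M (\<lambda>x. ?p x + ?q x) (\<lambda>x. u x + v x))\<bar> \<le> (nrm (\<lambda>x. ?p x + ?q x))\<^sup>2"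
    using form[OF add_mem[OF T vk]] by simp
   moreover have "d * Re (ip M (\<lambda>x. ?p x + ?q x) (\<lambda>x. u x + v x)) \<le> d * \<bar>Re (ip M (\<lambda>x. ?p x + ?q x) (\<lambda>x. u x + v x))\<bar>"
    using d by (intro mult_left_mono) auto
   ultimately show ?thesis by simp
  qed
  have minus: "- d * Re (ip M (\<lambda>x. ?p x - ?q x) (\<lambda>x. u x - v x)) \<le> (nrm (\<lambda>x. ?p x - ?q x))\<^sup>2"
  proof -
   have "(\<lambda>x. ?p x - ?q x) = ?R (\<lambda>x. u x - v x) (\<lambda>x. f x - k x)" by (auto simp: algebra_simps)
   then have "d * \<bar>Re (ip M (\<lambda>x. ?p x - ?q x) (\<lambda>x. u x - v x))\<bar> \<le> (nrm (\<lambda>x. ?p x - ?q x))\<^sup>2"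
    using form[OF diff_mem[OF T vk]] by simp
   moreover have "d * - Re (ip M (\<lambda>x. ?p x - ?q x) (\<lambda>x. u x - v x)) \<le> d * \<bar>Re (ip M (\<lambda>x. ?p x - ?q x) (\<lambda>x. u x - v x))\<bar>"
    using d by (intro mult_left_mono) auto
   ultimately show ?thesis by simp
  qed
  have ipp: "ip M (\<lambda>x. ?p x + ?q x) (\<lambda>x. u x + v x) = ip M ?p u + ip M ?p v + (ip M ?q u + ip M ?q v)"
   using L by (simp only: ip_add_left ip_add_right L2_add)
  have ipm: "ip M (\<lambda>x. ?p x - ?q x) (\<lambda>x. u x - v x) = ip M ?p u - ip M ?p v - (ip M ?q u - ip M ?q v)"
   using L by (simp only: ip_diff_left ip_diff_right L2_diff)
  have "d * (Re (ip M ?p u) + Re (ip M ?p v) + (Re (ip M ?q u) + Re (ip M ?q v))) \<le> (nrm (\<lambda>x. ?p x + ?q x))\<^sup>2"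
   using plus unfolding ipp by simp
  moreover have "- d * (Re (ip M ?p u) - Re (ip M ?p v) - (Re (ip M ?q u) - Re (ip M ?q v))) \<le> (nrm (\<lambda>x. ?p x - ?q x))\<^sup>2"
   using minus unfolding ipm by simp
  ultimately have "4 * (d * Re (ip M ?p v)) \<le> (nrm (\<lambda>x. ?p x + ?q x))\<^sup>2 + (nrm (\<lambda>x. ?p x - ?q x))\<^sup>2"
   unfolding qu by (simp add: algebra_simps)
  also have "\<dots> = 2 * (nrm ?p)\<^sup>2 + 2 * (nrm ?q)\<^sup>2" using L2_norm_add_square[OF L(2,4)] L2_norm_diff_square[OF L(2,4)] by simp
  finally show ?thesis by simp
 qed
 define S where "S = {?R u f |u f. (u, f) \<in> T}"
 have SL: "S \<subseteq> L2 M" using res_L2 by (auto simp: S_def)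
 have SI: "?R u f \<in> S" if "(u, f) \<in> T" for u f using that by (auto simp: S_def)
 have "closed_subspace M (L2_closure M S)"
 proof (rule closed_subspace_closure[OF SL])
  show "(\<lambda>x. 0) \<in> S" using SI[OF zero_mem] by simp
  show "(\<lambda>x. u x + v x) \<in> S" if uv: "u \<in> S" "v \<in> S" for u v
  proof -
   obtain a b a' b' where *: "(a, b) \<in> T" "u = ?R a b" "(a', b') \<in> T" "v = ?R a' b'" using uv by (auto simp: S_def)
   have "(\<lambda>x. u x + v x) = ?R (\<lambda>x. a x + a' x) (\<lambda>x. b x + b' x)" unfolding * by (auto simp: algebra_simps)
   then show ?thesis using SI[OF add_mem[OF *(1,3)]] by simp
  qed
  show "(\<lambda>x. c * u x) \<in> S" if u: "u \<in> S" for c u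
  proof -
   obtain a b where *: "(a, b) \<in> T" "u = ?R a b" using u by (auto simp: S_def)
   have "(\<lambda>x. c * u x) = ?R (\<lambda>x. c * a x) (\<lambda>x. c * b x)" unfolding * by (auto simp: algebra_simps)
   then show ?thesis using SI[OF scale_mem[OF *(1)]] by simp
  qed
 qed
 moreover have vL: "v \<in> L2 M" using L2D[OF vk] by auto
 ultimately obtain r where r: "r \<in> L2_closure M S" "\<And>t. t \<in> L2_closure M S ==> ip M (\<lambda>x. v x - r x) t = 0"
  using L2_projection by metis
 have rL: "r \<in> L2 M" using r(1) by (auto simp: L2_closure_def)
 have S_sub: "t \<in> L2_closure M S" if "t \<in> S" for t using that SL by (auto simp: L2_closure_def intro!: exI[of _ "\<lambda>_. t"])
 let ?e = "\<lambda>x. v x - r x"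
 have eL: "?e \<in> L2 M" using vL rL by auto
 \<comment> \<open>The part of \<open>v\<close> orthogonal to the range lies in the eigenspace,
   hence is orthogonal to \<open>v\<close> and therefore null.\<close>
 have "(?e, \<lambda>x. cnj ?l * ?e x) \<in> T"
 proof (rule range_orthogonal[OF eL])
  fix u f assume "(u, f) \<in> T"
  from r(2)[OF S_sub[OF SI[OF this]]] show "ip M (?R u f) ?e = 0" using ip_cnj[of M ?e "?R u f"] by simp
 qed
 then have "?e \<in> eigenspace M T ?l" using eL by (simp add: eigenspace_iff)
 then have "ip M v ?e = 0" by (rule orth)
 moreover have re: "ip M r ?e = 0" using r(2)[OF r(1)] ip_cnj[of M ?e r] by simp
 moreover have "ip M ?e ?e = ip M v ?e - ip M r ?e" using vL rL eL by (rule ip_diff_left)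
 ultimately have "nrm ?e = 0" by (simp add: ip_self)
 then have "AE x in M. v x = r x" using eL by (simp add: L2_norm_eq_0_iff)
 then have vr: "nrm v = nrm r" by (rule L2_norm_AE_cong) (use vL rL L2_measurable in auto)
 have "ip M r v = ip M r r"
 proof -
  have "ip M r ?e = ip M r v - ip M r r" by (rule ip_diff_right[OF vL rL rL])
  then show ?thesis using re by simp
 qed
 then have rv: "Re (ip M r v) = (nrm v)\<^sup>2" by (simp add: ip_self vr)
 obtain s where s: "\<And>n. s n \<in> S" "L2_tendsto M s r" using r(1) by (auto simp: L2_closure_def)
 have sL: "s n \<in> L2 M" for n using s(1) SL by auto
 \<comment> \<open>Scaling u by \<open>d\<close> balances the two squares: in the limit 2 d^2 |v|^2
   \<le> d^2 |v|^2 + |R v|^2.\<close>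
 have le: "2 * d * (d * Re (ip M (s n) v)) \<le> d\<^sup>2 * (nrm (s n))\<^sup>2 + (nrm (?R v k))\<^sup>2" for n
 proof -
  obtain u f where *: "(u, f) \<in> T" "s n = ?R u f" using s(1)[of n] by (auto simp: S_def)
  have eq: "?R (\<lambda>x. cor d * u x) (\<lambda>x. cor d * f x) = (\<lambda>x. cor d * s n x)" unfolding * by (auto simp: algebra_simps)
  show ?thesis using polar[OF scale_mem[OF *(1)], of "cor d"] d unfolding eq by (simp add: ip_scale_left L2_norm_scale power_mult_distrib)
 qed
 have "(\<lambda>n. 2 * d * (d * Re (ip M (s n) v))) \<longlonglongrightarrow> 2 * d * (d * Re (ip M r v))"
  by (intro tendsto_intros L2_tendsto_ip) (use s sL rL vL in auto)
 moreover have "(\<lambda>n. d\<^sup>2 * (nrm (s n))\<^sup>2 + (nrm (?R v k))\<^sup>2) \<longlonglongrightarrow> d\<^sup>2 * (nrm r)\<^sup>2 + (nrm (?R v k))\<^sup>2"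
  by (intro tendsto_intros L2_tendsto_norm) (use s sL rL in auto)
 ultimately have "2 * d * (d * Re (ip M r v)) \<le> d\<^sup>2 * (nrm r)\<^sup>2 + (nrm (?R v k))\<^sup>2" by (rule LIMSEQ_le) (use le in auto)
 then have "(d * nrm v)\<^sup>2 \<le> (nrm (?R v k))\<^sup>2" unfolding rv vr[symmetric] by (simp add: power2_eq_square mult.assoc mult.left_commute)
 then show ?thesis by (rule power2_le_imp_le) simp
qed

text \<open>If l were an isolated eigenvalue of finite multiplicity, \<open>isolated_gap\<close>
  would send the components orthogonal to the eigenspace to zero, and weak convergence in finite
  dimension would do the same to the projections. This contradicts the unit norms.\<close>

theorem singular_sequence_essential:
 fixes l :: real
 assumes T: "\<And>n. (u n, f n) \<in> T" and one: "\<And>n. nrm (u n) = 1"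
  and lim: "(\<lambda>n. nrm (\<lambda>x. f n x - cor l * u n x)) \<longlonglongrightarrow> 0"
  and weak: "\<And>b. b \<in> L2 M ==> (\<lambda>n. ip M (u n) b) \<longlonglongrightarrow> 0"
 shows "cor l \<in> essential_spectrum M T"
proof -
 let ?l = "cor l"
 have uL: "u n \<in> L2 M" and fL: "f n \<in> L2 M" for n using L2D[OF T] by auto
 have "?l \<in> spectrum M T"
 proof (rule ccontr)
  assume "?l \<notin> spectrum M T"
  then have "?l \<in> resolvent_set M T" by (simp add: spectrum_def)
  then obtain C where C: "\<And>u f. (u, f) \<in> T ==> nrm u \<le> C * nrm (\<lambda>x. f x - ?l * u x)" using resolvent_bound by metis
  have "(\<lambda>n. C * nrm (\<lambda>x. f n x - ?l * u n x)) \<longlonglongrightarrow> C * 0" by (intro tendsto_intros lim)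
  then have "1 \<le> C * 0" by (rule LIMSEQ_le_const) (use C[OF T] one in auto)
  then show False by simp
 qed
 moreover have "?l \<notin> discrete_spectrum M T"
 proof
  assume "?l \<in> discrete_spectrum M T"
  then have iso: "?l isolated_in spectrum M T" and fin: "finite_multiplicity M T ?l" by (auto simp: discrete_spectrum_def)
  obtain d where d: "d > 0" "\<And>y. y \<in> spectrum M T ==> dist ?l y < d ==> y = ?l" using iso unfolding isolated_in_dist_Ex_iff by blast
  have res: "cor s \<in> resolvent_set M T" if "s \<noteq> l" "\<bar>s - l\<bar> < d" for s
  proof -
   have "dist ?l (cor s) < d" using that by (simp add: dist_norm abs_minus_commute flip: of_real_diff)
   then show ?thesis using d(2)[of "cor s"] that by (auto simp: spectrum_def)
  qed
  let ?N = "eigenspace M T ?l"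
  obtain B where B: "finite B" "B \<subseteq> L2 M" "\<And>u. u \<in> ?N ==> \<exists>c. AE x in M. u x = (\<Sum>b\<in>B. c b * b x)"
   using fin unfolding finite_multiplicity_def by blast
  obtain E C where E: "finite E" "E \<subseteq> L2 M" "0 \<le> C" and
   EC: "\<And>c. nrm (\<lambda>x. \<Sum>b\<in>B. c b * b x) \<le> C * (\<Sum>a\<in>E. cmod (ip M (\<lambda>x. \<Sum>b\<in>B. c b * b x) a))"
   using L2_finite_dim_norm_le[OF B(1,2)] by blast
  have "closed_subspace M ?N" unfolding closed_subspace_def
  proof (intro conjI ballI allI impI)
   show "?N \<subseteq> L2 M" by (auto simp: eigenspace_iff)
   show "(\<lambda>x. 0) \<in> ?N" using zero_mem by (simp add: eigenspace_iff)
   show "(\<lambda>x. u x + v x) \<in> ?N" if "u \<in> ?N" "v \<in> ?N" for u v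
    using that add_mem[of u "\<lambda>x. ?l * u x" v "\<lambda>x. ?l * v x"] by (auto simp: eigenspace_iff distrib_left)
   show "(\<lambda>x. c * u x) \<in> ?N" if "u \<in> ?N" for c u
    using that scale_mem[of u "\<lambda>x. ?l * u x" c] by (auto simp: eigenspace_iff mult.left_commute)
  next
   fix s u assume u: "u \<in> L2 M" and s: "\<forall>n. s n \<in> ?N" "L2_tendsto M s u"
   have "(u, \<lambda>x. ?l * u x) \<in> T"
    by (rule closed_mem[of s "\<lambda>n x. ?l * s n x"]) (use s u L2_tendsto_scale in \<open>auto simp: eigenspace_iff\<close>)
   then show "u \<in> ?N" using u by (simp add: eigenspace_iff)
  qed
  then have "\<exists>e. e \<in> ?N \<and> (\<forall>t\<in>?N. ip M (\<lambda>x. u n x - e x) t = 0)" for n using L2_projection[OF _ uL] by blast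
  then obtain e where e: "\<And>n. e n \<in> ?N" "\<And>n t. t \<in> ?N ==> ip M (\<lambda>x. u n x - e n x) t = 0" by metis
  have eT: "(e n, \<lambda>x. ?l * e n x) \<in> T" and eL: "e n \<in> L2 M" for n using e(1) by (auto simp: eigenspace_iff)
  let ?w = "\<lambda>n x. u n x - e n x"
  have wL: "?w n \<in> L2 M" for n using uL eL by auto
  have "d * nrm (?w n) \<le> nrm (\<lambda>x. f n x - ?l * u n x)" for n
  proof -
   have "d * nrm (?w n) \<le> nrm (\<lambda>x. (f n x - ?l * e n x) - ?l * (u n x - e n x))"
    by (rule isolated_gap[OF d(1) res diff_mem[OF T eT] e(2)])
   also have "(\<lambda>x. (f n x - ?l * e n x) - ?l * (u n x - e n x)) = (\<lambda>x. f n x - ?l * u n x)" by (auto simp: algebra_simps)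
   finally show ?thesis .
  qed
  then have w_le: "nrm (?w n) \<le> inverse d * nrm (\<lambda>x. f n x - ?l * u n x)" for n using d(1) by (simp add: field_simps)
  have wlim: "(\<lambda>n. nrm (?w n)) \<longlonglongrightarrow> 0"
  proof (rule tendsto_sandwich[OF _ _ tendsto_const])
   show "(\<lambda>n. inverse d * nrm (\<lambda>x. f n x - ?l * u n x)) \<longlonglongrightarrow> 0"
    using tendsto_mult[OF tendsto_const lim, of "inverse d"] by simp
  qed (auto intro: always_eventually w_le)
  have e_le: "nrm (e n) \<le> C * (\<Sum>a\<in>E. cmod (ip M (u n) a) + nrm (?w n) * nrm a)" for n
  proof -
   obtain c where c: "AE x in M. e n x = (\<Sum>b\<in>B. c b * b x)" using B(3)[OF e(1)] by blast
   have cL: "(\<lambda>x. \<Sum>b\<in>B. c b * b x) \<in> L2 M" using B(2) by (intro L2_sum L2_scale) auto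
   have "ip M (\<lambda>x. \<Sum>b\<in>B. c b * b x) a = ip M (e n) a" if "a \<in> E" for a
    by (rule ip_AE_cong[symmetric, OF c]) (use L2_measurable eL cL E(2) that in auto)
   then have "nrm (e n) \<le> C * (\<Sum>a\<in>E. cmod (ip M (e n) a))"
    using EC[of c] L2_norm_AE_cong[OF c L2_measurable[OF eL] L2_measurable[OF cL]] by simp
   also have "\<dots> \<le> C * (\<Sum>a\<in>E. cmod (ip M (u n) a) + nrm (?w n) * nrm a)"
   proof (rule mult_left_mono[OF sum_mono E(3)])
    fix a assume "a \<in> E"
    then have a: "a \<in> L2 M" using E by auto
    have "ip M (e n) a = ip M (u n) a - ip M (?w n) a" using ip_diff_left[OF uL eL a, of n n] by simp
    then have "cmod (ip M (e n) a) \<le> cmod (ip M (u n) a) + cmod (ip M (?w n) a)" by (simp add: norm_triangle_ineq4)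
    then show "cmod (ip M (e n) a) \<le> cmod (ip M (u n) a) + nrm (?w n) * nrm a" using L2_Cauchy_Schwarz[OF wL a, of n] by linarith
   qed
   finally show ?thesis .
  qed
  have "1 \<le> C * (\<Sum>a\<in>E. cmod (ip M (u n) a) + nrm (?w n) * nrm a) + nrm (?w n)" for n
   using e_le[of n] L2_norm_triangle[OF eL wL, of n n] one[of n] by simp
  moreover have "(\<lambda>n. C * (\<Sum>a\<in>E. cmod (ip M (u n) a) + nrm (?w n) * nrm a) + nrm (?w n)) \<longlonglongrightarrow>
    C * (\<Sum>a\<in>E. cmod 0 + 0 * nrm a) + 0" by (intro tendsto_intros weak wlim) (use E in auto)
  ultimately have "1 \<le> C * (\<Sum>a\<in>E. cmod 0 + 0 * nrm a) + 0" by (intro LIMSEQ_le_const) auto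
  then show False by simp
 qed
 ultimately show ?thesis by (simp add: essential_spectrum_def)
qed

end

section \<open>Calculus of smooth functions\<close>

lemma pderivs_append: "pderivs (vs @ ws) f = pderivs vs (pderivs ws f)" by (induction vs) auto

lemma pderivs_has_derivative:
 assumes "(f has_derivative f') (at x)"
 shows "pderivs [v] f x = f' v"
proof -
 have "f' = frechet_derivative f (at x)" by (rule frechet_derivative_at[OF assms])
 then show ?thesis by simp
qed

text \<open>Invariant families replace formulas for iterated derivatives: it is enough to name a
  class of differentiable functions that is stable under each partial derivative.\<close>

lemma smooth_coinduct:
 assumes "P f"
  and "\<And>f x. P f ==> f differentiable (at x)"
  and "\<And>f v. P f ==> v \<in> Basis ==> P (pderivs [v] f)"
 shows "smooth f"
proof -
 have "P (pderivs vs f)" if "set vs \<subseteq> Basis" for vs using that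
 proof (induction vs)
  case (Cons v vs)
  then show ?case using assms(3)[of "pderivs vs f" v] by simp
 qed (simp add: assms(1))
 then show ?thesis unfolding smooth_def using assms(2) by blast
qed

lemma smooth_differentiable: "smooth f ==> f differentiable (at x)" unfolding smooth_def by (metis pderivs.simps(1) empty_set empty_subsetI)

lemma smooth_pderivs:
 assumes "smooth f" "set vs \<subseteq> Basis"
 shows "smooth (pderivs vs f)" unfolding smooth_def
proof (intro allI impI)
 fix ws :: "'a list" and x assume "set ws \<subseteq> Basis"
 then show "pderivs ws (pderivs vs f) differentiable (at x)" using assms unfolding smooth_def pderivs_append[symmetric] by (metis Un_least set_append)
qed

lemma smooth_has_derivative:
 assumes "smooth f"
 shows "(f has_derivative (\<lambda>h. \<Sum>i\<in>Basis. (h \<bullet> i) *\<^sub>R pderivs [i] f x)) (at x)"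
proof -
 let ?f' = "frechet_derivative f (at x)"
 have D: "(f has_derivative ?f') (at x)" using smooth_differentiable[OF assms] frechet_derivative_works by blast
 then have lin: "linear ?f'" by (rule has_derivative_linear)
 have "?f' h = (\<Sum>i\<in>Basis. (h \<bullet> i) *\<^sub>R ?f' i)" for h
 proof -
  have "?f' h = ?f' (\<Sum>i\<in>Basis. (h \<bullet> i) *\<^sub>R i)" by (simp add: euclidean_representation)
  also have "\<dots> = (\<Sum>i\<in>Basis. (h \<bullet> i) *\<^sub>R ?f' i)" by (simp add: linear_sum[OF lin] linear_cmul[OF lin])
  finally show ?thesis .
 qed
 then have "?f' = (\<lambda>h. \<Sum>i\<in>Basis. (h \<bullet> i) *\<^sub>R pderivs [i] f x)" unfolding pderivs.simps by (rule ext)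
 from back_subst[of "\<lambda>F. (f has_derivative F) (at x)", OF D this] show ?thesis .
qed

lemma smooth_continuous: "smooth f ==> continuous_on A f"
 by (intro continuous_at_imp_continuous_on ballI has_derivative_continuous[OF smooth_has_derivative])

lemma smooth_const [intro, simp]: "smooth (\<lambda>x. c)" by (rule smooth_coinduct[where P = "\<lambda>f. \<exists>c. f = (\<lambda>x. c)"]) auto

lemma smooth_pderivs_add:
 assumes "smooth f" "smooth g"
 shows "smooth (\<lambda>x. f x + g x)"
  and "set vs \<subseteq> Basis ==> pderivs vs (\<lambda>x. f x + g x) = (\<lambda>x. pderivs vs f x + pderivs vs g x)"
proof -
 have eq: "pderivs [v] (\<lambda>x. f x + g x) = (\<lambda>x. pderivs [v] f x + pderivs [v] g x)"
  if "smooth f" "smooth g" for f g :: "'a => 'b" and v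
 proof
  fix x
  have "f differentiable (at x)" "g differentiable (at x)" using that smooth_differentiable by blast+
  then show "pderivs [v] (\<lambda>x. f x + g x) x = pderivs [v] f x + pderivs [v] g x"
   by (intro pderivs_has_derivative has_derivative_add[THEN has_derivative_eq_rhs]) (auto simp: frechet_derivative_works)
 qed
 show "smooth (\<lambda>x. f x + g x)"
 proof (rule smooth_coinduct[where P = "\<lambda>h. \<exists>f g. smooth f \<and> smooth g \<and> h = (\<lambda>x. f x + g x)"])
  show "\<exists>fa ga. smooth fa \<and> smooth ga \<and> (\<lambda>x. f x + g x) = (\<lambda>x. fa x + ga x)" using assms by blast
  show "h differentiable (at x)" if h: "\<exists>f g. smooth f \<and> smooth g \<and> h = (\<lambda>x. f x + g x)" for h :: "'a => 'b" and x
   using h smooth_differentiable by (auto intro: differentiable_add)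
  show "\<exists>f g. smooth f \<and> smooth g \<and> pderivs [v] h = (\<lambda>x. f x + g x)"
   if h: "\<exists>f g. smooth f \<and> smooth g \<and> h = (\<lambda>x. f x + g x)" and v: "v \<in> Basis" for h :: "'a => 'b" and v
  proof -
   obtain f g where *: "smooth f" "smooth g" "h = (\<lambda>x. f x + g x)" using h by blast
   have "smooth (pderivs [v] f)" "smooth (pderivs [v] g)" using * v by (auto intro!: smooth_pderivs simp del: pderivs.simps)
   then show ?thesis unfolding *(3) eq[OF *(1,2)] by blast
  qed
 qed
 show "pderivs vs (\<lambda>x. f x + g x) = (\<lambda>x. pderivs vs f x + pderivs vs g x)" if "set vs \<subseteq> Basis" using that
 proof (induction vs)
  case (Cons v vs)
  then have IH: "pderivs vs (\<lambda>x. f x + g x) = (\<lambda>x. pderivs vs f x + pderivs vs g x)" by simp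
  have "smooth (pderivs vs f)" "smooth (pderivs vs g)" using assms Cons.prems by (auto intro: smooth_pderivs)
  from eq[OF this, of v] show ?case
   using pderivs_append[of "[v]" vs "\<lambda>x. f x + g x"] pderivs_append[of "[v]" vs f] pderivs_append[of "[v]" vs g] IH
   by (simp del: pderivs.simps)
 qed simp
qed

lemma smooth_pderivs_linear:
 assumes L: "bounded_linear L" and f: "smooth f"
 shows "smooth (\<lambda>x. L (f x))"
  and "set vs \<subseteq> Basis ==> pderivs vs (\<lambda>x. L (f x)) = (\<lambda>x. L (pderivs vs f x))"
proof -
 have D: "((\<lambda>x. L (f x)) has_derivative (\<lambda>h. L (frechet_derivative f (at x) h))) (at x)" if "smooth f" for f x
  using smooth_differentiable[OF that, of x] L by (intro bounded_linear.has_derivative[OF L]) (simp add: frechet_derivative_works)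
 then have eq: "pderivs [v] (\<lambda>x. L (f x)) = (\<lambda>x. L (pderivs [v] f x))" if "smooth f" for f v
  using pderivs_has_derivative[OF D[OF that]] by (auto simp: fun_eq_iff)
 show "smooth (\<lambda>x. L (f x))"
 proof (rule smooth_coinduct[where P = "\<lambda>h. \<exists>f. smooth f \<and> h = (\<lambda>x. L (f x))"])
  show "h differentiable (at x)" if "\<exists>f. smooth f \<and> h = (\<lambda>x. L (f x))" for h x using D that unfolding differentiable_def by blast
  show "\<exists>f. smooth f \<and> pderivs [v] h = (\<lambda>x. L (f x))"
   if h: "\<exists>f. smooth f \<and> h = (\<lambda>x. L (f x))" and v: "v \<in> Basis" for h v
  proof -
   obtain f where *: "smooth f" "h = (\<lambda>x. L (f x))" using h by blast
   have "smooth (pderivs [v] f)" using * v by (auto intro!: smooth_pderivs simp del: pderivs.simps)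
   then show ?thesis unfolding * eq[OF *(1)] by blast
  qed
 qed (use f in blast)
 show "pderivs vs (\<lambda>x. L (f x)) = (\<lambda>x. L (pderivs vs f x))" if "set vs \<subseteq> Basis" using that
 proof (induction vs)
  case (Cons v vs)
  then have IH: "pderivs vs (\<lambda>x. L (f x)) = (\<lambda>x. L (pderivs vs f x))" by simp
  have "smooth (pderivs vs f)" using f Cons.prems by (auto intro: smooth_pderivs)
  from eq[OF this, of v] show ?case using pderivs_append[of "[v]" vs "\<lambda>x. L (f x)"] pderivs_append[of "[v]" vs f] IH
   by (simp del: pderivs.simps)
 qed simp
qed

lemma pderiv_mult:
 fixes f g :: "'a::euclidean_space => 'b::real_normed_algebra"
 assumes "smooth f" "smooth g"
 shows "pderivs [v] (\<lambda>x. f x * g x) = (\<lambda>x. f x * pderivs [v] g x + pderivs [v] f x * g x)"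
proof
 fix x
 have "(f has_derivative frechet_derivative f (at x)) (at x)" "(g has_derivative frechet_derivative g (at x)) (at x)"
  using assms smooth_differentiable frechet_derivative_works by blast+
 from has_derivative_mult[OF this] show "pderivs [v] (\<lambda>x. f x * g x) x = f x * pderivs [v] g x + pderivs [v] f x * g x"
  by (subst pderivs_has_derivative) auto
qed

text \<open>Sums of products of smooth functions are stable under differentiation, which spares
  iterating the Leibniz rule.\<close>

inductive smooth_products :: "('a::euclidean_space => 'b::real_normed_algebra) => bool" where
 mult: "smooth f ==> smooth g ==> smooth_products (\<lambda>x. f x * g x)"
| add: "smooth_products f ==> smooth_products g ==> smooth_products (\<lambda>x. f x + g x)"

lemma smooth_products_differentiable: "smooth_products f ==> f differentiable (at x)"
 by (induction rule: smooth_products.induct) (auto intro: differentiable_mult differentiable_add smooth_differentiable)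

lemma smooth_products_pderiv: "smooth_products f ==> v \<in> Basis ==> smooth_products (pderivs [v] f)"
proof (induction rule: smooth_products.induct)
 case (mult f g)
 then show ?case unfolding pderiv_mult[OF mult(1,2)] by (intro smooth_products.intros smooth_pderivs) auto
next
 case (add f g)
 have "pderivs [v] (\<lambda>x. f x + g x) = (\<lambda>x. pderivs [v] f x + pderivs [v] g x)"
 proof
  fix x
  have "(f has_derivative frechet_derivative f (at x)) (at x)" "(g has_derivative frechet_derivative g (at x)) (at x)"
   using add smooth_products_differentiable frechet_derivative_works by blast+
  from has_derivative_add[OF this] show "pderivs [v] (\<lambda>x. f x + g x) x = pderivs [v] f x + pderivs [v] g x"
   by (subst pderivs_has_derivative) auto
 qed
 then show ?case using add by (auto intro: smooth_products.intros simp del: pderivs.simps)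
qed

lemma smooth_mult:
 fixes f g :: "'a::euclidean_space => 'b::real_normed_algebra"
 assumes "smooth f" "smooth g"
 shows "smooth (\<lambda>x. f x * g x)"
proof (rule smooth_coinduct[where P = smooth_products])
 show "smooth_products (\<lambda>x. f x * g x)" by (rule smooth_products.mult[OF assms])
qed (rule smooth_products_differentiable smooth_products_pderiv; assumption)+

lemma smooth_prod:
 fixes f :: "'i => 'a::euclidean_space => real"
 assumes "\<And>i. i \<in> I ==> smooth (f i)"
 shows "smooth (\<lambda>x. \<Prod>i\<in>I. f i x)" using assms by (induction I rule: infinite_finite_induct) (simp_all add: smooth_mult)

lemma smooth_bounded_linear:
 assumes "bounded_linear L"
 shows "smooth L"
proof (rule smooth_coinduct[where P = "\<lambda>f. f = L \<or> (\<exists>c. f = (\<lambda>x. c))"])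
 show "f differentiable (at x)" if "f = L \<or> (\<exists>c. f = (\<lambda>x. c))" for f x
  using that bounded_linear_imp_differentiable[OF assms] by auto
 show "pderivs [v] f = L \<or> (\<exists>c. pderivs [v] f = (\<lambda>x. c))"
  if f: "f = L \<or> (\<exists>c. f = (\<lambda>x. c))" for f v
 proof -
  consider "f = L" | c where "f = (\<lambda>x. c)" using f by blast
  then show ?thesis
  proof cases
   case 1
   have "pderivs [v] f = (\<lambda>x. L v)"
    unfolding 1 using pderivs_has_derivative[OF bounded_linear.has_derivative[OF assms has_derivative_ident], of v] by (auto simp: fun_eq_iff)
   then show ?thesis by blast
  next
   case 2
   have "pderivs [v] f = (\<lambda>x. 0)" unfolding 2 by (auto simp: fun_eq_iff)
   then show ?thesis by blast
  qed
 qed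
qed simp

lemma smooth_real_polynomial_function: "real_polynomial_function p ==> smooth p" by (induction rule: real_polynomial_function.induct)
  (auto intro: smooth_bounded_linear smooth_pderivs_add(1) smooth_mult)

lemma smooth_affine:
 assumes f: "smooth f"
 shows "smooth (\<lambda>x. f (s *\<^sub>R x + a))"
  and "v \<in> Basis ==> pderivs [v] (\<lambda>x. f (s *\<^sub>R x + a)) = (\<lambda>x. s *\<^sub>R pderivs [v] f (s *\<^sub>R x + a))"
proof -
 have D: "((\<lambda>x. c *\<^sub>R f (s *\<^sub>R x + a)) has_derivative (\<lambda>h. c *\<^sub>R s *\<^sub>R frechet_derivative f (at (s *\<^sub>R x + a)) h)) (at x)"
  if "smooth f" for f :: "'a => 'b" and x c
 proof -
  let ?f' = "frechet_derivative f (at (s *\<^sub>R x + a))"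
  have f': "(f has_derivative ?f') (at (s *\<^sub>R x + a))" using smooth_differentiable[OF that] frechet_derivative_works by blast
  have "((\<lambda>x. s *\<^sub>R x + a) has_derivative (\<lambda>h. s *\<^sub>R h)) (at x)" by (auto intro!: derivative_eq_intros)
  from has_derivative_compose[OF this f']
  have "((\<lambda>x. c *\<^sub>R f (s *\<^sub>R x + a)) has_derivative (\<lambda>h. c *\<^sub>R ?f' (s *\<^sub>R h))) (at x)"
   by (rule has_derivative_scaleR_right)
  then show ?thesis using linear_cmul[OF has_derivative_linear[OF f']] by simp
 qed
 have eq: "pderivs [v] (\<lambda>x. c *\<^sub>R f (s *\<^sub>R x + a)) = (\<lambda>x. (c * s) *\<^sub>R pderivs [v] f (s *\<^sub>R x + a))"
  if "smooth f" for f :: "'a => 'b" and c v using pderivs_has_derivative[OF D[OF that]] by (auto simp: fun_eq_iff)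
 show "smooth (\<lambda>x. f (s *\<^sub>R x + a))"
 proof (rule smooth_coinduct[where P = "\<lambda>h. \<exists>c f. smooth f \<and> h = (\<lambda>x. c *\<^sub>R f (s *\<^sub>R x + a))"])
  show "\<exists>c fa. smooth fa \<and> (\<lambda>x. f (s *\<^sub>R x + a)) = (\<lambda>x. c *\<^sub>R fa (s *\<^sub>R x + a))"
   using f by (intro exI[of _ 1] exI[of _ f]) simp
  show "h differentiable (at x)" if "\<exists>c f. smooth f \<and> h = (\<lambda>x. c *\<^sub>R f (s *\<^sub>R x + a))" for h :: "'a => 'b" and x
   using D that unfolding differentiable_def by blast
  show "\<exists>c f. smooth f \<and> pderivs [v] h = (\<lambda>x. c *\<^sub>R f (s *\<^sub>R x + a))"
   if h: "\<exists>c f. smooth f \<and> h = (\<lambda>x. c *\<^sub>R f (s *\<^sub>R x + a))" and v: "v \<in> Basis" for h :: "'a => 'b" and v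
  proof -
   obtain c f where *: "smooth f" "h = (\<lambda>x. c *\<^sub>R f (s *\<^sub>R x + a))" using h by blast
   have "smooth (pderivs [v] f)" using * v by (auto intro!: smooth_pderivs simp del: pderivs.simps)
   then show ?thesis unfolding * eq[OF *(1)] by blast
  qed
 qed
 show "pderivs [v] (\<lambda>x. f (s *\<^sub>R x + a)) = (\<lambda>x. s *\<^sub>R pderivs [v] f (s *\<^sub>R x + a))" if "v \<in> Basis"
  using eq[OF f, of v 1] by simp
qed

section \<open>Bump functions\<close>

text \<open>The classical cutoff exp (- 1/t), extended by zero, with a polynomial factor in 1/t that
  makes the family stable under differentiation.\<close>

definition flat :: "real poly => real => real" where
 "flat p t = (if t > 0 then poly p (inverse t) * exp (- inverse t) else 0)"

lemma poly_times_exp_neg_tendsto_0: "((\<lambda>s. poly p s * exp (- s)) \<longlongrightarrow> (0::real)) at_top"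
proof -
 have "((\<lambda>s. \<Sum>i\<le>degree p. coeff p i * (s ^ i / exp s)) \<longlongrightarrow> (\<Sum>i\<le>degree p. coeff p i * 0)) at_top"
  by (intro tendsto_intros tendsto_power_div_exp_0)
 then show ?thesis by (simp add: poly_altdef sum_distrib_right exp_minus divide_inverse mult.assoc)
qed

text \<open>With s = 1/t, differentiation in t turns p(s) exp(-s) into s^2 (p - p')(s) exp(-s). At t
  = 0 the difference quotient from the right is s p(s) exp(-s) with s tending to infinity.\<close>

lemma flat_derivative: "(flat p has_real_derivative flat ([:0, 0, 1:] * (p - pderiv p)) t) (at t)"
proof -
 consider "t > 0" | "t < 0" | "t = 0" by linarith
 then show ?thesis
 proof cases
  case 1
  have "((\<lambda>t. poly p (inverse t) * exp (- inverse t)) has_real_derivative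
    poly p (inverse t) * (exp (- inverse t) * (inverse t)\<^sup>2) + poly (pderiv p) (inverse t) * - ((inverse t)\<^sup>2) * exp (- inverse t)) (at t)"
   using 1 by (auto intro!: derivative_eq_intros DERIV_chain2[OF poly_DERIV] simp: power2_eq_square)
  then have "((\<lambda>t. poly p (inverse t) * exp (- inverse t)) has_real_derivative flat ([:0, 0, 1:] * (p - pderiv p)) t) (at t)"
   using 1 by (simp add: flat_def algebra_simps power2_eq_square)
  then show ?thesis by (rule DERIV_cong_ev[THEN iffD1, rotated -1, OF _ refl _ refl])
    (use 1 eventually_nhds_in_open[of "{0<..}" t] in \<open>auto simp: flat_def elim!: eventually_mono\<close>)
 next
  case 2
  have "((\<lambda>t. 0) has_real_derivative flat ([:0, 0, 1:] * (p - pderiv p)) t) (at t)" using 2 by (simp add: flat_def)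
  then show ?thesis by (rule DERIV_cong_ev[THEN iffD1, rotated -1, OF _ refl _ refl])
    (use 2 eventually_nhds_in_open[of "{..<0}" t] in \<open>auto simp: flat_def elim!: eventually_mono\<close>)
 next
  case 3
  have "((\<lambda>h. flat p h / h) \<longlongrightarrow> 0) (at 0)"
  proof (rule filterlim_split_at)
   show "((\<lambda>h. flat p h / h) \<longlongrightarrow> 0) (at_left 0)" by (rule tendsto_eventually) (auto simp: eventually_at_filter flat_def)
   have "((\<lambda>s. flat p (inverse s) / inverse s) \<longlongrightarrow> 0) at_top"
   proof (rule Lim_transform_eventually[OF poly_times_exp_neg_tendsto_0[of "p * [:0, 1:]"]])
    show "\<forall>\<^sub>F s in at_top. poly (p * [:0, 1:]) s * exp (- s) = flat p (inverse s) / inverse s"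
     using eventually_gt_at_top[of "0::real"] by eventually_elim (simp add: flat_def field_simps)
   qed
   then show "((\<lambda>h. flat p h / h) \<longlongrightarrow> 0) (at_right 0)" unfolding filterlim_at_right_to_top .
  qed
  then show ?thesis unfolding 3 has_field_derivative_iff by (simp add: flat_def)
 qed
qed

lemma smooth_flat_affine: "smooth (\<lambda>x::'a::euclidean_space. flat p (x \<bullet> v + c))"
proof (rule smooth_coinduct[where P = "\<lambda>f. \<exists>k p. f = (\<lambda>x. k * flat p (x \<bullet> v + c))"])
 have D: "((\<lambda>x. k * flat p (x \<bullet> v + c)) has_derivative
   (\<lambda>h. k * ((h \<bullet> v) * flat ([:0, 0, 1:] * (p - pderiv p)) (x \<bullet> v + c)))) (at x)" for k p and x :: 'a
 proof -
  have "((\<lambda>x. x \<bullet> v + c) has_derivative (\<lambda>h. h \<bullet> v)) (at x)" by (auto intro!: derivative_eq_intros)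
  from has_derivative_compose[OF this flat_derivative[unfolded has_field_derivative_def]]
  have "((\<lambda>x. flat p (x \<bullet> v + c)) has_derivative
   (\<lambda>h. flat ([:0, 0, 1:] * (p - pderiv p)) (x \<bullet> v + c) * (h \<bullet> v))) (at x)" .
  from has_derivative_mult_right[OF this, of k] show ?thesis by (simp add: mult.commute)
 qed
 show "f differentiable (at x)" if "\<exists>k p. f = (\<lambda>x. k * flat p (x \<bullet> v + c))" for f and x :: 'a
  using D that unfolding differentiable_def by blast
 show "\<exists>k p. pderivs [w] f = (\<lambda>x. k * flat p (x \<bullet> v + c))" if f: "\<exists>k p. f = (\<lambda>x. k * flat p (x \<bullet> v + c))" for f and w :: 'a
 proof -
  obtain k p where f: "f = (\<lambda>x. k * flat p (x \<bullet> v + c))" using f by blast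
  have "pderivs [w] f = (\<lambda>x. (k * (w \<bullet> v)) * flat ([:0, 0, 1:] * (p - pderiv p)) (x \<bullet> v + c))"
   unfolding f using pderivs_has_derivative[OF D[of k p], of w] by (auto simp: fun_eq_iff mult.assoc)
  then show ?thesis by blast
 qed
 show "\<exists>k pa. (\<lambda>x. flat p (x \<bullet> v + c)) = (\<lambda>x. k * flat pa (x \<bullet> v + c))"
  by (intro exI[of _ 1] exI[of _ p]) simp
qed

text \<open>A product of one-sided cutoffs, one for each face of the box. The scale \<open>n\<close>
  steepens them, so that the bumps tend to the indicator of the open box.\<close>

definition box_bump :: "real => 'a::euclidean_space => 'a => 'a => real" where
 "box_bump n a b x = (\<Prod>i\<in>Basis. flat 1 (x \<bullet> (n *\<^sub>R i) - n * (a \<bullet> i)) * flat 1 (n * (b \<bullet> i) - x \<bullet> (n *\<^sub>R i)))"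

lemma smooth_box_bump: "smooth (box_bump n a b)"
proof -
 have "smooth (\<lambda>x. flat 1 (x \<bullet> (n *\<^sub>R i) + (- n * (a \<bullet> i))) * flat 1 (x \<bullet> (- n *\<^sub>R i) + n * (b \<bullet> i)))" for i
  by (intro smooth_mult smooth_flat_affine)
 then have "smooth (\<lambda>x. \<Prod>i\<in>Basis. flat 1 (x \<bullet> (n *\<^sub>R i) + (- n * (a \<bullet> i))) * flat 1 (x \<bullet> (- n *\<^sub>R i) + n * (b \<bullet> i)))"
  by (intro smooth_prod)
 moreover have "box_bump n a b = (\<lambda>x. \<Prod>i\<in>Basis. flat 1 (x \<bullet> (n *\<^sub>R i) + (- n * (a \<bullet> i))) * flat 1 (x \<bullet> (- n *\<^sub>R i) + n * (b \<bullet> i)))"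
  by (auto simp: box_bump_def fun_eq_iff)
 ultimately show ?thesis by simp
qed

lemma flat_1_bounds: "0 \<le> flat 1 t" "flat 1 t \<le> 1" by (auto simp: flat_def)

lemma flat_1_not_neg: "\<not> flat 1 t < 0" using flat_1_bounds(1)[of t] by simp

lemma flat_1_pos_iff: "0 < flat 1 t \<longleftrightarrow> 0 < t" by (auto simp: flat_def)

lemma box_bump_bounds: "0 \<le> box_bump n a b x" "box_bump n a b x \<le> 1" unfolding box_bump_def
 by (auto intro!: prod_nonneg prod_le_1 mult_le_one simp: flat_1_bounds)

lemma box_bump_pos_iff:
 assumes "n > 0"
 shows "0 < box_bump n a b x \<longleftrightarrow> x \<in> box a b"
proof -
 have *: "0 < flat 1 (x \<bullet> (n *\<^sub>R i) - n * (a \<bullet> i)) * flat 1 (n * (b \<bullet> i) - x \<bullet> (n *\<^sub>R i)) \<longleftrightarrow> a \<bullet> i < x \<bullet> i \<and> x \<bullet> i < b \<bullet> i" for i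
  using assms by (auto simp: zero_less_mult_iff flat_1_pos_iff flat_1_not_neg)
 show ?thesis
 proof
  assume pos: "0 < box_bump n a b x"
  have "0 < flat 1 (x \<bullet> (n *\<^sub>R i) - n * (a \<bullet> i)) * flat 1 (n * (b \<bullet> i) - x \<bullet> (n *\<^sub>R i))" if "i \<in> Basis" for i
  proof (rule ccontr)
   assume "\<not> ?thesis"
   then have "flat 1 (x \<bullet> (n *\<^sub>R i) - n * (a \<bullet> i)) * flat 1 (n * (b \<bullet> i) - x \<bullet> (n *\<^sub>R i)) = 0"
    using flat_1_bounds(1) mult_nonneg_nonneg by (metis less_eq_real_def)
   then have "box_bump n a b x = 0" unfolding box_bump_def using that by (intro prod_zero) auto
   then show False using pos by simp
  qed
  then show "x \<in> box a b" unfolding * mem_box by blast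
 next
  assume "x \<in> box a b"
  then show "0 < box_bump n a b x" unfolding box_bump_def mem_box by (intro prod_pos) (use * in blast)
 qed
qed

lemma box_bump_eq_0: "n > 0 ==> x \<notin> box a b ==> box_bump n a b x = 0"
 using box_bump_pos_iff[of n a b x] box_bump_bounds(1)[of n a b x] by force

lemma box_bump_tendsto: "(\<lambda>n. box_bump (real (Suc n)) a b x) \<longlonglongrightarrow> indicator (box a b) x"
proof (cases "x \<in> box a b")
 case False
 then show ?thesis by (simp add: box_bump_eq_0 del: of_nat_Suc)
next
 case True
 have lim: "(\<lambda>n. flat 1 (real (Suc n) * s)) \<longlonglongrightarrow> 1" if s: "s > 0" for s
 proof -
  have "(\<lambda>n. exp (- (inverse (real (Suc n)) * inverse s))) \<longlonglongrightarrow> exp (- (0 * inverse s))"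
   by (intro tendsto_intros LIMSEQ_inverse_real_of_nat)
  moreover have "flat 1 (real (Suc n) * s) = exp (- (inverse (real (Suc n)) * inverse s))" for n
   using s by (simp add: flat_def inverse_mult_distrib del: of_nat_Suc)
  ultimately show ?thesis by simp
 qed
 have "(\<lambda>n. flat 1 (x \<bullet> (real (Suc n) *\<^sub>R i) - real (Suc n) * (a \<bullet> i)) * flat 1 (real (Suc n) * (b \<bullet> i) - x \<bullet> (real (Suc n) *\<^sub>R i))) \<longlonglongrightarrow> 1 * 1"
  if "i \<in> Basis" for i using that True lim[of "x \<bullet> i - a \<bullet> i"] lim[of "b \<bullet> i - x \<bullet> i"]
  by (intro tendsto_mult) (auto simp: mem_box right_diff_distrib simp del: of_nat_Suc)
 then have "(\<lambda>n. box_bump (real (Suc n)) a b x) \<longlonglongrightarrow> (\<Prod>i\<in>(Basis::'a set). 1 * 1)"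
  unfolding box_bump_def by (rule tendsto_prod)
 then show ?thesis using True by simp
qed

section \<open>Test functions\<close>

lemma test_functionsI:
 assumes "smooth f" "compact K" "K \<subseteq> \<Omega>" "\<And>x. x \<notin> K ==> f x = 0"
 shows "f \<in> \<D> \<Omega>"
proof -
 have "closure {x. f x \<noteq> 0} \<subseteq> K" by (rule closure_minimal) (use assms compact_imp_closed in auto)
 moreover have "compact (closure {x. f x \<noteq> 0})"
  by (rule compact_closure[THEN iffD2]) (rule bounded_subset[OF compact_imp_bounded[OF assms(2)]], use assms in auto)
 ultimately show ?thesis using assms by (auto simp: test_functions_def)
qed

text \<open>One compact set serves f and all its derivatives, because f is zero on the open
  complement of its support.\<close>

lemma test_support:
 assumes "f \<in> \<D> \<Omega>"
 shows "\<exists>K. compact K \<and> K \<subseteq> \<Omega> \<and> (\<forall>x. x \<notin> K \<longrightarrow> f x = 0) \<and> (\<forall>vs x. x \<notin> K \<longrightarrow> pderivs vs f x = 0)"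
proof (intro exI conjI allI impI)
 let ?K = "closure {x. f x \<noteq> 0}"
 show "compact ?K" "?K \<subseteq> \<Omega>" using assms by (auto simp: test_functions_def)
 show z: "f x = 0" if "x \<notin> ?K" for x using that closure_subset[of "{x. f x \<noteq> 0}"] by auto
 show "pderivs vs f x = 0" if "x \<notin> ?K" for vs x using that
 proof (induction vs arbitrary: x)
  case (Cons v vs)
  have "((\<lambda>y. 0) has_derivative (\<lambda>h. 0)) (at x)" by simp
  then have "(pderivs vs f has_derivative (\<lambda>h. 0)) (at x)" by (rule has_derivative_transform_within_open[where s = "- ?K"]) (use Cons in auto)
  from pderivs_has_derivative[OF this, of v] show ?case by simp
 next
  case Nil
  show ?case unfolding pderivs.simps by (rule z[OF Nil])
 qed
qed

lemma test_smooth: "f \<in> \<D> \<Omega> ==> smooth f" by (simp add: test_functions_def)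

lemma test_outside: "f \<in> \<D> \<Omega> ==> x \<notin> \<Omega> ==> f x = 0" using test_support[of f \<Omega>] by blast

lemma test_mono: "f \<in> \<D> \<Omega> ==> \<Omega> \<subseteq> \<Omega>' ==> f \<in> \<D> \<Omega>'" by (auto simp: test_functions_def)

lemma test_UNIV: "f \<in> \<D> \<Omega> ==> f \<in> \<D> UNIV" by (rule test_mono) auto

lemma test_pderivs:
 assumes "f \<in> \<D> \<Omega>" "set vs \<subseteq> Basis"
 shows "pderivs vs f \<in> \<D> \<Omega>"
proof -
 obtain K where K: "compact K" "K \<subseteq> \<Omega>" "\<And>vs x. x \<notin> K ==> pderivs vs f x = 0" using test_support[OF assms(1)] by blast
 show ?thesis by (rule test_functionsI[OF smooth_pderivs[OF test_smooth[OF assms(1)] assms(2)] K(1,2)]) (rule K(3))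
qed

lemma test_zero: "(\<lambda>x. 0) \<in> \<D> \<Omega>" by (rule test_functionsI[of _ "{}"]) auto

lemma test_add:
 assumes "f \<in> \<D> \<Omega>" "g \<in> \<D> \<Omega>"
 shows "(\<lambda>x. f x + g x) \<in> \<D> \<Omega>"
proof -
 obtain K L where "compact K" "K \<subseteq> \<Omega>" "\<And>x. x \<notin> K ==> f x = 0" "compact L" "L \<subseteq> \<Omega>" "\<And>x. x \<notin> L ==> g x = 0"
  using test_support[OF assms(1)] test_support[OF assms(2)] by blast
 then show ?thesis by (intro test_functionsI[where K = "K \<union> L"] smooth_pderivs_add(1) test_smooth[OF assms(1)] test_smooth[OF assms(2)]) auto
qed

lemma test_smooth_mult:
 assumes "smooth g" "f \<in> \<D> \<Omega>"
 shows "(\<lambda>x. g x * f x) \<in> \<D> \<Omega>"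
proof -
 obtain K where "compact K" "K \<subseteq> \<Omega>" "\<And>x. x \<notin> K ==> f x = 0" using test_support[OF assms(2)] by blast
 then show ?thesis by (intro test_functionsI[where K = K] smooth_mult assms test_smooth[OF assms(2)]) auto
qed

lemma test_scale: "f \<in> \<D> \<Omega> ==> (\<lambda>x. c * f x) \<in> \<D> \<Omega>" by (intro test_smooth_mult) auto

lemma test_cnj:
 assumes "f \<in> \<D> \<Omega>"
 shows "(\<lambda>x. cnj (f x)) \<in> \<D> \<Omega>"
proof -
 obtain K where "compact K" "K \<subseteq> \<Omega>" "\<And>x. x \<notin> K ==> f x = 0" using test_support[OF assms] by blast
 then show ?thesis by (intro test_functionsI[where K = K] smooth_pderivs_linear(1)[OF bounded_linear_cnj] test_smooth[OF assms]) auto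
qed

lemma test_diff: "f \<in> \<D> \<Omega> ==> g \<in> \<D> \<Omega> ==> (\<lambda>x. f x - g x) \<in> \<D> \<Omega>"
 using test_add[OF _ test_scale[of g \<Omega> "-1"], of f] by simp

lemma test_translate:
 assumes "f \<in> \<D> UNIV"
 shows "(\<lambda>x. f (x + a)) \<in> \<D> UNIV"
  and "v \<in> Basis ==> pderivs [v] (\<lambda>x. f (x + a)) = (\<lambda>x. pderivs [v] f (x + a))"
proof -
 obtain K where K': "compact K" "K \<subseteq> UNIV" "\<forall>x. x \<notin> K \<longrightarrow> f x = 0"
  using test_support[OF assms] by (elim exE conjE) (rule that)
 note K = K'(1) K'(3)[rule_format]
 have "compact ((\<lambda>x. x - a) ` K)" by (intro compact_continuous_image continuous_intros K)
 moreover have "f (x + a) = 0" if "x \<notin> (\<lambda>x. x - a) ` K" for x using K(2)[of "x + a"] that by (metis add_diff_cancel image_eqI)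
 ultimately show "(\<lambda>x. f (x + a)) \<in> \<D> UNIV" using smooth_affine(1)[OF test_smooth[OF assms], of 1 a] by (intro test_functionsI) auto
 show "pderivs [v] (\<lambda>x. f (x + a)) = (\<lambda>x. pderivs [v] f (x + a))" if "v \<in> Basis"
  using smooth_affine(2)[OF test_smooth[OF assms] that, of 1 a] by simp
qed

lemma test_reflect:
 assumes "f \<in> \<D> UNIV"
 shows "smooth (\<lambda>y. f (x - y))"
  and "v \<in> Basis ==> pderivs [v] (\<lambda>y. f (x - y)) = (\<lambda>y. - pderivs [v] f (x - y))"
 using smooth_affine[OF test_smooth[OF assms], where s = "-1" and a = x] by simp_all

lemma pderivs_test_add:
 assumes "f \<in> \<D> \<Omega>" "g \<in> \<D> \<Omega>'" "set vs \<subseteq> Basis"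
 shows "pderivs vs (\<lambda>x. f x + g x) = (\<lambda>x. pderivs vs f x + pderivs vs g x)"
 by (rule smooth_pderivs_add(2)) (use assms test_smooth in auto)

lemma pderivs_test_scale:
 assumes "f \<in> \<D> \<Omega>" "set vs \<subseteq> Basis"
 shows "pderivs vs (\<lambda>x. c * f x) = (\<lambda>x. c * pderivs vs f x)"
 by (rule smooth_pderivs_linear(2)[OF bounded_linear_mult_right]) (use assms test_smooth in auto)

lemma pderivs_test_diff:
 assumes "f \<in> \<D> \<Omega>" "g \<in> \<D> \<Omega>" "set vs \<subseteq> Basis"
 shows "pderivs vs (\<lambda>x. f x - g x) = (\<lambda>x. pderivs vs f x - pderivs vs g x)"
 using pderivs_test_add[OF assms(1) test_scale[OF assms(2), of "-1"] assms(3)] pderivs_test_scale[OF assms(2,3), of "-1"] by simp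

lemma pderivs_test_cnj:
 assumes "f \<in> \<D> \<Omega>" "set vs \<subseteq> Basis"
 shows "pderivs vs (\<lambda>x. cnj (f x)) = (\<lambda>x. cnj (pderivs vs f x))"
 by (rule smooth_pderivs_linear(2)[OF bounded_linear_cnj]) (use assms test_smooth in auto)

lemma test_laplacian: "f \<in> \<D> \<Omega> ==> laplacian f \<in> \<D> \<Omega>"
proof -
 assume f: "f \<in> \<D> \<Omega>"
 have "(\<lambda>x. \<Sum>i\<in>I. pderivs [i, i] f x) \<in> \<D> \<Omega>" if "finite I" "I \<subseteq> Basis" for I using that
 proof (induction I rule: finite_induct)
  case (insert i I)
  then show ?case using test_add[OF test_pderivs[OF f, of "[i, i]"]] by (simp del: pderivs.simps)
 qed (simp add: test_zero)
 then show ?thesis by (simp add: laplacian_def[abs_def] del: pderivs.simps)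
qed

lemma laplacian_test_scale: "f \<in> \<D> \<Omega> ==> laplacian (\<lambda>x. c * f x) = (\<lambda>x. c * laplacian f x)"
 by (auto simp: laplacian_def fun_eq_iff pderivs_test_scale sum_distrib_left simp del: pderivs.simps)

lemma laplacian_test_add:
 "f \<in> \<D> \<Omega> ==> g \<in> \<D> \<Omega> ==> laplacian (\<lambda>x. f x + g x) = (\<lambda>x. laplacian f x + laplacian g x)"
 by (auto simp: laplacian_def fun_eq_iff pderivs_test_add sum.distrib simp del: pderivs.simps)

lemma laplacian_test_diff:
 "f \<in> \<D> \<Omega> ==> g \<in> \<D> \<Omega> ==> laplacian (\<lambda>x. f x - g x) = (\<lambda>x. laplacian f x - laplacian g x)"
 by (auto simp: laplacian_def fun_eq_iff pderivs_test_diff sum_subtractf simp del: pderivs.simps)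

lemma laplacian_test_cnj: "f \<in> \<D> \<Omega> ==> laplacian (\<lambda>x. cnj (f x)) = (\<lambda>x. cnj (laplacian f x))"
 by (auto simp: laplacian_def fun_eq_iff pderivs_test_cnj simp del: pderivs.simps)

lemma box_bump_test:
 assumes "n > 0" "cbox a b \<subseteq> \<Omega>"
 shows "(\<lambda>x. cor (box_bump n a b x)) \<in> \<D> \<Omega>"
proof (rule test_functionsI[where K = "cbox a b"])
 show "smooth (\<lambda>x. cor (box_bump n a b x))" by (rule smooth_pderivs_linear(1)[OF bounded_linear_of_real smooth_box_bump])
 show "cor (box_bump n a b x) = 0" if "x \<notin> cbox a b" for x using that box_subset_cbox[of a b] box_bump_eq_0[OF assms(1)] by auto
qed (use assms in auto)

lemma test_bounded:
 assumes "f \<in> \<D> \<Omega>"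
 obtains C where "C \<ge> 0" "\<And>x. cmod (f x) \<le> C"
proof -
 obtain K where K': "compact K" "K \<subseteq> \<Omega>" "\<forall>x. x \<notin> K \<longrightarrow> f x = 0"
  using test_support[OF assms] by (elim exE conjE) (rule that)
 note K = K'(1) K'(3)[rule_format]
 have "compact (f ` K)" by (intro compact_continuous_image smooth_continuous test_smooth[OF assms] K)
 then obtain C where C: "\<And>x. x \<in> K ==> cmod (f x) \<le> C" using compact_imp_bounded bounded_iff by (metis image_eqI)
 have "cmod (f x) \<le> \<bar>C\<bar>" for x using C[of x] K(2)[of x] by (cases "x \<in> K") auto
 then show ?thesis using that[of "\<bar>C\<bar>"] by auto
qed

section \<open>Lipschitz and Taylor bounds for test functions\<close>

lemma test_gradient_bound:
 assumes "f \<in> \<D> UNIV"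
  and bd: "\<And>i x. i \<in> Basis ==> cmod (pderivs [i] f x) \<le> C i"
 shows "onorm (\<lambda>h::'a::euclidean_space. \<Sum>i\<in>Basis. (h \<bullet> i) *\<^sub>R pderivs [i] f x) \<le> (\<Sum>i\<in>Basis. C i)"
proof (rule onorm_bound)
 have C0: "C i \<ge> 0" if "i \<in> Basis" for i using bd[OF that, of 0] norm_ge_zero order_trans by blast
 then show "0 \<le> (\<Sum>i\<in>Basis. C i)" by (rule sum_nonneg)
 fix h :: 'a
 have "norm (\<Sum>i\<in>Basis. (h \<bullet> i) *\<^sub>R pderivs [i] f x) \<le> (\<Sum>i\<in>Basis. norm h * C i)"
 proof (rule sum_norm_le)
  fix i :: 'a assume i: "i \<in> Basis"
  have "norm ((h \<bullet> i) *\<^sub>R pderivs [i] f x) = \<bar>h \<bullet> i\<bar> * cmod (pderivs [i] f x)" by simp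
  also have "\<dots> \<le> norm h * C i" by (intro mult_mono Basis_le_norm bd i) auto
  finally show "norm ((h \<bullet> i) *\<^sub>R pderivs [i] f x) \<le> norm h * C i" .
 qed
 also have "(\<Sum>i\<in>Basis. norm h * C i) = (\<Sum>i\<in>Basis. C i) * norm h"
  by (subst mult.commute[of _ "norm h"]) (rule sum_distrib_left[symmetric])
 finally show "norm (\<Sum>i\<in>Basis. (h \<bullet> i) *\<^sub>R pderivs [i] f x) \<le> (\<Sum>i\<in>Basis. C i) * norm h" .
qed

lemma test_lipschitz:
 assumes f: "f \<in> \<D> UNIV"
 obtains C where "C \<ge> 0" "\<And>x y. cmod (f x - f y) \<le> C * norm (x - y)"
proof -
 have "\<exists>c\<ge>0. \<forall>x. cmod (pderivs [i] f x) \<le> c" if "i \<in> Basis" for i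
  using test_bounded[OF test_pderivs[OF f, of "[i]"]] that by (metis empty_set insert_subset list.simps(15) empty_subsetI)
 then obtain c where c: "\<And>i. i \<in> Basis ==> 0 \<le> c i" "\<And>i x. i \<in> Basis ==> cmod (pderivs [i] f x) \<le> c i" by metis
 have "cmod (f x - f y) \<le> (\<Sum>i\<in>Basis. c i) * norm (x - y)" for x y
 proof (rule differentiable_bound[of UNIV _ "\<lambda>x h. \<Sum>i\<in>Basis. (h \<bullet> i) *\<^sub>R pderivs [i] f x"])
  show "(f has_derivative (\<lambda>h. \<Sum>i\<in>Basis. (h \<bullet> i) *\<^sub>R pderivs [i] f x)) (at x within UNIV)" for x
   using smooth_has_derivative[OF test_smooth[OF f]] by simp
  show "onorm (\<lambda>h. \<Sum>i\<in>Basis. (h \<bullet> i) *\<^sub>R pderivs [i] f x) \<le> (\<Sum>i\<in>Basis. c i)" for x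
   by (rule test_gradient_bound[OF f c(2)])
 qed auto
 moreover have "(\<Sum>i\<in>Basis. c i) \<ge> 0" by (rule sum_nonneg[OF c(1)])
 ultimately show ?thesis using that by blast
qed

definition dderiv :: "'a::euclidean_space => ('a => complex) => 'a => complex" where
 "dderiv h \<phi> x = (\<Sum>i\<in>Basis. cor (h \<bullet> i) * pderivs [i] \<phi> x)"

text \<open>Subtracting the linear part at \<open>x\<close> leaves a function whose derivative on
  the ball of radius norm h is at most a Lipschitz constant times norm h; the mean value inequality
  supplies the second factor norm h.\<close>

lemma test_taylor:
 assumes f: "f \<in> \<D> UNIV"
 obtains C where "C \<ge> 0" "\<And>x h. cmod (f (x + h) - f x - dderiv h f x) \<le> C * (norm h)\<^sup>2"
proof -
 have "\<exists>c\<ge>0. \<forall>x y. cmod (pderivs [i] f x - pderivs [i] f y) \<le> c * norm (x - y)" if "i \<in> Basis" for i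
  using test_lipschitz[OF test_pderivs[OF f, of "[i]"]] that by (metis empty_set insert_subset list.simps(15) empty_subsetI)
 then obtain c where c: "\<And>i. i \<in> Basis ==> 0 \<le> c i"
  "\<And>i x y. i \<in> Basis ==> cmod (pderivs [i] f x - pderivs [i] f y) \<le> c i * norm (x - y)" by metis
 define C where "C = (\<Sum>i\<in>Basis. c i)"
 have C0: "C \<ge> 0" unfolding C_def by (rule sum_nonneg[OF c(1)])
 have "cmod (f (x + h) - f x - dderiv h f x) \<le> C * (norm h)\<^sup>2" for x h :: 'a
 proof -
  let ?D = "\<lambda>y k. \<Sum>i\<in>Basis. (k \<bullet> i) *\<^sub>R pderivs [i] f y"
  have Dx: "bounded_linear (?D x)" using smooth_has_derivative[OF test_smooth[OF f]] has_derivative_bounded_linear by blast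
  define F where "F k = f (x + k) - ?D x k" for k
  have F': "(F has_derivative (\<lambda>l. \<Sum>i\<in>Basis. (l \<bullet> i) *\<^sub>R (pderivs [i] f (x + k) - pderivs [i] f x))) (at k within cball 0 (norm h))" for k
  proof -
   have "((\<lambda>k. x + k) has_derivative (\<lambda>l. l)) (at k)" by (auto intro!: derivative_eq_intros)
   from has_derivative_compose[OF this smooth_has_derivative[OF test_smooth[OF f]]]
   have "((\<lambda>k. f (x + k)) has_derivative ?D (x + k)) (at k)" .
   from has_derivative_diff[OF this bounded_linear.has_derivative[OF Dx has_derivative_ident]]
   have "(F has_derivative (\<lambda>l. ?D (x + k) l - ?D x l)) (at k)" unfolding F_def[abs_def] .
   then have "(F has_derivative (\<lambda>l. \<Sum>i\<in>Basis. (l \<bullet> i) *\<^sub>R (pderivs [i] f (x + k) - pderivs [i] f x))) (at k)"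
    by (simp add: scaleR_diff_right sum_subtractf del: pderivs.simps)
   then show ?thesis by (rule has_derivative_at_withinI)
  qed
  have "norm (F h - F 0) \<le> (C * norm h) * norm (h - 0)"
  proof (rule differentiable_bound[of "cball 0 (norm h)" F, OF _ F'])
   fix k :: 'a assume k: "k \<in> cball 0 (norm h)"
   show "onorm (\<lambda>l. \<Sum>i\<in>Basis. (l \<bullet> i) *\<^sub>R (pderivs [i] f (x + k) - pderivs [i] f x)) \<le> C * norm h"
   proof (rule onorm_bound)
    fix l :: 'a
    have "norm (\<Sum>i\<in>Basis. (l \<bullet> i) *\<^sub>R (pderivs [i] f (x + k) - pderivs [i] f x)) \<le> (\<Sum>i\<in>Basis. norm l * (c i * norm h))"
    proof (rule sum_norm_le)
     fix i :: 'a assume i: "i \<in> Basis"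
     have "cmod (pderivs [i] f (x + k) - pderivs [i] f x) \<le> c i * norm k" using c(2)[OF i, of "x + k" x] by simp
     also have "\<dots> \<le> c i * norm h" using k c(1)[OF i] by (intro mult_left_mono) auto
     finally have "cmod (pderivs [i] f (x + k) - pderivs [i] f x) \<le> c i * norm h" .
     then show "norm ((l \<bullet> i) *\<^sub>R (pderivs [i] f (x + k) - pderivs [i] f x)) \<le> norm l * (c i * norm h)"
      unfolding norm_scaleR by (intro mult_mono Basis_le_norm i) auto
    qed
    also have "\<dots> = C * norm h * norm l" unfolding C_def by (simp add: sum_distrib_left mult_ac)
    finally show "norm (\<Sum>i\<in>Basis. (l \<bullet> i) *\<^sub>R (pderivs [i] f (x + k) - pderivs [i] f x)) \<le> C * norm h * norm l" .
   qed (use C0 in simp)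
  qed auto
  moreover have "?D x 0 = 0" by simp
  moreover have "?D x h = dderiv h f x" by (simp add: dderiv_def scaleR_conv_of_real del: pderivs.simps)
  ultimately show ?thesis by (simp add: F_def power2_eq_square algebra_simps del: pderivs.simps)
 qed
 then show ?thesis using that C0 by blast
qed

declare pderivs.simps(2) [simp del]

section \<open>Integral estimates for test functions\<close>

lemma pderivs_pderivs: "pderivs [i] (pderivs [j] f) = pderivs [i, j] f" by (simp add: pderivs.simps)

lemma smooth_borel: "smooth f ==> f \<in> borel_measurable borel" by (rule borel_measurable_continuous_onI[OF smooth_continuous])

lemma test_borel: "f \<in> \<D> \<Omega> ==> f \<in> borel_measurable borel" by (rule smooth_borel[OF test_smooth])

lemma test_ball_support:
 assumes "f \<in> \<D> \<Omega>"
 shows "\<exists>R\<ge>0. \<forall>x vs. norm x > R \<longrightarrow> pderivs vs f x = 0"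
proof -
 obtain K where K: "compact K" "\<forall>vs x. x \<notin> K \<longrightarrow> pderivs vs f x = 0" using test_support[OF assms] by blast
 obtain R where "\<forall>x\<in>K. norm x \<le> R" using compact_imp_bounded[OF K(1)] by (auto simp: bounded_iff)
 then have "\<forall>x vs. norm x > \<bar>R\<bar> \<longrightarrow> pderivs vs f x = 0" using K(2) by force
 then show ?thesis by (intro exI[of _ "\<bar>R\<bar>"]) auto
qed

lemma cont_bounded_support_integrable:
 fixes f :: "'a::euclidean_space => 'b::{banach, second_countable_topology}"
 assumes "continuous_on UNIV f" "\<And>x. norm x > R ==> f x = 0"
 shows "integrable lborel f"
proof -
 have "integrable lborel (\<lambda>x. indicator (cball 0 R) x *\<^sub>R f x)"
  by (intro borel_integrable_compact continuous_on_subset[OF assms(1)]) auto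
 also have "(\<lambda>x. indicator (cball 0 R) x *\<^sub>R f x) = f" using assms(2) by (auto simp: indicator_def fun_eq_iff)
 finally show ?thesis .
qed

lemma integrable_cont_test:
 assumes "continuous_on UNIV g" "f \<in> \<D> \<Omega>"
 shows "integrable lborel (\<lambda>x. g x * f x)" "integrable lborel (\<lambda>x. f x * g x)"
proof -
 obtain R where "\<forall>x vs. norm x > R \<longrightarrow> pderivs vs f x = 0" using test_ball_support[OF assms(2)] by blast
 from this[rule_format, of _ "[]"] have R: "f x = 0" if "norm x > R" for x using that by simp
 show "integrable lborel (\<lambda>x. g x * f x)" by (rule cont_bounded_support_integrable[OF
     continuous_on_mult[OF assms(1) smooth_continuous[OF test_smooth[OF assms(2)]]], of R]) (simp add: R)
 then show "integrable lborel (\<lambda>x. f x * g x)" by (simp add: mult.commute)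
qed

lemma test_integrable: "f \<in> \<D> \<Omega> ==> integrable lborel f" using integrable_cont_test(1)[of "\<lambda>x. 1" f \<Omega>] by simp

lemma test_mult_integrable: "f \<in> \<D> \<Omega> ==> g \<in> \<D> \<Omega>' ==> integrable lborel (\<lambda>x. f x * g x)"
 by (rule integrable_cont_test(1)[OF smooth_continuous[OF test_smooth]])

lemma test_L2:
 assumes "f \<in> \<D> \<Omega>"
 shows "f \<in> L2 lborel"
proof (rule L2_dominated)
 have "integrable lborel (\<lambda>x. f x * cnj (f x))" by (rule test_mult_integrable[OF assms test_cnj[OF assms]])
 then show "integrable lborel (\<lambda>x. cmod (f x * cnj (f x)))" by (rule integrable_norm)
qed (use test_borel[OF assms] in \<open>auto simp: norm_mult power2_eq_square\<close>)

lemma lborel_integral_translate: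
 fixes f :: "'a::euclidean_space => 'b::{banach, second_countable_topology}"
 assumes "f \<in> borel_measurable borel"
 shows "(LINT x|lborel. f (x + a)) = (LINT x|lborel. f x)"
proof -
 have "(LINT x|lborel. f x) = integral\<^sup>L (distr lborel borel ((+) a)) f" by (simp add: lborel_distr_plus)
 also have "\<dots> = (LINT x|lborel. f (a + x))" by (rule integral_distr) (use assms in auto)
 finally show ?thesis by (simp add: add.commute)
qed

lemma lborel_nn_integral_translate:
 assumes "f \<in> borel_measurable borel"
 shows "(\<integral>\<^sup>+x. f (x + a) \<partial>lborel) = (\<integral>\<^sup>+x. f x \<partial>lborel)"
proof -
 have "(\<integral>\<^sup>+x. f x \<partial>lborel) = (\<integral>\<^sup>+x. f x \<partial>distr lborel borel ((+) a))" by (simp add: lborel_distr_plus)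
 also have "\<dots> = (\<integral>\<^sup>+x. f (a + x) \<partial>lborel)" by (rule nn_integral_distr) (use assms in auto)
 finally show ?thesis by (simp add: add.commute)
qed

lemma lborel_distr_reflect: "distr lborel borel (\<lambda>y. x - y) = (lborel :: 'a::euclidean_space measure)"
 using lborel_affine[of "-1" x] by (simp add: density_1)

lemma L2_norm_translate:
 assumes "f \<in> borel_measurable borel"
 shows "lnorm (\<lambda>x. f (x + a)) = lnorm f"
 unfolding L2_norm_def using assms lborel_integral_translate[of "\<lambda>x. (cmod (f x))\<^sup>2" a] by simp

lemma L2_norm_bounded_support:
 fixes f :: "'a::euclidean_space => complex"
 assumes "f \<in> borel_measurable borel" "\<And>x. cmod (f x) \<le> c" "\<And>x. norm x > R ==> f x = 0"
 shows "f \<in> L2 lborel" "lnorm f \<le> c * sqrt (measure lborel (cball (0::'a) R))"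
proof -
 have c: "0 \<le> c" using assms(2)[of 0] norm_ge_zero order_trans by blast
 have fin: "emeasure lborel (cball (0::'a) R) \<noteq> \<infinity>" using emeasure_bounded_finite[OF bounded_cball[of "0::'a" R]] by simp
 have "(\<integral>\<^sup>+x. ennreal ((cmod (f x))\<^sup>2) \<partial>lborel) \<le> (\<integral>\<^sup>+x. ennreal (c\<^sup>2) * indicator (cball (0::'a) R) x \<partial>lborel)"
 proof (rule nn_integral_mono)
  fix x
  show "ennreal ((cmod (f x))\<^sup>2) \<le> ennreal (c\<^sup>2) * indicator (cball 0 R) x"
   using assms(2)[of x] assms(3)[of x] by (cases "norm x > R") (auto simp: indicator_def intro!: ennreal_leI power_mono)
 qed
 also have "\<dots> = ennreal (c\<^sup>2) * emeasure lborel (cball (0::'a) R)" by (rule nn_integral_cmult_indicator) simp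
 also have "\<dots> = ennreal (c\<^sup>2 * measure lborel (cball (0::'a) R))" using fin by (simp add: emeasure_eq_ennreal_measure ennreal_mult)
 also have "c\<^sup>2 * measure lborel (cball (0::'a) R) = (c * sqrt (measure lborel (cball (0::'a) R)))\<^sup>2" by (simp add: power_mult_distrib)
 finally have *: "(\<integral>\<^sup>+x. ennreal ((cmod (f x))\<^sup>2) \<partial>lborel) \<le> ennreal ((c * sqrt (measure lborel (cball (0::'a) R)))\<^sup>2)" .
 have f: "f \<in> borel_measurable lborel" using assms(1) by simp
 show "f \<in> L2 lborel" by (rule L2I_nn_integral(1)[OF f *])
 show "lnorm f \<le> c * sqrt (measure lborel (cball (0::'a) R))" by (rule L2I_nn_integral(2)[OF f *]) (use c in simp)
qed

lemma integral_bounded_support: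
 fixes f :: "'a::euclidean_space => complex"
 assumes "integrable lborel f" "\<And>x. cmod (f x) \<le> c" "\<And>x. norm x > R ==> f x = 0"
 shows "cmod (LINT x|lborel. f x) \<le> c * measure lborel (cball (0::'a) R)"
proof -
 have fin: "emeasure lborel (cball (0::'a) R) < \<infinity>" by (rule emeasure_bounded_finite) simp
 have "cmod (LINT x|lborel. f x) \<le> (LINT x|lborel. c * indicator (cball (0::'a) R) x)"
 proof (rule Bochner_Integration.integral_norm_bound_integral[OF assms(1)])
  show "integrable lborel (\<lambda>x. c * indicat_real (cball (0::'a) R) x)"
   using fin by (intro integrable_mult_right integrable_real_indicator) auto
  show "cmod (f x) \<le> c * indicat_real (cball 0 R) x" for x using assms(2)[of x] assms(3)[of x] by (cases "norm x > R") (auto simp: indicator_def)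
 qed
 also have "\<dots> = c * measure lborel (cball (0::'a) R)" by simp
 finally show ?thesis .
qed

section \<open>Differentiating along translations; integration by parts\<close>

lemma test_dderiv: "f \<in> \<D> \<Omega> ==> dderiv h f \<in> \<D> \<Omega>"
proof -
 assume f: "f \<in> \<D> \<Omega>"
 have "(\<lambda>x. \<Sum>i\<in>I. cor (h \<bullet> i) * pderivs [i] f x) \<in> \<D> \<Omega>" if "finite I" "I \<subseteq> Basis" for I using that
 proof (induction I rule: finite_induct)
  case (insert i I)
  then show ?case using test_add[OF test_scale[OF test_pderivs[OF f, of "[i]"]]] by simp
 qed (simp add: test_zero)
 from this[OF finite_Basis subset_refl] show ?thesis by (simp only: dderiv_def[abs_def])
qed

lemma dderiv_Basis:
 assumes "i \<in> Basis"
 shows "dderiv (s *\<^sub>R i) f x = cor s * pderivs [i] f x"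
proof -
 have "dderiv (s *\<^sub>R i) f x = (\<Sum>j\<in>Basis. if j = i then cor s * pderivs [i] f x else 0)"
  unfolding dderiv_def by (intro sum.cong refl) (use assms in \<open>auto simp: inner_Basis\<close>)
 then show ?thesis using assms by simp
qed

text \<open>For shifts of length at most 1 the remainder vanishes off a fixed ball, so its pointwise
  bound becomes a norm or integral bound with the same power of h.\<close>

lemma dderiv_remainder:
 assumes f: "f \<in> \<D> (UNIV :: 'a::euclidean_space set)"
 obtains C R where "C \<ge> 0" "\<And>x h. cmod (f (x + h) - f x - dderiv h f x) \<le> C * (norm h)\<^sup>2"
  "\<And>x h. norm h \<le> 1 ==> norm x > R ==> f (x + h) - f x - dderiv h f x = 0"
proof -
 obtain C where C: "C \<ge> 0" "\<And>x h. cmod (f (x + h) - f x - dderiv h f x) \<le> C * (norm h)\<^sup>2" using test_taylor[OF f] by blast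
 obtain r where "\<forall>x vs. norm x > r \<longrightarrow> pderivs vs f x = 0" using test_ball_support[OF f] by blast
 then have r: "pderivs vs f x = 0" if "norm x > r" for x vs using that by blast
 have "f (x + h) - f x - dderiv h f x = 0" if h: "norm h \<le> 1" and x: "norm x > r + 1" for x h :: 'a
 proof -
  have "norm (x + h) > r" using norm_diff_ineq[of x h] h x by linarith
  then show ?thesis using r[of "x + h" "[]"] r[of x "[]"] r[of x "[i]" for i] x by (simp add: dderiv_def)
 qed
 then show ?thesis using that C by blast
qed

lemma integral_taylor:
 assumes f: "f \<in> \<D> (UNIV :: 'a::euclidean_space set)" and g: "continuous_on UNIV g"
 shows "\<exists>C. \<forall>h. norm h \<le> 1 \<longrightarrow> cmod ((LINT x|lborel. f (x + h) * g x) - (LINT x|lborel. f x * g x)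
   - (LINT x|lborel. dderiv h f x * g x)) \<le> C * (norm h)\<^sup>2"
proof -
 obtain C R where C: "C \<ge> 0" "\<And>x h. cmod (f (x + h) - f x - dderiv h f x) \<le> C * (norm h)\<^sup>2"
  and R: "\<And>x h. norm h \<le> 1 ==> norm x > R ==> f (x + h) - f x - dderiv h f x = 0" using dderiv_remainder[OF f] by blast
 have "compact (g ` cball 0 R)" by (intro compact_continuous_image continuous_on_subset[OF g]) auto
 then have "bounded (g ` cball 0 R)" by (rule compact_imp_bounded)
 then obtain B where B0: "\<forall>y\<in>g ` cball 0 R. norm y \<le> B" unfolding bounded_iff by (rule exE)
 have B: "cmod (g x) \<le> \<bar>B\<bar>" if "norm x \<le> R" for x
 proof -
  have "g x \<in> g ` cball 0 R" using that by simp
  then have "cmod (g x) \<le> B" using B0 by (rule bspec[rotated])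
  then show ?thesis by linarith
 qed
 show ?thesis
 proof (intro exI[of _ "C * \<bar>B\<bar> * measure lborel (cball (0::'a) R)"] allI impI)
  fix h :: 'a assume h: "norm h \<le> 1"
  let ?r = "\<lambda>x. (f (x + h) - f x - dderiv h f x) * g x"
  have i: "integrable lborel (\<lambda>x. f (x + h) * g x)" "integrable lborel (\<lambda>x. f x * g x)"
   "integrable lborel (\<lambda>x. dderiv h f x * g x)" using integrable_cont_test(2)[OF g] test_translate(1)[OF f] f test_dderiv[OF f] by blast+
  have ir: "integrable lborel ?r" using Bochner_Integration.integrable_diff[OF Bochner_Integration.integrable_diff[OF i(1,2)] i(3)]
   by (simp add: algebra_simps)
  have "(LINT x|lborel. f (x + h) * g x) - (LINT x|lborel. f x * g x) - (LINT x|lborel. dderiv h f x * g x)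
    = (LINT x|lborel. ?r x)" using i by (simp add: left_diff_distrib)
  also have "cmod \<dots> \<le> (C * (norm h)\<^sup>2 * \<bar>B\<bar>) * measure lborel (cball (0::'a) R)"
  proof (rule integral_bounded_support[OF ir])
   show "?r x = 0" if "norm x > R" for x using R[OF h that] by simp
   show "cmod (?r x) \<le> C * (norm h)\<^sup>2 * \<bar>B\<bar>" for x
   proof (cases "norm x > R")
    case True
    then show ?thesis using R[OF h True] C(1) by simp
   next
    case False
    then show ?thesis unfolding norm_mult by (intro mult_mono C B) (use C in auto)
   qed
  qed
  finally show "cmod ((LINT x|lborel. f (x + h) * g x) - (LINT x|lborel. f x * g x) - (LINT x|lborel. dderiv h f x * g x))
    \<le> C * \<bar>B\<bar> * measure lborel (cball (0::'a) R) * (norm h)\<^sup>2" by (simp add: mult_ac)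
 qed
qed

text \<open>Reads off a vanishing first-order coefficient from an expansion known up to O(s^2); this
  is how integral identities are differentiated along translations.\<close>

lemma quadratic_bound_zero:
 fixes A :: complex
 assumes "\<And>s. 0 < s ==> s \<le> 1 ==> cmod (cor s * A) \<le> C * s\<^sup>2"
 shows "A = 0"
proof -
 have "cmod A \<le> C * inverse (real (Suc n))" for n
 proof -
  define s where "s = inverse (real (Suc n))"
  have s: "0 < s" "s \<le> 1" by (auto simp: s_def field_simps)
  have "s * cmod A \<le> s * (C * s)" using assms[OF s] s by (simp add: norm_mult power2_eq_square mult_ac)
  then have "cmod A \<le> C * s" using s(1) by simp
  then show ?thesis by (simp only: s_def)
 qed
 then have "cmod A \<le> C * 0" by (intro LIMSEQ_le_const[OF tendsto_mult[OF tendsto_const LIMSEQ_inverse_real_of_nat]]) auto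
 then show ?thesis by simp
qed

text \<open>Translation does not change the integral, so the first-order term of its expansion in
  the shift is zero.\<close>

lemma integral_pderiv_eq_0:
 assumes f: "f \<in> \<D> \<Omega>" and i: "i \<in> Basis"
 shows "(LINT x|lborel. pderivs [i] f x) = 0"
proof -
 obtain C where C: "\<forall>h. norm h \<le> 1 \<longrightarrow> cmod ((LINT x|lborel. f (x + h) * 1) - (LINT x|lborel. f x * 1)
   - (LINT x|lborel. dderiv h f x * 1)) \<le> C * (norm h)\<^sup>2" using integral_taylor[OF test_UNIV[OF f], of "\<lambda>x. 1"] by auto
 show ?thesis
 proof (rule quadratic_bound_zero)
  fix s :: real assume s: "0 < s" "s \<le> 1"
  have "(LINT x|lborel. f (x + s *\<^sub>R i)) = (LINT x|lborel. f x)" by (rule lborel_integral_translate[OF test_borel[OF f]])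
  then show "cmod (cor s * (LINT x|lborel. pderivs [i] f x)) \<le> C * s\<^sup>2"
   using C[rule_format, of "s *\<^sub>R i"] s i by (simp add: dderiv_Basis[OF i])
 qed
qed

lemma integration_by_parts:
 assumes f: "f \<in> \<D> \<Omega>" and g: "smooth g" and i: "i \<in> Basis"
 shows "(LINT x|lborel. pderivs [i] f x * g x) = - (LINT x|lborel. f x * pderivs [i] g x)"
proof -
 have i': "set [i] \<subseteq> Basis" using i by simp
 have t: "(\<lambda>x. g x * f x) \<in> \<D> \<Omega>" by (rule test_smooth_mult[OF g f])
 have "(LINT x|lborel. pderivs [i] (\<lambda>x. g x * f x) x) = 0" by (rule integral_pderiv_eq_0[OF t i])
 also have "(LINT x|lborel. pderivs [i] (\<lambda>x. g x * f x) x) =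
   (LINT x|lborel. g x * pderivs [i] f x + pderivs [i] g x * f x)" by (simp add: pderiv_mult[OF g test_smooth[OF f]])
 also have "\<dots> = (LINT x|lborel. g x * pderivs [i] f x) + (LINT x|lborel. pderivs [i] g x * f x)"
  by (intro Bochner_Integration.integral_add integrable_cont_test(1)[where \<Omega> = \<Omega>] smooth_continuous g smooth_pderivs[OF g i'] test_pderivs[OF f i'] f)
 finally show ?thesis by (simp add: mult.commute eq_neg_iff_add_eq_0)
qed

text \<open>Translation commutes with differentiation; differentiating
 \<open>\<integral> \<partial>\<^sub>j\<phi>(x + s i) \<psi>(x) dx = - \<integral> \<phi>(x + s i) \<partial>\<^sub>j\<psi>(x) dx\<close> in \<open>s\<close> avoids the symmetry of second derivatives.\<close>

lemma integral_mixed_pderivs: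
 assumes \<phi>: "\<phi> \<in> \<D> UNIV" and \<psi>: "\<psi> \<in> \<D> UNIV" and i: "i \<in> Basis" and j: "j \<in> Basis"
 shows "(LINT x|lborel. pderivs [i, j] \<phi> x * \<psi> x) = - (LINT x|lborel. pderivs [i] \<phi> x * pderivs [j] \<psi> x)"
proof -
 have ij: "set [i] \<subseteq> Basis" "set [j] \<subseteq> Basis" using i j by auto
 note c\<psi> = smooth_continuous[OF test_smooth[OF \<psi>], of UNIV]
  and cd\<psi> = smooth_continuous[OF test_smooth[OF test_pderivs[OF \<psi> ij(2)]], of UNIV]
 obtain C where C: "\<forall>h. norm h \<le> 1 \<longrightarrow> cmod ((LINT x|lborel. pderivs [j] \<phi> (x + h) * \<psi> x) - (LINT x|lborel. pderivs [j] \<phi> x * \<psi> x)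
   - (LINT x|lborel. dderiv h (pderivs [j] \<phi>) x * \<psi> x)) \<le> C * (norm h)\<^sup>2"
  using integral_taylor[OF test_pderivs[OF \<phi> ij(2)] c\<psi>] by blast
 obtain C' where C': "\<forall>h. norm h \<le> 1 \<longrightarrow> cmod ((LINT x|lborel. \<phi> (x + h) * pderivs [j] \<psi> x) - (LINT x|lborel. \<phi> x * pderivs [j] \<psi> x)
   - (LINT x|lborel. dderiv h \<phi> x * pderivs [j] \<psi> x)) \<le> C' * (norm h)\<^sup>2" using integral_taylor[OF \<phi> cd\<psi>] by blast
 let ?A = "LINT x|lborel. pderivs [i, j] \<phi> x * \<psi> x" and ?B = "LINT x|lborel. pderivs [i] \<phi> x * pderivs [j] \<psi> x"
 have "?A + ?B = 0"
 proof (rule quadratic_bound_zero)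
  fix s :: real assume s: "0 < s" "s \<le> 1"
  let ?h = "s *\<^sub>R i"
  have n: "norm ?h = s" using s i by simp
  have p1: "(LINT x|lborel. pderivs [j] \<phi> (x + ?h) * \<psi> x) = - (LINT x|lborel. \<phi> (x + ?h) * pderivs [j] \<psi> x)"
   using integration_by_parts[OF test_translate(1)[OF \<phi>, of ?h] test_smooth[OF \<psi>] j] by (simp add: test_translate(2)[OF \<phi> j])
  have p2: "(LINT x|lborel. pderivs [j] \<phi> x * \<psi> x) = - (LINT x|lborel. \<phi> x * pderivs [j] \<psi> x)"
   by (rule integration_by_parts[OF \<phi> test_smooth[OF \<psi>] j])
  have d1: "(LINT x|lborel. dderiv ?h (pderivs [j] \<phi>) x * \<psi> x) = cor s * ?A" by (simp add: dderiv_Basis[OF i] pderivs_pderivs mult.assoc)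
  have d2: "(LINT x|lborel. dderiv ?h \<phi> x * pderivs [j] \<psi> x) = cor s * ?B" by (simp add: dderiv_Basis[OF i] mult.assoc)
  have b1: "cmod (- (LINT x|lborel. \<phi> (x + ?h) * pderivs [j] \<psi> x) + (LINT x|lborel. \<phi> x * pderivs [j] \<psi> x) - cor s * ?A) \<le> C * s\<^sup>2"
   using C[rule_format, of ?h] s unfolding n p1 p2 d1 by simp
  have b2: "cmod ((LINT x|lborel. \<phi> (x + ?h) * pderivs [j] \<psi> x) - (LINT x|lborel. \<phi> x * pderivs [j] \<psi> x) - cor s * ?B) \<le> C' * s\<^sup>2"
   using C'[rule_format, of ?h] s unfolding n d2 by simp
  have "cor s * (?A + ?B) =
    - ((- (LINT x|lborel. \<phi> (x + ?h) * pderivs [j] \<psi> x) + (LINT x|lborel. \<phi> x * pderivs [j] \<psi> x) - cor s * ?A) +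
     ((LINT x|lborel. \<phi> (x + ?h) * pderivs [j] \<psi> x) - (LINT x|lborel. \<phi> x * pderivs [j] \<psi> x) - cor s * ?B))"
   by (simp add: algebra_simps)
  also have "cmod \<dots> \<le> C * s\<^sup>2 + C' * s\<^sup>2"
   unfolding norm_minus_cancel by (rule order_trans[OF norm_triangle_ineq add_mono[OF b1 b2]])
  finally show "cmod (cor s * (?A + ?B)) \<le> (C + C') * s\<^sup>2" by (simp add: distrib_right)
 qed
 then show ?thesis by (simp add: eq_neg_iff_add_eq_0)
qed

text \<open>Read together, the two formulas are the weak symmetry of mixed second
  derivatives.\<close>

lemma integral_second_pderivs:
 assumes f: "f \<in> \<D> UNIV" and g: "g \<in> \<D> UNIV" and i: "i \<in> Basis" and j: "j \<in> Basis"
 shows "(LINT x|lborel. pderivs [i, j] f x * g x) = (LINT x|lborel. f x * pderivs [i, j] g x)"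
  and "(LINT x|lborel. pderivs [i, j] f x * g x) = (LINT x|lborel. f x * pderivs [j, i] g x)"
proof -
 have j': "set [j] \<subseteq> Basis" and i': "set [i] \<subseteq> Basis" using i j by auto
 show "(LINT x|lborel. pderivs [i, j] f x * g x) = (LINT x|lborel. f x * pderivs [i, j] g x)"
  using integral_mixed_pderivs[OF f g i j] integration_by_parts[OF f smooth_pderivs[OF test_smooth[OF g] j'] i] by (simp add: pderivs_pderivs)
 have "(LINT x|lborel. pderivs [i, j] f x * g x) = - (LINT x|lborel. pderivs [j] f x * pderivs [i] g x)"
  using integration_by_parts[OF test_pderivs[OF f j'] test_smooth[OF g] i] by (simp add: pderivs_pderivs)
 also have "\<dots> = (LINT x|lborel. f x * pderivs [j, i] g x)"
  using integration_by_parts[OF f smooth_pderivs[OF test_smooth[OF g] i'] j] by (simp add: pderivs_pderivs)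
 finally show "(LINT x|lborel. pderivs [i, j] f x * g x) = (LINT x|lborel. f x * pderivs [j, i] g x)" .
qed

lemma integral_laplacian:
 assumes "f \<in> \<D> UNIV" "g \<in> \<D> UNIV"
 shows "(LINT x|lborel. laplacian f x * g x) = (LINT x|lborel. f x * laplacian g x)"
proof -
 have i2: "set [i, i] \<subseteq> Basis" if "i \<in> Basis" for i :: 'a using that by simp
 have "(LINT x|lborel. laplacian f x * g x) = (\<Sum>i\<in>Basis. LINT x|lborel. pderivs [i, i] f x * g x)" unfolding laplacian_def sum_distrib_right
  by (intro Bochner_Integration.integral_sum test_mult_integrable[OF test_pderivs[OF assms(1) i2] assms(2)])
 also have "\<dots> = (\<Sum>i\<in>Basis. LINT x|lborel. f x * pderivs [i, i] g x)" by (intro sum.cong refl integral_second_pderivs(1) assms)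
 also have "\<dots> = (LINT x|lborel. f x * laplacian g x)" unfolding laplacian_def sum_distrib_left
  by (intro Bochner_Integration.integral_sum[symmetric] test_mult_integrable[OF assms(1) test_pderivs[OF assms(2) i2]])
 finally show ?thesis .
qed

lemma ip_laplacian:
 assumes "f \<in> \<D> UNIV"
 shows "ip lborel (laplacian f) f = - cor (\<Sum>i\<in>Basis. (lnorm (pderivs [i] f))\<^sup>2)"
proof -
 note g = test_cnj[OF assms]
 have i2: "set [i, i] \<subseteq> Basis" "set [i] \<subseteq> Basis" if "i \<in> Basis" for i :: 'a using that by auto
 have "ip lborel (laplacian f) f = (\<Sum>i\<in>Basis. LINT x|lborel. pderivs [i, i] f x * cnj (f x))"
  unfolding laplacian_def ip_def sum_distrib_right by (intro Bochner_Integration.integral_sum test_mult_integrable[OF test_pderivs[OF assms i2(1)] g])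
 also have "\<dots> = (\<Sum>i\<in>Basis. - ip lborel (pderivs [i] f) (pderivs [i] f))"
 proof (intro sum.cong refl)
  fix i :: 'a assume i: "i \<in> Basis"
  show "(LINT x|lborel. pderivs [i, i] f x * cnj (f x)) = - ip lborel (pderivs [i] f) (pderivs [i] f)"
   using integral_mixed_pderivs[OF assms g i i] by (simp add: ip_def pderivs_test_cnj[OF assms i2(2)[OF i]])
 qed
 finally show ?thesis by (simp add: ip_self sum_negf)
qed

text \<open>Two integrations by parts turn the inner product of the i-th and j-th pure second
  derivatives into the squared norm of the mixed one. So for test functions the Laplacian bounds
  every second derivative, with constant 1.\<close>

lemma norm_laplacian:
 assumes "f \<in> \<D> UNIV"
 shows "(lnorm (laplacian f))\<^sup>2 = (\<Sum>i\<in>Basis. \<Sum>j\<in>Basis. (lnorm (pderivs [i, j] f))\<^sup>2)"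
proof -
 note g = test_cnj[OF assms]
 let ?g = "\<lambda>x. cnj (f x)"
 have b: "set [i, j] \<subseteq> Basis" "set [i] \<subseteq> Basis" if "i \<in> Basis" "j \<in> Basis" for i j :: 'a using that by auto
 have t: "pderivs [i, j] f \<in> L2 lborel" if "i \<in> Basis" "j \<in> Basis" for i j by (rule test_L2[OF test_pderivs[OF assms b(1)[OF that]]])
 have "ip lborel (laplacian f) (laplacian f) = (\<Sum>i\<in>Basis. ip lborel (pderivs [i, i] f) (laplacian f))"
  using ip_sum_left[of Basis "\<lambda>i. pderivs [i, i] f" lborel "laplacian f"] t test_L2[OF test_laplacian[OF assms]]
  by (simp add: laplacian_def[abs_def])
 also have "\<dots> = (\<Sum>i\<in>Basis. \<Sum>j\<in>Basis. ip lborel (pderivs [i, i] f) (pderivs [j, j] f))"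
 proof (intro sum.cong refl)
  fix i :: 'a assume i: "i \<in> Basis"
  have "ip lborel (laplacian f) (pderivs [i, i] f) = (\<Sum>j\<in>Basis. ip lborel (pderivs [j, j] f) (pderivs [i, i] f))"
   using ip_sum_left[of Basis "\<lambda>j. pderivs [j, j] f" lborel "pderivs [i, i] f"] t i by (simp add: laplacian_def[abs_def])
  then have "cnj (ip lborel (laplacian f) (pderivs [i, i] f)) = (\<Sum>j\<in>Basis. cnj (ip lborel (pderivs [j, j] f) (pderivs [i, i] f)))" by simp
  then show "ip lborel (pderivs [i, i] f) (laplacian f) = (\<Sum>j\<in>Basis. ip lborel (pderivs [i, i] f) (pderivs [j, j] f))" by (simp only: ip_cnj)
 qed
 also have "\<dots> = (\<Sum>i\<in>Basis. \<Sum>j\<in>Basis. ip lborel (pderivs [i, j] f) (pderivs [i, j] f))"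
 proof (intro sum.cong refl)
  fix i j :: 'a assume i: "i \<in> Basis" and j: "j \<in> Basis"
  have p: "pderivs vs ?g x = cnj (pderivs vs f x)" if "set vs \<subseteq> Basis" for vs x using pderivs_test_cnj[OF assms that] by simp
  have app: "pderivs [i] (pderivs [j, j] ?g) = pderivs [i, j] (pderivs [j] ?g)"
   "pderivs [j] (pderivs [i, j] ?g) = pderivs [j, i] (pderivs [j] ?g)" by (simp_all add: pderivs.simps)
  have "ip lborel (pderivs [i, i] f) (pderivs [j, j] f) = (LINT x|lborel. pderivs [i] (pderivs [i] f) x * pderivs [j, j] ?g x)"
   using i j by (simp add: ip_def p pderivs_pderivs)
  also have "\<dots> = - (LINT x|lborel. pderivs [i] f x * pderivs [i] (pderivs [j, j] ?g) x)"
   using i j by (intro integration_by_parts[of _ UNIV] test_pderivs assms smooth_pderivs test_smooth[OF g]) auto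
  also have "\<dots> = - (LINT x|lborel. pderivs [i] f x * pderivs [i, j] (pderivs [j] ?g) x)" unfolding app ..
  \<comment> \<open>The order of the mixed derivatives is exchanged only under the integral, by
    their weak symmetry.\<close>
  also have "(LINT x|lborel. pderivs [i] f x * pderivs [i, j] (pderivs [j] ?g) x) =
    (LINT x|lborel. pderivs [i] f x * pderivs [j, i] (pderivs [j] ?g) x)"
   using integral_second_pderivs[of "pderivs [i] f" "pderivs [j] ?g" i j] i j assms g by (simp add: test_pderivs)
  also have "- \<dots> = - (LINT x|lborel. pderivs [i] f x * pderivs [j] (pderivs [i, j] ?g) x)" unfolding app ..
  also have "\<dots> = (LINT x|lborel. pderivs [i, j] f x * pderivs [i, j] ?g x)"
   using integral_mixed_pderivs[OF assms test_pderivs[OF g, of "[i, j]"] i j] i j by simp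
  also have "\<dots> = ip lborel (pderivs [i, j] f) (pderivs [i, j] f)" using i j by (simp add: ip_def p)
  finally show "ip lborel (pderivs [i, i] f) (pderivs [j, j] f) = ip lborel (pderivs [i, j] f) (pderivs [i, j] f)" .
 qed
 finally have "cor ((lnorm (laplacian f))\<^sup>2) =
   cor (\<Sum>i\<in>Basis. \<Sum>j\<in>Basis. (lnorm (pderivs [i, j] f))\<^sup>2)" by (simp add: ip_self)
 then show ?thesis by (simp only: of_real_eq_iff)
qed

lemma norm_mixed_pderivs_le:
 assumes "p \<in> \<D> UNIV" "i \<in> Basis" "j \<in> Basis"
 shows "lnorm (pderivs [i, j] p) \<le> lnorm (laplacian p)"
proof (rule power2_le_imp_le)
 have "(lnorm (pderivs [i, j] p))\<^sup>2 \<le> (\<Sum>j\<in>Basis. (lnorm (pderivs [i, j] p))\<^sup>2)" using assms by (intro member_le_sum) auto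
 also have "\<dots> \<le> (\<Sum>i\<in>Basis. \<Sum>j\<in>Basis. (lnorm (pderivs [i, j] p))\<^sup>2)"
  using assms by (intro member_le_sum[where f = "\<lambda>i. \<Sum>j\<in>Basis. (lnorm (pderivs [i, j] p))\<^sup>2"] sum_nonneg) auto
 finally show "(lnorm (pderivs [i, j] p))\<^sup>2 \<le> (lnorm (laplacian p))\<^sup>2" by (simp add: norm_laplacian[OF assms(1)])
qed simp

section \<open>Gradient interpolation, translations and the Poincare inequality\<close>

definition grad_norm :: "('a::euclidean_space => complex) => real" where
 "grad_norm \<phi> = (\<Sum>i\<in>Basis. lnorm (pderivs [i] \<phi>))"

lemma grad_norm_nonneg [simp]: "0 \<le> grad_norm f" by (simp add: grad_norm_def sum_nonneg)

lemma norm_pderiv_le_grad_norm: "i \<in> Basis ==> lnorm (pderivs [i] f) \<le> grad_norm f" unfolding grad_norm_def by (intro member_le_sum) auto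

text \<open>Green's identity and Cauchy-Schwarz bound the sum of the squared norms of the partial
  derivatives; the dimension enters in passing to the square of their sum.\<close>

lemma grad_norm_square_le:
 fixes f :: "'a::euclidean_space => complex"
 assumes "f \<in> \<D> UNIV"
 shows "(grad_norm f)\<^sup>2 \<le> real DIM('a) * (lnorm f * lnorm (laplacian f))"
proof -
 have "(grad_norm f)\<^sup>2 \<le> (\<Sum>i\<in>Basis. (lnorm (pderivs [i] f))\<^sup>2) * real DIM('a)"
  unfolding grad_norm_def by (rule sum_squared_le_sum_of_squares)
 also have "(\<Sum>i\<in>Basis. (lnorm (pderivs [i] f))\<^sup>2) = cmod (ip lborel (laplacian f) f)"
  unfolding ip_laplacian[OF assms] norm_minus_cancel norm_of_real by (simp add: sum_nonneg)
 also have "\<dots> * real DIM('a) \<le> (lnorm (laplacian f) * lnorm f) * real DIM('a)"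
  by (intro mult_right_mono L2_Cauchy_Schwarz test_L2[OF assms] test_L2[OF test_laplacian[OF assms]]) auto
 finally show ?thesis by (simp add: mult_ac)
qed

lemma norm_dderiv_le:
 assumes "f \<in> \<D> UNIV"
 shows "lnorm (dderiv h f) \<le> norm h * grad_norm f"
proof -
 have "lnorm (dderiv h f) \<le> (\<Sum>i\<in>Basis. lnorm (\<lambda>x. cor (h \<bullet> i) * pderivs [i] f x))" unfolding dderiv_def[abs_def]
  by (intro L2_norm_sum L2_scale test_L2[OF test_pderivs[OF assms]]) auto
 also have "\<dots> \<le> (\<Sum>i\<in>Basis. norm h * lnorm (pderivs [i] f))"
  unfolding L2_norm_scale by (intro sum_mono mult_right_mono) (auto simp: Basis_le_norm)
 also have "\<dots> = norm h * grad_norm f" by (simp add: grad_norm_def sum_distrib_left)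
 finally show ?thesis .
qed

text \<open>The difference quotients of step \<open>h/n\<close> add up, so the estimate follows from its infinitesimal version.\<close>

lemma norm_translate_diff_le:
 fixes f :: "'a::euclidean_space => complex"
 assumes f: "f \<in> \<D> UNIV"
 shows "lnorm (\<lambda>x. f (x + h) - f x) \<le> norm h * grad_norm f"
proof -
 obtain C R where C: "C \<ge> 0" "\<And>x h. cmod (f (x + h) - f x - dderiv h f x) \<le> C * (norm h)\<^sup>2"
  and R: "\<And>x h. norm h \<le> 1 ==> norm x > R ==> f (x + h) - f x - dderiv h f x = 0" using dderiv_remainder[OF f] by blast
 define c where "c = C * sqrt (measure lborel (cball (0::'a) R))"
 have tL: "(\<lambda>x. f (x + k)) \<in> L2 lborel" for k by (rule test_L2[OF test_translate(1)[OF f]])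
 have fL: "f \<in> L2 lborel" by (rule test_L2[OF f])
 have dL: "dderiv k f \<in> L2 lborel" for k by (rule test_L2[OF test_dderiv[OF f]])
 have small: "lnorm (\<lambda>x. f (x + k) - f x) \<le> norm k * grad_norm f + c * (norm k)\<^sup>2" if k: "norm k \<le> 1" for k
 proof -
  let ?r = "\<lambda>x. f (x + k) - f x - dderiv k f x"
  have rm: "?r \<in> borel_measurable borel" using L2_measurable[OF L2_diff[OF L2_diff[OF tL fL] dL], of k k] by simp
  have "lnorm ?r \<le> (C * (norm k)\<^sup>2) * sqrt (measure lborel (cball (0::'a) R))" by (rule L2_norm_bounded_support(2)[OF rm C(2) R[OF k]])
  moreover have "lnorm (\<lambda>x. ?r x + dderiv k f x) \<le> lnorm ?r + lnorm (dderiv k f)" by (intro L2_norm_triangle L2_diff tL fL dL)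
  ultimately show ?thesis using norm_dderiv_le[OF f, of k] by (simp add: c_def mult_ac)
 qed
 have tele: "lnorm (\<lambda>x. f (x + real m *\<^sub>R k) - f x) \<le> real m * lnorm (\<lambda>x. f (x + k) - f x)" for m k
 proof (induction m)
  case (Suc m)
  let ?d = "\<lambda>x. f (x + k) - f x"
  have "lnorm (\<lambda>x. f (x + real (Suc m) *\<^sub>R k) - f x) \<le>
    lnorm (\<lambda>x. f (x + real (Suc m) *\<^sub>R k) - f (x + real m *\<^sub>R k)) + lnorm (\<lambda>x. f (x + real m *\<^sub>R k) - f x)"
   by (rule L2_norm_dist_triangle[OF tL tL fL])
  also have "(\<lambda>x. f (x + real (Suc m) *\<^sub>R k) - f (x + real m *\<^sub>R k)) = (\<lambda>x. ?d (x + real m *\<^sub>R k))"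
   by (auto simp: algebra_simps)
  also have "lnorm \<dots> = lnorm ?d" by (rule L2_norm_translate) (use L2_measurable[OF L2_diff[OF tL fL]] in simp)
  finally show ?case using Suc by (simp add: distrib_right)
 qed simp
 have "lnorm (\<lambda>x. f (x + h) - f x) \<le> norm h * grad_norm f + c * (norm h)\<^sup>2 * inverse (real (Suc n))"
  if n: "norm h \<le> real (Suc n)" for n
 proof -
  define N where "N = real (Suc n)"
  have N: "N > 0" "norm h \<le> N" using n by (auto simp: N_def)
  let ?k = "inverse N *\<^sub>R h"
  have k1: "norm ?k \<le> 1" using N by (simp add: field_simps)
  have "lnorm (\<lambda>x. f (x + N *\<^sub>R ?k) - f x) \<le> N * lnorm (\<lambda>x. f (x + ?k) - f x)" unfolding N_def by (rule tele)
  also have "\<dots> \<le> N * (norm ?k * grad_norm f + c * (norm ?k)\<^sup>2)" using small[OF k1] N by (intro mult_left_mono) auto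
  also have "\<dots> = norm h * grad_norm f + c * (norm h)\<^sup>2 * inverse N" using N by (simp add: field_simps power2_eq_square)
  finally show ?thesis using N by (simp add: N_def)
 qed
 note le = this
 obtain n0 where n0: "norm h \<le> real n0" using real_arch_simple by blast
 have "\<forall>n\<ge>n0. lnorm (\<lambda>x. f (x + h) - f x) \<le> norm h * grad_norm f + c * (norm h)\<^sup>2 * inverse (real (Suc n))"
  using n0 by (intro allI impI le) simp
 then have "\<exists>n0. \<forall>n\<ge>n0. lnorm (\<lambda>x. f (x + h) - f x) \<le> norm h * grad_norm f + c * (norm h)\<^sup>2 * inverse (real (Suc n))" ..
 moreover have "(\<lambda>n. norm h * grad_norm f + c * (norm h)\<^sup>2 * inverse (real (Suc n))) \<longlonglongrightarrow> norm h * grad_norm f + c * (norm h)\<^sup>2 * 0"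
  by (intro tendsto_intros LIMSEQ_inverse_real_of_nat)
 ultimately have "lnorm (\<lambda>x. f (x + h) - f x) \<le> norm h * grad_norm f + c * (norm h)\<^sup>2 * 0" by (intro LIMSEQ_le_const)
 then show ?thesis by simp
qed

text \<open>A shift by 2 R + 1 moves the ball carrying f off itself. Then f and its translate are
  orthogonal, their distance has square twice that of the norm of f, and the translation estimate
  bounds this distance by the gradient.\<close>

lemma Poincare:
 fixes f :: "'a::euclidean_space => complex"
 assumes f: "f \<in> \<D> UNIV" and R: "R \<ge> 0" "\<And>x. norm x > R ==> f x = 0"
 shows "lnorm f \<le> (2 * R + 1) * grad_norm f"
proof -
 obtain b :: 'a where b: "b \<in> Basis" using nonempty_Basis by blast
 define h where "h = (2 * R + 1) *\<^sub>R b"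
 have h: "norm h = 2 * R + 1" using b R by (simp add: h_def)
 have tL: "(\<lambda>x. f (x + h)) \<in> L2 lborel" by (rule test_L2[OF test_translate(1)[OF f]])
 have fL: "f \<in> L2 lborel" by (rule test_L2[OF f])
 have "f (x + h) * cnj (f x) = 0" for x
 proof (cases "norm x > R")
  case False
  then have "norm (x + h) > R" using h norm_diff_ineq[of h x] by (simp add: add.commute)
  then show ?thesis using R by simp
 qed (use R in simp)
 then have "(\<lambda>x. f (x + h) * cnj (f x)) = (\<lambda>x. 0)" by (rule ext)
 then have "ip lborel (\<lambda>x. f (x + h)) f = 0" by (simp only: ip_def Bochner_Integration.integral_zero)
 then have "(lnorm (\<lambda>x. f (x + h) - f x))\<^sup>2 = (lnorm f)\<^sup>2 + (lnorm f)\<^sup>2"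
  using L2_norm_diff_square[OF tL fL] L2_norm_translate[OF test_borel[OF f]] by simp
 then have "(lnorm f)\<^sup>2 \<le> (lnorm (\<lambda>x. f (x + h) - f x))\<^sup>2" by simp
 then have "lnorm f \<le> lnorm (\<lambda>x. f (x + h) - f x)" by (rule power2_le_imp_le) simp
 also have "\<dots> \<le> norm h * grad_norm f" by (rule norm_translate_diff_le[OF f])
 finally show ?thesis by (simp add: h)
qed

text \<open>Inserting the Poincare inequality into the gradient interpolation lets one factor
  \<open>grad_norm f\<close> cancel.\<close>

lemma test_norms_le_laplacian:
 fixes R :: real
 assumes R: "R \<ge> 0"
 obtains C where "C > 0" "\<And>f :: 'a::euclidean_space => complex. f \<in> \<D> UNIV ==> (\<And>x. norm x > R ==> f x = 0) ==>
  grad_norm f \<le> C * lnorm (laplacian f) \<and> lnorm f \<le> C * lnorm (laplacian f)"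
proof -
 define d where "d = real DIM('a)"
 have d: "d \<ge> 1" by (simp add: d_def DIM_positive Suc_leI)
 define r where "r = 2 * R + 1"
 have r: "r \<ge> 1" using R by (simp add: r_def)
 define C where "C = d * r * r"
 have C0: "C > 0" using d r by (simp add: C_def)
 have "grad_norm f \<le> C * lnorm (laplacian f) \<and> lnorm f \<le> C * lnorm (laplacian f)"
  if f: "f \<in> \<D> UNIV" and 0: "\<And>x. norm x > R ==> f x = 0" for f :: "'a => complex"
 proof -
  let ?L = "lnorm (laplacian f)" and ?g = "grad_norm f"
  have P: "lnorm f \<le> r * ?g" using Poincare[OF f R 0] by (simp add: r_def)
  have "?g\<^sup>2 \<le> d * (lnorm f * ?L)" using grad_norm_square_le[OF f] by (simp add: d_def)
  also have "\<dots> \<le> d * ((r * ?g) * ?L)" using P d by (intro mult_left_mono mult_right_mono) auto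
  finally have "?g * ?g \<le> (d * r * ?L) * ?g" by (simp add: power2_eq_square mult_ac)
  then have g: "?g \<le> d * r * ?L"
  proof (cases "?g = 0")
   case True
   then show ?thesis using d r by simp
  next
   case False
   then have "?g > 0" using grad_norm_nonneg[of f] by linarith
   then show ?thesis using \<open>?g * ?g \<le> (d * r * ?L) * ?g\<close> by (rule mult_right_le_imp_le[rotated])
  qed
  have "d * r * ?L \<le> (d * r * ?L) * r" using d r by (intro mult_left_mono[of 1 r, simplified]) auto
  then have "?g \<le> C * ?L" using g by (simp add: C_def mult_ac)
  moreover have "lnorm f \<le> C * ?L"
  proof -
   have "r * ?g \<le> r * (d * r * ?L)" using g r by (intro mult_left_mono) auto
   then show ?thesis using P by (simp add: C_def mult_ac)
  qed
  ultimately show ?thesis by blast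
 qed
 then show ?thesis using that C0 by blast
qed

section \<open>Convolution with test functions\<close>

definition conv :: "('a::euclidean_space => complex) => ('a => complex) => 'a => complex" where
 "conv \<rho> u x = (LINT y|lborel. \<rho> (x - y) * u y)"

lemma test_times_integrable:
 assumes "f \<in> \<D> \<Omega>" "integrable lborel u"
 shows "integrable lborel (\<lambda>y. f (x - y) * u y)"
proof -
 obtain C where C: "C \<ge> 0" "\<And>x. cmod (f x) \<le> C" using test_bounded[OF assms(1)] by blast
 show ?thesis
 proof (rule Bochner_Integration.integrable_bound)
  show "integrable lborel (\<lambda>y. C * cmod (u y))" using assms(2) by simp
  have "(\<lambda>y. f (x - y)) \<in> borel_measurable borel" by (rule measurable_compose[OF _ test_borel[OF assms(1)]]) simp
  then show "(\<lambda>y. f (x - y) * u y) \<in> borel_measurable lborel" using borel_measurable_integrable[OF assms(2)] by simp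
  show "AE y in lborel. norm (f (x - y) * u y) \<le> norm (C * cmod (u y))" using C by (auto simp: norm_mult abs_mult intro!: mult_right_mono)
 qed
qed

text \<open>The Taylor remainder of the test function is quadratic uniformly in the base point, so
  integrating it against |u| keeps it quadratic in h.\<close>

lemma conv_has_derivative:
 assumes r: "r \<in> \<D> UNIV" and u: "integrable lborel u"
 shows "(conv r u has_derivative (\<lambda>h. \<Sum>i\<in>Basis. (h \<bullet> i) *\<^sub>R conv (pderivs [i] r) u x)) (at x)"
proof -
 obtain C where C: "C \<ge> 0" "\<And>x h. cmod (r (x + h) - r x - dderiv h r x) \<le> C * (norm h)\<^sup>2" using test_taylor[OF r] by blast
 define c where "c = (LINT y|lborel. C * cmod (u y))"
 let ?D = "\<lambda>h. \<Sum>i\<in>Basis. (h \<bullet> i) *\<^sub>R conv (pderivs [i] r) u x"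
 have i: "integrable lborel (\<lambda>y. pderivs [i] r (x - y) * u y)" if "i \<in> Basis" for i
  by (rule test_times_integrable[OF test_pderivs[OF r] u]) (use that in auto)
 have "?D h = (LINT y|lborel. dderiv h r (x - y) * u y)" for h
 proof -
  have "(LINT y|lborel. dderiv h r (x - y) * u y) =
    (LINT y|lborel. (\<Sum>i\<in>Basis. cor (h \<bullet> i) * (pderivs [i] r (x - y) * u y)))" by (simp add: dderiv_def sum_distrib_right mult.assoc)
  also have "\<dots> = (\<Sum>i\<in>Basis. LINT y|lborel. cor (h \<bullet> i) * (pderivs [i] r (x - y) * u y))"
   by (rule Bochner_Integration.integral_sum) (use i in auto)
  finally show ?thesis by (simp add: conv_def scaleR_conv_of_real)
 qed
 note D = this
 have bound: "norm (conv r u (x + h) - conv r u x - ?D h) \<le> c * (norm h)\<^sup>2" for h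
 proof -
  have ii: "integrable lborel (\<lambda>y. r (x + h - y) * u y)" "integrable lborel (\<lambda>y. r (x - y) * u y)"
   "integrable lborel (\<lambda>y. dderiv h r (x - y) * u y)" by (rule test_times_integrable[OF _ u], rule r test_dderiv[OF r])+
  have "conv r u (x + h) - conv r u x - ?D h =
    (LINT y|lborel. r (x + h - y) * u y - r (x - y) * u y - dderiv h r (x - y) * u y)" unfolding D using ii by (simp add: conv_def)
  also have "norm \<dots> \<le> (LINT y|lborel. (C * cmod (u y)) * (norm h)\<^sup>2)"
  proof (rule Bochner_Integration.integral_norm_bound_integral)
   show "integrable lborel (\<lambda>y. r (x + h - y) * u y - r (x - y) * u y - dderiv h r (x - y) * u y)"
    by (intro Bochner_Integration.integrable_diff ii)
   show "integrable lborel (\<lambda>y. (C * cmod (u y)) * (norm h)\<^sup>2)" using u by simp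
   fix y
   have "r (x + h - y) * u y - r (x - y) * u y - dderiv h r (x - y) * u y =
     (r ((x - y) + h) - r (x - y) - dderiv h r (x - y)) * u y" by (simp add: algebra_simps)
   also have "norm \<dots> \<le> (C * (norm h)\<^sup>2) * norm (u y)" unfolding norm_mult by (intro mult_right_mono C(2)) auto
   finally show "norm (r (x + h - y) * u y - r (x - y) * u y - dderiv h r (x - y) * u y) \<le> C * cmod (u y) * (norm h)\<^sup>2"
    by (simp add: mult_ac)
  qed
  also have "\<dots> = c * (norm h)\<^sup>2" unfolding c_def by simp
  finally show ?thesis .
 qed
 show ?thesis unfolding has_derivative_at
 proof
  show "bounded_linear ?D" by (intro bounded_linear_sum bounded_linear_scaleR_left[THEN bounded_linear_compose] bounded_linear_inner_left)
  show "(\<lambda>h. norm (conv r u (x + h) - conv r u x - ?D h) / norm h) \<midarrow>0\<rightarrow> 0"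
  proof (rule Lim_null_comparison)
   have "norm (norm (conv r u (x + h) - conv r u x - ?D h) / norm h) \<le> c * norm h" for h
    using bound[of h] by (cases "h = 0") (simp_all add: divide_simps power2_eq_square)
   then show "\<forall>\<^sub>F h in at 0. norm (norm (conv r u (x + h) - conv r u x - ?D h) / norm h) \<le> c * norm h"
    by (intro always_eventually allI)
   show "(\<lambda>h::'a. c * norm h) \<midarrow>0\<rightarrow> 0" by (intro tendsto_mult_right_zero tendsto_norm_zero tendsto_ident_at)
  qed
 qed
qed

lemma pderiv_conv:
 assumes "r \<in> \<D> UNIV" "integrable lborel u" "i \<in> Basis"
 shows "pderivs [i] (conv r u) = conv (pderivs [i] r) u"
proof
 fix x
 have "pderivs [i] (conv r u) x = (\<Sum>j\<in>Basis. (i \<bullet> j) *\<^sub>R conv (pderivs [j] r) u x)"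
  by (rule pderivs_has_derivative[OF conv_has_derivative[OF assms(1,2)]])
 also have "\<dots> = (\<Sum>j\<in>Basis. if j = i then conv (pderivs [i] r) u x else 0)"
  by (intro sum.cong refl) (use assms(3) in \<open>auto simp: inner_Basis\<close>)
 finally show "pderivs [i] (conv r u) x = conv (pderivs [i] r) u x" using assms(3) by simp
qed

lemma smooth_conv:
 assumes "s \<in> \<D> UNIV" "integrable lborel u"
 shows "smooth (conv s u)"
proof (rule smooth_coinduct[where P = "\<lambda>f. \<exists>s\<in>\<D> UNIV. f = conv s u"])
 show "f differentiable (at x)" if f: "\<exists>s\<in>\<D> UNIV. f = conv s u" for f x
 proof -
  obtain s where r: "s \<in> \<D> UNIV" "f = conv s u" using f by (rule bexE)
  show ?thesis unfolding r(2) by (rule differentiableI[OF conv_has_derivative[OF r(1) assms(2)]])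
 qed
 show "\<exists>s\<in>\<D> UNIV. pderivs [i] f = conv s u" if f: "\<exists>s\<in>\<D> UNIV. f = conv s u" and i: "i \<in> Basis" for f i
 proof -
  obtain s where r: "s \<in> \<D> UNIV" "f = conv s u" using f by (rule bexE)
  show ?thesis unfolding r(2) pderiv_conv[OF r(1) assms(2) i] by (rule bexI[OF refl test_pderivs[OF r(1)]]) (use i in simp)
 qed
 show "\<exists>s'\<in>\<D> UNIV. conv s u = conv s' u" by (rule bexI[OF refl assms(1)])
qed

lemma conv_test:
 fixes s u :: "'a::euclidean_space => complex"
 assumes s: "s \<in> \<D> UNIV" and u: "integrable lborel u"
  and supp: "\<And>x. norm x > r ==> s x = 0" "\<And>x. norm x > R ==> u x = 0"
 shows "conv s u \<in> \<D> UNIV" "\<And>x. norm x > R + r ==> conv s u x = 0"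
proof -
 show z: "conv s u x = 0" if x: "norm x > R + r" for x
 proof -
  have "s (x - y) * u y = 0" for y
  proof (cases "norm y > R")
   case False
   then have "norm (x - y) > r" using x norm_triangle_ineq2[of x y] by linarith
   then show ?thesis using supp(1) by simp
  qed (use supp in simp)
  then have "(\<lambda>y. s (x - y) * u y) = (\<lambda>y. 0)" by (rule ext)
  then show ?thesis by (simp only: conv_def Bochner_Integration.integral_zero)
 qed
 show "conv s u \<in> \<D> UNIV" by (rule test_functionsI[OF smooth_conv[OF s u], of "cball 0 (R + r)"]) (use z in auto)
qed

section \<open>Averaging and mollification in L2\<close>

lemma conv_swap:
 assumes "r \<in> borel_measurable borel" "u \<in> borel_measurable borel"
 shows "conv r u x = (LINT y|lborel. r y * u (x - y))"
proof -
 have "(LINT y|lborel. r y * u (x - y)) = integral\<^sup>L (distr lborel borel (\<lambda>y. x - y)) (\<lambda>y. r y * u (x - y))"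
  by (simp add: lborel_distr_reflect)
 also have "\<dots> = (LINT y|lborel. r (x - y) * u (x - (x - y)))" by (rule integral_distr) (use assms in measurable)
 finally show ?thesis by (simp add: conv_def)
qed

lemma lborel_translate_reflect_nn_integral:
 assumes "f \<in> borel_measurable borel"
 shows "(\<integral>\<^sup>+x. f (x - y) \<partial>lborel) = (\<integral>\<^sup>+x. f x \<partial>lborel)"
 using lborel_nn_integral_translate[OF assms, of "- y"] by simp

text \<open>A Minkowski inequality for averages: Cauchy-Schwarz with the weight split as sqrt k
  times sqrt k bounds the square of the average by the average of the squares, and Tonelli's theorem
  exchanges the integrals. Slices are bounded only where the weight lives, since translation
  differences are small only for small shifts.\<close>

lemma averaging_L2:
 fixes k :: "'a::euclidean_space => real" and F :: "'a \<times> 'a => complex"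
 assumes k[measurable]: "k \<in> borel_measurable borel" and k0: "\<And>y. 0 \<le> k y"
  and k1: "(\<integral>\<^sup>+y. ennreal (k y) \<partial>lborel) = 1"
  and F[measurable]: "F \<in> borel_measurable (borel \<Otimes>\<^sub>M borel)"
  and A: "0 \<le> A" "\<And>y. k y \<noteq> 0 ==> (\<integral>\<^sup>+x. ennreal ((cmod (F (x, y)))\<^sup>2) \<partial>lborel) \<le> ennreal (A\<^sup>2)"
 shows "(\<lambda>x. LINT y|lborel. cor (k y) * F (x, y)) \<in> L2 lborel"
  and "lnorm (\<lambda>x. LINT y|lborel. cor (k y) * F (x, y)) \<le> A"
proof -
 let ?g = "\<lambda>x. LINT y|lborel. cor (k y) * F (x, y)"
 have pair: "sets (lborel \<Otimes>\<^sub>M lborel) = sets (borel \<Otimes>\<^sub>M (borel :: 'a measure))" by (rule sets_pair_measure_cong) auto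
 have F'[measurable]: "F \<in> borel_measurable (lborel \<Otimes>\<^sub>M lborel)" using F by (simp add: measurable_cong_sets[OF pair refl])
 have k'[measurable]: "k \<in> borel_measurable lborel" using k by simp
 have g[measurable]: "?g \<in> borel_measurable lborel" by (rule lborel.borel_measurable_lebesgue_integral) simp
 have le: "ennreal ((cmod (?g x))\<^sup>2) \<le> (\<integral>\<^sup>+y. ennreal (k y) * ennreal ((cmod (F (x, y)))\<^sup>2) \<partial>lborel)" for x
 \<comment> \<open>Where the slice is not integrable, the Bochner integral is 0 by convention and
   the bound is trivial.\<close>
 proof (cases "integrable lborel (\<lambda>y. cor (k y) * F (x, y))")
  case False
  then show ?thesis by (simp add: not_integrable_integral_eq)
 next
  case True
  have "ennreal (cmod (?g x)) \<le> (\<integral>\<^sup>+y. norm (cor (k y) * F (x, y)) \<partial>lborel)"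
   by (rule integral_norm_bound_ennreal[OF True])
  also have "\<dots> = (\<integral>\<^sup>+y. ennreal (sqrt (k y)) * ennreal (sqrt (k y) * cmod (F (x, y))) \<partial>lborel)"
  proof (rule nn_integral_cong)
   fix y
   have "norm (cor (k y) * F (x, y)) = (sqrt (k y) * sqrt (k y)) * cmod (F (x, y))" using k0[of y] by (simp add: norm_mult)
   moreover have "ennreal (sqrt (k y)) * ennreal (sqrt (k y) * cmod (F (x, y))) = ennreal (sqrt (k y) * (sqrt (k y) * cmod (F (x, y))))"
    by (rule ennreal_mult[symmetric]) (use k0[of y] in auto)
   ultimately show "ennreal (norm (cor (k y) * F (x, y))) = ennreal (sqrt (k y)) * ennreal (sqrt (k y) * cmod (F (x, y)))" by (simp only: mult.assoc)
  qed
  finally have "(ennreal (cmod (?g x)))\<^sup>2 \<le> (\<integral>\<^sup>+y. ennreal (sqrt (k y)) * ennreal (sqrt (k y) * cmod (F (x, y))) \<partial>lborel)\<^sup>2"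
   by (rule power_mono) simp
  also have "\<dots> \<le> (\<integral>\<^sup>+y. (ennreal (sqrt (k y)))\<^sup>2 \<partial>lborel) * (\<integral>\<^sup>+y. (ennreal (sqrt (k y) * cmod (F (x, y))))\<^sup>2 \<partial>lborel)"
   by (rule Cauchy_Schwarz_nn_integral) simp_all
  also have "(\<integral>\<^sup>+y. (ennreal (sqrt (k y)))\<^sup>2 \<partial>lborel) = 1" using k1 k0 by (simp add: ennreal_power)
  also have "(\<integral>\<^sup>+y. (ennreal (sqrt (k y) * cmod (F (x, y))))\<^sup>2 \<partial>lborel) =
    (\<integral>\<^sup>+y. ennreal (k y) * ennreal ((cmod (F (x, y)))\<^sup>2) \<partial>lborel)"
   using k0 by (intro nn_integral_cong) (simp add: ennreal_power power_mult_distrib ennreal_mult)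
  finally show ?thesis by (simp add: ennreal_power)
 qed
 have "(\<integral>\<^sup>+x. ennreal ((cmod (?g x))\<^sup>2) \<partial>lborel) \<le> (\<integral>\<^sup>+x. (\<integral>\<^sup>+y. ennreal (k y) * ennreal ((cmod (F (x, y)))\<^sup>2) \<partial>lborel) \<partial>lborel)"
  by (rule nn_integral_mono) (rule le)
 also have "\<dots> = (\<integral>\<^sup>+y. (\<integral>\<^sup>+x. ennreal (k y) * ennreal ((cmod (F (x, y)))\<^sup>2) \<partial>lborel) \<partial>lborel)"
  using lborel_pair.Fubini[of "\<lambda>(x, y). ennreal (k y) * ennreal ((cmod (F (x, y)))\<^sup>2)"] by simp
 also have "\<dots> = (\<integral>\<^sup>+y. ennreal (k y) * (\<integral>\<^sup>+x. ennreal ((cmod (F (x, y)))\<^sup>2) \<partial>lborel) \<partial>lborel)"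
  by (intro nn_integral_cong nn_integral_cmult) simp
 also have "\<dots> \<le> (\<integral>\<^sup>+y. ennreal (k y) * ennreal (A\<^sup>2) \<partial>lborel)"
 proof (rule nn_integral_mono)
  fix y
  show "ennreal (k y) * (\<integral>\<^sup>+x. ennreal ((cmod (F (x, y)))\<^sup>2) \<partial>lborel) \<le> ennreal (k y) * ennreal (A\<^sup>2)"
   using A(2)[of y] by (cases "k y = 0") (auto intro: mult_left_mono)
 qed
 also have "\<dots> = ennreal (A\<^sup>2)" using k1 by (simp add: nn_integral_multc)
 finally have *: "(\<integral>\<^sup>+x. ennreal ((cmod (?g x))\<^sup>2) \<partial>lborel) \<le> ennreal (A\<^sup>2)" .
 show "?g \<in> L2 lborel" by (rule L2I_nn_integral(1)[OF g *])
 show "lnorm ?g \<le> A" by (rule L2I_nn_integral(2)[OF g * A(1)])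
qed

text \<open>The normalisation is stated for the nonnegative integral, the form that
  \<open>averaging_L2\<close> consumes.\<close>

definition mollifier :: "real => ('a::euclidean_space => real) => bool" where
 "mollifier \<delta> \<rho> \<longleftrightarrow> (\<lambda>x. cor (\<rho> x)) \<in> \<D> UNIV \<and> (\<forall>x. 0 \<le> \<rho> x) \<and>
   (\<forall>x. norm x > \<delta> \<longrightarrow> \<rho> x = 0) \<and> \<rho> \<in> borel_measurable borel \<and> (\<integral>\<^sup>+x. ennreal (\<rho> x) \<partial>lborel) = 1"

lemma mollifier_exists:
 assumes "d > 0"
 shows "\<exists>s :: 'a::euclidean_space => real. mollifier d s"
proof -
 \<comment> \<open>Half the side of a cube whose points have l1 norm at most d, so that the cube
   lies in the ball of radius d.\<close>
 define a where "a = d / real DIM('a)"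
 have a: "a > 0" using assms by (simp add: a_def)
 let ?lo = "(- a) *\<^sub>R (One :: 'a)" and ?hi = "a *\<^sub>R (One :: 'a)"
 let ?b = "box_bump 1 ?lo ?hi"
 have in_box: "norm x \<le> d" if "x \<in> box ?lo ?hi" for x
 proof -
  have "norm x \<le> (\<Sum>i\<in>Basis. \<bar>x \<bullet> i\<bar>)" by (rule norm_le_l1)
  also have "\<dots> \<le> (\<Sum>i\<in>(Basis::'a set). a)"
  proof (rule sum_mono)
   fix i :: 'a assume "i \<in> Basis"
   then have "- a < x \<bullet> i" "x \<bullet> i < a" using that by (auto simp: mem_box)
   then show "\<bar>x \<bullet> i\<bar> \<le> a" by linarith
  qed
  also have "\<dots> = d" by (simp add: a_def)
  finally show ?thesis .
 qed
 have test: "(\<lambda>x. cor (?b x)) \<in> \<D> UNIV" by (rule box_bump_test) auto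
 have b: "?b \<in> borel_measurable borel" by (rule smooth_borel[OF smooth_box_bump])
 have int: "integrable lborel ?b" using integrable_Re[OF test_integrable[OF test]] by simp
 define I where "I = (LINT x|lborel. ?b x)"
 have "I \<noteq> 0"
 proof
  assume "I = 0"
  then have "AE x in lborel. ?b x = 0" using integral_nonneg_eq_0_iff_AE[OF int] by (simp add: I_def box_bump_bounds)
  then have "AE x in lborel. x \<notin> box ?lo ?hi" by eventually_elim (use box_bump_pos_iff[of 1] in force)
  then have "emeasure lborel (box ?lo ?hi) = 0" by (subst (asm) AE_iff_measurable[OF _ refl]) auto
  then have "measure lborel (box ?lo ?hi) = 0" by (simp add: measure_def)
  moreover have "measure lborel (box ?lo ?hi) = (\<Prod>i\<in>(Basis::'a set). 2 * a)"
   using a by (subst measure_lborel_box) (auto simp: inner_diff_left algebra_simps intro!: prod.cong)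
  moreover have "(\<Prod>i\<in>(Basis::'a set). 2 * a) > 0" using a by (intro prod_pos) simp
  ultimately show False by linarith
 qed
 moreover have "I \<ge> 0" unfolding I_def by (simp add: box_bump_bounds)
 ultimately have I: "I > 0" by simp
 let ?r = "\<lambda>x. ?b x / I"
 have "(\<lambda>x. cor (?r x)) = (\<lambda>x. cor (inverse I) * cor (?b x))" by (auto simp: divide_inverse)
 then have "(\<lambda>x. cor (?r x)) \<in> \<D> UNIV" using test_scale[OF test, of "cor (inverse I)"] by (simp only:)
 moreover have "(\<integral>\<^sup>+x. ennreal (?r x) \<partial>lborel) = 1"
 proof -
  have "(\<integral>\<^sup>+x. ennreal (?r x) \<partial>lborel) = ennreal (LINT x|lborel. ?r x)"
   using int I by (intro nn_integral_eq_integral) (auto simp: box_bump_bounds)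
  also have "(LINT x|lborel. ?r x) = I / I" unfolding I_def by (rule integral_divide_zero)
  finally show ?thesis using I by simp
 qed
 moreover have "?r x = 0" if "norm x > d" for x using in_box[of x] that box_bump_eq_0[of 1 x ?lo ?hi] by force
 ultimately show ?thesis unfolding mollifier_def using b I by (intro exI[of _ ?r]) (auto simp: box_bump_bounds)
qed

abbreviation cr :: "('a => real) => 'a => complex" where
 "cr \<rho> \<equiv> \<lambda>x. cor (\<rho> x)"

lemma mollifierD:
 assumes "mollifier d r"
 shows "cr r \<in> \<D> UNIV" "\<And>x. 0 \<le> r x" "\<And>x. norm x > d ==> r x = 0"
  "r \<in> borel_measurable borel" "(\<integral>\<^sup>+x. ennreal (r x) \<partial>lborel) = 1" using assms by (auto simp: mollifier_def)

lemma mollifier_integral: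
 assumes "mollifier d r"
 shows "integrable lborel (cr r)" "(LINT x|lborel. cr r x) = 1"
proof -
 show "integrable lborel (cr r)" by (rule test_integrable[OF mollifierD(1)[OF assms]])
 then have "integrable lborel r" using complex_of_real_integrable_eq by blast
 then have "ennreal (LINT x|lborel. r x) = 1" using nn_integral_eq_integral[of lborel r] mollifierD[OF assms] by simp
 then have "(LINT x|lborel. r x) = 1" by simp
 then show "(LINT x|lborel. cr r x) = 1" by (simp add: integral_complex_of_real)
qed

lemma conv_mollifier_norm_le:
 assumes r: "mollifier d r" and u: "u \<in> borel_measurable borel" "u \<in> L2 lborel"
 shows "conv (cr r) u \<in> L2 lborel" "lnorm (conv (cr r) u) \<le> lnorm u"
proof -
 let ?F = "\<lambda>(x, y). u (x - y)"
 have F: "?F \<in> borel_measurable (borel \<Otimes>\<^sub>M borel)" using u(1) by measurable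
 have eq: "conv (cr r) u = (\<lambda>x. LINT y|lborel. cor (r y) * ?F (x, y))" using conv_swap[OF test_borel[OF mollifierD(1)[OF r]] u(1)] by auto
 have A: "(\<integral>\<^sup>+x. ennreal ((cmod (?F (x, y)))\<^sup>2) \<partial>lborel) \<le> ennreal ((lnorm u)\<^sup>2)" for y
  using lborel_translate_reflect_nn_integral[of "\<lambda>x. ennreal ((cmod (u x))\<^sup>2)" y] u L2_nn_integral[OF u(2)] by simp
 note * = averaging_L2[OF mollifierD(4)[OF r] mollifierD(2)[OF r] mollifierD(5)[OF r] F L2_norm_nonneg A]
 show "conv (cr r) u \<in> L2 lborel" "lnorm (conv (cr r) u) \<le> lnorm u" unfolding eq using * by blast+
qed

text \<open>The mollification error is an average of translation differences with shifts of length
  at most \<open>d\<close>.\<close>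

lemma conv_mollifier_diff_le:
 fixes f :: "'a::euclidean_space => complex"
 assumes r: "mollifier d r" and d: "d > 0" and f: "f \<in> \<D> UNIV"
 shows "lnorm (\<lambda>x. conv (cr r) f x - f x) \<le> d * grad_norm f"
proof -
 let ?F = "\<lambda>(x, y). f (x - y) - f x"
 have F: "?F \<in> borel_measurable (borel \<Otimes>\<^sub>M borel)" using test_borel[OF f] by measurable
 have eq: "(\<lambda>x. conv (cr r) f x - f x) = (\<lambda>x. LINT y|lborel. cor (r y) * ?F (x, y))"
 proof
  fix x
  have "smooth (\<lambda>y. f (x - y))" by (rule test_reflect(1)[OF f])
  then have i: "integrable lborel (\<lambda>y. cor (r y) * f (x - y))" by (intro integrable_cont_test(2)[OF smooth_continuous mollifierD(1)[OF r]])
  have "conv (cr r) f x - f x = (LINT y|lborel. cor (r y) * f (x - y)) - (LINT y|lborel. cor (r y)) * f x"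
   using mollifier_integral[OF r] conv_swap[OF test_borel[OF mollifierD(1)[OF r]] test_borel[OF f]] by simp
  also have "\<dots> = (LINT y|lborel. cor (r y) * f (x - y) - cor (r y) * f x)" using i mollifier_integral(1)[OF r] by simp
  finally show "conv (cr r) f x - f x = (LINT y|lborel. cor (r y) * ?F (x, y))" by (simp add: right_diff_distrib)
 qed
 have A: "(\<integral>\<^sup>+x. ennreal ((cmod (?F (x, y)))\<^sup>2) \<partial>lborel) \<le> ennreal ((d * grad_norm f)\<^sup>2)" if y: "r y \<noteq> 0" for y
 proof -
  have ny: "norm y \<le> d" using mollifierD(3)[OF r, of y] y by force
  have L: "(\<lambda>x. f (x + (- y)) - f x) \<in> L2 lborel" by (intro L2_diff test_L2[OF test_translate(1)[OF f]] test_L2[OF f])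
  have "lnorm (\<lambda>x. f (x + (- y)) - f x) \<le> norm (- y) * grad_norm f" by (rule norm_translate_diff_le[OF f])
  also have "\<dots> \<le> d * grad_norm f" using ny by (intro mult_right_mono) auto
  finally have "(lnorm (\<lambda>x. f (x + (- y)) - f x))\<^sup>2 \<le> (d * grad_norm f)\<^sup>2" by (rule power_mono) simp
  then show ?thesis using L2_nn_integral[OF L] by (simp add: ennreal_leI)
 qed
 have 0: "0 \<le> d * grad_norm f" using d by simp
 show ?thesis unfolding eq by (rule averaging_L2(2)[OF mollifierD(4)[OF r] mollifierD(2)[OF r] mollifierD(5)[OF r] F 0 A])
qed

section \<open>Compactness estimates\<close>

text \<open>A quantitative form of Rellich's theorem: up to a small multiple of the gradient norm, the
 norm of a test function is controlled by finitely many functionals, namely the values of its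
 mollification at the points of a finite net.\<close>

lemma Rellich:
 fixes R d :: real
 assumes R: "R \<ge> 0" and d: "d > 0"
 shows "\<exists>(Z :: ('a::euclidean_space => complex) set) C. finite Z \<and> C \<ge> 0 \<and> Z \<subseteq> \<D> UNIV \<and>
  (\<forall>g \<in> \<D> UNIV. (\<forall>x. norm x > R \<longrightarrow> g x = 0) \<longrightarrow>
   lnorm g \<le> d * (grad_norm g + lnorm g) + C * (\<Sum>r\<in>Z. cmod (LINT y|lborel. r y * g y)))"
proof -
 obtain s :: "'a => real" where s: "mollifier d s" using mollifier_exists[OF d] by blast
 note st = mollifierD(1)[OF s]
 obtain L where L: "L \<ge> 0" "\<And>x y. cmod (cr s x - cr s y) \<le> L * norm (x - y)" using test_lipschitz[OF st] by blast
 define m where "m = sqrt (measure lborel (cball (0::'a) (R + d)))"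
 define n where "n = sqrt (measure lborel (cball (0::'a) R))"
 have mn: "m \<ge> 0" "n \<ge> 0" by (auto simp: m_def n_def)
 \<comment> \<open>The mesh of the net. Within distance t the mollification varies by at most L t n
   times the norm of g, and the factor \<open>m\<close> from the sup bound to the L2 norm must leave
   this below d.\<close>
 define t where "t = d / (L * n * m + 1)"
 have t: "t > 0" using d L mn unfolding t_def by (intro divide_pos_pos add_nonneg_pos) auto
 have t2: "m * (L * t * n) \<le> d"
 proof -
  have "m * (L * t * n) = d * (L * n * m / (L * n * m + 1))" by (simp add: t_def)
  also have "\<dots> \<le> d * 1" using d L mn by (intro mult_left_mono) (auto simp: divide_simps add_nonneg_pos)
  finally show ?thesis by simp
 qed
 have "\<forall>e>0. \<exists>k. finite k \<and> cball (0::'a) (R + d) \<subseteq> (\<Union>x\<in>k. ball x e)"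
  using compact_cball[of "0::'a" "R + d"] unfolding compact_eq_totally_bounded by (rule conjunct2)
 then obtain k where k: "finite k" "cball (0::'a) (R + d) \<subseteq> (\<Union>x\<in>k. ball x t)" using t by blast
 define Z where "Z = (\<lambda>z y. cr s (z - y)) ` k"
 have Zfin: "finite Z" using k by (simp add: Z_def)
 have Zt: "Z \<subseteq> \<D> UNIV"
 proof
  fix r assume "r \<in> Z"
  then obtain z where z: "r = (\<lambda>y. cr s (z - y))" by (auto simp: Z_def)
  show "r \<in> \<D> UNIV" unfolding z
  proof (rule test_functionsI[where K = "cball 0 (norm z + d)"])
   show "smooth (\<lambda>y. cr s (z - y))" by (rule test_reflect(1)[OF st])
   show "cr s (z - y) = 0" if "y \<notin> cball 0 (norm z + d)" for y
   proof -
    have "norm (z - y) > d" using that norm_triangle_ineq3[of y z] by (simp add: norm_minus_commute)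
    then show ?thesis using mollifierD(3)[OF s] by simp
   qed
  qed auto
 qed
 have "lnorm g \<le> d * (grad_norm g + lnorm g) + m * (\<Sum>r\<in>Z. cmod (LINT y|lborel. r y * g y))"
  if g: "g \<in> \<D> UNIV" and supp: "\<And>x. norm x > R ==> g x = 0" for g
 proof -
  let ?S = "\<Sum>r\<in>Z. cmod (LINT y|lborel. r y * g y)"
  let ?v = "conv (cr s) g"
  note gi = test_integrable[OF g] and gL = test_L2[OF g]
  have v: "?v \<in> \<D> UNIV" "\<And>x. norm x > R + d ==> ?v x = 0" using conv_test[OF st gi _ supp, of d] mollifierD(3)[OF s] by auto
  have lip: "cmod (?v x - ?v z) \<le> (L * norm (x - z)) * (n * lnorm g)" for x z
  proof -
   let ?f = "\<lambda>y. (cr s (x - y) - cr s (z - y)) * indicator (cball 0 R) y"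
   have fb: "?f \<in> borel_measurable borel" by (intro borel_measurable_times borel_measurable_diff smooth_borel[OF test_reflect(1)[OF st]]
      borel_measurable_indicator borel_closed closed_cball)
   have f: "cmod (?f y) \<le> L * norm (x - z)" for y using L(2)[of "x - y" "z - y"] L(1) by (auto simp: indicator_def)
   have f0: "?f y = 0" if "norm y > R" for y using that by (simp add: indicator_def)
   note fL = L2_norm_bounded_support[OF fb f f0]
   have "?v x - ?v z = (LINT y|lborel. cr s (x - y) * g y - cr s (z - y) * g y)" unfolding conv_def using test_times_integrable[OF st gi] by simp
   also have "\<dots> = (LINT y|lborel. ?f y * cnj (cnj (g y)))"
    using supp by (intro Bochner_Integration.integral_cong refl) (auto simp: indicator_def algebra_simps)
   also have "\<dots> = ip lborel ?f (\<lambda>y. cnj (g y))" by (simp add: ip_def)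
   also have "cmod \<dots> \<le> lnorm ?f * lnorm (\<lambda>y. cnj (g y))" by (rule L2_Cauchy_Schwarz[OF fL(1) L2_cnj[OF gL]])
   also have "\<dots> \<le> (L * norm (x - z) * n) * lnorm g" using fL(2) unfolding n_def by (simp add: mult_right_mono)
   finally show ?thesis by (simp add: mult_ac)
  qed
  let ?c = "?S + L * t * (n * lnorm g)"
  have S0: "?S \<ge> 0" by (rule sum_nonneg) simp
  have vb: "cmod (?v x) \<le> ?c" for x
  proof (cases "norm x > R + d")
   case True
   then show ?thesis using v(2)[OF True] S0 L t mn by simp
  next
   case False
   then have "x \<in> cball 0 (R + d)" by simp
   then obtain z where z: "z \<in> k" "dist z x < t" using k(2) by (auto simp: subset_iff)
   have "cmod (?v z) \<le> ?S"
   proof -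
    have "?v z = (LINT y|lborel. (\<lambda>y. cr s (z - y)) y * g y)" by (simp add: conv_def)
    moreover have "(\<lambda>y. cr s (z - y)) \<in> Z" using z by (auto simp: Z_def)
    ultimately show ?thesis using member_le_sum[of "\<lambda>y. cr s (z - y)" Z "\<lambda>r. cmod (LINT y|lborel. r y * g y)"] Zfin by simp
   qed
   moreover have "cmod (?v x - ?v z) \<le> L * t * (n * lnorm g)"
   proof -
    have "(L * norm (x - z)) * (n * lnorm g) \<le> (L * t) * (n * lnorm g)"
     using z L mn by (intro mult_right_mono mult_left_mono) (auto simp: dist_norm norm_minus_commute)
    then show ?thesis using lip[of x z] by linarith
   qed
   ultimately show ?thesis using norm_triangle_ineq2[of "?v x" "?v z"] by linarith
  qed
  have "lnorm ?v \<le> ?c * m" unfolding m_def by (rule L2_norm_bounded_support(2)[OF test_borel[OF v(1)] vb v(2)])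
  also have "\<dots> = m * ?S + (m * (L * t * n)) * lnorm g" by (simp add: algebra_simps)
  also have "\<dots> \<le> m * ?S + d * lnorm g" using t2 by (intro add_left_mono mult_right_mono) auto
  finally have "lnorm ?v \<le> m * ?S + d * lnorm g" .
  moreover have "lnorm (\<lambda>x. ?v x - g x) \<le> d * grad_norm g" by (rule conv_mollifier_diff_le[OF s d g])
  moreover have "lnorm g \<le> lnorm ?v + lnorm (\<lambda>x. ?v x - g x)" using L2_norm_diff_abs[OF test_L2[OF v(1)] gL] by linarith
  ultimately show ?thesis by (simp add: algebra_simps)
 qed
 then show ?thesis using Zfin Zt mn(1) by blast
qed

section \<open>Square-integrable functions on an open set\<close>

lemma open_lebesgue: "open \<Omega> ==> \<Omega> \<inter> space lebesgue \<in> sets lebesgue" by (simp add: borel_open)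

lemma borel_lebesgue_on: "f \<in> borel_measurable borel ==> f \<in> borel_measurable (lebesgue_on \<Omega>)"
 by (intro measurable_restrict_space1 measurable_completion) simp

lemma borel_indicator_zero:
 fixes f :: "'a::euclidean_space => 'b::real_normed_vector"
 assumes "\<And>x. x \<notin> \<Omega> ==> f x = 0"
 shows "(\<lambda>x. indicator \<Omega> x *\<^sub>R f x) = f" using assms by (auto simp: indicator_def)

lemma integral_lebesgue_on_borel:
 fixes f :: "'a::euclidean_space => 'b::{banach, second_countable_topology}"
 assumes "open \<Omega>" "f \<in> borel_measurable borel" "\<And>x. x \<notin> \<Omega> ==> f x = 0"
 shows "(LINT x|lebesgue_on \<Omega>. f x) = (LINT x|lborel. f x)"
  and "integrable (lebesgue_on \<Omega>) f \<longleftrightarrow> integrable lborel f"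
proof -
 have f: "f \<in> lborel \<rightarrow>\<^sub>M borel" using assms(2) by simp
 have eq: "(\<lambda>x. indicator \<Omega> x *\<^sub>R f x) = f" by (rule borel_indicator_zero[OF assms(3)])
 show "(LINT x|lebesgue_on \<Omega>. f x) = (LINT x|lborel. f x)"
  by (simp only: integral_restrict_space[OF open_lebesgue[OF assms(1)]] eq integral_completion[OF f])
 show "integrable (lebesgue_on \<Omega>) f \<longleftrightarrow> integrable lborel f"
  by (simp only: integrable_restrict_space[OF open_lebesgue[OF assms(1)]] eq integrable_completion[OF f])
qed

lemma AE_lebesgue_on_iff: "open \<Omega> ==> (AE x in lebesgue_on \<Omega>. P x) \<longleftrightarrow> (AE x in lborel. x \<in> \<Omega> \<longrightarrow> P x)"
 by (simp add: AE_restrict_space_iff[OF open_lebesgue] AE_completion_iff)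

lemma L2_lebesgue_on_borel:
 assumes "open \<Omega>" "f \<in> borel_measurable borel" "\<And>x. x \<notin> \<Omega> ==> f x = 0"
 shows "f \<in> L2 (lebesgue_on \<Omega>) \<longleftrightarrow> f \<in> L2 lborel" "L2_norm (lebesgue_on \<Omega>) f = lnorm f"
proof -
 have f2: "(\<lambda>x. (cmod (f x))\<^sup>2) \<in> borel_measurable borel" using assms(2) by simp
 show "f \<in> L2 (lebesgue_on \<Omega>) \<longleftrightarrow> f \<in> L2 lborel"
  unfolding L2_def using integral_lebesgue_on_borel(2)[OF assms(1) f2] assms(3) borel_lebesgue_on[OF assms(2)] assms(2) by simp
 show "L2_norm (lebesgue_on \<Omega>) f = lnorm f" unfolding L2_norm_def using integral_lebesgue_on_borel(1)[OF assms(1) f2] assms(3) by simp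
qed

lemma L2_lborel_lebesgue_on:
 assumes "open \<Omega>" "f \<in> borel_measurable borel" "f \<in> L2 lborel"
 shows "f \<in> L2 (lebesgue_on \<Omega>)"
proof -
 let ?f = "\<lambda>x. indicator \<Omega> x *\<^sub>R f x"
 have b: "?f \<in> borel_measurable borel" using assms(1,2) by (intro borel_measurable_scaleR borel_measurable_indicator borel_open)
 have "?f \<in> L2 lborel" by (rule L2_dominated[OF _ L2_integrable_square[OF assms(3)]]) (use b in \<open>auto simp: indicator_def\<close>)
 then have "?f \<in> L2 (lebesgue_on \<Omega>)" using L2_lebesgue_on_borel(1)[OF assms(1) b] by simp
 then show ?thesis by (rule L2_AE_cong[OF _ borel_lebesgue_on[OF assms(2)]]) (auto simp: AE_lebesgue_on_iff[OF assms(1)])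
qed

lemma test_L2_on: "open \<Omega> ==> f \<in> \<D> \<Omega>' ==> f \<in> L2 (lebesgue_on \<Omega>)"
 by (rule L2_lborel_lebesgue_on[OF _ test_borel test_L2])

lemma test_norm_on: "open \<Omega> ==> f \<in> \<D> \<Omega> ==> L2_norm (lebesgue_on \<Omega>) f = lnorm f"
 by (rule L2_lebesgue_on_borel(2)[OF _ test_borel test_outside])

lemma test_integral_on:
 assumes "open \<Omega>" "f \<in> \<D> \<Omega>" "g \<in> borel_measurable borel"
 shows "(LINT x|lebesgue_on \<Omega>. f x * g x) = (LINT x|lborel. f x * g x)"
 by (rule integral_lebesgue_on_borel(1)) (use assms test_borel[OF assms(2)] test_outside[OF assms(2)] in auto)

text \<open>Fubini, translations and convolutions are used on \<open>lborel\<close>; a Borel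
  representative extended by zero carries an element of L2(\<Omega>) there with the same
  norm.\<close>

lemma borel_representative:
 fixes u :: "'a::euclidean_space => complex"
 assumes \<Omega>: "open \<Omega>" and u: "u \<in> L2 (lebesgue_on \<Omega>)"
 obtains v where "v \<in> borel_measurable borel" "v \<in> L2 lborel" "\<And>x. x \<notin> \<Omega> ==> v x = 0"
  "AE x in lebesgue_on \<Omega>. u x = v x" "lnorm v = L2_norm (lebesgue_on \<Omega>) u"
proof -
 let ?u = "\<lambda>x. indicator \<Omega> x *\<^sub>R u x"
 have m: "?u \<in> borel_measurable lebesgue" using borel_measurable_restrict_space_iff[OF open_lebesgue[OF \<Omega>]] L2_measurable[OF u] by blast
 have "Re \<in> borel_measurable borel" "Im \<in> borel_measurable borel" by (auto intro!: borel_measurable_continuous_onI continuous_intros)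
 note ri = this[THEN measurable_compose[OF m]]
 obtain a where a: "a \<in> borel_measurable lborel" "AE x in lborel. Re (?u x) = a x"
  using completion_ex_borel_measurable_real[OF ri(1)] by (rule bexE)
 obtain b where b: "b \<in> borel_measurable lborel" "AE x in lborel. Im (?u x) = b x"
  using completion_ex_borel_measurable_real[OF ri(2)] by (rule bexE)
 define v where "v x = indicator \<Omega> x *\<^sub>R (cor (a x) + \<i> * cor (b x))" for x
 have v: "v \<in> borel_measurable borel"
 proof -
  have "(\<lambda>x. cor (a x) + \<i> * cor (b x)) \<in> borel_measurable borel" using a b by simp
  then show ?thesis unfolding v_def using \<Omega> by (intro borel_measurable_scaleR borel_measurable_indicator borel_open) auto
 qed
 have AE: "AE x in lebesgue_on \<Omega>. u x = v x" unfolding AE_lebesgue_on_iff[OF \<Omega>] using a(2) b(2)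
  by eventually_elim (auto simp: v_def complex_eq_iff)
 have v0: "v x = 0" if "x \<notin> \<Omega>" for x using that by (simp add: v_def)
 have "v \<in> L2 (lebesgue_on \<Omega>)" by (rule L2_AE_cong[OF u borel_lebesgue_on[OF v] AE])
 then have vL: "v \<in> L2 lborel" using L2_lebesgue_on_borel(1)[OF \<Omega> v] v0 by blast
 have "lnorm v = L2_norm (lebesgue_on \<Omega>) u"
  using L2_lebesgue_on_borel(2)[OF \<Omega> v] v0 L2_norm_AE_cong[OF AE L2_measurable[OF u] borel_lebesgue_on[OF v]] by simp
 with that v vL v0 AE show ?thesis by blast
qed

text \<open>Boxes form an intersection-stable generator of the Borel sets, so a Dynkin argument
  gives zero integral over every Borel set. The total integral serves the complement step.\<close>

lemma integrable_zero_on_boxes: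
 fixes f :: "'a::euclidean_space => complex"
 assumes f: "integrable lborel f" and boxes: "\<And>a b. (LINT x:box a b|lborel. f x) = 0" and total: "(LINT x|lborel. f x) = 0"
 shows "AE x in lborel. f x = 0"
proof (rule sigma_finite_measure.density_zero[OF sigma_finite_lborel f])
 have si: "set_integrable lborel A f" if "A \<in> sets borel" for A
  unfolding set_integrable_def by (rule integrable_mult_indicator) (use that f in auto)
 have gen: "sets borel = sigma_sets UNIV (range (\<lambda>(a, b). box a b :: 'a set))" unfolding borel_eq_box by simp
 fix A :: "'a set" assume "A \<in> sets lborel"
 then have A: "A \<in> sigma_sets UNIV (range (\<lambda>(a, b). box a b))" by (simp add: gen)
 have sub: "range (\<lambda>(a, b). box a b :: 'a set) \<subseteq> Pow UNIV" by simp
 have Int: "Int_stable (range (\<lambda>(a, b). box a b :: 'a set))" by (auto simp: Int_stable_def box_Int_box)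
 show "(LINT x:A|lborel. f x) = 0" using Int sub A
 proof (induction rule: sigma_sets_induct_disjoint)
  case (basic A)
  then show ?case using boxes by auto
 next
  case empty
  show ?case by (simp add: set_lebesgue_integral_def)
 next
  case (compl A)
  then have A: "A \<in> sets borel" by (simp add: gen)
  have "(LINT x:UNIV|lborel. f x) = (LINT x:(A \<union> (UNIV - A))|lborel. f x)" by simp
  also have "\<dots> = (LINT x:A|lborel. f x) + (LINT x:(UNIV - A)|lborel. f x)" by (rule set_integral_Un) (use si A in auto)
  finally show ?case using compl total by (simp add: set_lebesgue_integral_def)
 next
  case (union A)
  then have "A i \<in> sets borel" for i by (auto simp: gen)
  then have "(LINT x:(\<Union>i. A i)|lborel. f x) = (\<Sum>i. LINT x:A i|lborel. f x)"
   using union(1) by (intro lebesgue_integral_countable_add si) (auto simp: disjoint_family_on_def)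
  then show ?case using union by simp
 qed
qed

lemma L2_bounded_integrable:
 assumes "u \<in> L2 lborel" "bounded S" "S \<in> sets borel"
 shows "integrable lborel (\<lambda>x. indicator S x *\<^sub>R u x)"
proof -
 have "(\<lambda>x. cor (indicator S x)) \<in> L2 lborel"
 proof -
  have "(\<lambda>x. (cmod (cor (indicator S x)))\<^sup>2) = indicator S" by (auto simp: indicator_def)
  then show ?thesis unfolding L2_def using emeasure_bounded_finite[OF assms(2)] assms(3) by simp
 qed
 from L2_mult_integrable[OF this assms(1)] show ?thesis by (simp add: scaleR_conv_of_real)
qed

text \<open>Bumps tending to the indicator of a box turn the hypothesis into vanishing box
  integrals. The Dynkin argument then makes u vanish almost everywhere on each closed box in
  \<Omega>, and countably many of these cover \<Omega>.\<close>

theorem fundamental_lemma: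
 fixes u :: "'a::euclidean_space => complex"
 assumes \<Omega>: "open \<Omega>" and u: "u \<in> L2 (lebesgue_on \<Omega>)"
  and zero: "\<And>p. p \<in> \<D> \<Omega> ==> (LINT x|lebesgue_on \<Omega>. u x * p x) = 0"
 shows "AE x in lebesgue_on \<Omega>. u x = 0"
proof -
 obtain v where v: "v \<in> borel_measurable borel" "v \<in> L2 lborel" "\<And>x. x \<notin> \<Omega> ==> v x = 0"
  "AE x in lebesgue_on \<Omega>. u x = v x" using borel_representative[OF \<Omega> u] by blast
 have zero': "(LINT x|lborel. p x * v x) = 0" if p: "p \<in> \<D> \<Omega>" for p
 proof -
  have "(LINT x|lborel. p x * v x) = (LINT x|lebesgue_on \<Omega>. p x * v x)" using test_integral_on[OF \<Omega> p v(1)] by simp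
  also have "\<dots> = (LINT x|lebesgue_on \<Omega>. u x * p x)"
  proof (rule integral_cong_AE)
   show "AE x in lebesgue_on \<Omega>. p x * v x = u x * p x" using v(4) by eventually_elim simp
  qed (intro borel_measurable_times borel_lebesgue_on[OF test_borel[OF p]] borel_lebesgue_on[OF v(1)] L2_measurable[OF u])+
  finally show ?thesis using zero[OF p] by simp
 qed
 have box0: "(LINT x:box a b|lborel. v x) = 0" if ab: "cbox a b \<subseteq> \<Omega>" for a b
 proof -
  let ?b = "\<lambda>n x. cor (box_bump (real (Suc n)) a b x)"
  have int: "integrable lborel (\<lambda>x. indicator (cbox a b) x *\<^sub>R v x)" by (rule L2_bounded_integrable[OF v(2)]) auto
  have lim: "(\<lambda>n. LINT x|lborel. ?b n x * v x) \<longlonglongrightarrow> (LINT x|lborel. indicator (box a b) x *\<^sub>R v x)"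
  proof (rule integral_dominated_convergence)
   show "integrable lborel (\<lambda>x. cmod (indicator (cbox a b) x *\<^sub>R v x))" using int by (rule integrable_norm)
   show "(\<lambda>x. indicator (box a b) x *\<^sub>R v x) \<in> borel_measurable lborel"
    using v(1) by (auto intro!: borel_measurable_scaleR borel_measurable_indicator borel_open)
   show "(\<lambda>x. ?b n x * v x) \<in> borel_measurable lborel" for n using v(1) smooth_borel[OF smooth_box_bump, of "real (Suc n)" a b] by simp
   show "AE x in lborel. (\<lambda>n. ?b n x * v x) \<longlonglongrightarrow> indicator (box a b) x *\<^sub>R v x"
    unfolding scaleR_conv_of_real by (intro always_eventually allI tendsto_intros box_bump_tendsto)
   show "AE x in lborel. norm (?b n x * v x) \<le> cmod (indicator (cbox a b) x *\<^sub>R v x)" for n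
   proof (intro always_eventually allI)
    fix x
    show "norm (?b n x * v x) \<le> cmod (indicator (cbox a b) x *\<^sub>R v x)"
    proof (cases "x \<in> box a b")
     case True
     then have "x \<in> cbox a b" using box_subset_cbox by blast
     then show ?thesis using box_bump_bounds[of "real (Suc n)" a b x] mult_right_mono[of "box_bump (real (Suc n)) a b x" 1 "cmod (v x)"]
      by (simp add: norm_mult)
    next
     case False
     then show ?thesis by (simp add: box_bump_eq_0 del: of_nat_Suc)
    qed
   qed
  qed
  have "(LINT x|lborel. ?b n x * v x) = 0" for n by (rule zero'[OF box_bump_test[OF _ ab]]) simp
  then have "(LINT x|lborel. indicator (box a b) x *\<^sub>R v x) = 0" using lim by (simp add: LIMSEQ_const_iff)
  then show ?thesis by (simp add: set_lebesgue_integral_def)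
 qed
 have AE_box: "AE x in lborel. x \<in> cbox a b \<longrightarrow> v x = 0" if ab: "cbox a b \<subseteq> \<Omega>" for a b
 proof -
  let ?f = "\<lambda>x. indicator (box a b) x *\<^sub>R v x"
  have "AE x in lborel. ?f x = 0"
  proof (rule integrable_zero_on_boxes)
   show "integrable lborel ?f" by (rule L2_bounded_integrable[OF v(2)]) auto
   show "(LINT x|lborel. ?f x) = 0" using box0[OF ab] by (simp add: set_lebesgue_integral_def)
   fix c d :: 'a
   \<comment> \<open>An arbitrary box need not lie in \<Omega>; its intersection with
     \<open>box a b\<close> does.\<close>
   obtain a' b' where ab': "box c d \<inter> box a b = box a' b'" by (simp add: box_Int_box)
   have "(\<lambda>x. indicator (box c d) x *\<^sub>R ?f x) = (\<lambda>x. indicator (box a' b') x *\<^sub>R v x)"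
    unfolding ab'[symmetric] by (auto simp: indicator_def)
   then have eq: "(LINT x:box c d|lborel. ?f x) = (LINT x:box a' b'|lborel. v x)" by (simp only: set_lebesgue_integral_def)
   show "(LINT x:box c d|lborel. ?f x) = 0"
   proof (cases "box a' b' = {}")
    case True
    then show ?thesis unfolding eq by (simp add: set_lebesgue_integral_def)
   next
    case False
    have "box a' b' \<subseteq> cbox a b" using ab' box_subset_cbox[of a b] by blast
    then have "closure (box a' b') \<subseteq> cbox a b" by (rule closure_minimal) (rule closed_cbox)
    then have "cbox a' b' \<subseteq> \<Omega>" using ab False by (simp add: closure_box)
    then show ?thesis using box0 eq by simp
   qed
  qed
  moreover have "AE x in lborel. x \<notin> cbox a b - box a b"
  proof -
   have "cbox a b - box a b \<in> null_sets lebesgue" using negligible_frontier_interval by (simp add: negligible_iff_null_sets)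
   then have "AE x in lebesgue. x \<notin> cbox a b - box a b" by (rule AE_not_in)
   then show ?thesis by (simp only: AE_completion_iff)
  qed
  ultimately show ?thesis by eventually_elim (auto simp: indicator_def split: if_splits)
 qed
 obtain D where D: "countable D" "\<And>X. X \<in> D ==> \<exists>a b. X = cbox a b" "\<Union>D = \<Omega>"
  using open_countable_Union_open_cbox[OF \<Omega>] by metis
 have "\<forall>X\<in>D. AE x in lborel. x \<in> X \<longrightarrow> v x = 0"
 proof
  fix X assume X: "X \<in> D"
  then obtain a b where ab: "X = cbox a b" using D(2) by blast
  then have "cbox a b \<subseteq> \<Omega>" using X D(3) by blast
  then show "AE x in lborel. x \<in> X \<longrightarrow> v x = 0" unfolding ab by (rule AE_box)
 qed
 then have "AE x in lborel. \<forall>X\<in>D. x \<in> X \<longrightarrow> v x = 0" by (simp only: AE_ball_countable[OF D(1)])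
 then have "AE x in lborel. x \<in> \<Omega> \<longrightarrow> v x = 0" by eventually_elim (use D(3) in blast)
 then have "AE x in lebesgue_on \<Omega>. v x = 0" by (simp only: AE_lebesgue_on_iff[OF \<Omega>])
 with v(4) show ?thesis by eventually_elim simp
qed

text \<open>The error of projecting u onto the closure of the test functions is orthogonal to all of
  them, hence null by \<open>fundamental_lemma\<close>.\<close>

lemma test_dense:
 fixes u :: "'a::euclidean_space => complex"
 assumes \<Omega>: "open \<Omega>" and u: "u \<in> L2 (lebesgue_on \<Omega>)" and e: "e > 0"
 obtains f where "f \<in> \<D> \<Omega>" "L2_norm (lebesgue_on \<Omega>) (\<lambda>x. f x - u x) < e"
proof -
 let ?M = "lebesgue_on \<Omega>" and ?T = "\<D> \<Omega> :: ('a => complex) set"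
 have T: "?T \<subseteq> L2 ?M" using test_L2_on[OF \<Omega>] by blast
 have "closed_subspace ?M (L2_closure ?M ?T)" by (rule closed_subspace_closure[OF T test_zero test_add test_scale])
 then obtain p where p: "p \<in> L2_closure ?M ?T" "\<And>t. t \<in> L2_closure ?M ?T ==> ip ?M (\<lambda>x. u x - p x) t = 0"
  using L2_projection[OF _ u] by blast
 have pL: "p \<in> L2 ?M" using p(1) by (simp add: L2_closure_def)
 have "AE x in ?M. u x - p x = 0"
 proof (rule fundamental_lemma[OF \<Omega> L2_diff[OF u pL]])
  fix f assume f: "f \<in> ?T"
  have "(\<lambda>x. cnj (f x)) \<in> L2_closure ?M ?T"
   unfolding L2_closure_def using test_cnj[OF f] T by (auto intro!: exI[of _ "\<lambda>_ x. cnj (f x)"])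
  from p(2)[OF this] show "(LINT x|?M. (u x - p x) * f x) = 0" by (simp add: ip_def)
 qed
 then have AE: "AE x in ?M. p x = u x" by eventually_elim simp
 obtain f where f: "f \<in> ?T" "L2_norm ?M (\<lambda>x. f x - p x) < e" using p(1) L2_closure_iff[OF T pL] e by blast
 have "L2_norm ?M (\<lambda>x. f x - u x) = L2_norm ?M (\<lambda>x. f x - p x)"
  by (rule L2_norm_AE_cong) (use AE u pL test_L2_on[OF \<Omega> f(1)] in \<open>auto intro!: L2_measurable\<close>)
 with f that show ?thesis by simp
qed

section \<open>The closure of the Laplacian on test functions\<close>

text \<open>The graph closure of the Laplacian on test functions. Its pairs are (w, \<Delta>w) with
  w in H^2_0, by \<open>sobolev_0_lap0\<close> and \<open>lap0_sobolev_0\<close>; only two limits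
  have to be tracked instead of one for every weak derivative.\<close>

definition lap0 :: "'a::euclidean_space set => (('a => complex) \<times> ('a => complex)) set" where
 "lap0 \<Omega> = {(w, g). w \<in> L2 (lebesgue_on \<Omega>) \<and> g \<in> L2 (lebesgue_on \<Omega>) \<and>
   (\<forall>e>0. \<exists>\<phi>\<in>\<D> \<Omega>. L2_norm (lebesgue_on \<Omega>) (\<lambda>x. \<phi> x - w x) < e \<and>
    L2_norm (lebesgue_on \<Omega>) (\<lambda>x. laplacian \<phi> x - g x) < e)}"

lemma lap0_L2: "(w, g) \<in> lap0 \<Omega> ==> w \<in> L2 (lebesgue_on \<Omega>)" "(w, g) \<in> lap0 \<Omega> ==> g \<in> L2 (lebesgue_on \<Omega>)"
 by (auto simp: lap0_def)

lemma lap0_sequence: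
 assumes "(w, g) \<in> lap0 \<Omega>"
 obtains f where "\<And>n. f n \<in> \<D> \<Omega>" "L2_tendsto (lebesgue_on \<Omega>) f w"
  "L2_tendsto (lebesgue_on \<Omega>) (\<lambda>n. laplacian (f n)) g"
proof -
 have "\<forall>n. \<exists>f\<in>\<D> \<Omega>. L2_norm (lebesgue_on \<Omega>) (\<lambda>x. f x - w x) < inverse (real (Suc n)) \<and>
    L2_norm (lebesgue_on \<Omega>) (\<lambda>x. laplacian f x - g x) < inverse (real (Suc n))" using assms by (simp add: lap0_def)
 then obtain f where f: "\<And>n. f n \<in> \<D> \<Omega>"
  "\<And>n. L2_norm (lebesgue_on \<Omega>) (\<lambda>x. f n x - w x) < inverse (real (Suc n))"
  "\<And>n. L2_norm (lebesgue_on \<Omega>) (\<lambda>x. laplacian (f n) x - g x) < inverse (real (Suc n))" by metis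
 show ?thesis by (rule that[OF f(1) L2_tendstoI[OF less_imp_le[OF f(2)] LIMSEQ_inverse_real_of_nat]
     L2_tendstoI[OF less_imp_le[OF f(3)] LIMSEQ_inverse_real_of_nat]])
qed

lemma lap0I:
 assumes w: "w \<in> L2 (lebesgue_on \<Omega>)" and g: "g \<in> L2 (lebesgue_on \<Omega>)" and f: "\<And>n. f n \<in> \<D> \<Omega>"
  and "L2_tendsto (lebesgue_on \<Omega>) f w" "L2_tendsto (lebesgue_on \<Omega>) (\<lambda>n. laplacian (f n)) g"
 shows "(w, g) \<in> lap0 \<Omega>" unfolding lap0_def mem_Collect_eq case_prod_conv
proof (intro conjI w g allI impI)
 fix e :: real assume e: "e > 0"
 have "\<forall>\<^sub>F n in sequentially. L2_norm (lebesgue_on \<Omega>) (\<lambda>x. f n x - w x) < e \<and>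
   L2_norm (lebesgue_on \<Omega>) (\<lambda>x. laplacian (f n) x - g x) < e"
  using assms(4,5) e unfolding L2_tendsto_def by (intro eventually_conj order_tendstoD(2)[where y = 0])
 then obtain n where "L2_norm (lebesgue_on \<Omega>) (\<lambda>x. f n x - w x) < e"
   "L2_norm (lebesgue_on \<Omega>) (\<lambda>x. laplacian (f n) x - g x) < e" using eventually_happens'[OF sequentially_bot] by blast
 then show "\<exists>f\<in>\<D> \<Omega>. L2_norm (lebesgue_on \<Omega>) (\<lambda>x. f x - w x) < e \<and>
   L2_norm (lebesgue_on \<Omega>) (\<lambda>x. laplacian f x - g x) < e" using f by blast
qed

lemma lap0_test: "open \<Omega> ==> f \<in> \<D> \<Omega> ==> (f, laplacian f) \<in> lap0 \<Omega>"
 by (rule lap0I[where f = "\<lambda>n. f"]) (auto intro: test_L2_on test_laplacian)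

lemma lap0_add:
 assumes \<Omega>: "open \<Omega>" and 1: "(w, g) \<in> lap0 \<Omega>" and 2: "(v, k) \<in> lap0 \<Omega>"
 shows "((\<lambda>x. w x + v x), (\<lambda>x. g x + k x)) \<in> lap0 \<Omega>"
proof -
 obtain f where f: "\<And>n. f n \<in> \<D> \<Omega>" "L2_tendsto (lebesgue_on \<Omega>) f w"
  "L2_tendsto (lebesgue_on \<Omega>) (\<lambda>n. laplacian (f n)) g" using lap0_sequence[OF 1] by blast
 obtain q where q: "\<And>n. q n \<in> \<D> \<Omega>" "L2_tendsto (lebesgue_on \<Omega>) q v"
  "L2_tendsto (lebesgue_on \<Omega>) (\<lambda>n. laplacian (q n)) k" using lap0_sequence[OF 2] by blast
 note L = test_L2_on[OF \<Omega>] test_laplacian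
 show ?thesis
 proof (rule lap0I[where f = "\<lambda>n x. f n x + q n x"])
  show "L2_tendsto (lebesgue_on \<Omega>) (\<lambda>n x. f n x + q n x) (\<lambda>x. w x + v x)"
   by (rule L2_tendsto_add[OF L(1)[OF f(1)] L(1)[OF q(1)] lap0_L2(1)[OF 1] lap0_L2(1)[OF 2] f(2) q(2)])
  show "L2_tendsto (lebesgue_on \<Omega>) (\<lambda>n. laplacian (\<lambda>x. f n x + q n x)) (\<lambda>x. g x + k x)"
   unfolding laplacian_test_add[OF f(1) q(1)]
   by (rule L2_tendsto_add[OF L(1)[OF L(2)[OF f(1)]] L(1)[OF L(2)[OF q(1)]] lap0_L2(2)[OF 1] lap0_L2(2)[OF 2] f(3) q(3)])
 qed (intro L2_add lap0_L2[OF 1] lap0_L2[OF 2] test_add f(1) q(1))+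
qed

lemma lap0_scale:
 assumes "(w, g) \<in> lap0 \<Omega>"
 shows "((\<lambda>x. c * w x), (\<lambda>x. c * g x)) \<in> lap0 \<Omega>"
proof -
 obtain f where f: "\<And>n. f n \<in> \<D> \<Omega>" "L2_tendsto (lebesgue_on \<Omega>) f w"
  "L2_tendsto (lebesgue_on \<Omega>) (\<lambda>n. laplacian (f n)) g" using lap0_sequence[OF assms] by blast
 show ?thesis
 proof (rule lap0I[where f = "\<lambda>n x. c * f n x"])
  show "L2_tendsto (lebesgue_on \<Omega>) (\<lambda>n. laplacian (\<lambda>x. c * f n x)) (\<lambda>x. c * g x)"
   unfolding laplacian_test_scale[OF f(1)] by (rule L2_tendsto_scale[OF f(3)])
 qed (intro L2_scale lap0_L2[OF assms] test_scale f(1) L2_tendsto_scale f(2))+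
qed

lemma lap0_diff:
 assumes "open \<Omega>" "(w, g) \<in> lap0 \<Omega>" "(v, k) \<in> lap0 \<Omega>"
 shows "((\<lambda>x. w x - v x), (\<lambda>x. g x - k x)) \<in> lap0 \<Omega>"
proof -
 have "(\<lambda>x. w x + (- 1) * v x) = (\<lambda>x. w x - v x)" "(\<lambda>x. g x + (- 1) * k x) = (\<lambda>x. g x - k x)" by auto
 then show ?thesis using lap0_add[OF assms(1,2) lap0_scale[OF assms(3), of "-1"]] by (simp only:)
qed

lemma lap0_closed:
 assumes \<Omega>: "open \<Omega>" and wg: "\<And>n. (w n, g n) \<in> lap0 \<Omega>" and u: "u \<in> L2 (lebesgue_on \<Omega>)" and f: "f \<in> L2 (lebesgue_on \<Omega>)"
  and lim: "L2_tendsto (lebesgue_on \<Omega>) w u" "L2_tendsto (lebesgue_on \<Omega>) g f"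
 shows "(u, f) \<in> lap0 \<Omega>" unfolding lap0_def mem_Collect_eq case_prod_conv
proof (intro conjI u f allI impI)
 let ?M = "lebesgue_on \<Omega>"
 fix e :: real assume e: "e > 0"
 have "\<forall>\<^sub>F n in sequentially. L2_norm ?M (\<lambda>x. w n x - u x) < e/2 \<and> L2_norm ?M (\<lambda>x. g n x - f x) < e/2"
  using lim e unfolding L2_tendsto_def by (intro eventually_conj order_tendstoD(2)[where y = 0]) auto
 then obtain n where n: "L2_norm ?M (\<lambda>x. w n x - u x) < e/2" "L2_norm ?M (\<lambda>x. g n x - f x) < e/2"
  using eventually_happens'[OF sequentially_bot] by blast
 have "\<forall>e>0. \<exists>p\<in>\<D> \<Omega>. L2_norm ?M (\<lambda>x. p x - w n x) < e \<and> L2_norm ?M (\<lambda>x. laplacian p x - g n x) < e"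
  using wg[of n] unfolding lap0_def by blast
 moreover have "e/2 > 0" using e by simp
 ultimately obtain p where p: "p \<in> \<D> \<Omega>" "L2_norm ?M (\<lambda>x. p x - w n x) < e/2" "L2_norm ?M (\<lambda>x. laplacian p x - g n x) < e/2"
  by meson
 have "L2_norm ?M (\<lambda>x. p x - u x) < e"
  using L2_norm_dist_triangle[OF test_L2_on[OF \<Omega> p(1)] lap0_L2(1)[OF wg] u, of n] p(2) n(1) by linarith
 moreover have "L2_norm ?M (\<lambda>x. laplacian p x - f x) < e"
  using L2_norm_dist_triangle[OF test_L2_on[OF \<Omega> test_laplacian[OF p(1)]] lap0_L2(2)[OF wg] f, of n] p(3) n(2) by linarith
 ultimately show "\<exists>p\<in>\<D> \<Omega>. L2_norm ?M (\<lambda>x. p x - u x) < e \<and> L2_norm ?M (\<lambda>x. laplacian p x - f x) < e"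
  using p(1) by blast
qed

section \<open>The Sobolev space \<open>H\<^sup>2\<^sub>0\<close>\<close>

lemma L2_tendsto_integral:
 assumes "\<And>n. s n \<in> L2 M" "u \<in> L2 M" "v \<in> L2 M" "L2_tendsto M s u"
 shows "(\<lambda>n. LINT x|M. s n x * v x) \<longlonglongrightarrow> (LINT x|M. u x * v x)"
 using L2_tendsto_ip[OF assms(1) L2_cnj[OF assms(3)] assms(2) L2_cnj[OF assms(3)] assms(4) L2_tendsto_const] by (simp add: ip_def)

lemma L2_tendsto_sum:
 assumes "\<And>i n. i \<in> I ==> s i n \<in> L2 M" "\<And>i. i \<in> I ==> u i \<in> L2 M" "\<And>i. i \<in> I ==> L2_tendsto M (s i) (u i)"
 shows "L2_tendsto M (\<lambda>n x. \<Sum>i\<in>I. s i n x) (\<lambda>x. \<Sum>i\<in>I. u i x)"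
proof (rule L2_tendstoI)
 show "L2_norm M (\<lambda>x. (\<Sum>i\<in>I. s i n x) - (\<Sum>i\<in>I. u i x)) \<le> (\<Sum>i\<in>I. L2_norm M (\<lambda>x. s i n x - u i x))" for n
  unfolding sum_subtractf[symmetric] by (rule L2_norm_sum) (use assms in auto)
 have "(\<lambda>n. \<Sum>i\<in>I. L2_norm M (\<lambda>x. s i n x - u i x)) \<longlonglongrightarrow> (\<Sum>i\<in>I. 0)"
  using assms(3) unfolding L2_tendsto_def by (rule tendsto_sum)
 then show "(\<lambda>n. \<Sum>i\<in>I. L2_norm M (\<lambda>x. s i n x - u i x)) \<longlonglongrightarrow> 0" by simp
qed

text \<open>The index set of \<open>sobolev_norm 2\<close>: lists of basis vectors serve as
  multi-indices, with every order of differentiation listed separately.\<close>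

definition orders2 :: "'a::euclidean_space list set" where
 "orders2 = {vs. set vs \<subseteq> Basis \<and> length vs \<le> 2}"

lemma orders2_finite: "finite orders2" unfolding orders2_def by (rule finite_lists_length_le) simp

lemma orders2_cases:
 assumes "vs \<in> orders2"
 obtains "vs = []" | i where "i \<in> Basis" "vs = [i]" | i j where "i \<in> Basis" "j \<in> Basis" "vs = [i, j]"
proof (cases vs)
 case Nil
 then show ?thesis using that by blast
next
 case (Cons i ws)
 show ?thesis
 proof (cases ws)
  case Nil
  then show ?thesis using that(2)[of i] assms Cons by (auto simp: orders2_def)
 next
  case (Cons j zs)
  then have "zs = []" using assms \<open>vs = i # ws\<close> by (auto simp: orders2_def)
  then show ?thesis using that(3)[of i j] assms Cons \<open>vs = i # ws\<close> by (auto simp: orders2_def)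
 qed
qed

lemma orders2_Basis: "vs \<in> orders2 ==> set vs \<subseteq> Basis" by (simp add: orders2_def)

locale bounded_open =
 fixes \<Omega> :: "'a::euclidean_space set"
 assumes open_\<Omega>: "open \<Omega>" and bounded_\<Omega>: "bounded \<Omega>"
begin

abbreviation M :: "'a measure" where "M \<equiv> lebesgue_on \<Omega>"
abbreviation nrm :: "('a => complex) => real" where "nrm \<equiv> L2_norm M"

lemma test_L: "f \<in> \<D> \<Omega>' ==> f \<in> L2 M" by (rule test_L2_on[OF open_\<Omega>])

lemma test_pderivs_L: "f \<in> \<D> \<Omega>' ==> vs \<in> orders2 ==> pderivs vs f \<in> L2 M" by (rule test_L[OF test_pderivs[OF _ orders2_Basis]])

lemma has_weak_test:
 assumes f: "f \<in> \<D> \<Omega>" and vs: "vs \<in> orders2"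
 shows "has_weak_pderivs \<Omega> vs f (pderivs vs f)" unfolding has_weak_pderivs_def
proof
 fix g :: "'a => complex" assume g: "g \<in> \<D> \<Omega>"
 note vb = orders2_Basis[OF vs]
 have "(LINT x|lborel. f x * pderivs vs g x) = (- 1) ^ length vs * (LINT x|lborel. pderivs vs f x * g x)" using vs
 proof (cases rule: orders2_cases)
  case 1
  then show ?thesis by simp
 next
  case (2 i)
  then show ?thesis using integration_by_parts[OF f test_smooth[OF g] 2(1)] by simp
 next
  case (3 i j)
  then show ?thesis using integral_second_pderivs(1)[OF test_UNIV[OF f] test_UNIV[OF g] 3(1,2)] by simp
 qed
 then show "(LINT x|M. f x * pderivs vs g x) = (- 1) ^ length vs * (LINT x|M. pderivs vs f x * g x)"
  by (simp add: test_integral_on[OF open_\<Omega> f test_borel[OF test_pderivs[OF g vb]]]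
    test_integral_on[OF open_\<Omega> test_pderivs[OF f vb] test_borel[OF g]])
qed

lemma has_weak_diff:
 assumes "u \<in> L2 M" "v \<in> L2 M" "g \<in> L2 M" "k \<in> L2 M" "vs \<in> orders2"
  and "has_weak_pderivs \<Omega> vs u g" "has_weak_pderivs \<Omega> vs v k"
 shows "has_weak_pderivs \<Omega> vs (\<lambda>x. u x - v x) (\<lambda>x. g x - k x)" unfolding has_weak_pderivs_def
proof
 fix q :: "'a => complex" assume q: "q \<in> \<D> \<Omega>"
 have L: "q \<in> L2 M" "pderivs vs q \<in> L2 M" using q assms(5) test_L test_pderivs_L by auto
 have "(LINT x|M. (u x - v x) * pderivs vs q x) = (LINT x|M. u x * pderivs vs q x) - (LINT x|M. v x * pderivs vs q x)"
  using assms L by (simp add: left_diff_distrib L2_mult_integrable)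
 moreover have "(LINT x|M. (g x - k x) * q x) = (LINT x|M. g x * q x) - (LINT x|M. k x * q x)"
  using assms L by (simp add: left_diff_distrib L2_mult_integrable)
 ultimately show "(LINT x|M. (u x - v x) * pderivs vs q x) = (- 1) ^ length vs * (LINT x|M. (g x - k x) * q x)"
  using assms(6,7) q by (simp add: has_weak_pderivs_def right_diff_distrib)
qed

lemma test_orthogonal_AE_eq:
 assumes "u \<in> L2 M" "v \<in> L2 M" "\<And>f. f \<in> \<D> \<Omega> ==> (LINT x|M. u x * f x) = (LINT x|M. v x * f x)"
 shows "AE x in M. u x = v x"
proof -
 have "AE x in M. u x - v x = 0"
 proof (rule fundamental_lemma[OF open_\<Omega> L2_diff[OF assms(1,2)]])
  fix f :: "'a => complex" assume f: "f \<in> \<D> \<Omega>"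
  have "(LINT x|M. (u x - v x) * f x) = (LINT x|M. u x * f x) - (LINT x|M. v x * f x)"
   using assms test_L[OF f] by (simp add: left_diff_distrib L2_mult_integrable)
  then show "(LINT x|M. (u x - v x) * f x) = 0" using assms(3)[OF f] by simp
 qed
 then show ?thesis by eventually_elim simp
qed

text \<open>Uniqueness of weak derivatives identifies the choice made in \<open>weak_pderivs\<close>
  with whatever weak derivative is at hand.\<close>

lemma weak_pderivs_AE:
 assumes "g \<in> L2 M" "has_weak_pderivs \<Omega> vs u g"
 shows "weak_pderivs \<Omega> vs u \<in> L2 M" "AE x in M. weak_pderivs \<Omega> vs u x = g x"
proof -
 have *: "weak_pderivs \<Omega> vs u \<in> L2 M \<and> has_weak_pderivs \<Omega> vs u (weak_pderivs \<Omega> vs u)"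
  unfolding weak_pderivs_def by (rule someI[of _ g]) (use assms in blast)
 then show "weak_pderivs \<Omega> vs u \<in> L2 M" by blast
 show "AE x in M. weak_pderivs \<Omega> vs u x = g x"
 proof (rule test_orthogonal_AE_eq)
  fix f :: "'a => complex" assume f: "f \<in> \<D> \<Omega>"
  have "(- 1) ^ length vs * (LINT x|M. weak_pderivs \<Omega> vs u x * f x) = (- 1) ^ length vs * (LINT x|M. g x * f x)"
   using * assms(2) f by (simp add: has_weak_pderivs_def)
  then show "(LINT x|M. weak_pderivs \<Omega> vs u x * f x) = (LINT x|M. g x * f x)" by simp
 qed (use * assms in auto)
qed

lemma weak_pderivs_diff_norm:
 assumes "w \<in> L2 M" "f \<in> \<D> \<Omega>" "vs \<in> orders2" "g \<in> L2 M" "has_weak_pderivs \<Omega> vs w g"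
 shows "nrm (weak_pderivs \<Omega> vs (\<lambda>x. w x - f x)) = nrm (\<lambda>x. pderivs vs f x - g x)"
proof -
 have L: "(\<lambda>x. g x - pderivs vs f x) \<in> L2 M" using assms test_pderivs_L by blast
 have "has_weak_pderivs \<Omega> vs (\<lambda>x. w x - f x) (\<lambda>x. g x - pderivs vs f x)"
  by (rule has_weak_diff) (use assms test_L test_pderivs_L has_weak_test in auto)
 note * = weak_pderivs_AE[OF L this]
 have "nrm (weak_pderivs \<Omega> vs (\<lambda>x. w x - f x)) = nrm (\<lambda>x. g x - pderivs vs f x)"
  by (rule L2_norm_AE_cong[OF *(2) L2_measurable[OF *(1)] L2_measurable[OF L]])
 then show ?thesis by (simp add: L2_norm_minus_commute)
qed

text \<open>Convergence in the Sobolev norm contains that of the pure second derivatives, whose sum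
  is the Laplacian.\<close>

lemma sobolev_0_lap0:
 assumes "w \<in> sobolev_0 2 \<Omega>"
 obtains g where "(w, g) \<in> lap0 \<Omega>"
proof -
 from assms obtain f where w: "w \<in> sobolev 2 \<Omega>" and f: "\<And>n. f n \<in> \<D> \<Omega>"
  and lim: "(\<lambda>n. sobolev_norm 2 \<Omega> (\<lambda>x. w x - f n x)) \<longlonglongrightarrow> 0" by (auto simp: sobolev_0_def)
 have wL: "w \<in> L2 M" using w by (simp add: sobolev_def)
 have tends: "L2_tendsto M (\<lambda>n. pderivs vs (f n)) g" if vs: "vs \<in> orders2" and g: "g \<in> L2 M" "has_weak_pderivs \<Omega> vs w g" for vs g
 proof (rule L2_tendstoI[OF _ lim])
  fix n
  have "(nrm (weak_pderivs \<Omega> vs (\<lambda>x. w x - f n x)))\<^sup>2 \<le>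
    (\<Sum>vs\<in>orders2. (nrm (weak_pderivs \<Omega> vs (\<lambda>x. w x - f n x)))\<^sup>2)" by (rule member_le_sum[OF vs _ orders2_finite]) simp
  then have "nrm (weak_pderivs \<Omega> vs (\<lambda>x. w x - f n x)) \<le> sobolev_norm 2 \<Omega> (\<lambda>x. w x - f n x)"
   unfolding sobolev_norm_def orders2_def by (rule real_le_rsqrt)
  then show "nrm (\<lambda>x. pderivs vs (f n) x - g x) \<le> sobolev_norm 2 \<Omega> (\<lambda>x. w x - f n x)"
   by (simp add: weak_pderivs_diff_norm[OF wL f vs g])
 qed
 have 0: "L2_tendsto M f w"
 proof -
  have "has_weak_pderivs \<Omega> [] w w" by (simp add: has_weak_pderivs_def)
  from tends[OF _ wL this] show ?thesis by (simp add: orders2_def)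
 qed
 have ii: "[i, i] \<in> orders2" if "i \<in> Basis" for i :: 'a using that by (simp add: orders2_def)
 have "\<exists>g. g \<in> L2 M \<and> has_weak_pderivs \<Omega> [i, i] w g" if "i \<in> Basis" for i
  using w ii[OF that] unfolding sobolev_def orders2_def by blast
 then obtain G where G: "\<And>i. i \<in> Basis ==> G i \<in> L2 M" "\<And>i. i \<in> Basis ==> has_weak_pderivs \<Omega> [i, i] w (G i)" by metis
 have "L2_tendsto M (\<lambda>n x. \<Sum>i\<in>Basis. pderivs [i, i] (f n) x) (\<lambda>x. \<Sum>i\<in>Basis. G i x)"
  by (rule L2_tendsto_sum[OF test_pderivs_L[OF f ii] G(1) tends[OF ii G]])
 then have "L2_tendsto M (\<lambda>n. laplacian (f n)) (\<lambda>x. \<Sum>i\<in>Basis. G i x)" by (simp add: laplacian_def[abs_def])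
 then have "(w, \<lambda>x. \<Sum>i\<in>Basis. G i x) \<in> lap0 \<Omega>" by (intro lap0I[OF wL _ f 0] L2_sum G)
 then show ?thesis using that by blast
qed

lemma test_norm_on': "f \<in> \<D> \<Omega> ==> nrm f = lnorm f" by (rule test_norm_on[OF open_\<Omega>])

lemma radius: obtains R where "R \<ge> 0" "\<And>f x. f \<in> \<D> \<Omega> ==> norm x > R ==> f x = 0"
proof -
 obtain R where R: "\<forall>x\<in>\<Omega>. norm x \<le> R" using bounded_\<Omega> by (auto simp: bounded_iff)
 show ?thesis
 proof (rule that[of "\<bar>R\<bar>"])
  fix f :: "'a => complex" and x :: 'a assume "f \<in> \<D> \<Omega>" "norm x > \<bar>R\<bar>"
  moreover have "x \<notin> \<Omega>" using R \<open>norm x > \<bar>R\<bar>\<close> by force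
  ultimately show "f x = 0" by (simp add: test_outside)
 qed simp
qed

text \<open>\<open>norm_laplacian\<close> settles order two and the Poincare argument the lower
  orders; boundedness of \<Omega> gives all supports a common radius.\<close>

lemma test_bounds:
 obtains C where "C > 0" "\<And>f vs. f \<in> \<D> \<Omega> ==> vs \<in> orders2 ==> nrm (pderivs vs f) \<le> C * nrm (laplacian f)"
proof -
 obtain R where R: "R \<ge> 0" "\<And>f x. f \<in> \<D> \<Omega> ==> norm x > R ==> f x = 0" using radius by blast
 obtain C where C: "C > 0" "\<And>f :: 'a => complex. f \<in> \<D> UNIV ==> (\<And>x. norm x > R ==> f x = 0) ==>
  grad_norm f \<le> C * lnorm (laplacian f) \<and> lnorm f \<le> C * lnorm (laplacian f)" using test_norms_le_laplacian[OF R(1)] by blast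
 have "nrm (pderivs vs f) \<le> (C + 1) * nrm (laplacian f)"
  if f: "f \<in> \<D> \<Omega>" and vs: "vs \<in> orders2" for f vs
 proof -
  let ?L = "lnorm (laplacian f)"
  have *: "grad_norm f \<le> C * ?L" "lnorm f \<le> C * ?L" using C(2)[OF test_UNIV[OF f] R(2)[OF f]] by auto
  have L0: "?L \<ge> 0" by simp
  have "lnorm (pderivs vs f) \<le> C * ?L \<or> lnorm (pderivs vs f) \<le> ?L" using vs
  proof (cases rule: orders2_cases)
   case 1
   then show ?thesis using * by simp
  next
   case (2 i)
   then show ?thesis using * norm_pderiv_le_grad_norm[OF 2(1), of f] by simp
  next
   case (3 i j)
   then show ?thesis using norm_mixed_pderivs_le[OF test_UNIV[OF f] 3(1,2)] by simp
  qed
  moreover have "C * ?L \<le> (C + 1) * ?L" "?L \<le> (C + 1) * ?L" using C(1) L0 by (auto simp: distrib_right)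
  ultimately have "lnorm (pderivs vs f) \<le> (C + 1) * ?L" by linarith
  then show ?thesis by (simp add: test_norm_on' test_pderivs[OF f orders2_Basis[OF vs]] test_laplacian[OF f])
 qed
 moreover have "C + 1 > 0" using C by simp
 ultimately show ?thesis using that by blast
qed

text \<open>By \<open>test_bounds\<close>, convergence of the Laplacians of test functions forces
  convergence of all their derivatives up to order two, and the limits are weak derivatives of
  w.\<close>

lemma lap0_sobolev_0:
 assumes wg: "(w, g) \<in> lap0 \<Omega>"
 shows "w \<in> sobolev_0 2 \<Omega>"
proof -
 obtain p where p: "\<And>n. p n \<in> \<D> \<Omega>" "L2_tendsto M p w" "L2_tendsto M (\<lambda>n. laplacian (p n)) g"
  using lap0_sequence[OF wg] by blast
 note wL = lap0_L2(1)[OF wg] and gL = lap0_L2(2)[OF wg]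
 obtain C where C: "C > 0" "\<And>p vs. p \<in> \<D> \<Omega> ==> vs \<in> orders2 ==> nrm (pderivs vs p) \<le> C * nrm (laplacian p)"
  using test_bounds by blast
 have "\<exists>h\<in>L2 M. L2_tendsto M (\<lambda>n. pderivs vs (p n)) h" if vs: "vs \<in> orders2" for vs
 proof (rule Riesz_Fischer)
  fix e :: real assume e: "e > 0"
  obtain N where N: "\<forall>m\<ge>N. \<forall>n\<ge>N. nrm (\<lambda>x. laplacian (p m) x - laplacian (p n) x) < e / C"
   using L2_tendsto_Cauchy[OF test_L[OF test_laplacian[OF p(1)]] gL p(3), of "e / C"] e C(1) by auto
  have "nrm (\<lambda>x. pderivs vs (p m) x - pderivs vs (p n) x) < e" if "m \<ge> N" "n \<ge> N" for m n
  proof -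
   have "nrm (pderivs vs (\<lambda>x. p m x - p n x)) \<le> C * nrm (laplacian (\<lambda>x. p m x - p n x))"
    by (rule C(2)[OF test_diff[OF p(1) p(1)] vs])
   then have "nrm (\<lambda>x. pderivs vs (p m) x - pderivs vs (p n) x) \<le> C * nrm (\<lambda>x. laplacian (p m) x - laplacian (p n) x)"
    by (simp only: pderivs_test_diff[OF p(1) p(1) orders2_Basis[OF vs]] laplacian_test_diff[OF p(1) p(1)])
   moreover have "C * nrm (\<lambda>x. laplacian (p m) x - laplacian (p n) x) < e" using N that C(1) by (simp add: field_simps)
   ultimately show ?thesis by linarith
  qed
  then show "\<exists>N. \<forall>m\<ge>N. \<forall>n\<ge>N. nrm (\<lambda>x. pderivs vs (p m) x - pderivs vs (p n) x) < e" by blast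
 qed (use test_pderivs_L[OF p(1) vs] in auto)
 then have "\<forall>vs. \<exists>h. vs \<in> orders2 \<longrightarrow> h \<in> L2 M \<and> L2_tendsto M (\<lambda>n. pderivs vs (p n)) h" by blast
 then obtain G where G: "\<And>vs. vs \<in> orders2 ==> G vs \<in> L2 M" "\<And>vs. vs \<in> orders2 ==> L2_tendsto M (\<lambda>n. pderivs vs (p n)) (G vs)"
  by metis
 have weak: "has_weak_pderivs \<Omega> vs w (G vs)" if vs: "vs \<in> orders2" for vs unfolding has_weak_pderivs_def
 proof
  fix q :: "'a => complex" assume q: "q \<in> \<D> \<Omega>"
  have lim1: "(\<lambda>n. LINT x|M. p n x * pderivs vs q x) \<longlonglongrightarrow> (LINT x|M. w x * pderivs vs q x)"
   by (rule L2_tendsto_integral[OF test_L[OF p(1)] wL test_pderivs_L[OF q vs] p(2)])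
  have eq: "(LINT x|M. p n x * pderivs vs q x) = (- 1) ^ length vs * (LINT x|M. pderivs vs (p n) x * q x)" for n
   using has_weak_test[OF p(1) vs] q unfolding has_weak_pderivs_def by blast
  have lim2: "(\<lambda>n. (- 1) ^ length vs * (LINT x|M. pderivs vs (p n) x * q x)) \<longlonglongrightarrow> (- 1) ^ length vs * (LINT x|M. G vs x * q x)"
   by (intro tendsto_intros L2_tendsto_integral[OF test_pderivs_L[OF p(1) vs] G(1)[OF vs] test_L[OF q] G(2)[OF vs]])
  show "(LINT x|M. w x * pderivs vs q x) = (- 1) ^ length vs * (LINT x|M. G vs x * q x)" by (rule LIMSEQ_unique[OF lim1[unfolded eq] lim2])
 qed
 have "w \<in> sobolev 2 \<Omega>" unfolding sobolev_def using wL G(1) weak by (auto simp: orders2_def)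
 moreover have "(\<lambda>n. sobolev_norm 2 \<Omega> (\<lambda>x. w x - p n x)) \<longlonglongrightarrow> 0"
 proof -
  have eq: "sobolev_norm 2 \<Omega> (\<lambda>x. w x - p n x) = sqrt (\<Sum>vs\<in>orders2. (nrm (\<lambda>x. pderivs vs (p n) x - G vs x))\<^sup>2)" for n
   unfolding sobolev_norm_def orders2_def[symmetric]
   by (intro arg_cong[where f = sqrt] sum.cong refl) (simp add: weak_pderivs_diff_norm[OF wL p(1) _ G(1) weak])
  have "(\<lambda>n. sqrt (\<Sum>vs\<in>orders2. (nrm (\<lambda>x. pderivs vs (p n) x - G vs x))\<^sup>2)) \<longlonglongrightarrow> sqrt (\<Sum>vs\<in>(orders2 :: 'a list set). 0\<^sup>2)"
   using G(2) unfolding L2_tendsto_def by (intro tendsto_intros)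
  then show ?thesis unfolding eq by simp
 qed
 ultimately show ?thesis unfolding sobolev_0_def using p(1) by blast
qed

section \<open>The Krein Laplacian is self-adjoint\<close>

text \<open>The inverse bound for the Laplacian on H^2_0. The closed range and the continuity of
  functionals of w with respect to \<Delta>w rest on it.\<close>

lemma lap0_bound:
 obtains C where "C > 0" "\<And>w g. (w, g) \<in> lap0 \<Omega> ==> nrm w \<le> C * nrm g"
proof -
 obtain C where C: "C > 0" "\<And>f vs. f \<in> \<D> \<Omega> ==> vs \<in> orders2 ==> nrm (pderivs vs f) \<le> C * nrm (laplacian f)"
  using test_bounds by blast
 have nil: "[] \<in> (orders2 :: 'a list set)" by (simp add: orders2_def)
 have "nrm w \<le> C * nrm g" if wg: "(w, g) \<in> lap0 \<Omega>" for w g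
 proof -
  obtain f where f: "\<And>n. f n \<in> \<D> \<Omega>" "L2_tendsto M f w" "L2_tendsto M (\<lambda>n. laplacian (f n)) g"
   using lap0_sequence[OF wg] by blast
  show ?thesis
  proof (rule LIMSEQ_le)
   show "(\<lambda>n. nrm (f n)) \<longlonglongrightarrow> nrm w" by (rule L2_tendsto_norm[OF test_L[OF f(1)] lap0_L2(1)[OF wg] f(2)])
   show "(\<lambda>n. C * nrm (laplacian (f n))) \<longlonglongrightarrow> C * nrm g"
    by (intro tendsto_intros L2_tendsto_norm[OF test_L[OF test_laplacian[OF f(1)]] lap0_L2(2)[OF wg] f(3)])
   show "\<exists>N. \<forall>n\<ge>N. nrm (f n) \<le> C * nrm (laplacian (f n))" using C(2)[OF f(1) nil] by simp
  qed
 qed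
 with C(1) that show ?thesis by blast
qed

lemma lap0_symmetric:
 assumes wg: "(w, g) \<in> lap0 \<Omega>" and vk: "(v, k) \<in> lap0 \<Omega>"
 shows "ip M g v = ip M w k"
proof -
 obtain f where f: "\<And>n. f n \<in> \<D> \<Omega>" "L2_tendsto M f w" "L2_tendsto M (\<lambda>n. laplacian (f n)) g"
  using lap0_sequence[OF wg] by blast
 obtain q where q: "\<And>n. q n \<in> \<D> \<Omega>" "L2_tendsto M q v" "L2_tendsto M (\<lambda>n. laplacian (q n)) k"
  using lap0_sequence[OF vk] by blast
 have "ip M (laplacian (f n)) (q n) = ip M (f n) (laplacian (q n))" for n
 proof -
  note c = test_cnj[OF q(1)[of n]]
  have "ip M (laplacian (f n)) (q n) = (LINT x|lborel. laplacian (f n) x * cnj (q n x))"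
   unfolding ip_def by (rule test_integral_on[OF open_\<Omega> test_laplacian[OF f(1)] test_borel[OF c]])
  also have "\<dots> = (LINT x|lborel. f n x * laplacian (\<lambda>x. cnj (q n x)) x)"
   by (rule integral_laplacian[OF test_UNIV[OF f(1)] test_UNIV[OF c]])
  also have "\<dots> = ip M (f n) (laplacian (q n))"
   unfolding ip_def using test_integral_on[OF open_\<Omega> f(1) test_borel[OF test_laplacian[OF c]], of n] by (simp add: laplacian_test_cnj[OF q(1)])
  finally show ?thesis .
 qed
 moreover have "(\<lambda>n. ip M (laplacian (f n)) (q n)) \<longlonglongrightarrow> ip M g v"
  by (rule L2_tendsto_ip[OF test_L[OF test_laplacian[OF f(1)]] test_L[OF q(1)] lap0_L2(2)[OF wg] lap0_L2(1)[OF vk] f(3) q(2)])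
 moreover have "(\<lambda>n. ip M (f n) (laplacian (q n))) \<longlonglongrightarrow> ip M w k"
  by (rule L2_tendsto_ip[OF test_L[OF f(1)] test_L[OF test_laplacian[OF q(1)]] lap0_L2(1)[OF wg] lap0_L2(2)[OF vk] f(2) q(3)])
 ultimately show ?thesis using LIMSEQ_unique by simp
qed

lemma lap0_weak_laplacian:
 assumes wg: "(w, g) \<in> lap0 \<Omega>" and q: "q \<in> \<D> \<Omega>"
 shows "(LINT x|M. w x * laplacian q x) = (LINT x|M. g x * q x)" using lap0_symmetric[OF wg lap0_test[OF open_\<Omega> test_cnj[OF q]]]
 by (simp add: ip_def laplacian_test_cnj[OF q])

lemma harmonic_L2D: "h \<in> harmonic_L2 \<Omega> ==> h \<in> L2 M" by (simp add: harmonic_L2_def)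

text \<open>Test functions are stable under conjugation, so weak harmonicity, stated with a bilinear
  pairing, becomes orthogonality to the Laplacians of test functions.\<close>

lemma harmonic_L2_iff:
 "h \<in> harmonic_L2 \<Omega> \<longleftrightarrow> h \<in> L2 M \<and> (\<forall>f\<in>\<D> \<Omega>. ip M (laplacian f) h = 0)"
proof -
 have *: "ip M (laplacian f) h = cnj (LINT x|M. h x * laplacian (\<lambda>x. cnj (f x)) x)" if "f \<in> \<D> \<Omega>" for f
  unfolding laplacian_test_cnj[OF that] ip_cnj[of M h "laplacian f", symmetric] by (simp add: ip_def)
 show ?thesis unfolding harmonic_L2_def has_weak_laplacian_def mem_Collect_eq
 proof (intro conj_cong refl iffI ballI)
  fix f :: "'a => complex" assume h: "\<forall>f\<in>\<D> \<Omega>. (LINT x|M. h x * laplacian f x) = (LINT x|M. 0 * f x)" and f: "f \<in> \<D> \<Omega>"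
  show "ip M (laplacian f) h = 0" unfolding *[OF f] using h test_cnj[OF f] by simp
 next
  fix f :: "'a => complex" assume h: "\<forall>f\<in>\<D> \<Omega>. ip M (laplacian f) h = 0" and f: "f \<in> \<D> \<Omega>"
  have "cnj (LINT x|M. h x * laplacian f x) = 0" using *[OF test_cnj[OF f]] h test_cnj[OF f] by simp
  then show "(LINT x|M. h x * laplacian f x) = (LINT x|M. 0 * f x)" by simp
 qed
qed

lemma lap0_harmonic:
 assumes wg: "(w, g) \<in> lap0 \<Omega>" and h: "h \<in> harmonic_L2 \<Omega>"
 shows "ip M g h = 0"
proof -
 obtain f where f: "\<And>n. f n \<in> \<D> \<Omega>" "L2_tendsto M f w" "L2_tendsto M (\<lambda>n. laplacian (f n)) g"
  using lap0_sequence[OF wg] by blast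
 note hL = harmonic_L2D[OF h]
 have "(\<lambda>n. ip M (laplacian (f n)) h) \<longlonglongrightarrow> ip M g h"
  by (rule L2_tendsto_ip[OF test_L[OF test_laplacian[OF f(1)]] hL lap0_L2(2)[OF wg] hL f(3) L2_tendsto_const])
 moreover have "ip M (laplacian (f n)) h = 0" for n using h f(1) by (simp add: harmonic_L2_iff)
 ultimately show ?thesis by (simp add: LIMSEQ_const_iff)
qed

lemma harmonic_I:
 assumes "h \<in> L2 M" "\<And>w g. (w, g) \<in> lap0 \<Omega> ==> ip M g h = 0"
 shows "h \<in> harmonic_L2 \<Omega>" using assms(1) assms(2)[OF lap0_test[OF open_\<Omega>]] by (simp add: harmonic_L2_iff)

text \<open>By \<open>lap0_bound\<close> the preimages of a convergent sequence in the range are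
  Cauchy, and the graph is closed.\<close>

lemma lap0_range_closed: "closed_subspace M {g. \<exists>w. (w, g) \<in> lap0 \<Omega>}" unfolding closed_subspace_def
proof (intro conjI ballI allI impI)
 show "{g. \<exists>w. (w, g) \<in> lap0 \<Omega>} \<subseteq> L2 M" using lap0_L2(2) by auto
 show "(\<lambda>x. 0) \<in> {g. \<exists>w. (w, g) \<in> lap0 \<Omega>}" using lap0_scale[OF lap0_test[OF open_\<Omega> test_zero], of 0] by auto
next
 fix u v assume "u \<in> {g. \<exists>w. (w, g) \<in> lap0 \<Omega>}" "v \<in> {g. \<exists>w. (w, g) \<in> lap0 \<Omega>}"
 then show "(\<lambda>x. u x + v x) \<in> {g. \<exists>w. (w, g) \<in> lap0 \<Omega>}" using lap0_add[OF open_\<Omega>] by blast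
next
 fix c u assume "u \<in> {g. \<exists>w. (w, g) \<in> lap0 \<Omega>}"
 then show "(\<lambda>x. c * u x) \<in> {g. \<exists>w. (w, g) \<in> lap0 \<Omega>}" using lap0_scale by blast
next
 fix g f assume f: "f \<in> L2 M" and g: "\<forall>n :: nat. g n \<in> {g. \<exists>w. (w, g) \<in> lap0 \<Omega>}" and lim: "L2_tendsto M g f"
 have "\<forall>n. \<exists>w. (w, g n) \<in> lap0 \<Omega>" using g by simp
 then obtain w where w: "\<And>n. (w n, g n) \<in> lap0 \<Omega>" by metis
 obtain C where C: "C > 0" "\<And>w g. (w, g) \<in> lap0 \<Omega> ==> nrm w \<le> C * nrm g" using lap0_bound by blast
 have "\<exists>u\<in>L2 M. L2_tendsto M w u"
 proof (rule Riesz_Fischer)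
  fix e :: real assume "e > 0"
  then obtain N where N: "\<forall>m\<ge>N. \<forall>n\<ge>N. nrm (\<lambda>x. g m x - g n x) < e / C"
   using L2_tendsto_Cauchy[OF lap0_L2(2)[OF w] f lim, of "e / C"] C(1) by auto
  have "nrm (\<lambda>x. w m x - w n x) < e" if "m \<ge> N" "n \<ge> N" for m n
  proof -
   have "C * nrm (\<lambda>x. g m x - g n x) < e" using N that C(1) by (simp add: field_simps)
   then show ?thesis using C(2)[OF lap0_diff[OF open_\<Omega> w w], of m n] by linarith
  qed
  then show "\<exists>N. \<forall>m\<ge>N. \<forall>n\<ge>N. nrm (\<lambda>x. w m x - w n x) < e" by blast
 qed (rule lap0_L2(1)[OF w])
 then obtain u where "u \<in> L2 M" "L2_tendsto M w u" by blast
 then show "f \<in> {g. \<exists>w. (w, g) \<in> lap0 \<Omega>}" using lap0_closed[OF open_\<Omega> w _ f _ lim] by blast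
qed

text \<open>Project onto the closed range of the Laplacian on H^2_0; what is orthogonal to that
  range is weakly harmonic.\<close>

lemma harmonic_decomposition:
 assumes f: "f \<in> L2 M"
 obtains w g where "(w, g) \<in> lap0 \<Omega>" "(\<lambda>x. f x - g x) \<in> harmonic_L2 \<Omega>"
proof -
 obtain g where g: "\<exists>w. (w, g) \<in> lap0 \<Omega>" "\<And>t. \<exists>w. (w, t) \<in> lap0 \<Omega> ==> ip M (\<lambda>x. f x - g x) t = 0"
  using L2_projection[OF lap0_range_closed f] by blast
 then obtain w where w: "(w, g) \<in> lap0 \<Omega>" by blast
 have "(\<lambda>x. f x - g x) \<in> harmonic_L2 \<Omega>"
 proof (rule harmonic_I)
  show "(\<lambda>x. f x - g x) \<in> L2 M" using f lap0_L2[OF w] by blast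
  fix v k assume "(v, k) \<in> lap0 \<Omega>"
  then have "ip M (\<lambda>x. f x - g x) k = 0" using g(2) by blast
  then show "ip M k (\<lambda>x. f x - g x) = 0" using ip_cnj[of M "\<lambda>x. f x - g x" k] by simp
 qed
 with w that show ?thesis by blast
qed

text \<open>K sees only the H^2_0 component, on which it is - \<Delta>; the harmonic component is
  invisible to it. Equality holds almost everywhere because a weak Laplacian is determined only up
  to null sets.\<close>

lemma krein_laplacian_iff:
 "(u, f) \<in> krein_laplacian \<Omega> \<longleftrightarrow> u \<in> L2 M \<and> f \<in> L2 M \<and>
   (\<exists>w g. (w, g) \<in> lap0 \<Omega> \<and> (\<lambda>x. u x - w x) \<in> harmonic_L2 \<Omega> \<and> (AE x in M. f x = - g x))"
proof
 assume "(u, f) \<in> krein_laplacian \<Omega>"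
 then obtain h w where u: "u = (\<lambda>x. h x + w x)" and h: "h \<in> harmonic_L2 \<Omega>" and w: "w \<in> sobolev_0 2 \<Omega>"
  and f: "f \<in> L2 M" "has_weak_laplacian \<Omega> u (\<lambda>x. - f x)" by (auto simp: krein_laplacian_def krein_domain_def)
 obtain g where wg: "(w, g) \<in> lap0 \<Omega>" using sobolev_0_lap0[OF w] by blast
 note hL = harmonic_L2D[OF h] and wL = lap0_L2[OF wg]
 have "AE x in M. - f x = g x"
 proof (rule test_orthogonal_AE_eq[OF L2_uminus[OF f(1)] wL(2)])
  fix p :: "'a => complex" assume p: "p \<in> \<D> \<Omega>"
  note pL = test_L[OF test_laplacian[OF p]]
  have "(LINT x|M. - f x * p x) = (LINT x|M. u x * laplacian p x)" using f(2) p by (simp add: has_weak_laplacian_def)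
  also have "\<dots> = (LINT x|M. h x * laplacian p x) + (LINT x|M. w x * laplacian p x)"
   unfolding u using hL wL pL by (simp add: distrib_right L2_mult_integrable)
  also have "(LINT x|M. h x * laplacian p x) = 0" using h p by (simp add: harmonic_L2_def has_weak_laplacian_def)
  also have "(LINT x|M. w x * laplacian p x) = (LINT x|M. g x * p x)" by (rule lap0_weak_laplacian[OF wg p])
  finally show "(LINT x|M. - f x * p x) = (LINT x|M. g x * p x)" by simp
 qed
 then have "AE x in M. f x = - g x" by eventually_elim (simp add: minus_equation_iff eq_commute)
 moreover have "u \<in> L2 M" unfolding u using hL wL by blast
 moreover have "(\<lambda>x. u x - w x) \<in> harmonic_L2 \<Omega>" using h by (simp add: u)
 ultimately show "u \<in> L2 M \<and> f \<in> L2 M \<and>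
   (\<exists>w g. (w, g) \<in> lap0 \<Omega> \<and> (\<lambda>x. u x - w x) \<in> harmonic_L2 \<Omega> \<and> (AE x in M. f x = - g x))"
  using f wg by blast
next
 assume "u \<in> L2 M \<and> f \<in> L2 M \<and>
   (\<exists>w g. (w, g) \<in> lap0 \<Omega> \<and> (\<lambda>x. u x - w x) \<in> harmonic_L2 \<Omega> \<and> (AE x in M. f x = - g x))"
 then obtain w g where u: "u \<in> L2 M" and f: "f \<in> L2 M" and wg: "(w, g) \<in> lap0 \<Omega>"
  and h: "(\<lambda>x. u x - w x) \<in> harmonic_L2 \<Omega>" and AE: "AE x in M. f x = - g x" by blast
 have "u = (\<lambda>x. (u x - w x) + w x)" by auto
 then have "\<exists>h w. u = (\<lambda>x. h x + w x) \<and> h \<in> harmonic_L2 \<Omega> \<and> w \<in> sobolev_0 2 \<Omega>"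
  by (intro exI[of _ "\<lambda>x. u x - w x"] exI[of _ w] conjI h lap0_sobolev_0[OF wg])
 then have dom: "u \<in> krein_domain \<Omega>" by (simp only: krein_domain_def mem_Collect_eq)
 note hL = harmonic_L2D[OF h] and wL = lap0_L2[OF wg]
 have "has_weak_laplacian \<Omega> u (\<lambda>x. - f x)" unfolding has_weak_laplacian_def
 proof
  fix p :: "'a => complex" assume p: "p \<in> \<D> \<Omega>"
  note pL = test_L[OF test_laplacian[OF p]]
  have "(LINT x|M. u x * laplacian p x) = (LINT x|M. (u x - w x) * laplacian p x + w x * laplacian p x)" by (simp add: algebra_simps)
  also have "\<dots> = (LINT x|M. (u x - w x) * laplacian p x) + (LINT x|M. w x * laplacian p x)"
   by (rule Bochner_Integration.integral_add) (intro L2_mult_integrable hL wL pL)+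
  also have "(LINT x|M. (u x - w x) * laplacian p x) = 0" using h p by (simp add: harmonic_L2_def has_weak_laplacian_def)
  also have "(LINT x|M. w x * laplacian p x) = (LINT x|M. g x * p x)" by (rule lap0_weak_laplacian[OF wg p])
  also have "(LINT x|M. g x * p x) = (LINT x|M. - f x * p x)"
  proof (rule integral_cong_AE)
   show "AE x in M. g x * p x = - f x * p x" using AE by eventually_elim simp
  qed (intro borel_measurable_times borel_measurable_uminus L2_measurable[OF wL(2)] L2_measurable[OF f] L2_measurable[OF test_L[OF p]])+
  finally show "(LINT x|M. u x * laplacian p x) = (LINT x|M. - f x * p x)" by simp
 qed
 then show "(u, f) \<in> krein_laplacian \<Omega>" using dom f by (simp add: krein_laplacian_def)
qed

lemma ip_uminus_AE:
 assumes "AE x in M. f x = - g x" "f \<in> L2 M" "g \<in> L2 M" "v \<in> L2 M"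
 shows "ip M f v = - ip M g v" "ip M v f = - ip M v g"
proof -
 have "ip M f v = ip M (\<lambda>x. - g x) v" "ip M v f = ip M v (\<lambda>x. - g x)"
  by (rule ip_AE_cong; use assms in \<open>auto intro!: L2_measurable\<close>)+
 then show "ip M f v = - ip M g v" "ip M v f = - ip M v g" by (simp_all add: ip_uminus_left ip_uminus_right)
qed

text \<open>For maximality, testing the adjoint relation with harmonic functions shows that k is
  orthogonal to them, so k = \<Delta>w almost everywhere for some w in H^2_0. Testing with H^2_0
  functions then shows that v + w is harmonic, which puts v into the domain.\<close>

lemma krein_self_adjoint: "self_adjoint M (krein_laplacian \<Omega>)"
proof
 show "krein_laplacian \<Omega> \<subseteq> L2 M \<times> L2 M" using krein_laplacian_iff by auto
next
 fix u f v k assume "(u, f) \<in> krein_laplacian \<Omega>" "(v, k) \<in> krein_laplacian \<Omega>"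
 then obtain w g w' g' where u: "u \<in> L2 M" "f \<in> L2 M" and v: "v \<in> L2 M" "k \<in> L2 M"
  and wg: "(w, g) \<in> lap0 \<Omega>" and h: "(\<lambda>x. u x - w x) \<in> harmonic_L2 \<Omega>" and f: "AE x in M. f x = - g x"
  and wg': "(w', g') \<in> lap0 \<Omega>" and h': "(\<lambda>x. v x - w' x) \<in> harmonic_L2 \<Omega>" and k: "AE x in M. k x = - g' x"
  unfolding krein_laplacian_iff by blast
 note L = lap0_L2[OF wg] lap0_L2[OF wg']
 have "ip M g v = ip M g w'" using lap0_harmonic[OF wg h'] ip_diff_right[OF v(1) L(3) L(2)] by simp
 moreover have "ip M u g' = ip M w g'"
 proof -
  have "ip M (\<lambda>x. u x - w x) g' = 0" using lap0_harmonic[OF wg' h] ip_cnj[of M g' "\<lambda>x. u x - w x"] by simp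
  then show ?thesis using ip_diff_left[OF u(1) L(1) L(4)] by simp
 qed
 ultimately show "ip M f v = ip M u k"
  using lap0_symmetric[OF wg wg'] ip_uminus_AE(1)[OF f u(2) L(2) v(1)] ip_uminus_AE(2)[OF k v(2) L(4) u(1)] by simp
next
 fix v k assume v: "v \<in> L2 M" and k: "k \<in> L2 M"
  and adj: "\<And>u f. (u, f) \<in> krein_laplacian \<Omega> ==> ip M f v = ip M u k"
 have k_harm: "ip M h k = 0" if h: "h \<in> harmonic_L2 \<Omega>" for h
 proof -
  have "((\<lambda>x. 0), (\<lambda>x. 0)) \<in> lap0 \<Omega>" using lap0_scale[OF lap0_test[OF open_\<Omega> test_zero], of 0] by simp
  then have "(h, \<lambda>x. 0) \<in> krein_laplacian \<Omega>" unfolding krein_laplacian_iff using h harmonic_L2D[OF h]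
   by (intro conjI exI[of _ "\<lambda>x. 0"]) auto
  from adj[OF this] show ?thesis by simp
 qed
 obtain w g where wg: "(w, g) \<in> lap0 \<Omega>" and h: "(\<lambda>x. k x - g x) \<in> harmonic_L2 \<Omega>"
  using harmonic_decomposition[OF k] by blast
 note L = lap0_L2[OF wg] and hL = harmonic_L2D[OF h]
 have "ip M (\<lambda>x. k x - g x) g = 0" using lap0_harmonic[OF wg h] ip_cnj[of M g "\<lambda>x. k x - g x"] by simp
 then have "ip M (\<lambda>x. k x - g x) (\<lambda>x. k x - g x) = 0" using k_harm[OF h] ip_diff_right[OF k L(2) hL] by simp
 then have "AE x in M. k x - g x = 0" using L2_norm_eq_0_iff[OF hL] by (simp add: ip_self)
 then have kg: "AE x in M. k x = g x" by eventually_elim simp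
 have sum: "(\<lambda>x. v x + w x) \<in> harmonic_L2 \<Omega>"
 proof (rule harmonic_I)
  show "(\<lambda>x. v x + w x) \<in> L2 M" using v L by blast
  fix w' g' assume wg': "(w', g') \<in> lap0 \<Omega>"
  note L' = lap0_L2[OF wg']
  have zero: "(\<lambda>x. w' x - w' x) \<in> harmonic_L2 \<Omega>" by (simp add: harmonic_L2_iff)
  have "(w', \<lambda>x. - g' x) \<in> krein_laplacian \<Omega>"
   unfolding krein_laplacian_iff using L' wg' zero by (intro conjI exI[of _ w'] exI[of _ g']) auto
  from adj[OF this] have "- ip M g' v = ip M w' k" by (simp add: ip_uminus_left)
  also have "\<dots> = ip M w' g" by (rule ip_AE_cong) (use kg k L L' in \<open>auto intro!: L2_measurable\<close>)
  also have "\<dots> = ip M g' w" using lap0_symmetric[OF wg' wg] by simp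
  finally have "ip M g' w = - ip M g' v" ..
  then show "ip M g' (\<lambda>x. v x + w x) = 0" using ip_add_right[OF v L(1) L'(2)] by simp
 qed
 \<comment> \<open>The H^2_0 component of \<open>v\<close> is - w, in accordance with the minus sign
   in K.\<close>
 have mw: "((\<lambda>x. - 1 * w x), (\<lambda>x. - 1 * g x)) \<in> lap0 \<Omega>" by (rule lap0_scale[OF wg])
 have "(\<lambda>x. v x - - 1 * w x) \<in> harmonic_L2 \<Omega>" using sum by simp
 moreover have "AE x in M. k x = - (- 1 * g x)" using kg by eventually_elim simp
 ultimately show "(v, k) \<in> krein_laplacian \<Omega>" unfolding krein_laplacian_iff using v k mw by blast
qed

text \<open>By \<open>lap0_bound\<close> the functional sending \<Delta>w to the inner product of w
  with \<open>r\<close> is well defined and continuous; \<open>r'\<close> is its Riesz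
  representative, a multiple of the component of some \<open>g0\<close> orthogonal to the closure of
  the kernel. It converts functionals of w into functionals of \<Delta>w.\<close>

lemma lap0_functional:
 assumes r: "r \<in> L2 M"
 obtains r' where "r' \<in> L2 M" "\<And>w g. (w, g) \<in> lap0 \<Omega> ==> ip M w r = ip M g r'"
proof (cases "\<forall>(w, g)\<in>lap0 \<Omega>. ip M w r = 0")
 case True
 show ?thesis by (rule that[of "\<lambda>x. 0"]) (use True in auto)
next
 case False
 then obtain w0 g0 where w0: "(w0, g0) \<in> lap0 \<Omega>" "ip M w0 r \<noteq> 0" by blast
 define N where "N = {g. \<exists>w. (w, g) \<in> lap0 \<Omega> \<and> ip M w r = 0}"
 obtain C where C: "C > 0" "\<And>w g. (w, g) \<in> lap0 \<Omega> ==> nrm w \<le> C * nrm g" using lap0_bound by blast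
 have "closed_subspace M (L2_closure M N)"
 proof (rule closed_subspace_closure)
  show "N \<subseteq> L2 M" using lap0_L2(2) by (auto simp: N_def)
  show "(\<lambda>x. 0) \<in> N" unfolding N_def using lap0_scale[OF w0(1), of 0] by (auto intro!: exI[of _ "\<lambda>x. 0"])
  show "(\<lambda>x. u x + v x) \<in> N" if uv: "u \<in> N" "v \<in> N" for u v
  proof -
   obtain w w' where *: "(w, u) \<in> lap0 \<Omega>" "ip M w r = 0" "(w', v) \<in> lap0 \<Omega>" "ip M w' r = 0" using uv by (auto simp: N_def)
   have "ip M (\<lambda>x. w x + w' x) r = 0" using ip_add_left[OF lap0_L2(1)[OF *(1)] lap0_L2(1)[OF *(3)] r] * by simp
   then show ?thesis unfolding N_def using lap0_add[OF open_\<Omega> *(1,3)] by blast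
  qed
  show "(\<lambda>x. c * u x) \<in> N" if u: "u \<in> N" for c u
  proof -
   obtain w where *: "(w, u) \<in> lap0 \<Omega>" "ip M w r = 0" using u by (auto simp: N_def)
   have "ip M (\<lambda>x. c * w x) r = 0" using * by (simp add: ip_scale_left)
   then show ?thesis unfolding N_def using lap0_scale[OF *(1), of c] by blast
  qed
 qed
 then obtain p where p: "p \<in> L2_closure M N" "\<And>t. t \<in> L2_closure M N ==> ip M (\<lambda>x. g0 x - p x) t = 0"
  using L2_projection[OF _ lap0_L2(2)[OF w0(1)]] by blast
 have NL: "N \<subseteq> L2 M" using lap0_L2(2) by (auto simp: N_def)
 have pL: "p \<in> L2 M" using p(1) by (simp add: L2_closure_def)
 note gL = lap0_L2(2)[OF w0(1)]
 let ?q = "\<lambda>x. g0 x - p x"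
 have qL: "?q \<in> L2 M" using gL pL by blast
 have q_orth: "ip M t ?q = 0" if "t \<in> N" for t
 proof -
  have "t \<in> L2_closure M N" using that NL by (auto simp: L2_closure_def intro!: exI[of _ "\<lambda>_. t"])
  from p(2)[OF this] show ?thesis using ip_cnj[of M ?q t] by simp
 qed
 have key: "ip M g ?q = (ip M w r / ip M w0 r) * ip M g0 ?q" if wg: "(w, g) \<in> lap0 \<Omega>" for w g
 proof -
  define c where "c = ip M w r / ip M w0 r"
  have "ip M (\<lambda>x. w x - c * w0 x) r = 0"
   using w0(2) by (simp only: ip_diff_left[OF lap0_L2(1)[OF wg] L2_scale[OF lap0_L2(1)[OF w0(1)]] r] ip_scale_left) (simp add: c_def)
  then have "(\<lambda>x. g x - c * g0 x) \<in> N" unfolding N_def using lap0_diff[OF open_\<Omega> wg lap0_scale[OF w0(1), of c]] by blast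
  from q_orth[OF this] have "ip M g ?q - c * ip M g0 ?q = 0" by (simp only: ip_diff_left[OF lap0_L2(2)[OF wg] L2_scale[OF gL] qL] ip_scale_left)
  then show ?thesis by (simp add: c_def)
 qed
 \<comment> \<open>Otherwise \<open>g0\<close> would be a limit of elements of the kernel, and by
   continuity the functional would vanish at \<open>g0\<close>.\<close>
 have nz: "ip M g0 ?q \<noteq> 0"
 proof
  assume 0: "ip M g0 ?q = 0"
  have "ip M p ?q = 0" using p(2)[OF p(1)] ip_cnj[of M ?q p] by simp
  then have "ip M ?q ?q = 0" using 0 ip_diff_left[OF gL pL qL] by simp
  then have q0: "nrm ?q = 0" by (simp add: ip_self)
  obtain s where s: "\<And>n. s n \<in> N" "L2_tendsto M s p" using p(1) by (auto simp: L2_closure_def)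
  have "\<forall>n. \<exists>w. (w, s n) \<in> lap0 \<Omega> \<and> ip M w r = 0" using s(1) by (simp add: N_def)
  then obtain w where w: "\<And>n. (w n, s n) \<in> lap0 \<Omega>" "\<And>n. ip M (w n) r = 0" by metis
  have le: "cmod (ip M w0 r) \<le> C * nrm (\<lambda>x. s n x - p x) * nrm r" for n
  proof -
   have "ip M w0 r = ip M (\<lambda>x. w0 x - w n x) r" using ip_diff_left[OF lap0_L2(1)[OF w0(1)] lap0_L2(1)[OF w(1)] r, of n] w(2) by simp
   also have "cmod \<dots> \<le> nrm (\<lambda>x. w0 x - w n x) * nrm r"
    by (rule L2_Cauchy_Schwarz[OF L2_diff[OF lap0_L2(1)[OF w0(1)] lap0_L2(1)[OF w(1)]] r])
   also have "\<dots> \<le> (C * nrm (\<lambda>x. g0 x - s n x)) * nrm r"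
    by (intro mult_right_mono C(2)[OF lap0_diff[OF open_\<Omega> w0(1) w(1)]]) simp
   also have "nrm (\<lambda>x. g0 x - s n x) \<le> nrm ?q + nrm (\<lambda>x. p x - s n x)"
    by (rule L2_norm_dist_triangle[OF gL pL lap0_L2(2)[OF w(1)]])
   finally show ?thesis using q0 C(1) by (simp add: L2_norm_minus_commute[of M p] mult_right_mono)
  qed
  have "(\<lambda>n. C * nrm (\<lambda>x. s n x - p x) * nrm r) \<longlonglongrightarrow> C * 0 * nrm r"
   by (intro tendsto_intros s(2)[unfolded L2_tendsto_def])
  then have "cmod (ip M w0 r) \<le> C * 0 * nrm r" by (rule LIMSEQ_le_const) (use le in blast)
  then show False using w0(2) by simp
 qed
 define a where "a = cnj (ip M w0 r / ip M g0 ?q)"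
 show ?thesis
 proof (rule that[of "\<lambda>x. a * ?q x"])
  show "(\<lambda>x. a * ?q x) \<in> L2 M" using qL by (rule L2_scale)
  fix w g assume "(w, g) \<in> lap0 \<Omega>"
  from key[OF this] show "ip M w r = ip M g (\<lambda>x. a * ?q x)" using nz w0(2) unfolding ip_scale_right by (simp add: a_def)
 qed
qed

end

section \<open>Bounded real potentials preserve self-adjointness\<close>

lemma (in self_adjoint) add_potential_self_adjoint:
 assumes V: "V \<in> borel_measurable M" and bd: "\<And>x. x \<in> space M ==> \<bar>V x\<bar> \<le> C"
 shows "self_adjoint M (add_potential T V)"
  and "(u, f) \<in> add_potential T V \<longleftrightarrow> (u, \<lambda>x. f x - cor (V x) * u x) \<in> T"
proof -
 have VL: "(\<lambda>x. cor (V x) * u x) \<in> L2 M" if "u \<in> L2 M" for u by (rule L2_mult_bounded[OF that, of _ C]) (use V bd in auto)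
 have sym: "ip M (\<lambda>x. cor (V x) * u x) v = ip M u (\<lambda>x. cor (V x) * v x)" for u v unfolding ip_def by (simp add: mult_ac)
 have iff: "(u, f) \<in> add_potential T V \<longleftrightarrow> (u, \<lambda>x. f x - cor (V x) * u x) \<in> T" for u f
 proof
  assume "(u, f) \<in> add_potential T V"
  then obtain f0 where "(u, f0) \<in> T" "f = (\<lambda>x. f0 x + cor (V x) * u x)" by (auto simp: add_potential_def)
  then show "(u, \<lambda>x. f x - cor (V x) * u x) \<in> T" by simp
 next
  assume "(u, \<lambda>x. f x - cor (V x) * u x) \<in> T"
  then have "(u, \<lambda>x. (f x - cor (V x) * u x) + cor (V x) * u x) \<in> add_potential T V"
   unfolding add_potential_def by (intro CollectI exI conjI) (rule refl)
  then show "(u, f) \<in> add_potential T V" by simp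
 qed
 then show "(u, f) \<in> add_potential T V \<longleftrightarrow> (u, \<lambda>x. f x - cor (V x) * u x) \<in> T" .
 have L: "u \<in> L2 M" "f \<in> L2 M" if "(u, f) \<in> add_potential T V" for u f
 proof -
  have *: "(u, \<lambda>x. f x - cor (V x) * u x) \<in> T" by (rule iff[THEN iffD1, OF that])
  show "u \<in> L2 M" by (rule L2D(1)[OF *])
  from L2_add[OF L2D(2)[OF *] VL[OF this]] show "f \<in> L2 M" by simp
 qed
 show "self_adjoint M (add_potential T V)"
 proof
  show "add_potential T V \<subseteq> L2 M \<times> L2 M" using L by auto
 next
  fix u f v k assume uf: "(u, f) \<in> add_potential T V" and vk: "(v, k) \<in> add_potential T V"
  have "ip M (\<lambda>x. f x - cor (V x) * u x) v = ip M u (\<lambda>x. k x - cor (V x) * v x)"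
   by (rule symmetric[OF iff[THEN iffD1, OF uf] iff[THEN iffD1, OF vk]])
  then show "ip M f v = ip M u k" using ip_diff_left[OF L(2)[OF uf] VL[OF L(1)[OF uf]] L(1)[OF vk]]
    ip_diff_right[OF L(2)[OF vk] VL[OF L(1)[OF vk]] L(1)[OF uf]] sym[of u v] by simp
 next
  fix v k assume v: "v \<in> L2 M" and k: "k \<in> L2 M" and adj: "\<And>u f. (u, f) \<in> add_potential T V ==> ip M f v = ip M u k"
  have "(v, \<lambda>x. k x - cor (V x) * v x) \<in> T"
  proof (rule maximal[OF v L2_diff[OF k VL[OF v]]])
   fix u f assume uf: "(u, f) \<in> T"
   then have "(u, \<lambda>x. f x + cor (V x) * u x) \<in> add_potential T V" unfolding add_potential_def by (intro CollectI exI conjI) (rule refl)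
   from adj[OF this] show "ip M f v = ip M u (\<lambda>x. k x - cor (V x) * v x)"
    using ip_add_left[OF L2D(2)[OF uf] VL[OF L2D(1)[OF uf]] v] ip_diff_right[OF k VL[OF v] L2D(1)[OF uf]] sym[of u v] by (simp add: algebra_simps)
  qed
  then show "(v, k) \<in> add_potential T V" by (rule iff[THEN iffD2])
 qed
qed

section \<open>Interior compactness of harmonic functions\<close>

lemma smooth_pderiv_2:
 fixes f g :: "'a::euclidean_space => complex"
 assumes f: "smooth f" and g: "smooth g" and i: "i \<in> Basis"
 shows "pderivs [i, i] (\<lambda>x. f x * g x) x =
  f x * pderivs [i, i] g x + 2 * (pderivs [i] f x * pderivs [i] g x) + pderivs [i, i] f x * g x"
proof -
 have s: "smooth (pderivs [i] f)" "smooth (pderivs [i] g)" using smooth_pderivs[OF f] smooth_pderivs[OF g] i by auto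
 have "pderivs [i, i] (\<lambda>x. f x * g x) = pderivs [i] (\<lambda>x. f x * pderivs [i] g x + pderivs [i] f x * g x)"
  unfolding pderivs_pderivs[symmetric] pderiv_mult[OF f g] ..
 also have "\<dots> = (\<lambda>x. pderivs [i] (\<lambda>x. f x * pderivs [i] g x) x + pderivs [i] (\<lambda>x. pderivs [i] f x * g x) x)"
  by (rule smooth_pderivs_add(2)[OF smooth_mult[OF f s(2)] smooth_mult[OF s(1) g]]) (use i in auto)
 also have "\<dots> = (\<lambda>x. (f x * pderivs [i, i] g x + pderivs [i] f x * pderivs [i] g x) +
   (pderivs [i] f x * pderivs [i] g x + pderivs [i, i] f x * g x))" unfolding pderiv_mult[OF f s(2)] pderiv_mult[OF s(1) g] pderivs_pderivs ..
 finally show ?thesis by (simp add: algebra_simps)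
qed

lemma laplacian_mult:
 fixes f g :: "'a::euclidean_space => complex"
 assumes "smooth f" "smooth g"
 shows "laplacian (\<lambda>x. f x * g x) x =
  f x * laplacian g x + 2 * (\<Sum>i\<in>Basis. pderivs [i] f x * pderivs [i] g x) + laplacian f x * g x" unfolding laplacian_def
 by (simp add: smooth_pderiv_2[OF assms] sum.distrib sum_distrib_left sum_distrib_right)

lemma test_reflect_test:
 assumes f: "f \<in> \<D> UNIV"
 shows "(\<lambda>y. f (x - y)) \<in> \<D> (UNIV :: 'a::euclidean_space set)"
proof -
 obtain R where R: "\<And>y vs. norm y > R ==> pderivs vs f y = 0" using test_ball_support[OF f] by auto
 show ?thesis
 proof (rule test_functionsI[OF test_reflect(1)[OF f] compact_cball[of x R]])
  fix y assume "y \<notin> cball x R"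
  then have "norm (x - y) > R" by (simp add: dist_norm)
  then show "f (x - y) = 0" using R[of "x - y" "[]"] by simp
 qed auto
qed

lemma laplacian_reflect:
 assumes f: "f \<in> \<D> (UNIV :: 'a::euclidean_space set)"
 shows "laplacian (\<lambda>y. f (x - y)) y = laplacian f (x - y)" unfolding laplacian_def
proof (rule sum.cong[OF refl])
 fix i :: 'a assume i: "i \<in> Basis"
 have t: "pderivs [i] f \<in> \<D> UNIV" by (rule test_pderivs[OF f]) (use i in auto)
 have "pderivs [i, i] (\<lambda>y. f (x - y)) = pderivs [i] (\<lambda>y. (-1) * pderivs [i] f (x - y))"
  unfolding pderivs_pderivs[symmetric] test_reflect(2)[OF f i] by simp
 also have "\<dots> = (\<lambda>y. (-1) * pderivs [i] (\<lambda>y. pderivs [i] f (x - y)) y)"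
  by (rule pderivs_test_scale[OF test_reflect_test[OF t]]) (use i in auto)
 finally show "pderivs [i, i] (\<lambda>y. f (x - y)) y = pderivs [i, i] f (x - y)" by (simp add: test_reflect(2)[OF t i] pderivs_pderivs)
qed

lemma test_times_L2_integrable:
 assumes "g \<in> \<D> UNIV" "h \<in> L2 lborel"
 shows "integrable lborel (\<lambda>y. g y * h y)" by (rule L2_mult_integrable[OF test_L2[OF assms(1)] assms(2)])

lemma laplacian_conv:
 assumes r: "r \<in> \<D> (UNIV :: 'a::euclidean_space set)" and u: "integrable lborel u"
 shows "laplacian (conv r u) x = (LINT y|lborel. laplacian r (x - y) * u y)"
proof -
 have t: "pderivs [i] r \<in> \<D> UNIV" "pderivs [i, i] r \<in> \<D> UNIV" if "i \<in> Basis" for i by (rule test_pderivs[OF r], use that in auto)+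
 have "pderivs [i, i] (conv r u) = conv (pderivs [i, i] r) u" if i: "i \<in> Basis" for i
  unfolding pderivs_pderivs[symmetric] pderiv_conv[OF r u i] by (rule pderiv_conv[OF t(1)[OF i] u i])
 then have "laplacian (conv r u) x = (\<Sum>i\<in>Basis. LINT y|lborel. pderivs [i, i] r (x - y) * u y)" by (simp add: laplacian_def conv_def)
 also have "\<dots> = (LINT y|lborel. (\<Sum>i\<in>Basis. pderivs [i, i] r (x - y) * u y))"
  by (rule Bochner_Integration.integral_sum[symmetric]) (rule test_times_integrable[OF t(2) u])
 finally show ?thesis by (simp add: laplacian_def sum_distrib_right)
qed

lemma conv_test_mult:
 assumes r: "mollifier d r" and g: "g \<in> \<D> (UNIV :: 'a::euclidean_space set)" and h: "h \<in> L2 lborel"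
 shows "conv (cr r) (\<lambda>y. g y * h y) \<in> \<D> UNIV"
proof -
 obtain R where R: "\<And>y vs. norm y > R ==> pderivs vs g y = 0" using test_ball_support[OF g] by auto
 show ?thesis by (rule conv_test(1)[OF mollifierD(1)[OF r] test_times_L2_integrable[OF g h], of d R]) (use mollifierD(3)[OF r] R[of _ "[]"] in auto)
qed

lemma mult_test_L2:
 assumes g: "g \<in> \<D> (UNIV :: 'a::euclidean_space set)"
 obtains C where "C \<ge> 0" "\<And>h. h \<in> L2 lborel ==> (\<lambda>y. g y * h y) \<in> L2 lborel"
  "\<And>h. h \<in> L2 lborel ==> lnorm (\<lambda>y. g y * h y) \<le> C * lnorm h"
proof -
 obtain C where C: "C \<ge> 0" "\<And>x. cmod (g x) \<le> C" using test_bounded[OF g] by blast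
 have m: "g \<in> borel_measurable lborel" using test_borel[OF g] by simp
 show ?thesis by (rule that[OF C(1)]) (use L2_mult_bounded[OF _ m C(2)] L2_norm_mult_bounded[OF _ m C(2) C(1)] in auto)
qed

text \<open>For weakly harmonic h the product rule reads \<Delta>(t h) = 2 div (h grad t) - h
  \<Delta>t. Its mollified form results from testing harmonicity with \<open>t\<close> times the
  reflected mollifier; no derivative falls on h.\<close>

lemma conv_laplacian_identity:
 assumes r: "mollifier d r" and t: "t \<in> \<D> (UNIV :: 'a::euclidean_space set)" and h: "h \<in> L2 lborel"
  and harm: "\<And>f. f \<in> \<D> UNIV ==> (LINT y|lborel. h y * laplacian (\<lambda>y. t y * f y) y) = 0"
 shows "laplacian (conv (cr r) (\<lambda>y. t y * h y)) x =
  2 * (\<Sum>i\<in>Basis. pderivs [i] (conv (cr r) (\<lambda>y. pderivs [i] t y * h y)) x)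
  - conv (cr r) (\<lambda>y. laplacian t y * h y) x"
proof -
 note rt = mollifierD(1)[OF r]
 define f where "f y = cr r (x - y)" for y
 have ft: "f \<in> \<D> UNIV" unfolding f_def by (rule test_reflect_test[OF rt])
 have ti: "pderivs [i] t \<in> \<D> UNIV" if "i \<in> Basis" for i by (rule test_pderivs[OF t]) (use that in auto)
 have ri: "pderivs [i] (cr r) \<in> \<D> UNIV" if "i \<in> Basis" for i by (rule test_pderivs[OF rt]) (use that in auto)
 have fi: "pderivs [i] f y = - pderivs [i] (cr r) (x - y)" if "i \<in> Basis" for i y unfolding f_def test_reflect(2)[OF rt that] ..
 have Lf: "laplacian f y = laplacian (cr r) (x - y)" for y unfolding f_def by (rule laplacian_reflect[OF rt])
 let ?A = "\<lambda>y. laplacian (cr r) (x - y) * (t y * h y)"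
 let ?B = "\<lambda>i y. pderivs [i] (cr r) (x - y) * (pderivs [i] t y * h y)"
 let ?C = "\<lambda>y. cr r (x - y) * (laplacian t y * h y)"
 have A: "integrable lborel ?A" by (rule test_times_integrable[OF test_laplacian[OF rt] test_times_L2_integrable[OF t h]])
 have B: "integrable lborel (?B i)" if "i \<in> Basis" for i
  by (rule test_times_integrable[OF ri[OF that] test_times_L2_integrable[OF ti[OF that] h]])
 have C: "integrable lborel ?C" by (rule test_times_integrable[OF rt test_times_L2_integrable[OF test_laplacian[OF t] h]])
 have BS: "integrable lborel (\<lambda>y. 2 * (\<Sum>i\<in>Basis. ?B i y))" by (intro integrable_mult_right Bochner_Integration.integrable_sum B)
 have "0 = (LINT y|lborel. h y * laplacian (\<lambda>y. t y * f y) y)" using harm[OF ft] by simp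
 also have "\<dots> = (LINT y|lborel. (?A y - 2 * (\<Sum>i\<in>Basis. ?B i y)) + ?C y)"
 proof (rule Bochner_Integration.integral_cong[OF refl])
  fix y
  have "(\<Sum>i\<in>Basis. pderivs [i] t y * pderivs [i] f y) = - (\<Sum>i\<in>Basis. pderivs [i] t y * pderivs [i] (cr r) (x - y))"
   by (simp add: fi sum_negf)
  moreover have "(\<Sum>i\<in>Basis. ?B i y) = (\<Sum>i\<in>Basis. pderivs [i] t y * pderivs [i] (cr r) (x - y)) * h y"
   unfolding sum_distrib_right by (simp add: mult_ac)
  ultimately show "h y * laplacian (\<lambda>y. t y * f y) y = (?A y - 2 * (\<Sum>i\<in>Basis. ?B i y)) + ?C y"
   unfolding laplacian_mult[OF test_smooth[OF t] test_smooth[OF ft]] Lf by (simp add: f_def algebra_simps)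
 qed
 also have "\<dots> = (LINT y|lborel. ?A y) - (LINT y|lborel. 2 * (\<Sum>i\<in>Basis. ?B i y)) + (LINT y|lborel. ?C y)"
  unfolding Bochner_Integration.integral_add[OF Bochner_Integration.integrable_diff[OF A BS] C]
   Bochner_Integration.integral_diff[OF A BS] ..
 also have "(LINT y|lborel. 2 * (\<Sum>i\<in>Basis. ?B i y)) = 2 * (\<Sum>i\<in>Basis. LINT y|lborel. ?B i y)"
  using Bochner_Integration.integral_sum[of Basis lborel ?B, OF B] by simp
 finally have "(LINT y|lborel. ?A y) = 2 * (\<Sum>i\<in>Basis. LINT y|lborel. ?B i y) - (LINT y|lborel. ?C y)" by (simp add: algebra_simps)
 moreover have "(LINT y|lborel. ?B i y) = pderivs [i] (conv (cr r) (\<lambda>y. pderivs [i] t y * h y)) x" if "i \<in> Basis" for i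
  unfolding pderiv_conv[OF rt test_times_L2_integrable[OF ti[OF that] h] that] conv_def ..
 ultimately show ?thesis unfolding laplacian_conv[OF rt test_times_L2_integrable[OF t h]] by (simp add: conv_def)
qed

lemma quadratic_inequality_bound:
 fixes G H A B :: real
 assumes "G\<^sup>2 \<le> A * H * G + B * H\<^sup>2" "0 \<le> A" "0 \<le> B" "0 \<le> H" "0 \<le> G"
 shows "G \<le> (A + B + 1) * H"
proof (rule ccontr)
 assume "\<not> G \<le> (A + B + 1) * H"
 then have gt: "G > (A + B + 1) * H" by simp
 have GH: "G \<ge> H" using gt mult_nonneg_nonneg[OF assms(2,4)] mult_nonneg_nonneg[OF assms(3,4)] unfolding distrib_right by linarith
 have "G * ((A + B + 1) * H) < G * G" using gt assms by (intro mult_strict_left_mono) (auto intro: le_less_trans[OF _ gt])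
 moreover have "B * H\<^sup>2 \<le> B * (H * G)" unfolding power2_eq_square using GH assms by (intro mult_left_mono) auto
 moreover have "0 \<le> G * H" using assms by simp
 ultimately show False using assms(1) by (simp add: algebra_simps power2_eq_square)
qed

text \<open>A Caccioppoli inequality: pairing the mollified identity with the mollified product
  itself and integrating by parts leaves its gradient against L2 norms of h. The constant is
  independent of the mollifier, so the bound survives the removal of the mollification.\<close>

lemma conv_energy:
 fixes t :: "'a::euclidean_space => complex"
 assumes t: "t \<in> \<D> UNIV"
 obtains C where "C \<ge> 0" "\<And>h r d. h \<in> borel_measurable borel ==> h \<in> L2 lborel ==>
  (\<And>f. f \<in> \<D> UNIV ==> (LINT y|lborel. h y * laplacian (\<lambda>y. t y * f y) y) = 0) ==>
  mollifier d r ==> grad_norm (conv (cr r) (\<lambda>y. t y * h y)) \<le> C * lnorm h"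
proof -
 have ti: "pderivs [i] t \<in> \<D> UNIV" if "i \<in> Basis" for i by (rule test_pderivs[OF t]) (use that in auto)
 obtain C0 where C0: "C0 \<ge> 0" "\<And>h. h \<in> L2 lborel ==> (\<lambda>y. t y * h y) \<in> L2 lborel"
  "\<And>h. h \<in> L2 lborel ==> lnorm (\<lambda>y. t y * h y) \<le> C0 * lnorm h" using mult_test_L2[OF t] by metis
 obtain C2 where C2: "C2 \<ge> 0" "\<And>h. h \<in> L2 lborel ==> (\<lambda>y. laplacian t y * h y) \<in> L2 lborel"
  "\<And>h. h \<in> L2 lborel ==> lnorm (\<lambda>y. laplacian t y * h y) \<le> C2 * lnorm h" using mult_test_L2[OF test_laplacian[OF t]] by metis
 have "\<exists>C. C \<ge> 0 \<and> (\<forall>h. h \<in> L2 lborel \<longrightarrow> (\<lambda>y. pderivs [i] t y * h y) \<in> L2 lborel \<and>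
   lnorm (\<lambda>y. pderivs [i] t y * h y) \<le> C * lnorm h)" if "i \<in> Basis" for i using mult_test_L2[OF ti[OF that]] by metis
 then obtain K where K: "\<And>i. i \<in> Basis ==> K i \<ge> 0"
   "\<And>i h. i \<in> Basis ==> h \<in> L2 lborel ==> (\<lambda>y. pderivs [i] t y * h y) \<in> L2 lborel"
   "\<And>i h. i \<in> Basis ==> h \<in> L2 lborel ==> lnorm (\<lambda>y. pderivs [i] t y * h y) \<le> K i * lnorm h" by metis
 define C1 where "C1 = (\<Sum>i\<in>Basis. K i)"
 have C1: "0 \<le> C1" unfolding C1_def by (rule sum_nonneg) (rule K(1))
 define D where "D = real DIM('a)"
 have D0: "0 \<le> D" by (simp add: D_def)
 show ?thesis
 proof (rule that[of "D * (2 * C1) + D * (C2 * C0) + 1"])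
  show "0 \<le> D * (2 * C1) + D * (C2 * C0) + 1" using D0 C0(1) C1 C2(1) by simp
 next
  fix h :: "'a => complex" and r :: "'a => real" and d
  assume hb: "h \<in> borel_measurable borel" and h: "h \<in> L2 lborel" and r: "mollifier d r"
   and harm: "\<And>f. f \<in> \<D> UNIV ==> (LINT y|lborel. h y * laplacian (\<lambda>y. t y * f y) y) = 0"
  define H where "H = lnorm h"
  define v where "v = conv (cr r) (\<lambda>y. t y * h y)"
  define a where "a i = conv (cr r) (\<lambda>y. pderivs [i] t y * h y)" for i
  define c where "c = conv (cr r) (\<lambda>y. laplacian t y * h y)"
  have vt: "v \<in> \<D> UNIV" unfolding v_def by (rule conv_test_mult[OF r t h])
  have at: "a i \<in> \<D> UNIV" if "i \<in> Basis" for i unfolding a_def by (rule conv_test_mult[OF r ti[OF that] h])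
  have ct: "c \<in> \<D> UNIV" unfolding c_def by (rule conv_test_mult[OF r test_laplacian[OF t] h])
  have vi: "pderivs [i] v \<in> \<D> UNIV" if "i \<in> Basis" for i by (rule test_pderivs[OF vt]) (use that in auto)
  have ai: "pderivs [i] (a i) \<in> \<D> UNIV" if "i \<in> Basis" for i by (rule test_pderivs[OF at[OF that]]) (use that in auto)
  have m: "(\<lambda>y. g y * h y) \<in> borel_measurable borel" if "g \<in> \<D> UNIV" for g using test_borel[OF that] hb by measurable
  have vn: "lnorm v \<le> C0 * H" unfolding v_def H_def by (rule order_trans[OF conv_mollifier_norm_le(2)[OF r m[OF t] C0(2)[OF h]] C0(3)[OF h]])
  have cn: "lnorm c \<le> C2 * H" unfolding c_def H_def
   by (rule order_trans[OF conv_mollifier_norm_le(2)[OF r m[OF test_laplacian[OF t]] C2(2)[OF h]] C2(3)[OF h]])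
  have an: "lnorm (a i) \<le> C1 * H" if i: "i \<in> Basis" for i
  proof -
   have "lnorm (a i) \<le> K i * H" unfolding a_def H_def
    by (rule order_trans[OF conv_mollifier_norm_le(2)[OF r m[OF ti[OF i]] K(2)[OF i h]] K(3)[OF i h]])
   also have "\<dots> \<le> C1 * H" unfolding C1_def H_def by (intro mult_right_mono member_le_sum) (use i K(1) in auto)
   finally show ?thesis .
  qed
  have lap: "laplacian v = (\<lambda>x. 2 * (\<Sum>i\<in>Basis. pderivs [i] (a i) x) - c x)"
   unfolding v_def a_def c_def by (rule ext, rule conv_laplacian_identity[OF r t h harm])
  have ibp: "ip lborel (pderivs [i] (a i)) v = - ip lborel (a i) (pderivs [i] v)" if i: "i \<in> Basis" for i
   unfolding ip_def integration_by_parts[OF at[OF i] test_smooth[OF test_cnj[OF vt]] i] by (subst pderivs_test_cnj[OF vt]) (use i in auto)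
  have SL: "(\<lambda>x. \<Sum>i\<in>Basis. pderivs [i] (a i) x) \<in> L2 lborel" by (intro L2_sum test_L2[OF ai])
  have "ip lborel (laplacian v) v = 2 * (\<Sum>i\<in>Basis. ip lborel (pderivs [i] (a i)) v) - ip lborel c v"
   unfolding lap by (simp only: ip_diff_left[OF L2_scale[OF SL] test_L2[OF ct] test_L2[OF vt]] ip_scale_left
    ip_sum_left[OF test_L2[OF ai] test_L2[OF vt]])
  then have eq: "cor (\<Sum>i\<in>Basis. (lnorm (pderivs [i] v))\<^sup>2) =
    2 * (\<Sum>i\<in>Basis. ip lborel (a i) (pderivs [i] v)) + ip lborel c v"
   using ip_laplacian[OF vt] by (simp add: ibp sum_negf minus_equation_iff[of "_ + _"] algebra_simps)
  have "(\<Sum>i\<in>Basis. (lnorm (pderivs [i] v))\<^sup>2) = cmod (cor (\<Sum>i\<in>Basis. (lnorm (pderivs [i] v))\<^sup>2))"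
   unfolding norm_of_real by (simp add: sum_nonneg)
  also have "\<dots> \<le> cmod (2 * (\<Sum>i\<in>Basis. ip lborel (a i) (pderivs [i] v))) + cmod (ip lborel c v)"
   unfolding eq by (rule norm_triangle_ineq)
  also have "cmod (2 * (\<Sum>i\<in>Basis. ip lborel (a i) (pderivs [i] v))) \<le> 2 * (\<Sum>i\<in>Basis. (C1 * H) * lnorm (pderivs [i] v))"
  proof -
   have "cmod (\<Sum>i\<in>Basis. ip lborel (a i) (pderivs [i] v)) \<le> (\<Sum>i\<in>Basis. (C1 * H) * lnorm (pderivs [i] v))"
   proof (rule sum_norm_le)
    fix i :: 'a assume i: "i \<in> Basis"
    show "cmod (ip lborel (a i) (pderivs [i] v)) \<le> C1 * H * lnorm (pderivs [i] v)"
     by (rule order_trans[OF L2_Cauchy_Schwarz[OF test_L2[OF at[OF i]] test_L2[OF vi[OF i]]]])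
      (intro mult_right_mono an i, simp)
   qed
   then show ?thesis by (simp add: norm_mult)
  qed
  also have "\<dots> = 2 * (C1 * H) * grad_norm v" unfolding grad_norm_def sum_distrib_left by (simp add: mult_ac)
  also have "cmod (ip lborel c v) \<le> (C2 * H) * (C0 * H)" by (rule order_trans[OF L2_Cauchy_Schwarz[OF test_L2[OF ct] test_L2[OF vt]]])
    (intro mult_mono cn vn, use C2 H_def in auto)
  finally have *: "(\<Sum>i\<in>Basis. (lnorm (pderivs [i] v))\<^sup>2) \<le> 2 * (C1 * H) * grad_norm v + (C2 * H) * (C0 * H)" by simp
  have "(grad_norm v)\<^sup>2 \<le> D * (\<Sum>i\<in>Basis. (lnorm (pderivs [i] v))\<^sup>2)"
   unfolding grad_norm_def D_def using sum_squared_le_sum_of_squares[of "\<lambda>i. lnorm (pderivs [i] v)" "Basis :: 'a set"]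
   by (simp add: mult.commute)
  also have "\<dots> \<le> D * (2 * (C1 * H) * grad_norm v + (C2 * H) * (C0 * H))" by (intro mult_left_mono * D0)
  finally have "(grad_norm v)\<^sup>2 \<le> (D * (2 * C1)) * H * grad_norm v + (D * (C2 * C0)) * H\<^sup>2"
   by (simp add: algebra_simps power2_eq_square)
  from quadratic_inequality_bound[OF this] show "grad_norm (conv (cr r) (\<lambda>y. t y * h y)) \<le> (D * (2 * C1) + D * (C2 * C0) + 1) * lnorm h"
   using D0 C1 C2(1) C0(1) by (simp add: v_def H_def)
 qed
qed

lemma conv_diff:
 assumes r: "r \<in> \<D> UNIV" and "integrable lborel u" "integrable lborel w"
 shows "conv r (\<lambda>y. u y - w y) x = conv r u x - conv r w x" unfolding conv_def
 using Bochner_Integration.integral_diff[OF test_times_integrable[OF assms(1,2)] test_times_integrable[OF assms(1,3)], of x x]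
 by (simp add: algebra_simps)

text \<open>Mollification does not increase the norm, so a nearby test function reduces the claim to
  \<open>conv_mollifier_diff_le\<close>. The cap at 1 later confines all supports to one
  ball.\<close>

lemma conv_mollifier_approx:
 fixes v :: "'a::euclidean_space => complex"
 assumes vb: "v \<in> borel_measurable borel" and v: "v \<in> L2 lborel" and vi: "integrable lborel v" and e: "e > 0"
 obtains d where "0 < d" "d \<le> 1" "\<And>r. mollifier d r ==> lnorm (\<lambda>x. conv (cr r) v x - v x) < e"
proof -
 have "v \<in> L2 (lebesgue_on UNIV)" using L2_lebesgue_on_borel(1)[OF open_UNIV vb] v by simp
 then obtain f where f: "f \<in> \<D> UNIV" "L2_norm (lebesgue_on UNIV) (\<lambda>x. f x - v x) < e / 4"
  using test_dense[OF open_UNIV, of v "e / 4"] e by auto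
 have db: "(\<lambda>x. f x - v x) \<in> borel_measurable borel" using test_borel[OF f(1)] vb by measurable
 have fn: "lnorm (\<lambda>x. f x - v x) < e / 4" using f(2) L2_lebesgue_on_borel(2)[OF open_UNIV db] by simp
 define d where "d = min 1 (e / (4 * (grad_norm f + 1)))"
 have g: "0 < grad_norm f + 1" using grad_norm_nonneg[of f] by linarith
 have d: "0 < d" "d \<le> 1" using e g by (auto simp: d_def)
 have dg: "d * grad_norm f \<le> e / 4"
 proof -
  have "d * grad_norm f \<le> e / (4 * (grad_norm f + 1)) * (grad_norm f + 1)" by (intro mult_mono) (use d e g in \<open>auto simp: d_def\<close>)
  also have "\<dots> = e / 4" using g by (simp add: field_simps)
  finally show ?thesis .
 qed
 show ?thesis
 proof (rule that[OF d])
  fix r :: "'a => real" assume r: "mollifier d r"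
  note fL = test_L2[OF f(1)]
  have cv: "conv (cr r) v \<in> L2 lborel" by (rule conv_mollifier_norm_le(1)[OF r vb v])
  have cf: "conv (cr r) f \<in> L2 lborel" by (rule conv_mollifier_norm_le(1)[OF r test_borel[OF f(1)] fL])
  have "lnorm (\<lambda>x. conv (cr r) v x - v x) \<le> lnorm (\<lambda>x. conv (cr r) v x - conv (cr r) f x)
    + lnorm (\<lambda>x. conv (cr r) f x - v x)" by (rule L2_norm_dist_triangle[OF cv cf v])
  also have "lnorm (\<lambda>x. conv (cr r) f x - v x) \<le> lnorm (\<lambda>x. conv (cr r) f x - f x) + lnorm (\<lambda>x. f x - v x)"
   by (rule L2_norm_dist_triangle[OF cf fL v])
  also have "lnorm (\<lambda>x. conv (cr r) f x - f x) \<le> e / 4" using conv_mollifier_diff_le[OF r d(1) f(1)] dg by linarith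
  also have "lnorm (\<lambda>x. conv (cr r) v x - conv (cr r) f x) = lnorm (conv (cr r) (\<lambda>x. f x - v x))"
  proof -
   have "conv (cr r) (\<lambda>x. f x - v x) = (\<lambda>x. conv (cr r) f x - conv (cr r) v x)"
    by (rule ext, rule conv_diff[OF mollifierD(1)[OF r] test_integrable[OF f(1)] vi])
   then show ?thesis by (simp only: L2_norm_minus_commute[of lborel "conv (cr r) v"])
  qed
  also have "\<dots> \<le> lnorm (\<lambda>x. f x - v x)" by (rule conv_mollifier_norm_le(2)[OF r db L2_diff[OF fL v]])
  finally show "lnorm (\<lambda>x. conv (cr r) v x - v x) < e" using fn e by linarith
 qed
qed

lemma integral_mult_le_norms:
 assumes "u \<in> L2 M" "v \<in> L2 M"
 shows "cmod (LINT x|M. u x * v x) \<le> L2_norm M u * L2_norm M v" using L2_Cauchy_Schwarz[OF assms(1) L2_cnj[OF assms(2)]] by (simp add: ip_def)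

text \<open>The estimate \<open>Rellich\<close> is for test functions and involves a gradient, so it
  is applied to mollifications of t h, whose gradients \<open>conv_energy\<close> bounds uniformly;
  then the mollification error is sent to zero.\<close>

theorem interior_bound:
 fixes t :: "'a::euclidean_space => complex"
 assumes t: "t \<in> \<D> UNIV" and d: "d > 0"
 shows "\<exists>Z C. finite Z \<and> 0 \<le> C \<and> Z \<subseteq> \<D> UNIV \<and> (\<forall>h. h \<in> borel_measurable borel \<longrightarrow> h \<in> L2 lborel \<longrightarrow>
  (\<forall>f\<in>\<D> UNIV. (LINT y|lborel. h y * laplacian (\<lambda>y. t y * f y) y) = 0) \<longrightarrow>
  lnorm (\<lambda>y. t y * h y) \<le> d * lnorm h + C * (\<Sum>r\<in>Z. cmod (LINT y|lborel. r y * (t y * h y))))"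
proof (rule conv_energy[OF t])
 fix CE :: real assume CE: "CE \<ge> 0" "\<And>h k \<delta>. h \<in> borel_measurable borel ==> h \<in> L2 lborel ==>
  (\<And>f. f \<in> \<D> UNIV ==> (LINT y|lborel. h y * laplacian (\<lambda>y. t y * f y) y) = 0) ==>
  mollifier \<delta> k ==> grad_norm (conv (cr k) (\<lambda>y. t y * h y)) \<le> CE * lnorm h"
 obtain C0 where C0: "C0 \<ge> 0" "\<And>h. h \<in> L2 lborel ==> (\<lambda>y. t y * h y) \<in> L2 lborel"
  "\<And>h. h \<in> L2 lborel ==> lnorm (\<lambda>y. t y * h y) \<le> C0 * lnorm h" using mult_test_L2[OF t] by metis
 obtain R where R: "R \<ge> 0" "\<And>y vs. norm y > R ==> pderivs vs t y = 0" using test_ball_support[OF t] by auto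
 \<comment> \<open>Gradient and norm of the mollified product together are at most (CE + C0) times
   the norm of h, and this may cost only d.\<close>
 define d' where "d' = d / (CE + C0 + 1)"
 have d': "d' > 0" using d CE(1) C0(1) by (simp add: d'_def)
 have d'': "d' * (CE + C0) \<le> d" using d CE(1) C0(1) by (simp add: d'_def field_simps)
 have "R + 1 \<ge> 0" using R(1) by simp
 from Rellich[OF this d'] obtain Z :: "('a => complex) set" and C where Z: "finite Z" "C \<ge> 0" "Z \<subseteq> \<D> UNIV"
  "\<And>f. f \<in> \<D> UNIV ==> (\<forall>x. norm x > R + 1 \<longrightarrow> f x = 0) ==>
   lnorm f \<le> d' * (grad_norm f + lnorm f) + C * (\<Sum>r\<in>Z. cmod (LINT y|lborel. r y * f y))" by blast
 show ?thesis
 proof (rule exI[of _ Z], rule exI[of _ C], intro conjI Z(1-3) allI impI)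
  fix h :: "'a => complex"
  assume hb: "h \<in> borel_measurable borel" and h: "h \<in> L2 lborel"
   and "\<forall>f\<in>\<D> UNIV. (LINT y|lborel. h y * laplacian (\<lambda>y. t y * f y) y) = 0"
  then have harm: "\<And>f. f \<in> \<D> UNIV ==> (LINT y|lborel. h y * laplacian (\<lambda>y. t y * f y) y) = 0" by simp
  define v where "v y = t y * h y" for y
  have vb: "v \<in> borel_measurable borel" unfolding v_def using test_borel[OF t] hb by measurable
  have v: "v \<in> L2 lborel" unfolding v_def by (rule C0(2)[OF h])
  have vn: "lnorm v \<le> C0 * lnorm h" unfolding v_def by (rule C0(3)[OF h])
  have vi: "integrable lborel v" unfolding v_def by (rule test_times_L2_integrable[OF t h])
  have rL: "r \<in> L2 lborel" if "r \<in> Z" for r using test_L2 Z(3) that by blast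
  define N where "N = (\<Sum>r\<in>Z. lnorm r)"
  have N: "0 \<le> N" unfolding N_def by (rule sum_nonneg) simp
  define S where "S = (\<Sum>r\<in>Z. cmod (LINT y|lborel. r y * v y))"
  have "lnorm v \<le> d * lnorm h + C * S"
  proof (rule field_le_epsilon)
   fix e :: real assume e: "e > 0"
   \<comment> \<open>Replacing \<open>v\<close> by its mollification costs e1 in the norm and N e1
     in the functionals, the latter multiplied by C.\<close>
   define e1 where "e1 = e / (1 + C * N)"
   have CN: "0 < 1 + C * N" using mult_nonneg_nonneg[OF Z(2) N] by linarith
   have e1: "e1 > 0" unfolding e1_def using e CN by simp
   obtain \<delta> where \<delta>: "0 < \<delta>" "\<delta> \<le> 1" "\<And>k. mollifier \<delta> k ==> lnorm (\<lambda>x. conv (cr k) v x - v x) < e1"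
    using conv_mollifier_approx[OF vb v vi e1] by metis
   obtain k :: "'a => real" where k: "mollifier \<delta> k" using mollifier_exists[OF \<delta>(1)] by blast
   define s where "s = conv (cr k) v"
   have st: "s \<in> \<D> UNIV" "\<And>x. norm x > R + \<delta> ==> s x = 0" unfolding s_def
    by (rule conv_test[OF mollifierD(1)[OF k] vi, of \<delta> R], (use mollifierD(3)[OF k] R(2)[of _ "[]"] in \<open>auto simp: v_def\<close>))+
   note sL = test_L2[OF st(1)]
   have sn: "lnorm s \<le> lnorm v" unfolding s_def by (rule conv_mollifier_norm_le(2)[OF k vb v])
   have sv: "lnorm (\<lambda>x. s x - v x) \<le> e1" unfolding s_def using \<delta>(3)[OF k] by simp
   have sg: "grad_norm s \<le> CE * lnorm h" unfolding s_def v_def by (rule CE(2)[OF hb h harm k])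
   have Ss: "(\<Sum>r\<in>Z. cmod (LINT y|lborel. r y * s y)) \<le> S + N * e1" unfolding S_def N_def sum_distrib_right sum.distrib[symmetric]
   proof (rule sum_mono)
    fix r assume r: "r \<in> Z"
    have "(LINT y|lborel. r y * s y) = (LINT y|lborel. r y * v y) + (LINT y|lborel. r y * (s y - v y))"
     using Bochner_Integration.integral_diff[OF L2_mult_integrable[OF rL[OF r] sL] L2_mult_integrable[OF rL[OF r] v]]
     by (simp add: right_diff_distrib)
    then have "cmod (LINT y|lborel. r y * s y) \<le> cmod (LINT y|lborel. r y * v y) + cmod (LINT y|lborel. r y * (s y - v y))"
     using norm_triangle_ineq by metis
    also have "cmod (LINT y|lborel. r y * (s y - v y)) \<le> lnorm r * lnorm (\<lambda>y. s y - v y)"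
     by (rule integral_mult_le_norms[OF rL[OF r] L2_diff[OF sL v]])
    also have "\<dots> \<le> lnorm r * e1" by (intro mult_left_mono sv) simp
    finally show "cmod (LINT y|lborel. r y * s y) \<le> cmod (LINT y|lborel. r y * v y) + lnorm r * e1" by simp
   qed
   have "lnorm v \<le> lnorm s + lnorm (\<lambda>x. s x - v x)" using L2_norm_diff_abs[OF sL v] by linarith
   also have "lnorm s \<le> d' * (grad_norm s + lnorm s) + C * (\<Sum>r\<in>Z. cmod (LINT y|lborel. r y * s y))"
    by (rule Z(4)[OF st(1)]) (use st(2) \<delta>(2) in auto)
   also have "d' * (grad_norm s + lnorm s) \<le> d' * (CE * lnorm h + C0 * lnorm h)" using d' sg sn vn by (intro mult_left_mono add_mono) auto
   also have "\<dots> = d' * (CE + C0) * lnorm h" by (simp add: algebra_simps)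
   also have "\<dots> \<le> d * lnorm h" by (intro mult_right_mono d'') simp
   also have "C * (\<Sum>r\<in>Z. cmod (LINT y|lborel. r y * s y)) \<le> C * (S + N * e1)" by (intro mult_left_mono Ss Z(2))
   finally have "lnorm v \<le> d * lnorm h + C * (S + N * e1) + e1" using sv by linarith
   also have "\<dots> = d * lnorm h + C * S + (1 + C * N) * e1" by (simp add: algebra_simps)
   also have "(1 + C * N) * e1 = e" unfolding e1_def using CN by simp
   finally show "lnorm v \<le> d * lnorm h + C * S + e" .
  qed
  then show "lnorm (\<lambda>y. t y * h y) \<le> d * lnorm h + C * (\<Sum>r\<in>Z. cmod (LINT y|lborel. r y * (t y * h y)))" unfolding S_def v_def .
 qed
qed

text \<open>The quantitative form of compactness of the map \<open>q \<mapsto> p\<close>.\<close>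

definition compact_bound :: "'a measure => (('a => complex) \<times> ('a => complex)) set => bool" where
 "compact_bound M S \<longleftrightarrow> (\<forall>\<epsilon>>0. \<exists>B C. finite B \<and> B \<subseteq> L2 M \<and> 0 \<le> C \<and>
   (\<forall>(p, q)\<in>S. L2_norm M p \<le> \<epsilon> * L2_norm M q + C * (\<Sum>b\<in>B. cmod (ip M q b))))"

text \<open>Finite sums of compact maps are compact: share the tolerance among the terms and merge
  the functionals.\<close>

lemma compact_bound_dominated:
 fixes P :: "'i => ('a => complex) => 'a => complex" and A :: real
 assumes J: "finite J" and A: "0 \<le> A" and cb: "\<And>j. j \<in> J ==> compact_bound M {(P j q, q) | q. q \<in> H}"
  and dom: "\<And>q. q \<in> H ==> L2_norm M (Q q) \<le> A * (\<Sum>j\<in>J. L2_norm M (P j q))"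
 shows "compact_bound M {(Q q, q) | q. q \<in> H}" unfolding compact_bound_def
proof (intro allI impI)
 fix t :: real assume t: "t > 0"
 define e where "e = t / (A * real (card J) + 1)"
 have d: "A * real (card J) + 1 > 0" using A by (simp add: add_nonneg_pos)
 then have e: "e > 0" using t by (simp add: e_def)
 have e': "A * (real (card J) * e) \<le> t" using d t by (simp add: e_def field_simps)
 have "\<exists>B C. finite B \<and> B \<subseteq> L2 M \<and> 0 \<le> C \<and> (\<forall>q\<in>H. L2_norm M (P j q) \<le> e * L2_norm M q + C * (\<Sum>b\<in>B. cmod (ip M q b)))"
  if j: "j \<in> J" for j
 proof -
  obtain B C where "finite B" "B \<subseteq> L2 M" "0 \<le> C"
   and *: "\<forall>(p, q)\<in>{(P j q, q) | q. q \<in> H}. L2_norm M p \<le> e * L2_norm M q + C * (\<Sum>b\<in>B. cmod (ip M q b))"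
   using cb[OF j] e unfolding compact_bound_def by meson
  moreover have "\<forall>q\<in>H. L2_norm M (P j q) \<le> e * L2_norm M q + C * (\<Sum>b\<in>B. cmod (ip M q b))"
  proof
   fix q assume "q \<in> H"
   then show "L2_norm M (P j q) \<le> e * L2_norm M q + C * (\<Sum>b\<in>B. cmod (ip M q b))" by (intro bspec[OF *, of "(P j q, q)", simplified]) auto
  qed
  ultimately show ?thesis by (intro exI conjI)
 qed
 then have "\<forall>j\<in>J. \<exists>BC. finite (fst BC) \<and> fst BC \<subseteq> L2 M \<and> 0 \<le> snd BC \<and>
  (\<forall>q\<in>H. L2_norm M (P j q) \<le> e * L2_norm M q + snd BC * (\<Sum>b\<in>fst BC. cmod (ip M q b)))" by simp
 then obtain BC where BC: "\<And>j. j \<in> J ==> finite (fst (BC j))" "\<And>j. j \<in> J ==> fst (BC j) \<subseteq> L2 M" "\<And>j. j \<in> J ==> 0 \<le> snd (BC j)"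
  "\<And>j q. j \<in> J ==> q \<in> H ==> L2_norm M (P j q) \<le> e * L2_norm M q + snd (BC j) * (\<Sum>b\<in>fst (BC j). cmod (ip M q b))"
  unfolding bchoice_iff by blast
 let ?B = "\<Union>j\<in>J. fst (BC j)" and ?C = "A * (\<Sum>j\<in>J. snd (BC j))"
 have "L2_norm M (Q q) \<le> t * L2_norm M q + ?C * (\<Sum>b\<in>?B. cmod (ip M q b))" if q: "q \<in> H" for q
 proof -
  have "L2_norm M (Q q) \<le> A * (\<Sum>j\<in>J. L2_norm M (P j q))" by (rule dom[OF q])
  also have "\<dots> \<le> A * (\<Sum>j\<in>J. e * L2_norm M q + snd (BC j) * (\<Sum>b\<in>?B. cmod (ip M q b)))"
  proof (intro mult_left_mono sum_mono A)
   fix j assume j: "j \<in> J"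
   have "snd (BC j) * (\<Sum>b\<in>fst (BC j). cmod (ip M q b)) \<le> snd (BC j) * (\<Sum>b\<in>?B. cmod (ip M q b))"
    by (intro mult_left_mono sum_mono2 BC(3) j) (use j J BC(1) in auto)
   then show "L2_norm M (P j q) \<le> e * L2_norm M q + snd (BC j) * (\<Sum>b\<in>?B. cmod (ip M q b))" using BC(4)[OF j q] by linarith
  qed
  also have "\<dots> = A * (real (card J) * e) * L2_norm M q + ?C * (\<Sum>b\<in>?B. cmod (ip M q b))"
   by (simp add: sum.distrib sum_distrib_right[symmetric] algebra_simps)
  also have "A * (real (card J) * e) * L2_norm M q \<le> t * L2_norm M q" by (intro mult_right_mono e') simp
  finally show ?thesis by simp
 qed
 moreover have "finite ?B" "?B \<subseteq> L2 M" using BC(1,2) J by auto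
 moreover have "0 \<le> ?C" by (intro mult_nonneg_nonneg A sum_nonneg BC(3))
 ultimately show "\<exists>B C. finite B \<and> B \<subseteq> L2 M \<and> 0 \<le> C \<and>
   (\<forall>(p, q)\<in>{(Q q, q) | q. q \<in> H}. L2_norm M p \<le> t * L2_norm M q + C * (\<Sum>b\<in>B. cmod (ip M q b)))"
  by (intro exI[of _ ?B] exI[of _ ?C]) auto
qed

text \<open>Different indices may produce the same functional, and the sum over the image loses
  these multiplicities; the cardinality makes up for them.\<close>

lemma sum_le_card_sum_image:
 fixes g :: "'b => real"
 assumes "finite Z" "\<And>b. 0 \<le> g b"
 shows "(\<Sum>r\<in>Z. g (f r)) \<le> real (card Z) * (\<Sum>b\<in>f ` Z. g b)"
proof -
 have "(\<Sum>r\<in>Z. g (f r)) \<le> (\<Sum>r\<in>Z. \<Sum>b\<in>f ` Z. g b)" by (intro sum_mono member_le_sum) (use assms in auto)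
 then show ?thesis by simp
qed

section \<open>Compactness for harmonic functions and for H^2_0\<close>

context bounded_open
begin

lemma harmonic_test_integral:
 assumes h: "h \<in> harmonic_L2 \<Omega>" and f: "f \<in> \<D> \<Omega>"
 shows "(LINT x|M. h x * laplacian f x) = 0" using h f by (simp add: harmonic_L2_def has_weak_laplacian_def)

text \<open>Since \<open>n\<close> is supported in \<Omega>, its product with any test function on
  the whole space may test the harmonicity of h. So \<open>interior_bound\<close> applies to the
  extension of h by zero, and its functionals act on h through \<open>r x * n x\<close>.\<close>

lemma harmonic_bump_compact:
 assumes n: "n \<in> \<D> \<Omega>"
 shows "compact_bound M {((\<lambda>x. n x * h x), h) | h. h \<in> harmonic_L2 \<Omega>}" unfolding compact_bound_def
proof (intro allI impI)
 fix e :: real assume e: "e > 0"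
 obtain Z C where Z: "finite Z" "0 \<le> C" "Z \<subseteq> \<D> UNIV"
  "\<And>h. h \<in> borel_measurable borel ==> h \<in> L2 lborel ==>
  (\<forall>f\<in>\<D> UNIV. (LINT y|lborel. h y * laplacian (\<lambda>y. n y * f y) y) = 0) ==>
  lnorm (\<lambda>y. n y * h y) \<le> e * lnorm h + C * (\<Sum>r\<in>Z. cmod (LINT y|lborel. r y * (n y * h y)))"
  using interior_bound[OF test_UNIV[OF n] e] by blast
 have rn: "(\<lambda>x. r x * n x) \<in> \<D> \<Omega>" if "r \<in> \<D> UNIV" for r by (rule test_smooth_mult[OF test_smooth[OF that] n])
 let ?b = "\<lambda>r x. cnj (r x * n x)"
 have "nrm (\<lambda>x. n x * h x) \<le> e * nrm h + C * real (card Z) * (\<Sum>b\<in>?b ` Z. cmod (ip M h b))"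
  if h: "h \<in> harmonic_L2 \<Omega>" for h
 proof -
  have hL: "h \<in> L2 M" by (rule harmonic_L2D[OF h])
  obtain v where v: "v \<in> borel_measurable borel" "v \<in> L2 lborel" "\<And>x. x \<notin> \<Omega> ==> v x = 0"
   "AE x in M. h x = v x" "lnorm v = nrm h" using borel_representative[OF open_\<Omega> hL] by metis
  have vM: "v \<in> borel_measurable M" by (rule borel_lebesgue_on[OF v(1)])
  have hM: "h \<in> borel_measurable M" using hL by (rule L2_measurable)
  have nM: "n \<in> borel_measurable M" by (rule borel_lebesgue_on[OF test_borel[OF n]])
  have integral_eq: "(LINT y|lborel. v y * g y) = (LINT y|M. h y * g y)" if g: "g \<in> \<D> \<Omega>" for g
  proof -
   have "(LINT y|M. h y * g y) = (LINT y|M. g y * v y)"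
   proof (rule integral_cong_AE)
    show "AE y in M. h y * g y = g y * v y" using v(4) by eventually_elim simp
   qed (use hM vM borel_lebesgue_on[OF test_borel[OF g]] in measurable)
   also have "\<dots> = (LINT y|lborel. g y * v y)" by (rule test_integral_on[OF open_\<Omega> g v(1)])
   finally show ?thesis by (simp add: mult.commute)
  qed
  have harm: "(LINT y|lborel. v y * laplacian (\<lambda>y. n y * f y) y) = 0" if f: "f \<in> \<D> UNIV" for f
  proof -
   have t: "(\<lambda>y. n y * f y) \<in> \<D> \<Omega>" using rn[OF f] by (simp add: mult.commute)
   show ?thesis unfolding integral_eq[OF test_laplacian[OF t]] by (rule harmonic_test_integral[OF h t])
  qed
  have "nrm (\<lambda>x. n x * h x) = nrm (\<lambda>x. n x * v x)"
   by (rule L2_norm_AE_cong) (use v(4) hM vM nM in \<open>auto intro: borel_measurable_times\<close>)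
  also have "\<dots> = lnorm (\<lambda>x. n x * v x)" by (rule L2_lebesgue_on_borel(2)[OF open_\<Omega>]) (use test_borel[OF n] v(1,3) in auto)
  also have "\<dots> \<le> e * lnorm v + C * (\<Sum>r\<in>Z. cmod (LINT y|lborel. r y * (n y * v y)))" using Z(4)[OF v(1,2)] harm by blast
  also have "(\<Sum>r\<in>Z. cmod (LINT y|lborel. r y * (n y * v y))) = (\<Sum>r\<in>Z. cmod (ip M h (?b r)))"
  proof (rule sum.cong[OF refl])
   fix r assume "r \<in> Z"
   then have t: "(\<lambda>x. r x * n x) \<in> \<D> \<Omega>" using rn Z(3) by blast
   show "cmod (LINT y|lborel. r y * (n y * v y)) = cmod (ip M h (?b r))"
    unfolding ip_def complex_cnj_cnj using integral_eq[OF t] by (simp add: mult_ac)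
  qed
  also have "C * (\<Sum>r\<in>Z. cmod (ip M h (?b r))) \<le> C * (real (card Z) * (\<Sum>b\<in>?b ` Z. cmod (ip M h b)))"
   by (intro mult_left_mono sum_le_card_sum_image Z(1,2)) simp
  finally show ?thesis by (simp add: v(5) mult.assoc)
 qed
 moreover have "?b ` Z \<subseteq> L2 M" using Z(3) test_L[OF test_cnj[OF rn]] by blast
 ultimately show "\<exists>B C. finite B \<and> B \<subseteq> L2 M \<and> 0 \<le> C \<and> (\<forall>(p, q)\<in>{((\<lambda>x. n x * h x), h) | h. h \<in> harmonic_L2 \<Omega>}.
   nrm p \<le> e * nrm q + C * (\<Sum>b\<in>B. cmod (ip M q b)))" by (intro exI[of _ "?b ` Z"] exI[of _ "C * real (card Z)"]) (use Z(1,2) in auto)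
qed

text \<open>Finitely many bumps inside \<Omega> have a sum bounded below on K, so the restriction to
  K is dominated by the products with these bumps.\<close>

lemma harmonic_compact:
 assumes K: "compact K" "K \<subseteq> \<Omega>"
 shows "compact_bound M {((\<lambda>x. indicator K x * h x), h) | h. h \<in> harmonic_L2 \<Omega>}"
proof -
 define I where "I = {(a, b). cbox a b \<subseteq> \<Omega>}"
 let ?n = "\<lambda>(a, b). box_bump 1 a b"
 have cover: "K \<subseteq> (\<Union>(a, b)\<in>I. box a b)"
 proof
  fix x assume "x \<in> K"
  then have "x \<in> \<Omega>" using K by blast
  then obtain a b where "cbox a b \<subseteq> \<Omega>" "x \<in> box a b" by (rule open_contains_cbox[OF open_\<Omega>])
  then show "x \<in> (\<Union>(a, b)\<in>I. box a b)" by (auto simp: I_def)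
 qed
 have "\<exists>J\<subseteq>I. finite J \<and> K \<subseteq> (\<Union>(a, b)\<in>J. box a b)"
  by (rule compactE_image[OF K(1) _ cover]) (auto simp: open_box)
 then obtain J where J: "J \<subseteq> I" "finite J" "K \<subseteq> (\<Union>(a, b)\<in>J. box a b)" by blast
 have t: "cr (?n j) \<in> \<D> \<Omega>" if "j \<in> J" for j by (cases j) (use that J(1) in \<open>auto simp: I_def intro!: box_bump_test\<close>)
 define F where "F x = (\<Sum>j\<in>J. ?n j x)" for x
 have F0: "0 \<le> F x" for x unfolding F_def by (rule sum_nonneg) (auto simp: box_bump_bounds)
 have Fpos: "0 < F x" if xK: "x \<in> K" for x
 proof -
  obtain j where j: "j \<in> J" "x \<in> (case j of (a, b) => box a b)" using subsetD[OF J(3) xK] by (rule UN_E)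
  then have "0 < ?n j x" by (auto simp: box_bump_pos_iff split: prod.splits)
  also have "\<dots> \<le> F x" unfolding F_def by (rule member_le_sum) (use j J(2) in \<open>auto simp: box_bump_bounds\<close>)
  finally show ?thesis .
 qed
 have "continuous_on K F" unfolding F_def by (intro continuous_intros) (auto intro: smooth_continuous smooth_box_bump)
 then obtain m where m: "m > 0" "\<And>x. x \<in> K ==> m \<le> F x"
 proof (cases "K = {}")
  case False
  then obtain x where "x \<in> K" "\<And>y. y \<in> K ==> F x \<le> F y"
   using continuous_attains_inf[OF K(1) False \<open>continuous_on K F\<close>] by blast
  then show ?thesis using that[of "F x"] Fpos by blast
 qed (auto intro: that[of 1])
 have ind: "(indicator K :: 'a => complex) \<in> borel_measurable M" by (intro borel_lebesgue_on borel_measurable_indicator borel_compact K(1))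
 show ?thesis
 proof (rule compact_bound_dominated[where P = "\<lambda>j h x. cr (?n j) x * h x" and A = "1 / m", OF J(2)])
  show "0 \<le> 1 / m" using m by simp
  show "compact_bound M {(\<lambda>x. cr (?n j) x * q x, q) |q. q \<in> harmonic_L2 \<Omega>}" if "j \<in> J" for j
   by (rule harmonic_bump_compact[OF t[OF that]])
 next
  fix h assume h: "h \<in> harmonic_L2 \<Omega>"
  have hL: "h \<in> L2 M" by (rule harmonic_L2D[OF h])
  have hM: "h \<in> borel_measurable M" using hL by (rule L2_measurable)
  have jL: "(\<lambda>x. cr (?n j) x * h x) \<in> L2 M" if "j \<in> J" for j
   by (rule L2_mult_bounded[OF hL borel_lebesgue_on[OF test_borel[OF t[OF that]]], of 1]) (auto simp: box_bump_bounds split: prod.splits)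
  have "nrm (\<lambda>x. indicator K x * h x) \<le> 1 / m * nrm (\<lambda>x. \<Sum>j\<in>J. cr (?n j) x * h x)"
  proof (rule L2_norm_mono)
   show "(\<lambda>x. \<Sum>j\<in>J. cr (?n j) x * h x) \<in> L2 M" by (rule L2_sum) (rule jL)
   show "(\<lambda>x. indicator K x * h x) \<in> borel_measurable M" using ind hM by (rule borel_measurable_times)
   show "0 \<le> 1 / m" using m by simp
   show "AE x in M. cmod (indicator K x * h x) \<le> 1 / m * cmod (\<Sum>j\<in>J. cr (?n j) x * h x)"
   proof (rule AE_I2)
    fix x
    have "(\<Sum>j\<in>J. cr (?n j) x * h x) = cor (F x) * h x" by (simp add: F_def sum_distrib_right)
    moreover have "indicator K x \<le> F x / m" using m F0[of x] by (auto simp: indicator_def)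
    ultimately show "cmod (indicator K x * h x) \<le> 1 / m * cmod (\<Sum>j\<in>J. cr (?n j) x * h x)"
     using F0[of x] mult_right_mono[of "indicator K x" "F x / m" "cmod (h x)"]
     by (cases "x \<in> K") (use m in \<open>simp_all add: norm_mult\<close>)
   qed
  qed
  also have "\<dots> \<le> 1 / m * (\<Sum>j\<in>J. nrm (\<lambda>x. cr (?n j) x * h x))" by (intro mult_left_mono L2_norm_sum jL) (use m in auto)
  finally show "nrm (\<lambda>x. indicator K x * h x) \<le> 1 / m * (\<Sum>j\<in>J. nrm (\<lambda>x. cr (?n j) x * h x))" .
 qed
qed

text \<open>In the estimate \<open>Rellich\<close> for w the gradient is bounded by \<Delta>w, and
  \<open>lap0_functional\<close> rewrites the functionals of w as functionals of \<Delta>w. The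
  claim passes from test functions to the closure.\<close>

lemma lap0_compact: "compact_bound M (lap0 \<Omega>)" unfolding compact_bound_def
proof (intro allI impI)
 fix e :: real assume e: "e > 0"
 obtain R where R: "R \<ge> 0" "\<And>f x. f \<in> \<D> \<Omega> ==> norm x > R ==> f x = 0" using radius by metis
 obtain C1 where C1: "C1 > 0" "\<And>f :: 'a => complex. f \<in> \<D> UNIV ==> (\<And>x. norm x > R ==> f x = 0) ==>
  grad_norm f \<le> C1 * lnorm (laplacian f) \<and> lnorm f \<le> C1 * lnorm (laplacian f)" using test_norms_le_laplacian[OF R(1)] by blast
 define e' where "e' = e / (2 * C1)"
 have e': "e' > 0" using e C1 by (simp add: e'_def)
 obtain Z :: "('a => complex) set" and C where Z: "finite Z" "C \<ge> 0" "Z \<subseteq> \<D> UNIV"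
  "\<And>f. f \<in> \<D> UNIV ==> (\<forall>x. norm x > R \<longrightarrow> f x = 0) ==>
   lnorm f \<le> e' * (grad_norm f + lnorm f) + C * (\<Sum>r\<in>Z. cmod (LINT y|lborel. r y * f y))" using Rellich[OF R(1) e'] by blast
 have "\<exists>r'. r' \<in> L2 M \<and> (\<forall>w g. (w, g) \<in> lap0 \<Omega> \<longrightarrow> ip M w (\<lambda>x. cnj (r x)) = ip M g r')" if "r \<in> Z" for r
 proof -
  have "(\<lambda>x. cnj (r x)) \<in> L2 M" using test_L[OF test_cnj] Z(3) that by blast
  then show ?thesis using lap0_functional by metis
 qed
 then obtain r' where r': "\<And>r. r \<in> Z ==> r' r \<in> L2 M"
  "\<And>r w g. r \<in> Z ==> (w, g) \<in> lap0 \<Omega> ==> ip M w (\<lambda>x. cnj (r x)) = ip M g (r' r)" by metis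
 have test: "nrm f \<le> e * nrm (laplacian f) + C * (\<Sum>r\<in>Z. cmod (ip M (laplacian f) (r' r)))"
  if f: "f \<in> \<D> \<Omega>" for f
 proof -
  have b: "grad_norm f \<le> C1 * lnorm (laplacian f)" "lnorm f \<le> C1 * lnorm (laplacian f)" using C1(2)[OF test_UNIV[OF f]] R(2)[OF f] by auto
  have "nrm f = lnorm f" by (rule test_norm_on'[OF f])
  also have "\<dots> \<le> e' * (grad_norm f + lnorm f) + C * (\<Sum>r\<in>Z. cmod (LINT y|lborel. r y * f y))"
   by (rule Z(4)[OF test_UNIV[OF f]]) (use R(2)[OF f] in auto)
  also have "e' * (grad_norm f + lnorm f) \<le> e' * (2 * C1 * lnorm (laplacian f))" using e' b by (intro mult_left_mono) auto
  also have "\<dots> = e * nrm (laplacian f)" using C1(1) test_norm_on'[OF test_laplacian[OF f]] by (simp add: e'_def)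
  also have "(\<Sum>r\<in>Z. cmod (LINT y|lborel. r y * f y)) = (\<Sum>r\<in>Z. cmod (ip M (laplacian f) (r' r)))"
  proof (rule sum.cong[OF refl])
   fix r assume r: "r \<in> Z"
   then have "r \<in> borel_measurable borel" using Z(3) test_borel by blast
   then have "(LINT y|lborel. r y * f y) = ip M f (\<lambda>x. cnj (r x))"
    unfolding ip_def complex_cnj_cnj using test_integral_on[OF open_\<Omega> f, of r] by (simp add: mult.commute)
   also have "\<dots> = ip M (laplacian f) (r' r)" by (rule r'(2)[OF r lap0_test[OF open_\<Omega> f]])
   finally show "cmod (LINT y|lborel. r y * f y) = cmod (ip M (laplacian f) (r' r))" by simp
  qed
  finally show ?thesis by simp
 qed
 have "nrm w \<le> e * nrm g + C * real (card Z) * (\<Sum>b\<in>r' ` Z. cmod (ip M g b))" if wg: "(w, g) \<in> lap0 \<Omega>" for w g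
 proof -
  note wL = lap0_L2(1)[OF wg] and gL = lap0_L2(2)[OF wg]
  obtain f where f: "\<And>n. f n \<in> \<D> \<Omega>" "L2_tendsto M f w" "L2_tendsto M (\<lambda>n. laplacian (f n)) g"
   by (rule lap0_sequence[OF wg]) blast
  have L: "\<And>n. f n \<in> L2 M" "\<And>n. laplacian (f n) \<in> L2 M" using test_L[OF f(1)] test_L[OF test_laplacian[OF f(1)]] by auto
  have l1: "(\<lambda>n. nrm (f n)) \<longlonglongrightarrow> nrm w" by (rule L2_tendsto_norm[OF L(1) wL f(2)])
  have l2: "(\<lambda>n. e * nrm (laplacian (f n)) + C * (\<Sum>r\<in>Z. cmod (ip M (laplacian (f n)) (r' r))))
    \<longlonglongrightarrow> e * nrm g + C * (\<Sum>r\<in>Z. cmod (ip M g (r' r)))"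
   by (intro tendsto_intros L2_tendsto_norm[OF L(2) gL f(3)] L2_tendsto_ip[OF L(2) _ gL _ f(3) L2_tendsto_const] r'(1))
  have "nrm w \<le> e * nrm g + C * (\<Sum>r\<in>Z. cmod (ip M g (r' r)))" by (rule LIMSEQ_le[OF l1 l2]) (use test[OF f(1)] in blast)
  also have "(\<Sum>r\<in>Z. cmod (ip M g (r' r))) \<le> real (card Z) * (\<Sum>b\<in>r' ` Z. cmod (ip M g b))"
   by (intro sum_le_card_sum_image Z(1)) simp
  finally show ?thesis using Z(2) by (simp add: mult_left_mono mult.assoc)
 qed
 then show "\<exists>B C. finite B \<and> B \<subseteq> L2 M \<and> 0 \<le> C \<and>
   (\<forall>(p, q)\<in>lap0 \<Omega>. nrm p \<le> e * nrm q + C * (\<Sum>b\<in>B. cmod (ip M q b)))"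
  by (intro exI[of _ "r' ` Z"] exI[of _ "C * real (card Z)"]) (use Z(1,2) r'(1) in auto)
qed

end

section \<open>Hankel operators and the a priori estimate\<close>

context bounded_open
begin

lemma compact_closure_\<Omega>: "compact (closure \<Omega>)" using bounded_closure[OF bounded_\<Omega>] by (simp add: compact_eq_bounded_closed)

lemma continuous_measurable:
 fixes F :: "'a => 'b::euclidean_space"
 assumes "continuous_on (closure \<Omega>) F"
 shows "F \<in> borel_measurable M" by (rule continuous_imp_measurable_on_sets_lebesgue[OF continuous_on_subset[OF assms closure_subset]])
  (use open_\<Omega> in auto)

lemma continuous_bound:
 fixes F :: "'a => 'b::euclidean_space"
 assumes "continuous_on (closure \<Omega>) F"
 obtains C where "C \<ge> 0" "\<And>x. x \<in> closure \<Omega> ==> norm (F x) \<le> C"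
proof -
 have "bounded (F ` closure \<Omega>)" by (rule compact_imp_bounded[OF compact_continuous_image[OF assms compact_closure_\<Omega>]])
 then obtain C where "\<And>y. y \<in> F ` closure \<Omega> ==> norm y \<le> C" by (auto simp: bounded_iff)
 then show ?thesis by (intro that[of "max C 0"]) (auto simp: le_max_iff_disj)
qed

lemma multiplier_L2:
 fixes F :: "'a => complex"
 assumes F: "continuous_on (closure \<Omega>) F" and u: "u \<in> L2 M"
 shows "(\<lambda>x. F x * u x) \<in> L2 M"
proof -
 obtain C where C: "C \<ge> 0" "\<And>x. x \<in> closure \<Omega> ==> cmod (F x) \<le> C" using continuous_bound[OF F] by metis
 show ?thesis by (rule L2_mult_bounded[OF u continuous_measurable[OF F], of C])
   (use C(2) closure_subset in \<open>auto simp: space_restrict_space\<close>)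
qed

lemma multiplier:
 fixes F :: "'a => complex"
 assumes "continuous_on (closure \<Omega>) F"
 obtains C where "C \<ge> 0" "\<And>u. u \<in> L2 M ==> (\<lambda>x. F x * u x) \<in> L2 M"
  "\<And>u. u \<in> L2 M ==> nrm (\<lambda>x. F x * u x) \<le> C * nrm u"
proof -
 obtain C where C: "C \<ge> 0" "\<And>x. x \<in> closure \<Omega> ==> cmod (F x) \<le> C" using continuous_bound[OF assms] by metis
 have b: "cmod (F x) \<le> C" if "x \<in> space M" for x using that C(2) closure_subset by (auto simp: space_restrict_space)
 note m = continuous_measurable[OF assms]
 show ?thesis by (rule that[OF C(1)]) (use L2_mult_bounded[OF _ m b] L2_norm_mult_bounded[OF _ m b C(1)] in auto)
qed

text \<open>\<open>F \<Delta>\<phi>\<close> differs from \<open>\<Delta>(F \<phi>)\<close>, which is orthogonal to harmonic functions, by terms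
 containing only first derivatives of \<open>\<phi>\<close>.\<close>

lemma hankel_smooth:
 fixes F :: "'a => complex" and \<epsilon> :: real
 assumes F: "smooth F" and \<epsilon>: "\<epsilon> > 0"
 shows "\<exists>C\<ge>0. \<forall>h w g. h \<in> harmonic_L2 \<Omega> \<longrightarrow> (w, g) \<in> lap0 \<Omega> \<longrightarrow>
  cmod (ip M h (\<lambda>x. F x * g x)) \<le> nrm h * (\<epsilon> * nrm g + C * nrm w)"
proof -
 have sF: "smooth (pderivs vs F)" if "set vs \<subseteq> Basis" for vs by (rule smooth_pderivs[OF F that])
 let ?P = "\<lambda>vs C. 0 \<le> C \<and> (\<forall>u. u \<in> L2 M \<longrightarrow> (\<lambda>x. pderivs vs F x * u x) \<in> L2 M \<and>
   nrm (\<lambda>x. pderivs vs F x * u x) \<le> C * nrm u)"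
 have "\<exists>C. ?P vs C" if "set vs \<subseteq> Basis" for vs
 proof (rule multiplier[OF smooth_continuous[OF sF[OF that]]])
  fix C :: real assume "0 \<le> C" and "\<And>u. u \<in> L2 M ==> (\<lambda>x. pderivs vs F x * u x) \<in> L2 M"
   and "\<And>u. u \<in> L2 M ==> nrm (\<lambda>x. pderivs vs F x * u x) \<le> C * nrm u"
  then show "\<exists>C. ?P vs C" by (intro exI[of _ C]) simp
 qed
 then have "\<forall>vs\<in>{vs. set vs \<subseteq> Basis}. \<exists>C. ?P vs C" by simp
 then obtain K where KP: "\<forall>vs\<in>{vs. set vs \<subseteq> Basis}. ?P vs (K vs)" unfolding bchoice_iff by (rule exE)
 have K: "\<And>vs. set vs \<subseteq> Basis ==> K vs \<ge> 0"
  "\<And>vs u. set vs \<subseteq> Basis ==> u \<in> L2 M ==> (\<lambda>x. pderivs vs F x * u x) \<in> L2 M"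
  "\<And>vs u. set vs \<subseteq> Basis ==> u \<in> L2 M ==> nrm (\<lambda>x. pderivs vs F x * u x) \<le> K vs * nrm u" using KP by simp_all
 define K1 where "K1 = (\<Sum>i\<in>Basis. K [i])"
 define K2 where "K2 = (\<Sum>i\<in>Basis. K [i, i])"
 have K1: "0 \<le> K1" and K2: "0 \<le> K2" unfolding K1_def K2_def by (auto intro!: sum_nonneg K(1))
 define D where "D = real DIM('a)"
 have D: "0 \<le> D" by (simp add: D_def)
 \<comment> \<open>The gradient of \<phi> is interpolated between \<phi> and \<Delta>\<phi>.
   Weighting AM-GM so that \<Delta>\<phi> receives \<epsilon> puts K1^2 D / \<epsilon> in front of
   \<phi>; K2 comes from the second derivatives of F.\<close>
 define C where "C = K1\<^sup>2 * D / \<epsilon> + K2"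
 have C: "0 \<le> C" unfolding C_def using D \<epsilon> K2 by simp
 have test: "cmod (ip M h (\<lambda>x. F x * laplacian \<phi> x)) \<le> nrm h * (\<epsilon> * nrm (laplacian \<phi>) + C * nrm \<phi>)"
  if h: "h \<in> harmonic_L2 \<Omega>" and \<phi>: "\<phi> \<in> \<D> \<Omega>" for h \<phi>
 proof -
  have hL: "h \<in> L2 M" by (rule harmonic_L2D[OF h])
  have F\<phi>: "(\<lambda>x. F x * \<phi> x) \<in> \<D> \<Omega>" by (rule test_smooth_mult[OF F \<phi>])
  have \<phi>i: "pderivs [i] \<phi> \<in> \<D> \<Omega>" if "i \<in> Basis" for i by (rule test_pderivs[OF \<phi>]) (use that in auto)
  define p where "p x = (\<Sum>i\<in>Basis. pderivs [i] F x * pderivs [i] \<phi> x)" for x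
  define q where "q x = (\<Sum>i\<in>Basis. pderivs [i, i] F x * \<phi> x)" for x
  have pL: "p \<in> L2 M" unfolding p_def by (intro L2_sum K(2) test_L[OF \<phi>i]) auto
  have qL: "q \<in> L2 M" unfolding q_def by (intro L2_sum K(2) test_L[OF \<phi>]) auto
  have "nrm p \<le> (\<Sum>i\<in>Basis. nrm (\<lambda>x. pderivs [i] F x * pderivs [i] \<phi> x))"
   unfolding p_def by (intro L2_norm_sum K(2) test_L[OF \<phi>i]) auto
  also have "\<dots> \<le> (\<Sum>i\<in>Basis. K1 * lnorm (pderivs [i] \<phi>))"
  proof (rule sum_mono)
   fix i :: 'a assume i: "i \<in> Basis"
   have "nrm (\<lambda>x. pderivs [i] F x * pderivs [i] \<phi> x) \<le> K [i] * nrm (pderivs [i] \<phi>)"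
    by (rule K(3)[OF _ test_L[OF \<phi>i[OF i]]]) (use i in auto)
   also have "\<dots> \<le> K1 * nrm (pderivs [i] \<phi>)" unfolding K1_def by (intro mult_right_mono member_le_sum K(1)) (use i in auto)
   finally show "nrm (\<lambda>x. pderivs [i] F x * pderivs [i] \<phi> x) \<le> K1 * lnorm (pderivs [i] \<phi>)"
    unfolding test_norm_on'[OF \<phi>i[OF i]] .
  qed
  finally have pn: "nrm p \<le> K1 * grad_norm \<phi>" by (simp add: grad_norm_def sum_distrib_left)
  have "nrm q \<le> (\<Sum>i\<in>Basis. nrm (\<lambda>x. pderivs [i, i] F x * \<phi> x))"
   unfolding q_def by (intro L2_norm_sum K(2) test_L[OF \<phi>]) auto
  also have "\<dots> \<le> (\<Sum>i\<in>Basis. K [i, i] * nrm \<phi>)" by (intro sum_mono K(3) test_L[OF \<phi>]) auto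
  finally have qn: "nrm q \<le> K2 * nrm \<phi>" by (simp add: K2_def sum_distrib_right)
  have "ip M h (laplacian (\<lambda>x. F x * \<phi> x)) = cnj (ip M (laplacian (\<lambda>x. F x * \<phi> x)) h)" by (simp add: ip_cnj)
  also have "\<dots> = 0" using h F\<phi> by (simp add: harmonic_L2_iff)
  finally have orth: "ip M h (laplacian (\<lambda>x. F x * \<phi> x)) = 0" .
  have "(\<lambda>x. F x * laplacian \<phi> x) = (\<lambda>x. laplacian (\<lambda>x. F x * \<phi> x) x - (2 * p x + q x))"
   by (rule ext) (simp add: laplacian_mult[OF F test_smooth[OF \<phi>]] p_def q_def laplacian_def[of F] sum_distrib_right)
  then have "ip M h (\<lambda>x. F x * laplacian \<phi> x) = ip M h (laplacian (\<lambda>x. F x * \<phi> x)) - ip M h (\<lambda>x. 2 * p x + q x)"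
   using ip_diff_right[OF test_L[OF test_laplacian[OF F\<phi>]] L2_add[OF L2_scale[OF pL] qL] hL] by simp
  then have "cmod (ip M h (\<lambda>x. F x * laplacian \<phi> x)) = cmod (ip M h (\<lambda>x. 2 * p x + q x))" by (simp add: orth)
  also have "\<dots> \<le> nrm h * nrm (\<lambda>x. 2 * p x + q x)" by (rule L2_Cauchy_Schwarz[OF hL L2_add[OF L2_scale[OF pL] qL]])
  also have "\<dots> \<le> nrm h * (\<epsilon> * nrm (laplacian \<phi>) + C * nrm \<phi>)"
  proof (intro mult_left_mono)
   have amgm: "4 * a * b \<le> (a + b)\<^sup>2" for a b :: real using sum_squares_bound[of a b] by (simp add: power2_sum)
   let ?X = "nrm (laplacian \<phi>)" and ?Y = "nrm \<phi>"
   have "(2 * (K1 * grad_norm \<phi>))\<^sup>2 = 4 * K1\<^sup>2 * (grad_norm \<phi>)\<^sup>2" by (simp add: power2_eq_square)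
   also have "\<dots> \<le> 4 * K1\<^sup>2 * (D * (?Y * ?X))"
    using grad_norm_square_le[OF test_UNIV[OF \<phi>]] test_norm_on'[OF \<phi>] test_norm_on'[OF test_laplacian[OF \<phi>]]
    by (intro mult_left_mono) (auto simp: D_def)
   also have "\<dots> = 4 * (\<epsilon> * ?X) * (K1\<^sup>2 * D / \<epsilon> * ?Y)" using \<epsilon> by simp
   also have "\<dots> \<le> (\<epsilon> * ?X + K1\<^sup>2 * D / \<epsilon> * ?Y)\<^sup>2" by (rule amgm)
   finally have "2 * (K1 * grad_norm \<phi>) \<le> \<epsilon> * ?X + K1\<^sup>2 * D / \<epsilon> * ?Y"
    by (rule power2_le_imp_le) (use \<epsilon> D in simp)
   moreover have "nrm (\<lambda>x. 2 * p x + q x) \<le> 2 * nrm p + nrm q"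
    using L2_norm_triangle[OF L2_scale[OF pL, of 2] qL] by (simp add: L2_norm_scale)
   ultimately show "nrm (\<lambda>x. 2 * p x + q x) \<le> \<epsilon> * ?X + C * ?Y" using pn qn unfolding C_def distrib_right by linarith
  qed simp
  finally show ?thesis .
 qed
 have CF: "(\<lambda>x. F x * u x) \<in> L2 M" if "u \<in> L2 M" for u using K(2)[of "[]" u] that by simp
 have "cmod (ip M h (\<lambda>x. F x * g x)) \<le> nrm h * (\<epsilon> * nrm g + C * nrm w)"
  if h: "h \<in> harmonic_L2 \<Omega>" and wg: "(w, g) \<in> lap0 \<Omega>" for h w g
 proof -
  note wL = lap0_L2(1)[OF wg] and gL = lap0_L2(2)[OF wg] and hL = harmonic_L2D[OF h]
  obtain \<phi> where \<phi>: "\<And>n. \<phi> n \<in> \<D> \<Omega>" "L2_tendsto M \<phi> w" "L2_tendsto M (\<lambda>n. laplacian (\<phi> n)) g"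
   by (rule lap0_sequence[OF wg]) blast
  have L: "\<And>n. \<phi> n \<in> L2 M" "\<And>n. laplacian (\<phi> n) \<in> L2 M" using test_L[OF \<phi>(1)] test_L[OF test_laplacian[OF \<phi>(1)]] by auto
  obtain b where b: "b \<ge> 0" "\<And>x. x \<in> closure \<Omega> ==> cmod (F x) \<le> b" using continuous_bound[OF smooth_continuous[OF F]] by metis
  have "cmod (F x) \<le> b" if "x \<in> space M" for x using that b(2) closure_subset by (auto simp: space_restrict_space)
  then have Ft: "L2_tendsto M (\<lambda>n x. F x * laplacian (\<phi> n) x) (\<lambda>x. F x * g x)"
   by (rule L2_tendsto_mult_bounded[OF L(2) gL \<phi>(3) borel_lebesgue_on[OF smooth_borel[OF F]]])
  have l1: "(\<lambda>n. cmod (ip M h (\<lambda>x. F x * laplacian (\<phi> n) x))) \<longlonglongrightarrow> cmod (ip M h (\<lambda>x. F x * g x))"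
   by (rule tendsto_norm, rule L2_tendsto_ip[where s = "\<lambda>n. h", OF hL CF[OF L(2)] hL CF[OF gL] L2_tendsto_const Ft])
  have l2: "(\<lambda>n. nrm h * (\<epsilon> * nrm (laplacian (\<phi> n)) + C * nrm (\<phi> n)))
    \<longlonglongrightarrow> nrm h * (\<epsilon> * nrm g + C * nrm w)"
   by (intro tendsto_intros L2_tendsto_norm[OF L(2) gL \<phi>(3)] L2_tendsto_norm[OF L(1) wL \<phi>(2)])
  show ?thesis by (rule LIMSEQ_le[OF l1 l2]) (use test[OF h \<phi>(1)] in blast)
 qed
 then show ?thesis using C by blast
qed

text \<open>A Stone-Weierstrass polynomial replaces V: the uniform error e/2 acts as a bounded
  multiplier, and the polynomial part falls under \<open>hankel_smooth\<close>.\<close>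

lemma hankel:
 fixes V :: "'a => real" and e :: real and c :: complex
 assumes V: "continuous_on (closure \<Omega>) V" and e: "e > 0"
 shows "\<exists>C\<ge>0. \<forall>h w g. h \<in> harmonic_L2 \<Omega> \<longrightarrow> (w, g) \<in> lap0 \<Omega> \<longrightarrow>
  cmod (ip M h (\<lambda>x. (cor (V x) - c) * g x)) \<le> nrm h * (e * nrm g + C * nrm w)"
proof -
 obtain p where p: "real_polynomial_function p" "\<And>x. x \<in> closure \<Omega> ==> \<bar>V x - p x\<bar> < e / 2"
  using Stone_Weierstrass_real_polynomial_function[OF compact_closure_\<Omega> V, of "e / 2"] e by auto
 have sp: "smooth (cr p)" by (rule smooth_pderivs_linear(1)[OF bounded_linear_of_real smooth_real_polynomial_function[OF p(1)]])
 have sF: "smooth (\<lambda>x. cr p x + (- c))" by (rule smooth_pderivs_add(1)[OF sp smooth_const])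
 have "e / 2 > 0" using e by simp
 from hankel_smooth[OF sF this] obtain C where C: "C \<ge> 0" "\<And>h w g. h \<in> harmonic_L2 \<Omega> ==> (w, g) \<in> lap0 \<Omega> ==>
  cmod (ip M h (\<lambda>x. (cr p x + - c) * g x)) \<le> nrm h * (e / 2 * nrm g + C * nrm w)" by blast
 have "cmod (ip M h (\<lambda>x. (cor (V x) - c) * g x)) \<le> nrm h * (e * nrm g + C * nrm w)"
  if h: "h \<in> harmonic_L2 \<Omega>" and wg: "(w, g) \<in> lap0 \<Omega>" for h w g
 proof -
  note gL = lap0_L2(2)[OF wg] and hL = harmonic_L2D[OF h]
  have CF: "(\<lambda>x. (cr p x + - c) * u x) \<in> L2 M" if uL: "u \<in> L2 M" for u by (rule multiplier_L2[OF smooth_continuous[OF sF] uL])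
  have mV: "(\<lambda>x. cor (V x - p x)) \<in> borel_measurable M"
   using continuous_measurable[OF V] borel_lebesgue_on[OF smooth_borel[OF smooth_real_polynomial_function[OF p(1)]]] by measurable
  have bV: "cmod (cor (V x - p x)) \<le> e / 2" if "x \<in> space M" for x
   unfolding norm_of_real using p(2)[of x] that closure_subset[of \<Omega>] by (auto simp: space_restrict_space subset_iff intro: less_imp_le)
  let ?d = "\<lambda>x. cor (V x - p x) * g x"
  have dL: "?d \<in> L2 M" by (rule L2_mult_bounded[OF gL mV bV])
  have "(\<lambda>x. (cor (V x) - c) * g x) = (\<lambda>x. ?d x + (cr p x + - c) * g x)" by (rule ext) (simp add: algebra_simps)
  then have "ip M h (\<lambda>x. (cor (V x) - c) * g x) = ip M h ?d + ip M h (\<lambda>x. (cr p x + - c) * g x)"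
   using ip_add_right[OF dL CF[OF gL] hL] by simp
  then have "cmod (ip M h (\<lambda>x. (cor (V x) - c) * g x)) \<le> cmod (ip M h ?d) + cmod (ip M h (\<lambda>x. (cr p x + - c) * g x))"
   by (simp only: norm_triangle_ineq)
  also have "cmod (ip M h ?d) \<le> nrm h * (e / 2 * nrm g)" by (rule order_trans[OF L2_Cauchy_Schwarz[OF hL dL]])
    (intro mult_left_mono L2_norm_mult_bounded gL mV bV, use e in auto)
  also have "cmod (ip M h (\<lambda>x. (cr p x + - c) * g x)) \<le> nrm h * (e / 2 * nrm g + C * nrm w)" by (rule C(2)[OF h wg])
  finally show ?thesis by (simp add: algebra_simps)
 qed
 then show ?thesis using C(1) by blast
qed

end

section \<open>The a priori estimate away from the boundary values of V\<close>

context bounded_open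
begin

text \<open>Here h, X and m stand for the norms of the harmonic part, of \<Delta>w and of w, n for
  the residual, S and T for the functionals; let Q = S + n + m. The weight 1/(4A) makes the feedback
  of X through h cost only X^2/4, so X is at most D' Q. The weight 1/(2D') then gives m \<le> Q/2 +
  T, which is absorbed.\<close>

lemma essential_part_bound:
 fixes A C1 Cw X S n m h T :: real
 assumes pos: "0 < A" "0 \<le> C1" "0 \<le> Cw" "0 \<le> X" "0 \<le> S" "0 \<le> n" "0 \<le> m" "0 \<le> T"
  and h: "h \<le> A * (S + n + X + m)"
  and X: "X\<^sup>2 \<le> h * (1 / (4 * A) * X + C1 * m) + Cw * m * X + n * X"
  and m: "m \<le> X / (2 * (2 * (1 / 4 + C1 * A + Cw + 1) + 2 * (C1 * A) + 1)) + T"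
 shows "h + m \<le> 2 * (A * (2 * (1 / 4 + C1 * A + Cw + 1) + 2 * (C1 * A) + 1 + 1) + 1) * (S + n + T)"
proof -
 define Q where "Q = S + n + m"
 define D where "D = 1 / 4 + C1 * A + Cw + 1"
 define E where "E = C1 * A"
 define D' where "D' = 2 * D + 2 * E + 1"
 have Q: "0 \<le> Q" "m \<le> Q" "n \<le> Q" using pos by (auto simp: Q_def)
 have DE: "0 \<le> D" "0 \<le> E" using pos by (auto simp: D_def E_def)
 have D': "1 \<le> D'" using DE by (simp add: D'_def)
 have hQ: "h \<le> A * (Q + X)" using h by (simp add: Q_def algebra_simps)
 have "h * (1 / (4 * A) * X + C1 * m) \<le> A * (Q + X) * (1 / (4 * A) * X + C1 * m)" by (intro mult_right_mono hQ) (use pos in simp)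
 also have "\<dots> = (Q + X) * X / 4 + E * (Q + X) * m" using pos by (simp add: E_def field_simps)
 also have "E * (Q + X) * m \<le> E * (Q + X) * Q" by (intro mult_left_mono Q) (use DE Q pos in simp)
 finally have 1: "h * (1 / (4 * A) * X + C1 * m) \<le> (Q + X) * X / 4 + E * (Q + X) * Q" by simp
 have 2: "Cw * m * X \<le> Cw * Q * X" by (intro mult_right_mono mult_left_mono Q) (use pos in auto)
 have 3: "n * X \<le> Q * X" by (intro mult_right_mono Q) (use pos in auto)
 have "X\<^sup>2 \<le> (Q + X) * X / 4 + E * (Q + X) * Q + Cw * Q * X + Q * X" using X 1 2 3 by linarith
 moreover have "(Q + X) * X / 4 + E * (Q + X) * Q + Cw * Q * X + Q * X = 1 / 4 * X\<^sup>2 + (D * Q * X + E * Q\<^sup>2)"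
  by (simp add: D_def E_def field_simps power2_eq_square)
 ultimately have "3 / 4 * X\<^sup>2 \<le> D * Q * X + E * Q\<^sup>2" by linarith
 moreover have "0 \<le> X\<^sup>2" by simp
 ultimately have "X\<^sup>2 \<le> (2 * D) * Q * X + (2 * E) * Q\<^sup>2" by linarith
 then have XQ: "X \<le> D' * Q" unfolding D'_def by (rule quadratic_inequality_bound) (use DE Q pos in auto)
 have "X / (2 * D') \<le> Q / 2" using XQ D' by (simp add: field_simps)
 moreover have "m \<le> X / (2 * D') + T" using m by (simp add: D'_def D_def E_def)
 ultimately have mm: "m \<le> S + n + 2 * T" by (simp add: Q_def)
 then have QQ: "Q \<le> 2 * (S + n + T)" by (simp add: Q_def)
 have "h + m \<le> A * (Q + D' * Q) + Q" using hQ mult_left_mono[OF add_left_mono[OF XQ, of Q] less_imp_le[OF pos(1)]] Q(2) by linarith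
 also have "\<dots> = (A * (1 + D') + 1) * Q" by (simp add: algebra_simps)
 also have "\<dots> \<le> (A * (1 + D') + 1) * (2 * (S + n + T))" by (intro mult_left_mono QQ) (use pos D' in auto)
 also have "\<dots> = 2 * (A * (D' + 1) + 1) * (S + n + T)" by (simp add: algebra_simps)
 finally show ?thesis by (simp only: D'_def D_def E_def)
qed

text \<open>|W| exceeds some c > 0 on the compact boundary, so the sublevel set where |W| \<le> c in
  the closure avoids the boundary and is a compact subset of \<Omega>.\<close>

lemma nonvanishing_off_compact:
 fixes W :: "'a => complex"
 assumes W: "continuous_on (closure \<Omega>) W" and nz: "\<And>x. x \<in> frontier \<Omega> ==> W x \<noteq> 0"
 obtains K c where "c > 0" "compact K" "K \<subseteq> \<Omega>" "\<And>x. x \<in> \<Omega> - K ==> c \<le> cmod (W x)"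
proof -
 have "\<exists>c>0. \<forall>x\<in>frontier \<Omega>. c < cmod (W x)"
 proof (cases "frontier \<Omega> = {}")
  case False
  have cf: "compact (frontier \<Omega>)" by (rule compact_frontier_bounded[OF bounded_\<Omega>])
  have "continuous_on (frontier \<Omega>) (\<lambda>x. cmod (W x))" by (intro continuous_on_norm continuous_on_subset[OF W]) (simp add: frontier_def)
  then obtain x where x: "x \<in> frontier \<Omega>" "\<And>y. y \<in> frontier \<Omega> ==> cmod (W x) \<le> cmod (W y)"
   using continuous_attains_inf[OF cf False] by blast
  have "cmod (W x) > 0" using nz[OF x(1)] by simp
  moreover have "cmod (W x) / 2 < cmod (W y)" if "y \<in> frontier \<Omega>" for y using x(2)[OF that] \<open>cmod (W x) > 0\<close> by linarith
  ultimately show ?thesis by (intro exI[of _ "cmod (W x) / 2"]) auto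
 qed (auto intro: exI[of _ 1])
 then obtain c where c: "c > 0" "\<And>x. x \<in> frontier \<Omega> ==> c < cmod (W x)" by blast
 define K where "K = closure \<Omega> \<inter> (\<lambda>x. cmod (W x)) -` {..c}"
 have "closed K" unfolding K_def by (intro continuous_closed_preimage continuous_on_norm W) auto
 moreover have "K \<subseteq> closure \<Omega>" by (auto simp: K_def)
 ultimately have "compact K" using compact_Int_closed[OF compact_closure_\<Omega>, of K] by (simp add: Int_absorb1)
 moreover have "K \<subseteq> \<Omega>"
 proof
  fix x assume x: "x \<in> K"
  then have "x \<notin> frontier \<Omega>" using c(2)[of x] by (auto simp: K_def)
  then show "x \<in> \<Omega>" using x interior_open[OF open_\<Omega>] by (auto simp: K_def frontier_def)
 qed
 moreover have "c \<le> cmod (W x)" if "x \<in> \<Omega> - K" for x using that closure_subset by (force simp: K_def)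
 ultimately show ?thesis by (rule that[OF c(1)])
qed

text \<open>The equation reads \<Delta>w = W u - g0 with residual g0. Solved for W h, it bounds h
  off \<open>K\<close>; paired with \<Delta>w, it bounds \<Delta>w by the Hankel term, w and the
  residual. The numerical lemma \<open>essential_part_bound\<close> combines the two.\<close>

theorem krein_a_priori:
 fixes V :: "'a => real"
 assumes V: "continuous_on (closure \<Omega>) V" and z: "\<And>x. x \<in> frontier \<Omega> ==> cor (V x) \<noteq> z"
 shows "\<exists>B C. finite B \<and> B \<subseteq> L2 M \<and> (\<forall>u f w g. u \<in> L2 M \<longrightarrow> f \<in> L2 M \<longrightarrow> (w, g) \<in> lap0 \<Omega> \<longrightarrow>
   (\<lambda>x. u x - w x) \<in> harmonic_L2 \<Omega> \<longrightarrow> (AE x in M. f x - cor (V x) * u x = - g x) \<longrightarrow>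
   nrm u \<le> C * (nrm (\<lambda>x. f x - z * u x) + (\<Sum>b\<in>B. cmod (ip M u b))))"
proof -
 define W where "W x = cor (V x) - z" for x
 \<comment> \<open>The adjoint multiplier, different from \<open>W\<close> when z is not real;
   nonreal z have to be excluded from the essential spectrum as well.\<close>
 define Wc where "Wc x = cor (V x) - cnj z" for x
 have W: "continuous_on (closure \<Omega>) W" unfolding W_def by (intro continuous_intros V)
 have Wc: "continuous_on (closure \<Omega>) Wc" unfolding Wc_def by (intro continuous_intros V)
 obtain Cw where Cw: "0 \<le> Cw" "\<And>u. u \<in> L2 M ==> nrm (\<lambda>x. W x * u x) \<le> Cw * nrm u" using multiplier[OF W] by metis
 note WL = multiplier_L2[OF W] and WcL = multiplier_L2[OF Wc]
 have Wadj: "ip M (\<lambda>x. W x * a x) b = ip M a (\<lambda>x. Wc x * b x)" for a b by (simp add: ip_def W_def Wc_def mult_ac)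
 obtain K c0 where K: "c0 > 0" "compact K" "K \<subseteq> \<Omega>" "\<And>x. x \<in> \<Omega> - K ==> c0 \<le> cmod (W x)"
  using nonvanishing_off_compact[OF W] z unfolding W_def by (metis right_minus_eq)
 obtain Bh Ch where Bh: "finite Bh" "Bh \<subseteq> L2 M" "0 \<le> Ch"
  "\<forall>(p, q)\<in>{((\<lambda>x. indicator K x * h x), h) | h. h \<in> harmonic_L2 \<Omega>}.
    nrm p \<le> 1 / 2 * nrm q + Ch * (\<Sum>b\<in>Bh. cmod (ip M q b))"
  using harmonic_compact[OF K(2,3), unfolded compact_bound_def, rule_format, of "1 / 2"] by auto
 have Bh': "nrm (\<lambda>x. indicator K x * h x) \<le> 1 / 2 * nrm h + Ch * (\<Sum>b\<in>Bh. cmod (ip M h b))"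
  if "h \<in> harmonic_L2 \<Omega>" for h using bspec[OF Bh(4), of "((\<lambda>x. indicator K x * h x), h)"] that by auto
 \<comment> \<open>Absorbing half of the norm of h doubles the remaining coefficients; A dominates 2
   Ch, 2/c0 and 2 Cw/c0.\<close>
 define A where "A = 2 * (Ch + (1 + Cw) / c0)"
 have A: "0 < A" "2 * Ch \<le> A" "2 / c0 \<le> A" "2 * Cw / c0 \<le> A"
 proof -
  have "A = 2 * Ch + 2 / c0 + 2 * Cw / c0" by (simp add: A_def add_divide_distrib)
  moreover have "0 < 2 / c0" "0 \<le> 2 * Cw / c0" using K(1) Cw(1) by auto
  ultimately show "0 < A" "2 * Ch \<le> A" "2 / c0 \<le> A" "2 * Cw / c0 \<le> A" using Bh(3) by linarith+
 qed
 \<comment> \<open>The order of choices matters: A is fixed first, the Hankel tolerance is chosen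
   against A, and the tolerance 1/(2D') for w against both resulting constants.\<close>
 have "1 / (4 * A) > 0" using A by simp
 from hankel[OF V this, of "cnj z"] obtain C1 where C1: "C1 \<ge> 0"
  "\<And>h w g. h \<in> harmonic_L2 \<Omega> ==> (w, g) \<in> lap0 \<Omega> ==>
   cmod (ip M h (\<lambda>x. Wc x * g x)) \<le> nrm h * (1 / (4 * A) * nrm g + C1 * nrm w)" unfolding Wc_def by blast
 define D' where "D' = 2 * (1 / 4 + C1 * A + Cw + 1) + 2 * (C1 * A) + 1"
 have D': "D' > 0" unfolding D'_def by (rule add_nonneg_pos, rule add_nonneg_nonneg) (use C1(1) A(1) Cw(1) in auto)
 have "1 / (2 * D') > 0" using D' by simp
 then obtain Bw C2 where Bw: "finite Bw" "Bw \<subseteq> L2 M" "0 \<le> C2"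
  "\<forall>(w, g)\<in>lap0 \<Omega>. nrm w \<le> 1 / (2 * D') * nrm g + C2 * (\<Sum>b\<in>Bw. cmod (ip M g b))"
  using lap0_compact[unfolded compact_bound_def] by meson
 have "\<forall>b\<in>Bh. \<exists>b'. b' \<in> L2 M \<and> (\<forall>w g. (w, g) \<in> lap0 \<Omega> \<longrightarrow> ip M w b = ip M g b')"
  using lap0_functional Bh(2) by (metis subsetD)
 then obtain r where r: "\<And>b. b \<in> Bh ==> r b \<in> L2 M" "\<And>b w g. b \<in> Bh ==> (w, g) \<in> lap0 \<Omega> ==> ip M w b = ip M g (r b)"
  by metis
 \<comment> \<open>All functionals have to act on u. Those of h = u - w pass through
   \<open>r\<close>, which turns w into \<Delta>w; those of \<Delta>w = W u - g0 pass through the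
   adjoint multiplier, up to residual terms.\<close>
 define B where "B = Bh \<union> (\<lambda>b x. Wc x * r b x) ` Bh \<union> (\<lambda>b x. Wc x * b x) ` Bw"
 have B: "finite B" "B \<subseteq> L2 M" unfolding B_def using Bh(1,2) Bw(1,2) r(1) WcL by auto
 define nh where "nh = (\<Sum>b\<in>Bh. nrm (r b))"
 define nw where "nw = (\<Sum>b\<in>Bw. nrm b)"
 have nn: "0 \<le> nh" "0 \<le> nw" by (auto simp: nh_def nw_def intro: sum_nonneg)
 define K1 where "K1 = 2 * (A * (D' + 1) + 1)"
 have K1: "0 \<le> K1" using A D' by (simp add: K1_def)
 define N where "N = (2 * real (card Bh) + nh) + 1 + C2 * (real (card Bw) + nw)"
 have "nrm u \<le> K1 * N * (nrm (\<lambda>x. f x - z * u x) + (\<Sum>b\<in>B. cmod (ip M u b)))"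
  if u: "u \<in> L2 M" and f: "f \<in> L2 M" and wg: "(w, g) \<in> lap0 \<Omega>" and h: "(\<lambda>x. u x - w x) \<in> harmonic_L2 \<Omega>"
   and ae: "AE x in M. f x - cor (V x) * u x = - g x" for u f w g
 proof -
  define h where "h x = u x - w x" for x
  define g0 where "g0 x = f x - z * u x" for x
  have hh: "h \<in> harmonic_L2 \<Omega>" using h by (simp add: h_def[abs_def])
  note wL = lap0_L2(1)[OF wg] and gL = lap0_L2(2)[OF wg] and hL = harmonic_L2D[OF hh]
  have g0L: "g0 \<in> L2 M" unfolding g0_def by (intro L2_diff f L2_scale u)
  have geq: "AE x in M. g x = W x * u x - g0 x" using ae by eventually_elim (simp add: W_def g0_def algebra_simps)
  have kL: "(\<lambda>x. W x * u x - g0 x) \<in> L2 M" by (intro L2_diff WL u g0L)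
  have ipg: "ip M g b = ip M (\<lambda>x. W x * u x) b - ip M g0 b" if "b \<in> L2 M" for b unfolding ip_diff_left[OF WL[OF u] g0L that, symmetric]
   by (rule ip_AE_cong[OF geq]) (use L2_measurable gL kL that in auto)
  define S where "S = (\<Sum>b\<in>B. cmod (ip M u b))"
  define n where "n = nrm g0"
  define X where "X = nrm g"
  define m where "m = nrm w"
  define Sh where "Sh = (\<Sum>b\<in>Bh. cmod (ip M h b))"
  define Sw where "Sw = (\<Sum>b\<in>Bw. cmod (ip M g b))"
  have SB: "cmod (ip M u b) \<le> S" if "b \<in> B" for b unfolding S_def using that B(1) by (intro member_le_sum) auto
  have n0: "0 \<le> n" and S0: "0 \<le> S" by (auto simp: n_def S_def intro: sum_nonneg)
  have ipg_le: "cmod (ip M g b) \<le> cmod (ip M u (\<lambda>x. Wc x * b x)) + n * nrm b" if "b \<in> L2 M" for b unfolding ipg[OF that] Wadj n_def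
   by (rule order_trans[OF norm_triangle_ineq4]) (intro add_left_mono L2_Cauchy_Schwarz g0L that)
  have "Sw \<le> (\<Sum>b\<in>Bw. S + n * nrm b)" unfolding Sw_def
  proof (rule sum_mono)
   fix b assume b: "b \<in> Bw"
   then have "(\<lambda>x. Wc x * b x) \<in> B" by (simp add: B_def)
   from SB[OF this] show "cmod (ip M g b) \<le> S + n * nrm b" using ipg_le[of b] b Bw(2) by fastforce
  qed
  then have Sw: "Sw \<le> real (card Bw) * S + n * nw" by (simp add: sum.distrib sum_distrib_left nw_def)
  have "Sh \<le> (\<Sum>b\<in>Bh. 2 * S + n * nrm (r b))" unfolding Sh_def
  proof (rule sum_mono)
   fix b assume b: "b \<in> Bh"
   then have bL: "b \<in> L2 M" using Bh(2) by blast
   have "(\<lambda>x. Wc x * r b x) \<in> B" "b \<in> B" using b by (auto simp: B_def)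
   note SB[OF this(1)] SB[OF this(2)]
   moreover have "ip M h b = ip M u b - ip M g (r b)" unfolding h_def using ip_diff_left[OF u wL bL] r(2)[OF b wg] by simp
   then have "cmod (ip M h b) \<le> cmod (ip M u b) + cmod (ip M g (r b))" by (simp only: norm_triangle_ineq4)
   moreover note ipg_le[OF r(1)[OF b]]
   ultimately show "cmod (ip M h b) \<le> 2 * S + n * nrm (r b)" by linarith
  qed
  then have Sh: "Sh \<le> 2 * real (card Bh) * S + n * nh" by (simp add: sum.distrib sum_distrib_left nh_def)
  have hn: "nrm h \<le> A * (Sh + n + X + m)"
  proof -
   have "nrm (\<lambda>x. W x * h x) = nrm (\<lambda>x. (g0 x + g x) - W x * w x)" by (rule L2_norm_AE_cong)
     (use geq L2_measurable[OF WL[OF hL]] L2_measurable[OF L2_diff[OF L2_add[OF g0L gL] WL[OF wL]]] in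
      \<open>auto simp: h_def algebra_simps\<close>)
   also have "\<dots> \<le> nrm (\<lambda>x. g0 x + g x) + nrm (\<lambda>x. W x * w x)"
    by (rule L2_norm_diff_triangle[OF L2_add[OF g0L gL] WL[OF wL]])
   also have "\<dots> \<le> (n + X) + Cw * m" unfolding n_def X_def m_def by (intro add_mono L2_norm_triangle g0L gL Cw(2) wL)
   finally have Wh: "nrm (\<lambda>x. W x * h x) \<le> n + X + Cw * m" .
   have ind: "(indicator K :: 'a => complex) \<in> borel_measurable M" by (intro borel_lebesgue_on borel_measurable_indicator borel_compact K(2))
   have iL: "(\<lambda>x. indicator K x * h x) \<in> L2 M" by (rule L2_mult_bounded[OF hL ind, of 1]) (simp add: indicator_def)
   have jL: "(\<lambda>x. h x - indicator K x * h x) \<in> L2 M" by (rule L2_diff[OF hL iL])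
   have "nrm (\<lambda>x. h x - indicator K x * h x) \<le> 1 / c0 * nrm (\<lambda>x. W x * h x)"
   proof (rule L2_norm_mono[OF WL[OF hL] L2_measurable[OF jL] AE_I2])
    fix x assume "x \<in> space M"
    then have "x \<in> \<Omega>" by (simp add: space_restrict_space)
    then show "cmod (h x - indicator K x * h x) \<le> 1 / c0 * cmod (W x * h x)"
     using K(4)[of x] K(1) mult_right_mono[of c0 "cmod (W x)" "cmod (h x)"] by (cases "x \<in> K") (simp_all add: norm_mult field_simps)
   qed (use K(1) in simp)
   also have "\<dots> \<le> 1 / c0 * (n + X + Cw * m)" by (intro mult_left_mono Wh) (use K(1) in simp)
   finally have 1: "nrm (\<lambda>x. h x - indicator K x * h x) \<le> 1 / c0 * (n + X + Cw * m)" .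
   have "nrm h \<le> nrm (\<lambda>x. indicator K x * h x) + nrm (\<lambda>x. h x - indicator K x * h x)" using L2_norm_triangle[OF iL jL] by simp
   also have "\<dots> \<le> (1 / 2 * nrm h + Ch * Sh) + 1 / c0 * (n + X + Cw * m)" using Bh'[OF hh] 1 unfolding Sh_def by (rule add_mono)
   finally have "nrm h \<le> 2 * Ch * Sh + 2 / c0 * n + 2 / c0 * X + 2 * Cw / c0 * m" using K(1) by (simp add: field_simps)
   also have "\<dots> \<le> A * Sh + A * n + A * X + A * m"
    by (intro add_mono mult_right_mono A) (auto simp: Sh_def n_def X_def m_def intro: sum_nonneg)
   finally show ?thesis by (simp add: algebra_simps)
  qed
  have Xn: "X\<^sup>2 \<le> nrm h * (1 / (4 * A) * X + C1 * m) + Cw * m * X + n * X"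
  proof -
   have "ip M (\<lambda>x. W x * u x) g = ip M (\<lambda>x. W x * h x) g + ip M (\<lambda>x. W x * w x) g"
    unfolding ip_add_left[OF WL[OF hL] WL[OF wL] gL, symmetric] by (simp add: h_def algebra_simps)
   then have "ip M g g = ip M h (\<lambda>x. Wc x * g x) + ip M (\<lambda>x. W x * w x) g - ip M g0 g" unfolding ipg[OF gL] by (simp add: Wadj[of h])
   moreover have "cmod (ip M g g) = X\<^sup>2" unfolding ip_self X_def norm_of_real by simp
   ultimately have "X\<^sup>2 \<le> cmod (ip M h (\<lambda>x. Wc x * g x)) + cmod (ip M (\<lambda>x. W x * w x) g) + cmod (ip M g0 g)"
    using norm_triangle_ineq4[of "ip M h (\<lambda>x. Wc x * g x) + ip M (\<lambda>x. W x * w x) g" "ip M g0 g"]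
     norm_triangle_ineq[of "ip M h (\<lambda>x. Wc x * g x)" "ip M (\<lambda>x. W x * w x) g"] by simp
   moreover have "cmod (ip M h (\<lambda>x. Wc x * g x)) \<le> nrm h * (1 / (4 * A) * X + C1 * m)" unfolding X_def m_def by (rule C1(2)[OF hh wg])
   moreover have "cmod (ip M (\<lambda>x. W x * w x) g) \<le> Cw * m * X" unfolding X_def m_def
    by (rule order_trans[OF L2_Cauchy_Schwarz[OF WL[OF wL] gL]]) (intro mult_right_mono Cw(2) wL, simp)
   moreover have "cmod (ip M g0 g) \<le> n * X" unfolding n_def X_def by (rule L2_Cauchy_Schwarz[OF g0L gL])
   ultimately show ?thesis by linarith
  qed
  have mn: "m \<le> X / (2 * D') + C2 * Sw" using bspec[OF Bw(4) wg] by (simp add: m_def X_def Sw_def)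
  have "nrm u \<le> nrm h + m" using L2_norm_triangle[OF hL wL] by (simp add: h_def m_def)
  also have "\<dots> \<le> K1 * (Sh + n + C2 * Sw)" using essential_part_bound[OF A(1) C1(1) Cw(1) _ _ _ _ _ hn Xn mn[unfolded D'_def]]
   by (simp add: K1_def D'_def X_def Sh_def n_def m_def Sw_def Bw(3) sum_nonneg algebra_simps)
  also have "\<dots> \<le> K1 * (N * (n + S))"
  proof (intro mult_left_mono K1)
   have "C2 * Sw \<le> C2 * (real (card Bw) * S + n * nw)" by (intro mult_left_mono Sw Bw(3))
   moreover have "N * (n + S) = (2 * real (card Bh) * S + n * nh) + n + C2 * (real (card Bw) * S + n * nw)
     + (2 * real (card Bh) * n + nh * S + S + C2 * (real (card Bw) * n + nw * S))" by (simp add: N_def algebra_simps)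
   moreover have "0 \<le> 2 * real (card Bh) * n + nh * S + S + C2 * (real (card Bw) * n + nw * S)" using nn n0 S0 Bw(3) by simp
   ultimately show "Sh + n + C2 * Sw \<le> N * (n + S)" using Sh by linarith
  qed
  finally show ?thesis by (simp add: n_def g0_def[abs_def] S_def mult.assoc)
 qed
 then show ?thesis using B by (intro exI[of _ B] exI[of _ "K1 * N"]) blast
qed

end

section \<open>A harmonic function with a strong pole\<close>

lemma smooth_sum:
 fixes f :: "'i => 'a::euclidean_space => 'b::real_normed_vector"
 assumes "finite I" "\<And>i. i \<in> I ==> smooth (f i)"
 shows "smooth (\<lambda>x. \<Sum>i\<in>I. f i x)" using assms by (induction I rule: finite_induct) (simp_all add: smooth_pderivs_add(1))

lemma integral_laplacian_smooth:
 fixes f g :: "'a::euclidean_space => complex"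
 assumes f: "f \<in> \<D> \<Omega>" and g: "smooth g"
 shows "(LINT x|lborel. laplacian f x * g x) = (LINT x|lborel. f x * laplacian g x)"
proof -
 have s: "smooth (pderivs vs g)" if "set vs \<subseteq> Basis" for vs by (rule smooth_pderivs[OF g that])
 have t: "pderivs vs f \<in> \<D> \<Omega>" if "set vs \<subseteq> Basis" for vs by (rule test_pderivs[OF f that])
 have 1: "(LINT x|lborel. pderivs [i, i] f x * g x) = (LINT x|lborel. f x * pderivs [i, i] g x)" if i: "i \<in> Basis" for i
  using integration_by_parts[OF t[of "[i]"] g i] integration_by_parts[OF f s[of "[i]"] i] i by (simp add: pderivs_pderivs)
 have "(LINT x|lborel. laplacian f x * g x) = (\<Sum>i\<in>Basis. LINT x|lborel. pderivs [i, i] f x * g x)" unfolding laplacian_def sum_distrib_right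
  by (rule Bochner_Integration.integral_sum) (rule integrable_cont_test(2)[OF smooth_continuous[OF g] t], simp)
 also have "\<dots> = (\<Sum>i\<in>Basis. LINT x|lborel. f x * pderivs [i, i] g x)" by (rule sum.cong[OF refl 1])
 also have "\<dots> = (LINT x|lborel. f x * laplacian g x)" unfolding laplacian_def sum_distrib_left
  by (rule Bochner_Integration.integral_sum[symmetric]) (rule integrable_cont_test(2)[OF smooth_continuous[OF s] f], simp)
 finally show ?thesis .
qed

text \<open>For a fixed pole \<open>y\<close>, the function \<open>\<zeta>\<^sup>2 / \<bar>x - y\<bar>\<^bsup>d + 2\<^esup>\<close> is the Kelvin transform of the harmonic polynomial
 \<open>\<zeta>\<^sup>2\<close>, where \<open>\<zeta>\<close> is the complex coordinate in a plane.  Replacing \<open>\<bar>x - y\<bar>\<^sup>2\<close> by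
 \<open>\<bar>x - y\<bar>\<^sup>2 + \<epsilon>\<close> makes it smooth with a small Laplacian away from the pole.\<close>

locale pole =
 fixes e b y :: "'a::euclidean_space"
 assumes e: "norm e = 1" and b: "norm b = 1" and eb: "e \<bullet> b = 0"
begin

definition c :: "'a => complex" where "c v = Complex (v \<bullet> e) (v \<bullet> b)"
definition S :: "real => 'a => real" where "S \<epsilon> x = (x - y) \<bullet> (x - y) + \<epsilon>"
definition a :: real where "a = real DIM('a) / 2 + 1"
definition k :: "real => 'a => complex" where
 "k \<epsilon> x = (c (x - y))\<^sup>2 * cor (S \<epsilon> x powr (- a))"

lemma c_linear: "bounded_linear c"
proof (rule bounded_linear_intro[where K = 2])
 fix v :: 'a
 have "\<bar>v \<bullet> e\<bar> \<le> norm v" "\<bar>v \<bullet> b\<bar> \<le> norm v"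
  using Cauchy_Schwarz_ineq2[of v e] Cauchy_Schwarz_ineq2[of v b] e b by auto
 then show "norm (c v) \<le> norm v * 2" using cmod_le[of "c v"] by (simp add: c_def)
qed (auto simp: c_def complex_eq_iff inner_add_left)

lemma norm_c_square: "(cmod (c v))\<^sup>2 \<le> 2 * (v \<bullet> v)"
proof -
 have "\<bar>v \<bullet> e\<bar> \<le> norm v" "\<bar>v \<bullet> b\<bar> \<le> norm v"
  using Cauchy_Schwarz_ineq2[of v e] Cauchy_Schwarz_ineq2[of v b] e b by auto
 then have "(v \<bullet> e)\<^sup>2 \<le> (norm v)\<^sup>2" "(v \<bullet> b)\<^sup>2 \<le> (norm v)\<^sup>2"
  by (metis abs_ge_zero power2_abs power_mono)+
 then show ?thesis by (simp add: cmod_power2 c_def power2_norm_eq_inner)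
qed

text \<open>The complex vector e + i b is isotropic because e and b are orthonormal; this makes
  \<zeta>^2 harmonic.\<close>

lemma c_null: "(\<Sum>i\<in>Basis. (c i)\<^sup>2) = 0"
proof -
 have "(\<Sum>i\<in>Basis. (c i)\<^sup>2) = Complex ((\<Sum>i\<in>Basis. (e \<bullet> i) * (e \<bullet> i)) - (\<Sum>i\<in>Basis. (b \<bullet> i) * (b \<bullet> i))) (2 * (\<Sum>i\<in>Basis. (e \<bullet> i) * (b \<bullet> i)))"
  by (simp add: complex_eq_iff c_def power2_eq_square sum_subtractf sum_distrib_left inner_commute sum.distrib[symmetric] mult_ac
    Re_sum Im_sum)
 then show ?thesis using e b eb by (simp add: euclidean_inner[symmetric] norm_eq_1 Complex_eq_0)
qed

lemma c_expand: "(\<Sum>i\<in>Basis. c i * cor (v \<bullet> i)) = c v"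
proof -
 have "c v = c (\<Sum>i\<in>Basis. (v \<bullet> i) *\<^sub>R i)" by (simp add: euclidean_representation)
 also have "\<dots> = (\<Sum>i\<in>Basis. (v \<bullet> i) *\<^sub>R c i)" using c_linear by (simp add: bounded_linear.linear linear_sum linear_cmul)
 finally show ?thesis by (simp add: scaleR_conv_of_real mult.commute)
qed

lemma smooth_coordinate: "smooth (\<lambda>x. cor ((x - y) \<bullet> i))"
proof -
 have "smooth (\<lambda>x::'a. cor (x \<bullet> i) + cor (- (y \<bullet> i)))" by (intro smooth_pderivs_add(1) smooth_const smooth_bounded_linear
    bounded_linear_compose[OF bounded_linear_of_real bounded_linear_inner_left])
 then show ?thesis by (simp add: inner_diff_left)
qed

lemma smooth_S: "smooth (\<lambda>x. cor (S d x))"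
proof -
 have "smooth (\<lambda>x. (\<Sum>i\<in>Basis. cor ((x - y) \<bullet> i) * cor ((x - y) \<bullet> i)) + cor d)"
  by (intro smooth_pderivs_add(1) smooth_sum smooth_mult smooth_coordinate smooth_const finite_Basis)
 then show ?thesis unfolding S_def by (subst euclidean_inner) simp
qed

lemma S_pos: "d > 0 ==> S d x > 0" unfolding S_def by (rule add_nonneg_pos) auto

lemma S_powr_has_derivative:
 assumes "d > 0"
 shows "((\<lambda>x. cor (S d x powr p)) has_derivative
  (\<lambda>h. cor (p * S d x powr (p - 1) * (2 * ((x - y) \<bullet> h))))) (at x)"
proof -
 have "(S d has_derivative (\<lambda>h. 2 * ((x - y) \<bullet> h))) (at x)"
  unfolding S_def[abs_def] by (auto intro!: derivative_eq_intros simp: inner_commute)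
 moreover have "((\<lambda>s. s powr p) has_real_derivative p * S d x powr (p - 1)) (at (S d x))"
  by (rule has_real_derivative_powr[OF S_pos[OF assms]])
 ultimately have "((\<lambda>x. S d x powr p) has_derivative (\<lambda>h. p * S d x powr (p - 1) * (2 * ((x - y) \<bullet> h)))) (at x)"
  using has_derivative_compose[of "S d"] unfolding has_field_derivative_def by fastforce
 then show ?thesis by (rule has_derivative_of_real)
qed

lemma mult_powr_pderiv:
 assumes t: "t > 0" and g: "smooth g"
 shows "(\<lambda>x. g x * cor (S t x powr p)) differentiable (at x)"
  and "pderivs [i] (\<lambda>x. g x * cor (S t x powr p)) x = pderivs [i] g x * cor (S t x powr p)
   + g x * cor (p * S t x powr (p - 1) * (2 * ((x - y) \<bullet> i)))"
proof -
 have "g differentiable (at x)" by (rule smooth_differentiable[OF g])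
 then have "(g has_derivative (\<lambda>v. pderivs [v] g x)) (at x)" by (simp add: frechet_derivative_works pderivs.simps(2))
 note d = has_derivative_mult[OF this S_powr_has_derivative[OF t, of p x]]
 show "(\<lambda>x. g x * cor (S t x powr p)) differentiable (at x)" using d unfolding differentiable_def by blast
 show "pderivs [i] (\<lambda>x. g x * cor (S t x powr p)) x = pderivs [i] g x * cor (S t x powr p)
   + g x * cor (p * S t x powr (p - 1) * (2 * ((x - y) \<bullet> i)))" unfolding pderivs_has_derivative[OF d] by (simp add: add.commute)
qed

text \<open>Smooth functions times powers of \<open>S\<close> are stable under differentiation: one
  term loses a power, and the other one is brought to the same power by moving a smooth factor
  \<open>S\<close> out.\<close>

lemma smooth_mult_powr:
 assumes d: "d > 0" and g: "smooth g"
 shows "smooth (\<lambda>x. g x * cor (S d x powr p))"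
proof (rule smooth_coinduct[where P = "\<lambda>f. \<exists>g p. smooth g \<and> f = (\<lambda>x. g x * cor (S d x powr p))"])
 show "\<exists>g' p'. smooth g' \<and> (\<lambda>x. g x * cor (S d x powr p)) = (\<lambda>x. g' x * cor (S d x powr p'))"
  using g by (intro exI[of _ g] exI[of _ p] conjI refl)
next
 fix f x assume "\<exists>g p. smooth g \<and> f = (\<lambda>x. g x * cor (S d x powr p))"
 then show "f differentiable (at x)" using mult_powr_pderiv(1)[OF d] by auto
next
 fix f and v :: 'a assume "\<exists>g p. smooth g \<and> f = (\<lambda>x. g x * cor (S d x powr p))" and v: "v \<in> Basis"
 then obtain g p where g: "smooth g" and f: "f = (\<lambda>x. g x * cor (S d x powr p))" by auto
 let ?g = "\<lambda>x. pderivs [v] g x * cor (S d x) + g x * (cor (2 * p) * cor ((x - y) \<bullet> v))"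
 have "smooth ?g" by (intro smooth_pderivs_add(1) smooth_mult smooth_S smooth_coordinate smooth_const g smooth_pderivs) (use v in auto)
 moreover have "pderivs [v] f = (\<lambda>x. ?g x * cor (S d x powr (p - 1)))"
 proof
  fix x
  have "S d x powr p = S d x * S d x powr (p - 1)" using S_pos[OF d, of x] by (simp add: powr_mult_base)
  then show "pderivs [v] f x = ?g x * cor (S d x powr (p - 1))" unfolding f mult_powr_pderiv(2)[OF d g] by (simp add: algebra_simps)
 qed
 ultimately show "\<exists>g p. smooth g \<and> pderivs [v] f = (\<lambda>x. g x * cor (S d x powr p))"
  by (intro exI[of _ ?g] exI[of _ "p - 1"] conjI)
qed

lemma pderiv_coordinate: "pderivs [i] (\<lambda>x. cor q * cor ((x - y) \<bullet> j)) x = cor (q * (i \<bullet> j))"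
 by (rule trans[OF pderivs_has_derivative[where f' = "\<lambda>h. cor (q * (h \<bullet> j))"]]) (auto intro!: derivative_eq_intros)

lemma smooth_c: "smooth (\<lambda>x. c (x - y))"
proof -
 have "smooth (\<lambda>x. c x + (- c y))" by (intro smooth_pderivs_add(1) smooth_bounded_linear c_linear smooth_const)
 then show ?thesis using linear_diff[OF bounded_linear.linear[OF c_linear]] by simp
qed

lemma pderiv_c: "pderivs [i] (\<lambda>x. c (x - y)) x = c i"
proof (rule pderivs_has_derivative)
 have "((\<lambda>x. x - y) has_derivative (\<lambda>h. h)) (at x)" by (auto intro!: derivative_eq_intros)
 from bounded_linear.has_derivative[OF c_linear this] show "((\<lambda>x. c (x - y)) has_derivative c) (at x)" .
qed

lemma smooth_c2: "smooth (\<lambda>x. (c (x - y))\<^sup>2)" unfolding power2_eq_square by (intro smooth_mult smooth_c)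

lemma smooth_k: "d > 0 ==> smooth (k d)" unfolding k_def[abs_def] by (intro smooth_mult_powr smooth_c2)

lemma laplacian_k:
 assumes d: "d > 0"
 shows "laplacian (k d) x = - (c (x - y))\<^sup>2 * cor (4 * a * (a + 1) * d * S d x powr (- a - 2))"
proof -
 define z where "z x = c (x - y)" for x
 define g where "g x = cor (S d x powr (- a))" for x
 define P where "P = S d x powr (- a - 2)"
 have S1: "S d x powr (- a - 1) = S d x * P"
 proof -
  have eq: "- a - 1 = 1 + (- a - 2)" by simp
  show ?thesis unfolding eq P_def by (rule powr_mult_base[symmetric]) (use S_pos[OF d, of x] in simp)
 qed
 have sg: "smooth g" unfolding g_def[abs_def] using smooth_mult_powr[OF d smooth_const[of 1], of "- a"] by simp
 have sz: "smooth z" unfolding z_def[abs_def] by (rule smooth_c)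
 have zi: "pderivs [i] z = (\<lambda>x. c i)" for i unfolding z_def[abs_def] using pderiv_c by (intro ext)
 have c0: "pderivs [i] (\<lambda>x::'a. w) = (\<lambda>x. 0)" for i and w :: complex by (rule ext, rule pderivs_has_derivative) simp
 have zii: "pderivs [i, i] z x = 0" for i x unfolding pderivs_pderivs[symmetric] zi by (simp add: c0)
 have f1: "pderivs [i] (\<lambda>x. z x * z x) x = 2 * (z x * c i)" for i x unfolding pderiv_mult[OF sz sz] zi by (simp add: algebra_simps)
 have lf: "laplacian (\<lambda>x. z x * z x) x = 2 * (\<Sum>i\<in>Basis. (c i)\<^sup>2)"
  unfolding laplacian_def by (simp add: smooth_pderiv_2[OF sz sz] zi zii sum_distrib_left power2_eq_square)
 have g1: "pderivs [i] g = (\<lambda>x. (cor (- 2 * a) * cor ((x - y) \<bullet> i)) * cor (S d x powr (- a - 1)))" for i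
  using mult_powr_pderiv(2)[OF d smooth_const[of 1], of i "- a"] by (intro ext) (simp add: g_def[abs_def] c0 algebra_simps)
 have g2: "pderivs [i, i] g x = cor (- 2 * a * (S d x * P) + 4 * a * (a + 1) * ((x - y) \<bullet> i)\<^sup>2 * P)" if i: "i \<in> Basis" for i
 proof -
  have "pderivs [i, i] g x = cor (- 2 * a * (i \<bullet> i)) * cor (S d x powr (- a - 1))
   + (cor (- 2 * a) * cor ((x - y) \<bullet> i)) * cor ((- a - 1) * S d x powr (- a - 1 - 1) * (2 * ((x - y) \<bullet> i)))"
   unfolding pderivs_pderivs[symmetric] g1
   by (subst mult_powr_pderiv(2)[OF d smooth_mult[OF smooth_const smooth_coordinate]]) (simp only: pderiv_coordinate)
  also have "\<dots> = cor (- 2 * a * (S d x * P) + 4 * a * (a + 1) * ((x - y) \<bullet> i)\<^sup>2 * P)"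
   using i unfolding S1 by (simp add: P_def algebra_simps power2_eq_square)
  finally show ?thesis .
 qed
 have lg: "laplacian g x = cor (- 2 * a * real DIM('a) * (S d x * P) + 4 * a * (a + 1) * (S d x - d) * P)"
 proof -
  have "(x - y) \<bullet> (x - y) = (\<Sum>i\<in>Basis. ((x - y) \<bullet> i)\<^sup>2)" by (subst euclidean_inner) (simp add: power2_eq_square)
  then have "(\<Sum>i\<in>Basis. ((x - y) \<bullet> i)\<^sup>2) = S d x - d" by (simp add: S_def)
  moreover have "laplacian g x = cor (\<Sum>i\<in>Basis. - 2 * a * (S d x * P) + 4 * a * (a + 1) * P * ((x - y) \<bullet> i)\<^sup>2)"
   unfolding laplacian_def of_real_sum by (rule sum.cong[OF refl]) (simp add: g2 mult_ac)
  ultimately show ?thesis by (simp only: sum.distrib sum_distrib_left[symmetric] sum_constant) (simp add: mult_ac)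
 qed
 have cross: "(\<Sum>i\<in>Basis. pderivs [i] (\<lambda>x. z x * z x) x * pderivs [i] g x) = - cor (4 * a * (S d x * P)) * (z x)\<^sup>2"
 proof -
  have "(\<Sum>i\<in>Basis. pderivs [i] (\<lambda>x. z x * z x) x * pderivs [i] g x) =
   (\<Sum>i\<in>Basis. - cor (4 * a * (S d x * P)) * z x * (c i * cor ((x - y) \<bullet> i)))"
   unfolding f1 g1 S1 by (rule sum.cong[OF refl]) (simp add: mult_ac)
  also have "\<dots> = - cor (4 * a * (S d x * P)) * z x * z x" unfolding sum_distrib_left[symmetric] c_expand by (simp add: z_def)
  finally show ?thesis by (simp add: power2_eq_square)
 qed
 have kg: "k d = (\<lambda>x. (z x * z x) * g x)" by (simp add: k_def[abs_def] z_def g_def power2_eq_square)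
 have "laplacian (k d) x = (z x)\<^sup>2 * cor (- 2 * a * real DIM('a) * (S d x * P) + 4 * a * (a + 1) * (S d x - d) * P - 8 * a * (S d x * P))"
  unfolding kg laplacian_mult[OF smooth_mult[OF sz sz] sg] lg cross lf c_null by (simp add: power2_eq_square algebra_simps)
 \<comment> \<open>The terms containing \<open>S\<close> cancel because 2 a is the dimension plus 2;
   only the regularisation leaves a remainder, linear in \<open>d\<close>.\<close>
 also have "- 2 * a * real DIM('a) * (S d x * P) + 4 * a * (a + 1) * (S d x - d) * P - 8 * a * (S d x * P) = - (4 * a * (a + 1) * d * P)"
  by (simp add: a_def field_simps)
 finally show ?thesis by (simp add: z_def P_def)
qed

end

section \<open>Singular sequences\<close>

context pole
begin

text \<open>The kernel is at most twice the dimension-th negative power of the distance to the pole,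
  uniformly in the regularisation, which only increases \<open>S\<close>.\<close>

lemma k_bound:
 assumes "0 < t" "t \<le> norm (x - y)" "0 \<le> d"
 shows "cmod (k d x) \<le> 2 * (t\<^sup>2) powr (1 - a)"
proof -
 define s where "s = (x - y) \<bullet> (x - y)"
 have s: "t\<^sup>2 \<le> s" unfolding s_def using power_mono[OF assms(2), of 2] assms(1) by (simp add: power2_norm_eq_inner)
 have t: "0 < t\<^sup>2" using assms(1) by simp
 have s0: "0 < s" using s t by linarith
 have a1: "1 - a \<le> 0" "- a \<le> 0" by (auto simp: a_def)
 have "cmod (k d x) = (cmod (c (x - y)))\<^sup>2 * S d x powr (- a)" by (simp add: k_def norm_mult norm_power)
 also have "\<dots> \<le> (2 * s) * s powr (- a)" using norm_c_square[of "x - y"] powr_mono2'[OF a1(2) s0, of "S d x"] assms(3)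
  by (intro mult_mono) (auto simp: s_def S_def)
 also have "\<dots> = 2 * s powr (1 - a)" using s0 powr_mult_base[of s "- a"] by simp
 also have "\<dots> \<le> 2 * (t\<^sup>2) powr (1 - a)" using powr_mono2'[OF a1(1) t s] by simp
 finally show ?thesis .
qed

lemma laplacian_k_bound:
 assumes "0 < t" "t \<le> norm (x - y)" "0 < d"
 shows "cmod (laplacian (k d) x) \<le> d * (8 * a * (a + 1) * (t\<^sup>2) powr (- a - 1))"
proof -
 define s where "s = (x - y) \<bullet> (x - y)"
 have s: "t\<^sup>2 \<le> s" unfolding s_def using power_mono[OF assms(2), of 2] assms(1) by (simp add: power2_norm_eq_inner)
 have t: "0 < t\<^sup>2" using assms(1) by simp
 have s0: "0 < s" using s t by linarith
 have a0: "0 \<le> a" by (simp add: a_def)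
 have "cmod (laplacian (k d) x) = (cmod (c (x - y)))\<^sup>2 * (4 * a * (a + 1) * d * S d x powr (- a - 2))"
  unfolding laplacian_k[OF assms(3)] norm_mult norm_of_real norm_minus_cancel norm_power using a0 assms(3) by simp
 also have "\<dots> \<le> (2 * s) * (4 * a * (a + 1) * d * s powr (- a - 2))"
  using norm_c_square[of "x - y"] powr_mono2'[OF _ s0, of "- a - 2" "S d x"] assms(3) a0 s0
  by (intro mult_mono mult_left_mono) (auto simp: s_def S_def)
 also have "\<dots> = 8 * a * (a + 1) * d * (s * s powr (- a - 2))" by simp
 also have "s * s powr (- a - 2) = s powr (- a - 1)"
 proof -
  have eq: "- a - 1 = 1 + (- a - 2)" by simp
  show ?thesis unfolding eq by (rule powr_mult_base) (use s0 in simp)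
 qed
 also have "8 * a * (a + 1) * d * s powr (- a - 1) \<le> 8 * a * (a + 1) * d * (t\<^sup>2) powr (- a - 1)"
  using powr_mono2'[OF _ t s, of "- a - 1"] a0 assms(3) by (intro mult_left_mono) auto
 finally show ?thesis by (simp add: mult_ac)
qed

lemma c_measurable [measurable]: "c \<in> borel_measurable borel" by (rule borel_measurable_continuous_onI) (rule linear_continuous_on[OF c_linear])

lemma k_measurable [measurable]: "k d \<in> borel_measurable borel" unfolding k_def[abs_def] S_def by measurable

lemma k_tendsto:
 assumes "x \<noteq> y"
 shows "(\<lambda>n. k (inverse (real (Suc n))) x) \<longlonglongrightarrow> k 0 x"
proof -
 have "(\<lambda>n. (x - y) \<bullet> (x - y) + inverse (real (Suc n))) \<longlonglongrightarrow> (x - y) \<bullet> (x - y) + 0"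
  by (intro tendsto_intros LIMSEQ_inverse_real_of_nat)
 then have "(\<lambda>n. S (inverse (real (Suc n))) x powr (- a)) \<longlonglongrightarrow> S 0 x powr (- a)"
  unfolding S_def by (rule tendsto_powr[OF _ tendsto_const]) (use assms in simp)
 then show ?thesis unfolding k_def by (intro tendsto_mult tendsto_const tendsto_of_real)
qed

text \<open>The Laplacian of the regularised kernel is of the order of the regularisation uniformly
  on \<Omega>, so Green's formula gives zero in the limit; the kernels themselves converge under a
  uniform bound.\<close>

lemma k_weakly_harmonic:
 assumes f: "f \<in> \<D> \<Omega>" and t: "0 < t" "\<And>x. x \<in> \<Omega> ==> t \<le> norm (x - y)"
 shows "(LINT x|lborel. laplacian f x * k 0 x) = 0"
proof -
 define d where "d n = inverse (real (Suc n))" for n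
 have d: "0 < d n" for n by (simp add: d_def)
 note \<Delta> = test_laplacian[OF f]
 have [measurable]: "laplacian f \<in> borel_measurable borel" "f \<in> borel_measurable borel"
  by (rule test_borel[OF \<Delta>], rule test_borel[OF f])
 have lim: "(\<lambda>n. LINT x|lborel. laplacian f x * k (d n) x) \<longlonglongrightarrow> (LINT x|lborel. laplacian f x * k 0 x)"
 proof (rule integral_dominated_convergence[where w = "\<lambda>x. cmod (laplacian f x) * (2 * (t\<^sup>2) powr (1 - a))"])
  show "integrable lborel (\<lambda>x. cmod (laplacian f x) * (2 * (t\<^sup>2) powr (1 - a)))"
   by (intro integrable_mult_left integrable_norm test_integrable[OF \<Delta>])
  show "AE x in lborel. (\<lambda>n. laplacian f x * k (d n) x) \<longlonglongrightarrow> laplacian f x * k 0 x"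
  proof (rule AE_I2)
   fix x
   show "(\<lambda>n. laplacian f x * k (d n) x) \<longlonglongrightarrow> laplacian f x * k 0 x"
   proof (cases "x \<in> \<Omega>")
    case True
    then have "x \<noteq> y" using t(2)[of x] t(1) by auto
    from k_tendsto[OF this] show ?thesis unfolding d_def by (rule tendsto_mult_left)
   qed (simp add: test_outside[OF \<Delta>])
  qed
  show "AE x in lborel. cmod (laplacian f x * k (d n) x) \<le> cmod (laplacian f x) * (2 * (t\<^sup>2) powr (1 - a))" for n
  proof (rule AE_I2)
   fix x
   show "cmod (laplacian f x * k (d n) x) \<le> cmod (laplacian f x) * (2 * (t\<^sup>2) powr (1 - a))"
   proof (cases "x \<in> \<Omega>")
    case True
    show ?thesis unfolding norm_mult by (intro mult_left_mono k_bound[OF t(1) t(2)[OF True] less_imp_le[OF d]]) simp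
   qed (simp add: test_outside[OF \<Delta>])
  qed
 qed measurable
 define C where "C = 8 * a * (a + 1) * (t\<^sup>2) powr (- a - 1)"
 have le: "cmod (LINT x|lborel. laplacian f x * k (d n) x) \<le> d n * (C * (LINT x|lborel. cmod (f x)))" for n
 proof -
  have "cmod (LINT x|lborel. f x * laplacian (k (d n)) x) \<le> (LINT x|lborel. (d n * C) * cmod (f x))"
  proof (rule Bochner_Integration.integral_norm_bound_integral)
   have "(\<lambda>x. f x * laplacian (k (d n)) x) = (\<lambda>x. \<Sum>i\<in>Basis. f x * pderivs [i, i] (k (d n)) x)"
    by (simp add: laplacian_def[abs_def] sum_distrib_left)
   moreover have "integrable lborel (\<lambda>x. f x * pderivs [i, i] (k (d n)) x)" if "i \<in> Basis" for i
    by (rule integrable_cont_test(2)[OF smooth_continuous[OF smooth_pderivs[OF smooth_k[OF d]]] f]) (use that in auto)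
   ultimately show "integrable lborel (\<lambda>x. f x * laplacian (k (d n)) x)" by (simp add: Bochner_Integration.integrable_sum)
   show "integrable lborel (\<lambda>x. (d n * C) * cmod (f x))" by (intro integrable_mult_right integrable_norm test_integrable[OF f])
   fix x
   show "cmod (f x * laplacian (k (d n)) x) \<le> (d n * C) * cmod (f x)"
   proof (cases "x \<in> \<Omega>")
    case True
    show ?thesis unfolding norm_mult C_def mult.commute[of "cmod (f x)"] by (intro mult_right_mono laplacian_k_bound[OF t(1) t(2)[OF True] d]) simp
   qed (simp add: test_outside[OF f])
  qed
  then show ?thesis unfolding integral_laplacian_smooth[OF f smooth_k[OF d]] by (simp add: mult.assoc)
 qed
 have "d \<longlonglongrightarrow> 0" unfolding d_def[abs_def] by (rule LIMSEQ_inverse_real_of_nat)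
 then have "(\<lambda>n. d n * (C * (LINT x|lborel. cmod (f x)))) \<longlonglongrightarrow> 0" by (rule tendsto_mult_left_zero)
 then have "(\<lambda>n. LINT x|lborel. laplacian f x * k (d n) x) \<longlonglongrightarrow> 0"
  by (rule Lim_null_comparison[rotated]) (use le in simp)
 then show ?thesis using lim LIMSEQ_unique by blast
qed

text \<open>On this ball the coordinate along e is at least A t, and the distance to the pole is at
  most (A + 2) t; this controls numerator and denominator of the kernel.\<close>

lemma k_lower_bound:
 assumes A: "0 < A" and t: "0 < t" and x: "dist (y + ((A + 1) * t) *\<^sub>R e) x < t"
 shows "(A * t)\<^sup>2 / ((A + 2) * t) ^ (DIM('a) + 2) \<le> cmod (k 0 x)"
proof -
 define q where "q = x - (y + ((A + 1) * t) *\<^sub>R e)"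
 have q: "norm q \<le> t" using x by (simp add: q_def dist_norm norm_minus_commute)
 have z: "x - y = ((A + 1) * t) *\<^sub>R e + q" by (simp add: q_def)
 have "\<bar>q \<bullet> e\<bar> \<le> t" using Cauchy_Schwarz_ineq2[of q e] e q by simp
 moreover have "(x - y) \<bullet> e = (A + 1) * t + q \<bullet> e" using e by (simp add: z inner_add_left norm_eq_1)
 ultimately have ze: "A * t \<le> (x - y) \<bullet> e" by (simp add: algebra_simps)
 have zn: "norm (x - y) \<le> (A + 2) * t"
 proof -
  have "norm (((A + 1) * t) *\<^sub>R e) = (A + 1) * t" unfolding norm_scaleR e using A t by simp
  then show ?thesis unfolding z using norm_triangle_ineq[of "((A + 1) * t) *\<^sub>R e" q] q by (simp add: distrib_right)
 qed
 have At: "0 < A * t" using A t by simp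
 then have zpos: "0 < (x - y) \<bullet> (x - y)" using ze by (metis inner_gt_zero_iff inner_zero_left not_less)
 have "(A * t)\<^sup>2 \<le> ((x - y) \<bullet> e)\<^sup>2" using ze At by (intro power_mono) auto
 also have "\<dots> \<le> (cmod (c (x - y)))\<^sup>2" by (simp add: cmod_power2 c_def)
 finally have 1: "(A * t)\<^sup>2 \<le> (cmod (c (x - y)))\<^sup>2" .
 define R where "R = (A + 2) * t"
 have R: "0 < R" using A t by (simp add: R_def)
 have "(x - y) \<bullet> (x - y) \<le> R\<^sup>2" using power_mono[OF zn norm_ge_zero, of 2] by (simp add: power2_norm_eq_inner R_def)
 then have "(R\<^sup>2) powr (- a) \<le> S 0 x powr (- a)" unfolding S_def add_0_right by (intro powr_mono2' zpos) (simp_all add: a_def)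
 moreover have "(R\<^sup>2) powr (- a) = 1 / R ^ (DIM('a) + 2)"
 proof -
  have "R\<^sup>2 = R powr 2" using R by (simp add: powr_numeral)
  moreover have "2 * - a = - real (DIM('a) + 2)" by (simp add: a_def)
  ultimately have "(R\<^sup>2) powr (- a) = R powr (- real (DIM('a) + 2))" by (simp only: powr_powr)
  also have "\<dots> = 1 / R ^ (DIM('a) + 2)" using R by (simp only: powr_minus powr_realpow inverse_eq_divide)
  finally show ?thesis .
 qed
 ultimately have 2: "1 / R ^ (DIM('a) + 2) \<le> S 0 x powr (- a)" by simp
 have "(A * t)\<^sup>2 / R ^ (DIM('a) + 2) = (A * t)\<^sup>2 * (1 / R ^ (DIM('a) + 2))" by simp
 also have "\<dots> \<le> (cmod (c (x - y)))\<^sup>2 * S 0 x powr (- a)" by (intro mult_mono 1 2) (use R in auto)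
 finally show ?thesis by (simp add: k_def norm_mult norm_power R_def)
qed

end

section \<open>Harmonic functions with a pole outside the closure\<close>

context bounded_open
begin

lemma const_L2: "(\<lambda>x. w) \<in> L2 M"
proof (rule L2_dominated)
 have "finite_measure M" by (rule finite_measureI) (use bounded_set_imp_lmeasurable[OF bounded_\<Omega>] open_\<Omega> in \<open>auto simp: emeasure_restrict_space fmeasurable_def\<close>)
 then show "integrable M (\<lambda>x. (cmod w)\<^sup>2)" by (rule finite_measure.integrable_const)
qed auto

text \<open>On a ball of radius t in \<Omega> the kernel is at least a multiple of t^(-d), so its L2
  mass there is at least of that order. The bound away from the pole does not involve t; after
  normalisation the functions become small there.\<close>

lemma singular_harmonic:
 assumes e: "norm e = 1" and b: "norm b = 1" and eb: "e \<bullet> b = 0" and y: "y \<notin> closure \<Omega>"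
  and A: "0 < A" and t: "0 < t" "t \<le> 1" and sub: "ball (y + ((A + 1) * t) *\<^sub>R e) t \<subseteq> \<Omega>"
 shows "\<exists>k\<in>harmonic_L2 \<Omega>. (A\<^sup>2 / (A + 2) ^ (DIM('a) + 2))\<^sup>2 * unit_ball_vol (real DIM('a)) / t \<le> (nrm k)\<^sup>2 \<and>
  (\<forall>r>0. \<forall>x. r \<le> norm (x - y) \<longrightarrow> cmod (k x) \<le> 2 * (r\<^sup>2) powr (- real DIM('a) / 2))"
proof -
 interpret pole e b y by unfold_locales (use e b eb in auto)
 obtain r where r: "0 < r" "\<And>x. x \<in> closure \<Omega> ==> r \<le> dist y x" using separate_point_closed[OF closed_closure y] by blast
 have r': "r \<le> norm (x - y)" if "x \<in> \<Omega>" for x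
  using r(2)[of x] that closure_subset[of \<Omega>] by (auto simp: dist_norm norm_minus_commute)
 have kM: "k 0 \<in> borel_measurable M" by (rule borel_lebesgue_on[OF k_measurable])
 have kL: "k 0 \<in> L2 M"
 proof -
  have "(\<lambda>x. k 0 x * 1) \<in> L2 M" by (rule L2_mult_bounded[OF const_L2 kM, of "2 * (r\<^sup>2) powr (1 - a)"])
    (use k_bound[OF r(1) r'] in \<open>auto simp: space_restrict_space\<close>)
  then show ?thesis by simp
 qed
 have harm: "k 0 \<in> harmonic_L2 \<Omega>" unfolding harmonic_L2_def has_weak_laplacian_def
 proof (intro CollectI conjI kL ballI)
  fix f assume f: "f \<in> \<D> \<Omega>"
  have "(LINT x|M. k 0 x * laplacian f x) = (LINT x|M. laplacian f x * k 0 x)" by (simp only: mult.commute)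
  also have "\<dots> = (LINT x|lborel. laplacian f x * k 0 x)" by (rule test_integral_on[OF open_\<Omega> test_laplacian[OF f] k_measurable])
  also have "\<dots> = 0" by (rule k_weakly_harmonic[OF f r(1) r'])
  finally show "(LINT x|M. k 0 x * laplacian f x) = (LINT x|M. 0 * f x)" by simp
 qed
 define B where "B = ball (y + ((A + 1) * t) *\<^sub>R e) t"
 define d where "d = DIM('a)"
 define m where "m = (A * t)\<^sup>2 / ((A + 2) * t) ^ (d + 2)"
 define \<kappa> where "\<kappa> = A\<^sup>2 / (A + 2) ^ (d + 2)"
 define v where "v = unit_ball_vol (real d)"
 have v: "0 < v" by (simp add: v_def)
 have m: "0 < m" using A t(1) by (simp add: m_def)
 have m\<kappa>: "m * t ^ d = \<kappa>"
 proof -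
  have P: "((A + 2) * t) ^ (d + 2) = (A + 2) ^ (d + 2) * (t ^ d * t\<^sup>2)" by (simp only: power_mult_distrib power_add[of t])
  have "w * s / (p * (q * s)) * q = w / p" if "p \<noteq> 0" "q \<noteq> 0" "s \<noteq> 0" for w s p q :: real using that by simp
  then show ?thesis unfolding m_def \<kappa>_def P power_mult_distrib[of A] using A t(1) by simp
 qed
 have Bm: "(indicator B :: 'a => complex) \<in> borel_measurable borel" unfolding B_def by (rule borel_measurable_indicator) simp
 have "nrm (indicator B :: 'a => complex) \<le> 1 / m * nrm (k 0)"
 proof (rule L2_norm_mono[OF kL borel_lebesgue_on[OF Bm] AE_I2])
  fix x
  show "cmod (indicator B x) \<le> 1 / m * cmod (k 0 x)"
  proof (cases "x \<in> B")
   case True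
   then have "m \<le> cmod (k 0 x)" unfolding m_def d_def by (intro k_lower_bound A t(1)) (simp add: B_def)
   then show ?thesis using True m by (simp add: field_simps)
  qed (use m in simp)
 qed (use m in simp)
 moreover have "nrm (indicator B :: 'a => complex) = sqrt (v * t ^ d)"
 proof -
  have "nrm (indicator B :: 'a => complex) = lnorm (indicator B :: 'a => complex)"
   by (rule L2_lebesgue_on_borel(2)[OF open_\<Omega> Bm]) (use sub in \<open>auto simp: B_def indicator_def\<close>)
  also have "(\<lambda>x. (cmod (indicator B x :: complex))\<^sup>2) = indicator B" by (auto simp: indicator_def)
  then have "lnorm (indicator B :: 'a => complex) = sqrt (measure lborel B)" unfolding L2_norm_def by (simp add: B_def)
  also have "measure lborel B = v * t ^ d" unfolding B_def v_def d_def by (rule content_ball) (use t in simp)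
  finally show ?thesis .
 qed
 ultimately have "m * sqrt (v * t ^ d) \<le> nrm (k 0)" using m by (simp add: field_simps)
 then have "(m * sqrt (v * t ^ d))\<^sup>2 \<le> (nrm (k 0))\<^sup>2" by (rule power_mono) (use m v t in simp)
 moreover have "(m * sqrt (v * t ^ d))\<^sup>2 = \<kappa>\<^sup>2 * v / t ^ d"
  using v t(1) unfolding m\<kappa>[symmetric] by (simp add: power_mult_distrib power2_eq_square field_simps)
 \<comment> \<open>As t \<le> 1, the rate t^(-d) may be weakened to 1/t; only the blow-up
   matters.\<close>
 moreover have "\<kappa>\<^sup>2 * v / t \<le> \<kappa>\<^sup>2 * v / t ^ d" using t v power_decreasing[of 1 d t] DIM_positive[where 'a = 'a]
  by (intro divide_left_mono) (auto simp: d_def Suc_le_eq)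
 ultimately have low: "\<kappa>\<^sup>2 * v / t \<le> (nrm (k 0))\<^sup>2" by linarith
 have "1 - a = - real DIM('a) / 2" by (simp add: a_def)
 then show ?thesis using k_bound low by (intro bexI[OF _ harm] conjI allI impI) (auto simp: \<kappa>_def v_def d_def)
qed

end

section \<open>Concentration at boundary points and the essential spectrum\<close>

context bounded_open
begin

lemma space_M: "space M = \<Omega>" by (simp add: space_restrict_space)

text \<open>A test function lives on a compact subset of \<Omega>, which keeps a positive distance
  from x0 and on which the sequence tends to zero uniformly. Density of test functions and the unit
  norms do the rest.\<close>

lemma concentrating_weakly_null:
 assumes u: "\<And>n. u n \<in> L2 M" and one: "\<And>n. nrm (u n) = 1" and x0: "x0 \<notin> \<Omega>"
  and far: "\<And>t e. 0 < t ==> 0 < e ==> \<exists>n0::nat. \<forall>n\<ge>n0. \<forall>x\<in>\<Omega>. t \<le> dist x x0 \<longrightarrow> cmod (u n x) \<le> e"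
  and v: "v \<in> L2 M"
 shows "(\<lambda>n. ip M (u n) v) \<longlonglongrightarrow> 0"
proof (rule LIMSEQ_I)
 fix r :: real assume r: "0 < r"
 then have "0 < r / 2" by simp
 then obtain f where f: "f \<in> \<D> \<Omega>" "nrm (\<lambda>x. f x - v x) < r / 2" by (rule test_dense[OF open_\<Omega> v])
 obtain K where K: "compact K" "K \<subseteq> \<Omega>" "\<And>x. x \<notin> K ==> f x = 0" using test_support[OF f(1)] by blast
 obtain t where t: "0 < t" "\<And>x. x \<in> K ==> t \<le> dist x0 x"
  using separate_point_closed[OF compact_imp_closed[OF K(1)], of x0] x0 K(2) by blast
 define N where "N = nrm (\<lambda>x. 1) * nrm f"
 have N: "0 \<le> N" by (simp add: N_def)
 define e where "e = r / (2 * (N + 1))"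
 have e: "0 < e" using r N by (simp add: e_def)
 have eN: "e * N \<le> r / 2" using r N by (simp add: e_def field_simps)
 obtain n0 where n0: "\<And>n x. n \<ge> n0 ==> x \<in> \<Omega> ==> t \<le> dist x x0 ==> cmod (u n x) \<le> e" using far[OF t(1) e] by blast
 have ind: "(indicator K :: 'a => complex) \<in> borel_measurable M" by (intro borel_lebesgue_on borel_measurable_indicator borel_compact K(1))
 note fL = test_L[OF f(1)]
 have "cmod (ip M (u n) v) < r" if n: "n \<ge> n0" for n
 proof -
  let ?u = "\<lambda>x. indicator K x * u n x"
  have uL: "?u \<in> L2 M" by (rule L2_mult_bounded[OF u ind, of 1]) (simp add: indicator_def)
  have "nrm ?u \<le> e * nrm (\<lambda>x. 1)"
  proof (rule L2_norm_mono[OF const_L2 L2_measurable[OF uL] AE_I2])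
   fix x assume "x \<in> space M"
   then show "cmod (?u x) \<le> e * cmod 1" using n0[OF n, of x] t(2)[of x] e by (cases "x \<in> K") (auto simp: space_M dist_commute)
  qed (use e in simp)
  then have "nrm ?u * nrm f \<le> e * N" by (simp add: N_def mult_right_mono mult.assoc[symmetric])
  moreover have "ip M (u n) f = ip M ?u f"
   unfolding ip_def by (rule Bochner_Integration.integral_cong[OF refl]) (use K(3) in \<open>auto simp: indicator_def\<close>)
  ultimately have 1: "cmod (ip M (u n) f) \<le> r / 2" using L2_Cauchy_Schwarz[OF uL fL] eN by simp
  have "cmod (ip M (u n) (\<lambda>x. f x - v x)) \<le> nrm (\<lambda>x. f x - v x)"
   using L2_Cauchy_Schwarz[OF u L2_diff[OF fL v], of n] one[of n] by simp
  moreover have "ip M (u n) v = ip M (u n) f - ip M (u n) (\<lambda>x. f x - v x)" unfolding ip_diff_right[OF fL v u] by simp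
  then have "cmod (ip M (u n) v) \<le> cmod (ip M (u n) f) + cmod (ip M (u n) (\<lambda>x. f x - v x))" by (simp only: norm_triangle_ineq4)
  ultimately show ?thesis using 1 f(2) by linarith
 qed
 then show "\<exists>no. \<forall>n\<ge>no. norm (ip M (u n) v - 0) < r" by auto
qed

text \<open>Near x0 the factor V - V(x0) is small against unit norm; elsewhere it is bounded and the
  sequence is uniformly small.\<close>

lemma concentrating_multiplication:
 fixes V :: "'a => real"
 assumes u: "\<And>n. u n \<in> L2 M" and one: "\<And>n. nrm (u n) = 1" and x0: "x0 \<in> closure \<Omega>"
  and far: "\<And>t e. 0 < t ==> 0 < e ==> \<exists>n0::nat. \<forall>n\<ge>n0. \<forall>x\<in>\<Omega>. t \<le> dist x x0 \<longrightarrow> cmod (u n x) \<le> e"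
  and V: "continuous_on (closure \<Omega>) V"
 shows "(\<lambda>n. nrm (\<lambda>x. cor (V x - V x0) * u n x)) \<longlonglongrightarrow> 0"
proof (rule LIMSEQ_I)
 fix r :: real assume r: "0 < r"
 obtain C where C: "0 \<le> C" "\<And>x. x \<in> closure \<Omega> ==> \<bar>V x\<bar> \<le> C" using continuous_bound[OF V] unfolding real_norm_def by metis
 obtain t where t: "0 < t" "\<And>x. x \<in> closure \<Omega> ==> dist x x0 < t ==> \<bar>V x - V x0\<bar> < r / 3"
  using V x0 r unfolding continuous_on_iff dist_real_def by (metis divide_pos_pos zero_less_numeral)
 define N where "N = 2 * C * nrm (\<lambda>x. 1)"
 have N: "0 \<le> N" using C(1) by (simp add: N_def)
 define e where "e = r / (3 * (N + 1))"
 have e: "0 < e" using r N by (simp add: e_def)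
 have eN: "e * N \<le> r / 3" using r N by (simp add: e_def field_simps)
 obtain n0 where n0: "\<And>n x. n \<ge> n0 ==> x \<in> \<Omega> ==> t \<le> dist x x0 ==> cmod (u n x) \<le> e" using far[OF t(1) e] by blast
 have mV: "(\<lambda>x. cor (V x - V x0)) \<in> borel_measurable M" using continuous_measurable[OF V] by measurable
 have "nrm (\<lambda>x. cor (V x - V x0) * u n x) < r" if n: "n \<ge> n0" for n
 proof -
  \<comment> \<open>A majorant valid both near x0 and far from it, written as a sum of two L2
    functions so that the triangle inequality separates the two effects.\<close>
  let ?a = "\<lambda>x. cor (r / 3) * cor (cmod (u n x))"
  let ?b = "\<lambda>x. cor (2 * C * e) * 1 :: complex"
  have nL: "(\<lambda>x. cor (cmod (u n x))) \<in> L2 M" using u[of n] by (auto simp: L2_def)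
  have nn: "nrm (\<lambda>x. cor (cmod (u n x))) = 1" using one[of n] by (simp add: L2_norm_def)
  note aL = L2_scale[OF nL, of "cor (r / 3)"] and bL = L2_scale[OF const_L2, of "cor (2 * C * e)" 1]
  have "nrm (\<lambda>x. cor (V x - V x0) * u n x) \<le> 1 * nrm (\<lambda>x. ?a x + ?b x)"
  proof (rule L2_norm_mono[OF L2_add[OF aL bL] _ AE_I2])
   show "(\<lambda>x. cor (V x - V x0) * u n x) \<in> borel_measurable M" by (rule borel_measurable_times[OF mV L2_measurable[OF u]])
   fix x assume "x \<in> space M"
   then have x: "x \<in> \<Omega>" "x \<in> closure \<Omega>" using closure_subset by (auto simp: space_M)
   have "\<bar>V x - V x0\<bar> * cmod (u n x) \<le> r / 3 * cmod (u n x) + 2 * C * e"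
   proof (cases "dist x x0 < t")
    case True
    have "\<bar>V x - V x0\<bar> * cmod (u n x) \<le> r / 3 * cmod (u n x)" using t(2)[OF x(2) True] by (intro mult_right_mono) auto
    also have "\<dots> \<le> r / 3 * cmod (u n x) + 2 * C * e" using C(1) e by simp
    finally show ?thesis .
   next
    case False
    have "\<bar>V x - V x0\<bar> * cmod (u n x) \<le> (2 * C) * e" using C(2)[OF x(2)] C(2)[OF x0] n0[OF n x(1)] False by (intro mult_mono) auto
    also have "\<dots> \<le> r / 3 * cmod (u n x) + 2 * C * e" using r by simp
    finally show ?thesis .
   qed
   moreover have "cmod (?a x + ?b x) = r / 3 * cmod (u n x) + 2 * C * e"
   proof -
    have "?a x + ?b x = cor (r / 3 * cmod (u n x) + 2 * C * e)" by simp
    then show ?thesis using r C(1) e by (simp only: norm_of_real) simp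
   qed
   ultimately show "cmod (cor (V x - V x0) * u n x) \<le> 1 * cmod (?a x + ?b x)" unfolding norm_mult norm_of_real by simp
  qed simp
  also have "\<dots> \<le> nrm ?a + nrm ?b" using L2_norm_triangle[OF aL bL] by simp
  also have "\<dots> = r / 3 + e * N" unfolding L2_norm_scale norm_of_real nn using r C(1) e by (simp add: N_def)
  finally show ?thesis using eN r by linarith
 qed
 then show "\<exists>no. \<forall>n\<ge>no. norm (nrm (\<lambda>x. cor (V x - V x0) * u n x) - 0) < r" by auto
qed

text \<open>The graph function is constant along e. So moving x0 against e leaves the closure, and
  moving it along e by A t gains more height than the graph can vary over a ball of radius t. Poles
  and inner balls thus sit at comparable distances from x0.\<close>

lemma boundary_geometry:
 assumes sb: "smooth_boundary \<Omega>" and x0: "x0 \<in> frontier \<Omega>"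
 obtains e A t0 where "norm e = 1" "0 < A" "0 < t0" "t0 \<le> 1"
  "\<And>t. 0 < t ==> t \<le> t0 ==> x0 - t *\<^sub>R e \<notin> closure \<Omega>"
  "\<And>t. 0 < t ==> t \<le> t0 ==> ball (x0 + (A * t) *\<^sub>R e) t \<subseteq> \<Omega>"
proof -
 obtain r e and g :: "'a => real" where r: "0 < r" and e: "norm e = 1" and g: "smooth g"
  and inv: "\<And>x t. g (x + t *\<^sub>R e) = g x" and \<Omega>r: "\<Omega> \<inter> ball x0 r = {x \<in> ball x0 r. x \<bullet> e > g x}"
  using sb x0 unfolding smooth_boundary_def by blast
 have ee: "e \<bullet> e = 1" using e by (simp add: norm_eq_1)
 have mem: "x \<in> \<Omega>" if "dist x x0 < r" "x \<bullet> e > g x" for x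
 proof -
  have "x \<in> {x \<in> ball x0 r. x \<bullet> e > g x}" using that by (simp add: dist_commute)
  then show ?thesis unfolding \<Omega>r[symmetric] by blast
 qed
 have below: "x \<notin> closure \<Omega>" if "dist x x0 < r" "x \<bullet> e < g x" for x
 proof -
  have "open {x. x \<bullet> e < g x}" by (intro open_Collect_less continuous_intros smooth_continuous[OF g])
  then have "open (ball x0 r \<inter> {x. x \<bullet> e < g x})" by (intro open_Int open_ball)
  moreover have "(ball x0 r \<inter> {x. x \<bullet> e < g x}) \<inter> \<Omega> = {}"
  proof -
   have "z \<bullet> e > g z" if "z \<in> \<Omega>" "z \<in> ball x0 r" for z
   proof -
    have "z \<in> \<Omega> \<inter> ball x0 r" using that by blast
    then show ?thesis unfolding \<Omega>r by blast
   qed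
   then show ?thesis by (auto simp: not_less intro: less_imp_le dest: less_asym)
  qed
  ultimately have "(ball x0 r \<inter> {x. x \<bullet> e < g x}) \<inter> closure \<Omega> = {}" by (simp add: open_Int_closure_eq_empty)
  moreover have "x \<in> ball x0 r \<inter> {x. x \<bullet> e < g x}" using that by (simp add: dist_commute)
  ultimately show ?thesis by blast
 qed
 have x0c: "x0 \<in> closure \<Omega>" "x0 \<notin> \<Omega>" using x0 interior_open[OF open_\<Omega>] by (auto simp: frontier_def)
 \<comment> \<open>Points above the graph lie in \<Omega> and points below it outside the closure,
   so a boundary point lies on the graph.\<close>
 have g0: "x0 \<bullet> e = g x0" using below[of x0] mem[of x0] x0c r by fastforce
 obtain g' where g': "(g has_derivative g') (at x0)" using smooth_differentiable[OF g] unfolding differentiable_def by blast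
 then have bl: "bounded_linear g'" by (rule has_derivative_bounded_linear)
 obtain L where L: "0 < L" "\<And>h. norm (g' h) \<le> norm h * L" using bounded_linear.pos_bounded[OF bl] by blast
 obtain s where s: "0 < s" "\<And>x. norm (x - x0) < s ==> norm (g x - g x0 - g' (x - x0)) \<le> 1 * norm (x - x0)"
  using g'[unfolded has_derivative_at_alt] zero_less_one by blast
 have lip: "g x \<le> g x0 + (L + 1) * norm (x - x0)" if "norm (x - x0) < s" for x
  using s(2)[OF that] L(2)[of "x - x0"] unfolding real_norm_def distrib_right by (simp add: mult.commute)
 \<comment> \<open>Over a displacement shorter than t the graph rises by at most (L + 1) t and the
   height along e drops by less than t, so A \<ge> L + 2 would do.\<close>
 define A where "A = L + 3"
 define t0 where "t0 = min 1 (min r s / (A + 2))"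
 have A: "0 < A" "0 < A + 2" "A + 1 < A + 2" "1 < A + 2" using L(1) by (auto simp: A_def)
 have t0: "0 < t0" "t0 \<le> 1" using r s(1) A by (auto simp: t0_def)
 have tb: "(A + 1) * t < r" "t < r" "t < s" if t: "0 < t" "t \<le> t0" for t
 proof -
  have "t \<le> min r s / (A + 2)" using t(2) by (simp add: t0_def)
  then have "t * (A + 2) \<le> min r s" using A(2) by (simp add: pos_le_divide_eq)
  moreover have "t * (A + 2) = A * t + 2 * t" by (simp add: algebra_simps)
  ultimately have le: "A * t + 2 * t \<le> min r s" by simp
  have "p + t < r \<and> t < r \<and> t < s" if "p + 2 * t \<le> min r s" "0 < p" for p using that t(1) by auto
  from this[OF le] have *: "A * t + t < r \<and> t < r \<and> t < s" using A(1) t(1) by simp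
  then show "(A + 1) * t < r" "t < r" "t < s" by (simp_all add: distrib_right)
 qed
 show ?thesis
 proof (rule that[OF e A(1) t0])
  fix t assume t: "0 < t" "t \<le> t0"
  show "x0 - t *\<^sub>R e \<notin> closure \<Omega>"
  proof (rule below)
   show "dist (x0 - t *\<^sub>R e) x0 < r" using tb(2)[OF t] t e by (simp add: dist_norm)
   have "g (x0 - t *\<^sub>R e) = g x0" using inv[of x0 "- t"] by simp
   then show "(x0 - t *\<^sub>R e) \<bullet> e < g (x0 - t *\<^sub>R e)" using t by (simp add: inner_diff_left ee g0)
  qed
  show "ball (x0 + (A * t) *\<^sub>R e) t \<subseteq> \<Omega>"
  proof
   fix x assume "x \<in> ball (x0 + (A * t) *\<^sub>R e) t"
   then have xt: "norm (x - (x0 + (A * t) *\<^sub>R e)) < t" by (simp add: dist_norm norm_minus_commute)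
   define q where "q = x - (x0 + (A * t) *\<^sub>R e)"
   have x: "x = x0 + (A * t) *\<^sub>R e + q" by (simp add: q_def)
   have q: "norm q < t" using xt by (simp add: q_def)
   show "x \<in> \<Omega>"
   proof (rule mem)
    have "dist x x0 \<le> norm ((A * t) *\<^sub>R e) + norm q" unfolding dist_norm x
     using norm_triangle_ineq[of "(A * t) *\<^sub>R e" q] by (simp del: norm_scaleR add: add.assoc)
    also have "norm ((A * t) *\<^sub>R e) = A * t" unfolding norm_scaleR e using A t by simp
    finally show "dist x x0 < r" using q tb(1)[OF t] by (simp add: distrib_right)
    have "g x = g (x0 + q)" using inv[of "x0 + q" "A * t"] by (simp add: x add_ac)
    also have "\<dots> \<le> g x0 + (L + 1) * norm q" using lip[of "x0 + q"] q tb(3)[OF t] by simp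
    also have "(L + 1) * norm q \<le> (L + 1) * t" using q L(1) by (intro mult_left_mono) auto
    finally have "g x \<le> g x0 + (L + 1) * t" by simp
    moreover have "x \<bullet> e = g x0 + A * t + q \<bullet> e" by (simp add: x inner_add_left ee g0)
    moreover have "\<bar>q \<bullet> e\<bar> < t" using Cauchy_Schwarz_ineq2[of q e] e q by simp
    ultimately show "g x < x \<bullet> e" using t(1) by (simp add: A_def distrib_right abs_less_iff)
   qed
  qed
 qed
qed

lemma harmonic_scale: "h \<in> harmonic_L2 \<Omega> ==> (\<lambda>x. w * h x) \<in> harmonic_L2 \<Omega>"
 by (auto simp: harmonic_L2_iff ip_scale_right)

text \<open>The poles x0 - t_n e approach x0 from outside, and dimension at least two supplies the
  second axis of the plane. Normalising divides by norms tending to infinity, while away from x0 the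
  functions stay bounded.\<close>

lemma harmonic_concentrating_sequence:
 assumes dim: "DIM('a) \<ge> 2" and sb: "smooth_boundary \<Omega>" and x0: "x0 \<in> frontier \<Omega>"
 shows "\<exists>u :: nat => 'a => complex. (\<forall>n. u n \<in> harmonic_L2 \<Omega>) \<and> (\<forall>n. nrm (u n) = 1) \<and>
  (\<forall>m>0. \<forall>d>0. \<exists>n0. \<forall>n\<ge>n0. \<forall>x\<in>\<Omega>. m \<le> dist x x0 \<longrightarrow> cmod (u n x) \<le> d)"
proof (rule boundary_geometry[OF sb x0])
 fix e :: 'a and A t0 :: real
 assume e: "norm e = 1" and A: "0 < A" and t0: "0 < t0" "t0 \<le> 1"
  and out: "\<And>t. 0 < t ==> t \<le> t0 ==> x0 - t *\<^sub>R e \<notin> closure \<Omega>"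
  and sub: "\<And>t. 0 < t ==> t \<le> t0 ==> ball (x0 + (A * t) *\<^sub>R e) t \<subseteq> \<Omega>"
 obtain b0 where "b0 \<noteq> 0" "orthogonal e b0" using orthogonal_to_vector_exists[OF dim] by blast
 then have b: "norm (sgn b0) = 1" "e \<bullet> sgn b0 = 0" by (auto simp: norm_sgn orthogonal_def sgn_div_norm)
 define t where "t n = t0 * inverse (real (Suc n))" for n
 have t: "0 < t n" "t n \<le> t0" for n using t0 by (auto simp: t_def field_simps)
 have tlim: "t \<longlonglongrightarrow> 0" unfolding t_def[abs_def] by (rule tendsto_mult_right_zero[OF LIMSEQ_inverse_real_of_nat])
 define q where "q = (A\<^sup>2 / (A + 2) ^ (DIM('a) + 2))\<^sup>2 * unit_ball_vol (real DIM('a))"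
 have q: "0 < q" using A by (simp add: q_def)
 define C where "C r = 2 * (r\<^sup>2) powr (- real DIM('a) / 2)" for r
 have "\<exists>k. k \<in> harmonic_L2 \<Omega> \<and> q / t n \<le> (nrm k)\<^sup>2 \<and>
   (\<forall>r>0. \<forall>x. r \<le> norm (x - (x0 - t n *\<^sub>R e)) \<longrightarrow> cmod (k x) \<le> C r)" for n
 proof -
  have eq: "x0 - t n *\<^sub>R e + ((A + 1) * t n) *\<^sub>R e = x0 + (A * t n) *\<^sub>R e" by (simp add: algebra_simps)
  have "ball (x0 - t n *\<^sub>R e + ((A + 1) * t n) *\<^sub>R e) (t n) \<subseteq> \<Omega>" unfolding eq by (rule sub[OF t])
  from singular_harmonic[OF e b out[OF t] A t(1) order_trans[OF t(2) t0(2)] this]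
  show ?thesis unfolding q_def C_def by blast
 qed
 then have "\<forall>n. \<exists>k. k \<in> harmonic_L2 \<Omega> \<and> q / t n \<le> (nrm k)\<^sup>2 \<and>
   (\<forall>r>0. \<forall>x. r \<le> norm (x - (x0 - t n *\<^sub>R e)) \<longrightarrow> cmod (k x) \<le> C r)" by (rule allI)
 then have "\<exists>k. \<forall>n. k n \<in> harmonic_L2 \<Omega> \<and> q / t n \<le> (nrm (k n))\<^sup>2 \<and>
   (\<forall>r>0. \<forall>x. r \<le> norm (x - (x0 - t n *\<^sub>R e)) \<longrightarrow> cmod (k n x) \<le> C r)" by (rule choice)
 then obtain k where k: "\<And>n. k n \<in> harmonic_L2 \<Omega>" "\<And>n. q / t n \<le> (nrm (k n))\<^sup>2"
   "\<And>n r x. 0 < r ==> r \<le> norm (x - (x0 - t n *\<^sub>R e)) ==> cmod (k n x) \<le> C r" by blast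
 define N where "N n = nrm (k n)" for n
 have N: "0 < N n" for n
 proof -
  have "0 < q / t n" using q t(1)[of n] by simp
  then have "0 < (N n)\<^sup>2" using k(2)[of n] unfolding N_def by linarith
  moreover have "0 \<le> N n" by (simp add: N_def)
  ultimately show ?thesis by (simp add: zero_less_power2)
 qed
 define u where "u n = (\<lambda>x. cor (1 / N n) * k n x)" for n
 have "\<exists>n0. \<forall>n\<ge>n0. \<forall>x\<in>\<Omega>. m \<le> dist x x0 \<longrightarrow> cmod (u n x) \<le> d" if m: "0 < m" and d: "0 < d" for m d
 proof -
  define D where "D = C (m / 2)"
  have D: "0 \<le> D" by (simp add: D_def C_def)
  \<comment> \<open>The first bound keeps the pole within m/2 of x0; the second makes the norm of
    the kernel at least D/d.\<close>
  define s where "s = min (m / 2) (q / ((D / d)\<^sup>2 + 1))"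
  have pos: "0 < (D / d)\<^sup>2 + 1" by (rule add_nonneg_pos) auto
  then have s: "0 < s" using m q by (simp add: s_def)
  from order_tendstoD(2)[OF tlim this] obtain n0 where n0: "\<And>n. n \<ge> n0 ==> t n < s" unfolding eventually_sequentially by blast
  have "cmod (u n x) \<le> d" if n: "n \<ge> n0" and x: "m \<le> dist x x0" for n x
  proof -
   have tn: "t n < m / 2" "t n < q / ((D / d)\<^sup>2 + 1)" using n0[OF n] by (auto simp: s_def)
   have "(D / d)\<^sup>2 + 1 \<le> q / t n" using tn(2) pos t(1)[of n] by (simp add: field_simps)
   then have "(D / d)\<^sup>2 \<le> (N n)\<^sup>2" using k(2)[of n] by (simp add: N_def)
   then have "D / d \<le> N n" by (rule power2_le_imp_le) (use N[of n] in simp)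
   then have Dd: "D \<le> d * N n" using d by (simp add: pos_divide_le_eq mult.commute)
   have "norm (x - x0) \<le> norm (x - (x0 - t n *\<^sub>R e)) + norm (t n *\<^sub>R e)"
    using norm_triangle_ineq4[of "x - (x0 - t n *\<^sub>R e)" "t n *\<^sub>R e"] by simp
   then have "m / 2 \<le> norm (x - (x0 - t n *\<^sub>R e))" using x tn(1) t(1)[of n] e by (simp add: dist_norm)
   then have "cmod (k n x) \<le> D" unfolding D_def by (rule k(3)[rotated]) (use m in simp)
   then have "cmod (k n x) \<le> d * N n" using Dd by linarith
   then show ?thesis using N[of n] unfolding u_def norm_mult norm_of_real by (simp add: pos_divide_le_eq)
  qed
  then show ?thesis by blast
 qed
 moreover have "u n \<in> harmonic_L2 \<Omega>" for n unfolding u_def by (rule harmonic_scale[OF k(1)])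
 moreover have "nrm (u n) = 1" for n unfolding u_def L2_norm_scale norm_of_real using N[of n] by (simp add: N_def)
 ultimately show ?thesis by (intro exI[of _ u]) blast
qed

theorem krein_essential_spectrum:
 fixes V :: "'a => real"
 assumes dim: "DIM('a) \<ge> 2" and sb: "smooth_boundary \<Omega>" and V: "continuous_on (closure \<Omega>) V"
 shows "essential_spectrum M (add_potential (krein_laplacian \<Omega>) V) = cor ` V ` frontier \<Omega>"
proof -
 obtain C where C: "0 \<le> C" "\<And>x. x \<in> closure \<Omega> ==> \<bar>V x\<bar> \<le> C" using continuous_bound[OF V] unfolding real_norm_def by metis
 have bd: "\<bar>V x\<bar> \<le> C" if "x \<in> space M" for x using that C(2) closure_subset by (auto simp: space_M)
 note mV = continuous_measurable[OF V]
 let ?T = "add_potential (krein_laplacian \<Omega>) V"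
 interpret T: self_adjoint M ?T by (rule self_adjoint.add_potential_self_adjoint(1)[OF krein_self_adjoint mV]) (rule bd)
 have iff: "(u, f) \<in> ?T \<longleftrightarrow> (u, \<lambda>x. f x - cor (V x) * u x) \<in> krein_laplacian \<Omega>" for u f
  by (rule self_adjoint.add_potential_self_adjoint(2)[OF krein_self_adjoint mV]) (rule bd)
 show ?thesis
 proof
  show "essential_spectrum M ?T \<subseteq> cor ` V ` frontier \<Omega>"
  proof
   fix z assume z: "z \<in> essential_spectrum M ?T"
   show "z \<in> cor ` V ` frontier \<Omega>"
   proof (rule ccontr)
    assume nz: "z \<notin> cor ` V ` frontier \<Omega>"
    have "cor (V x) \<noteq> z" if "x \<in> frontier \<Omega>" for x using nz that by blast
    from krein_a_priori[OF V this] obtain B C where B: "finite B" "B \<subseteq> L2 M" and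
     le: "\<And>u f w g. u \<in> L2 M ==> f \<in> L2 M ==> (w, g) \<in> lap0 \<Omega> ==>
       (\<lambda>x. u x - w x) \<in> harmonic_L2 \<Omega> ==> AE x in M. f x - cor (V x) * u x = - g x ==>
       nrm u \<le> C * (nrm (\<lambda>x. f x - z * u x) + (\<Sum>b\<in>B. cmod (ip M u b)))" by blast
    have "nrm u \<le> C * (nrm (\<lambda>x. f x - z * u x) + (\<Sum>b\<in>B. cmod (ip M u b)))" if uf: "(u, f) \<in> ?T" for u f
    proof -
     obtain w g where "(w, g) \<in> lap0 \<Omega>" "(\<lambda>x. u x - w x) \<in> harmonic_L2 \<Omega>"
       "AE x in M. f x - cor (V x) * u x = - g x" using iff[THEN iffD1, OF uf] unfolding krein_laplacian_iff by blast
     then show ?thesis by (rule le[OF T.L2D(1)[OF uf] T.L2D(2)[OF uf]])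
    qed
    then have "T.a_priori z" unfolding T.a_priori_def using B by (intro exI[of _ B] exI[of _ C] conjI allI impI)
    then show False using z T.a_priori_not_essential by blast
   qed
  qed
  show "cor ` V ` frontier \<Omega> \<subseteq> essential_spectrum M ?T"
  proof clarify
   fix x0 assume x0: "x0 \<in> frontier \<Omega>"
   then have x0c: "x0 \<in> closure \<Omega>" "x0 \<notin> \<Omega>" using interior_open[OF open_\<Omega>] by (auto simp: frontier_def)
   obtain u :: "nat => 'a => complex" where u: "\<And>n. u n \<in> harmonic_L2 \<Omega>" "\<And>n. nrm (u n) = 1"
    "\<And>t e. 0 < t ==> 0 < e ==> \<exists>n0. \<forall>n\<ge>n0. \<forall>x\<in>\<Omega>. t \<le> dist x x0 \<longrightarrow> cmod (u n x) \<le> e"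
    using harmonic_concentrating_sequence[OF dim sb x0] by blast
   note uL = harmonic_L2D[OF u(1)]
   show "cor (V x0) \<in> essential_spectrum M ?T"
   proof (rule T.singular_sequence_essential[where u = u and f = "\<lambda>n x. cor (V x) * u n x"])
    fix n
    \<comment> \<open>K annihilates harmonic functions, so K + V acts on the sequence as
      multiplication by V.\<close>
    have "((\<lambda>x. 0), (\<lambda>x. 0)) \<in> lap0 \<Omega>" using lap0_scale[OF lap0_test[OF open_\<Omega> test_zero], of 0] by simp
    then have "(u n, \<lambda>x. 0) \<in> krein_laplacian \<Omega>"
     unfolding krein_laplacian_iff using uL u(1) by (intro conjI exI[of _ "\<lambda>x. 0"]) auto
    then show "(u n, \<lambda>x. cor (V x) * u n x) \<in> ?T" unfolding iff by simp
   next
    have "(\<lambda>x. cor (V x) * u n x - cor (V x0) * u n x) = (\<lambda>x. cor (V x - V x0) * u n x)" for n by (rule ext) (simp add: algebra_simps)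
    then show "(\<lambda>n. nrm (\<lambda>x. cor (V x) * u n x - cor (V x0) * u n x)) \<longlonglongrightarrow> 0"
     using concentrating_multiplication[OF uL u(2) x0c(1) u(3) V] by simp
   next
    fix v assume v: "v \<in> L2 M"
    show "(\<lambda>n. ip M (u n) v) \<longlonglongrightarrow> 0" by (rule concentrating_weakly_null[OF uL u(2) x0c(2) u(3) v])
   qed (rule u(2))
  qed
 qed
qed

end

theorem theorem5p1:
 fixes \<Omega> :: "'a::euclidean_space set" and V :: "'a \<Rightarrow> real"
 assumes "DIM('a) \<ge> 2"
  and "open \<Omega>" and "connected \<Omega>" and "\<Omega> \<noteq> {}" and "bounded \<Omega>"
  and "smooth_boundary \<Omega>"
  and "continuous_on (closure \<Omega>) V"
 shows "essential_spectrum (lebesgue_on \<Omega>) (add_potential (krein_laplacian \<Omega>) V)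
      = complex_of_real ` V ` frontier \<Omega> \<and>
     (essential_spectrum (lebesgue_on \<Omega>) (add_potential (krein_laplacian \<Omega>) V) = {0}
      \<longleftrightarrow> (\<forall>x \<in> frontier \<Omega>. V x = 0))"
proof -
 interpret bounded_open \<Omega> by (rule bounded_open.intro[OF assms(2,5)])
 have eq: "essential_spectrum (lebesgue_on \<Omega>) (add_potential (krein_laplacian \<Omega>) V) = complex_of_real ` V ` frontier \<Omega>"
  by (rule krein_essential_spectrum[OF assms(1,6,7)])
 \<comment> \<open>A nonempty boundary is what separates the image {0} from the empty image in the
   second claim.\<close>
 have "frontier \<Omega> \<noteq> {}" using frontier_eq_empty[of \<Omega>] assms(4,5) not_bounded_UNIV by auto
 then obtain p where p: "p \<in> frontier \<Omega>" by blast
 have "complex_of_real ` V ` frontier \<Omega> = {0} \<longleftrightarrow> (\<forall>x \<in> frontier \<Omega>. V x = 0)"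
 proof
  assume 0: "complex_of_real ` V ` frontier \<Omega> = {0}"
  show "\<forall>x\<in>frontier \<Omega>. V x = 0"
  proof
   fix x assume "x \<in> frontier \<Omega>"
   then have "complex_of_real (V x) \<in> {0}" unfolding 0[symmetric] by (intro imageI)
   then show "V x = 0" by simp
  qed
 next
  assume "\<forall>x\<in>frontier \<Omega>. V x = 0"
  then have "V ` frontier \<Omega> = (\<lambda>x. 0) ` frontier \<Omega>" by (intro image_cong refl) simp
  also have "\<dots> = {0}" using p by (rule image_constant)
  finally show "complex_of_real ` V ` frontier \<Omega> = {0}" by simp
 qed
 then show ?thesis unfolding eq by (rule conjI[OF refl])
qed

end
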